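(* Let $A$ be a separable indecomposable ring of finite degree in $\mathcal K$ and write $\Gamma$ for the set of ring endomorphisms of $A$. The following are equivalent: (i) $|\Gamma|=\deg(A)$. (ii) $F_A(A)\cong \mathbb 1_A^{\times t}$ as rings in $A\text{-}\mathrm{Mod}_{\mathcal K}$ for some $t>0$. (iii) $\lambda_\Gamma:A\otimes A\to\prod_{\gamma\in\Gamma}A_\gamma$ is an isomorphism. (iv) $\Gamma$ is a group and $A$ is quasi-Galois in $\mathcal K$ with group $\Gamma$.
   Context: $(\mathcal K,\otimes,\mathbb 1)$ is an idempotent-complete symmetric monoidal category: $\mathcal K$ is additive, $\otimes$ is additive in each variable, and every $e:x\to x$ with $e^2=e$ yields a decomposition $x\cong x_1\oplus x_2$ under which $e$ becomes $\left(\begin{smallmatrix}1&0\\0&0\end{smallmatrix}\right)$. Rings. A ring in $\mathcal K$ is a commutative monoid $(A,\mu:A\otimes A\to A,\eta:\mathbb 1\to A)$ in $\mathcal K$. Ring morphisms are morphisms in $\mathcal K$ compatible with multiplication and unit. $A\otimes B$ is the ring with multiplication $\mu_A\otimes\mu_B$ precomposed with the swap of the two middle factors; $A\times B$ is $A\oplus B$ with componentwise multiplication. $A$ is separable if there is $\sigma:A\to A\otimes A$ with $\mu\sigma=1_A$ and $(1\otimes\mu)(\sigma\otimes1)=\sigma\mu=(\mu\otimes1)(1\otimes\sigma)$. An $A$-algebra is a ring $B$ with a ring morphism $A\to B$. A ring $A$ is indecomposable if it is nonzero and the only idempotent $A$-linear endomorphisms $A\to A$ are $1_A$ and $0$ (equivalently,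 $A$ is nonzero and is not a product of two nonzero rings). Modules. For $A$ separable, $A\text{-}\mathrm{Mod}_{\mathcal K}$ is the category of left $A$-modules in $\mathcal K$ with $A$-linear morphisms; it is idempotent-complete symmetric monoidal under $\otimes_A$, where $x\otimes_A y$ is the coequaliser of the two action maps $x\otimes A\otimes y\rightrightarrows x\otimes y$, with unit $\mathbb 1_A=A$. Extension-of-scalars $F_A:\mathcal K\to A\text{-}\mathrm{Mod}_{\mathcal K}$, $F_A(x)=A\otimes x$ (free module), is monoidal. $A$-algebras in $\mathcal K$ correspond to rings in $A\text{-}\mathrm{Mod}_{\mathcal K}$, and separability is the same in both senses. Degree. For a separable ring $A$ there is a separable $A$-algebra $A'$, unique up to isomorphism of $A$-algebras, with a ring isomorphism $h:A\otimes A\to A\times A'$ such that $\mathrm{pr}_1h=\mu$, where $A'$ is an $A$-algebra via $\mathrm{pr}_2h(1_A\otimes\eta)$. Define $A^{[0]}=\mathbb 1$, $A^{[1]}=A$, and inductively $A^{[n+1]}=(A^{[n]})'$, where $A^{[n]}$ is regarded as a ring in $A^{[n-1]}\text{-}\mathrm{Mod}_{\mathcal K}$. The degree $\deg(A)$ is $d$ if $A^{[d]}\ne0$ and $A^{[d+1]}=0$; it is infinite if $A^{[d]}\neq0$ for all $d\ge 0$. Quasi-Galois. For a nonzero ring $A$ and a finite set $\Gamma$ of ring endomorphisms of $A$ containing $1_A$, $\lambda_\Gamma:A\otimes A\to\prod_{\gamma\in\Gamma}A_\gamma$ (with $A_\gamma=A$) is the ring morphism with $\mathrm{pr}_\gamma\lambda_\Gamma=\mu(1\otimes\gamma)$.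 If $\Gamma$ is a finite group of ring automorphisms of $A$, then $A$ is quasi-Galois in $\mathcal K$ with group $\Gamma$ if $\lambda_\Gamma$ is an isomorphism. (When $A$ is separable, indecomposable and of finite degree, the set of all ring endomorphisms of $A$ is finite.) *)

theory Defs
  imports "HOL-Library.Extended_Nat" "HOL-Algebra.Group"
begin

section \<open>Idempotent-complete symmetric monoidal categories\<close>

text \<open>
  Arrows carry their domain and codomain. The associator \<open>Asc K x y z\<close> goes from
  \<open>(x \<odot> y) \<odot> z\<close> to \<open>x \<odot> (y \<odot> z)\<close>; \<open>Lun\<close> and \<open>Run\<close> are the left and right unitors.
  The abelian group structure on the hom-sets of an additive category is part of the data; it is
  in any case determined by the underlying category.
\<close>

record ('o, 'm) smcat =
  Ob :: "'o set"
  Ar :: "'m set"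
  Dom :: "'m \<Rightarrow> 'o"
  Cod :: "'m \<Rightarrow> 'o"
  Idn :: "'o \<Rightarrow> 'm"
  Comp :: "'m \<Rightarrow> 'm \<Rightarrow> 'm" (infixr "\<cdot>\<index>" 60)
  Zer :: "'o \<Rightarrow> 'o \<Rightarrow> 'm"
  Add :: "'m \<Rightarrow> 'm \<Rightarrow> 'm" (infixl "\<boxplus>\<index>" 55)
  Unit :: "'o"
  TenO :: "'o \<Rightarrow> 'o \<Rightarrow> 'o" (infixl "\<odot>\<index>" 70)
  TenA :: "'m \<Rightarrow> 'm \<Rightarrow> 'm" (infixl "\<boxtimes>\<index>" 70)
  Asc :: "'o \<Rightarrow> 'o \<Rightarrow> 'o \<Rightarrow> 'm"
  Lun :: "'o \<Rightarrow> 'm"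
  Run :: "'o \<Rightarrow> 'm"
  Swp :: "'o \<Rightarrow> 'o \<Rightarrow> 'm"

definition homs :: "('o, 'm) smcat \<Rightarrow> 'o \<Rightarrow> 'o \<Rightarrow> 'm set" where
  "homs K x y = {f \<in> Ar K. Dom K f = x \<and> Cod K f = y}"

definition inverse_arrows :: "('o, 'm) smcat \<Rightarrow> 'm \<Rightarrow> 'm \<Rightarrow> bool" where
  "inverse_arrows K f g \<longleftrightarrow>
     f \<in> Ar K \<and> g \<in> homs K (Cod K f) (Dom K f) \<and>
     g \<cdot>\<^bsub>K\<^esub> f = Idn K (Dom K f) \<and> f \<cdot>\<^bsub>K\<^esub> g = Idn K (Cod K f)"

definition iso_arrow :: "('o, 'm) smcat \<Rightarrow> 'm \<Rightarrow> bool" where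
  "iso_arrow K f \<longleftrightarrow> (\<exists>g. inverse_arrows K f g)"

definition inv_arrow :: "('o, 'm) smcat \<Rightarrow> 'm \<Rightarrow> 'm" where
  "inv_arrow K f = (THE g. inverse_arrows K f g)"

definition zero_object :: "('o, 'm) smcat \<Rightarrow> 'o \<Rightarrow> bool" where
  "zero_object K z \<longleftrightarrow>
     z \<in> Ob K \<and> (\<forall>x\<in>Ob K. (\<exists>!f. f \<in> homs K z x) \<and> (\<exists>!f. f \<in> homs K x z))"

text \<open>\<open>x\<close> is the direct sum of \<open>x1\<close> and \<open>x2\<close>, with injections \<open>i1\<close>, \<open>i2\<close> and projections \<open>p1\<close>, \<open>p2\<close>.\<close>

definition biproduct ::
  "('o, 'm) smcat \<Rightarrow> 'o \<Rightarrow> 'o \<Rightarrow> 'o \<Rightarrow> 'm \<Rightarrow> 'm \<Rightarrow> 'm \<Rightarrow> 'm \<Rightarrow> bool" where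
  "biproduct K x1 x2 x i1 i2 p1 p2 \<longleftrightarrow>
     x1 \<in> Ob K \<and> x2 \<in> Ob K \<and> x \<in> Ob K \<and>
     i1 \<in> homs K x1 x \<and> i2 \<in> homs K x2 x \<and> p1 \<in> homs K x x1 \<and> p2 \<in> homs K x x2 \<and>
     p1 \<cdot>\<^bsub>K\<^esub> i1 = Idn K x1 \<and> p2 \<cdot>\<^bsub>K\<^esub> i2 = Idn K x2 \<and>
     p1 \<cdot>\<^bsub>K\<^esub> i2 = Zer K x2 x1 \<and> p2 \<cdot>\<^bsub>K\<^esub> i1 = Zer K x1 x2 \<and>
     (i1 \<cdot>\<^bsub>K\<^esub> p1) \<boxplus>\<^bsub>K\<^esub> (i2 \<cdot>\<^bsub>K\<^esub> p2) = Idn K x"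

locale category =
  fixes K :: "('o, 'm) smcat" (structure)
  assumes Dom_Ob: "f \<in> Ar K \<Longrightarrow> Dom K f \<in> Ob K"
    and Cod_Ob: "f \<in> Ar K \<Longrightarrow> Cod K f \<in> Ob K"
    and Idn_homs: "x \<in> Ob K \<Longrightarrow> Idn K x \<in> homs K x x"
    and Comp_homs: "\<lbrakk>f \<in> homs K x y; g \<in> homs K y z\<rbrakk> \<Longrightarrow> g \<cdot> f \<in> homs K x z"
    and Comp_Idn: "f \<in> homs K x y \<Longrightarrow> f \<cdot> Idn K x = f"
    and Idn_Comp: "f \<in> homs K x y \<Longrightarrow> Idn K y \<cdot> f = f"
    and Comp_assoc: "\<lbrakk>f \<in> homs K w x; g \<in> homs K x y; h \<in> homs K y z\<rbrakk>
          \<Longrightarrow> (h \<cdot> g) \<cdot> f = h \<cdot> (g \<cdot> f)"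

locale additive_category = category +
  assumes homs_comm_group: "\<lbrakk>x \<in> Ob K; y \<in> Ob K\<rbrakk>
          \<Longrightarrow> comm_group \<lparr>carrier = homs K x y, mult = Add K, one = Zer K x y\<rparr>"
    and Comp_Add_left: "\<lbrakk>f \<in> homs K x y; g \<in> homs K y z; g' \<in> homs K y z\<rbrakk>
          \<Longrightarrow> (g \<boxplus> g') \<cdot> f = (g \<cdot> f) \<boxplus> (g' \<cdot> f)"
    and Comp_Add_right: "\<lbrakk>f \<in> homs K x y; f' \<in> homs K x y; g \<in> homs K y z\<rbrakk>
          \<Longrightarrow> g \<cdot> (f \<boxplus> f') = (g \<cdot> f) \<boxplus> (g \<cdot> f')"
    and ex_zero_object: "\<exists>z. zero_object K z"
    and ex_biproduct: "\<lbrakk>x1 \<in> Ob K; x2 \<in> Ob K\<rbrakk>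
          \<Longrightarrow> \<exists>x i1 i2 p1 p2. biproduct K x1 x2 x i1 i2 p1 p2"

locale symmetric_monoidal_category = additive_category +
  assumes Unit_Ob: "Unit K \<in> Ob K"
    and TenO_Ob: "\<lbrakk>x \<in> Ob K; y \<in> Ob K\<rbrakk> \<Longrightarrow> x \<odot> y \<in> Ob K"
    and TenA_homs: "\<lbrakk>f \<in> homs K x y; g \<in> homs K x' y'\<rbrakk>
          \<Longrightarrow> f \<boxtimes> g \<in> homs K (x \<odot> x') (y \<odot> y')"
    and TenA_Idn: "\<lbrakk>x \<in> Ob K; y \<in> Ob K\<rbrakk> \<Longrightarrow> Idn K x \<boxtimes> Idn K y = Idn K (x \<odot> y)"
    and TenA_Comp: "\<lbrakk>f \<in> homs K x y; g \<in> homs K y z; f' \<in> homs K x' y'; g' \<in> homs K y' z'\<rbrakk>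
          \<Longrightarrow> (g \<cdot> f) \<boxtimes> (g' \<cdot> f') = (g \<boxtimes> g') \<cdot> (f \<boxtimes> f')"
    and TenA_Add_left: "\<lbrakk>f \<in> homs K x y; f' \<in> homs K x y; g \<in> homs K x' y'\<rbrakk>
          \<Longrightarrow> (f \<boxplus> f') \<boxtimes> g = (f \<boxtimes> g) \<boxplus> (f' \<boxtimes> g)"
    and TenA_Add_right: "\<lbrakk>f \<in> homs K x y; g \<in> homs K x' y'; g' \<in> homs K x' y'\<rbrakk>
          \<Longrightarrow> f \<boxtimes> (g \<boxplus> g') = (f \<boxtimes> g) \<boxplus> (f \<boxtimes> g')"
    and Asc_homs: "\<lbrakk>x \<in> Ob K; y \<in> Ob K; z \<in> Ob K\<rbrakk>
          \<Longrightarrow> Asc K x y z \<in> homs K ((x \<odot> y) \<odot> z) (x \<odot> (y \<odot> z))"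
    and Asc_iso: "\<lbrakk>x \<in> Ob K; y \<in> Ob K; z \<in> Ob K\<rbrakk> \<Longrightarrow> iso_arrow K (Asc K x y z)"
    and Asc_natural: "\<lbrakk>f \<in> homs K x x'; g \<in> homs K y y'; h \<in> homs K z z'\<rbrakk>
          \<Longrightarrow> Asc K x' y' z' \<cdot> ((f \<boxtimes> g) \<boxtimes> h) = (f \<boxtimes> (g \<boxtimes> h)) \<cdot> Asc K x y z"
    and Lun_homs: "x \<in> Ob K \<Longrightarrow> Lun K x \<in> homs K (Unit K \<odot> x) x"
    and Lun_iso: "x \<in> Ob K \<Longrightarrow> iso_arrow K (Lun K x)"
    and Lun_natural: "f \<in> homs K x y \<Longrightarrow> Lun K y \<cdot> (Idn K (Unit K) \<boxtimes> f) = f \<cdot> Lun K x"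
    and Run_homs: "x \<in> Ob K \<Longrightarrow> Run K x \<in> homs K (x \<odot> Unit K) x"
    and Run_iso: "x \<in> Ob K \<Longrightarrow> iso_arrow K (Run K x)"
    and Run_natural: "f \<in> homs K x y \<Longrightarrow> Run K y \<cdot> (f \<boxtimes> Idn K (Unit K)) = f \<cdot> Run K x"
    and pentagon: "\<lbrakk>w \<in> Ob K; x \<in> Ob K; y \<in> Ob K; z \<in> Ob K\<rbrakk>
          \<Longrightarrow> (Idn K w \<boxtimes> Asc K x y z) \<cdot> Asc K w (x \<odot> y) z \<cdot> (Asc K w x y \<boxtimes> Idn K z)
              = Asc K w x (y \<odot> z) \<cdot> Asc K (w \<odot> x) y z"
    and triangle: "\<lbrakk>x \<in> Ob K; y \<in> Ob K\<rbrakk>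
          \<Longrightarrow> (Idn K x \<boxtimes> Lun K y) \<cdot> Asc K x (Unit K) y = Run K x \<boxtimes> Idn K y"
    and Swp_homs: "\<lbrakk>x \<in> Ob K; y \<in> Ob K\<rbrakk> \<Longrightarrow> Swp K x y \<in> homs K (x \<odot> y) (y \<odot> x)"
    and Swp_natural: "\<lbrakk>f \<in> homs K x x'; g \<in> homs K y y'\<rbrakk>
          \<Longrightarrow> Swp K x' y' \<cdot> (f \<boxtimes> g) = (g \<boxtimes> f) \<cdot> Swp K x y"
    and Swp_Swp: "\<lbrakk>x \<in> Ob K; y \<in> Ob K\<rbrakk> \<Longrightarrow> Swp K y x \<cdot> Swp K x y = Idn K (x \<odot> y)"
    and hexagon: "\<lbrakk>x \<in> Ob K; y \<in> Ob K; z \<in> Ob K\<rbrakk>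
          \<Longrightarrow> Asc K y z x \<cdot> Swp K x (y \<odot> z) \<cdot> Asc K x y z
              = (Idn K y \<boxtimes> Swp K x z) \<cdot> Asc K y x z \<cdot> (Swp K x y \<boxtimes> Idn K z)"

locale idempotent_complete_smc = symmetric_monoidal_category +
  assumes idempotent_complete: "\<lbrakk>e \<in> homs K x x; e \<cdot> e = e\<rbrakk>
          \<Longrightarrow> \<exists>x1 x2 i1 i2 p1 p2. biproduct K x1 x2 x i1 i2 p1 p2 \<and> e = i1 \<cdot> p1"

section \<open>Finite products\<close>

text \<open>
  In an additive category the direct sum of a finite family is its product, so
  \<open>A \<times> B\<close> and \<open>\<Prod>i\<in>I. A i\<close> are formed on a chosen product cone.
\<close>

definition product_cone ::
  "('o, 'm) smcat \<Rightarrow> 'i set \<Rightarrow> ('i \<Rightarrow> 'o) \<Rightarrow> 'o \<Rightarrow> ('i \<Rightarrow> 'm) \<Rightarrow> bool" where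
  "product_cone K I X P p \<longleftrightarrow>
     P \<in> Ob K \<and> (\<forall>i\<in>I. p i \<in> homs K P (X i)) \<and>
     (\<forall>y\<in>Ob K. \<forall>f. (\<forall>i\<in>I. f i \<in> homs K y (X i)) \<longrightarrow>
        (\<exists>!h. h \<in> homs K y P \<and> (\<forall>i\<in>I. p i \<cdot>\<^bsub>K\<^esub> h = f i)))"

definition chosen_product ::
  "('o, 'm) smcat \<Rightarrow> 'i set \<Rightarrow> ('i \<Rightarrow> 'o) \<Rightarrow> 'o \<times> ('i \<Rightarrow> 'm)" where
  "chosen_product K I X = (SOME c. product_cone K I X (fst c) (snd c))"

abbreviation prod_ob :: "('o, 'm) smcat \<Rightarrow> 'i set \<Rightarrow> ('i \<Rightarrow> 'o) \<Rightarrow> 'o" where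
  "prod_ob K I X \<equiv> fst (chosen_product K I X)"

abbreviation proj :: "('o, 'm) smcat \<Rightarrow> 'i set \<Rightarrow> ('i \<Rightarrow> 'o) \<Rightarrow> 'i \<Rightarrow> 'm" where
  "proj K I X \<equiv> snd (chosen_product K I X)"

definition tuple ::
  "('o, 'm) smcat \<Rightarrow> 'i set \<Rightarrow> ('i \<Rightarrow> 'o) \<Rightarrow> 'o \<Rightarrow> ('i \<Rightarrow> 'm) \<Rightarrow> 'm" where
  "tuple K I X y f =
     (THE h. h \<in> homs K y (prod_ob K I X) \<and> (\<forall>i\<in>I. proj K I X i \<cdot>\<^bsub>K\<^esub> h = f i))"

section \<open>Rings\<close>

record ('o, 'm) cmon =
  Car :: 'o
  Mul :: 'm
  Unt :: 'm

definition is_ring :: "('o, 'm) smcat \<Rightarrow> ('o, 'm) cmon \<Rightarrow> bool" where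
  "is_ring K A \<longleftrightarrow>
     Car A \<in> Ob K \<and>
     Mul A \<in> homs K (Car A \<odot>\<^bsub>K\<^esub> Car A) (Car A) \<and>
     Unt A \<in> homs K (Unit K) (Car A) \<and>
     Mul A \<cdot>\<^bsub>K\<^esub> (Mul A \<boxtimes>\<^bsub>K\<^esub> Idn K (Car A))
       = Mul A \<cdot>\<^bsub>K\<^esub> (Idn K (Car A) \<boxtimes>\<^bsub>K\<^esub> Mul A) \<cdot>\<^bsub>K\<^esub> Asc K (Car A) (Car A) (Car A) \<and>
     Mul A \<cdot>\<^bsub>K\<^esub> (Unt A \<boxtimes>\<^bsub>K\<^esub> Idn K (Car A)) = Lun K (Car A) \<and>
     Mul A \<cdot>\<^bsub>K\<^esub> (Idn K (Car A) \<boxtimes>\<^bsub>K\<^esub> Unt A) = Run K (Car A) \<and>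
     Mul A \<cdot>\<^bsub>K\<^esub> Swp K (Car A) (Car A) = Mul A"

definition ring_mor ::
  "('o, 'm) smcat \<Rightarrow> ('o, 'm) cmon \<Rightarrow> ('o, 'm) cmon \<Rightarrow> 'm \<Rightarrow> bool" where
  "ring_mor K A B f \<longleftrightarrow>
     is_ring K A \<and> is_ring K B \<and> f \<in> homs K (Car A) (Car B) \<and>
     f \<cdot>\<^bsub>K\<^esub> Mul A = Mul B \<cdot>\<^bsub>K\<^esub> (f \<boxtimes>\<^bsub>K\<^esub> f) \<and> f \<cdot>\<^bsub>K\<^esub> Unt A = Unt B"

definition ring_isomorphism ::
  "('o, 'm) smcat \<Rightarrow> ('o, 'm) cmon \<Rightarrow> ('o, 'm) cmon \<Rightarrow> 'm \<Rightarrow> bool" where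
  "ring_isomorphism K A B f \<longleftrightarrow>
     ring_mor K A B f \<and> (\<exists>g. ring_mor K B A g \<and> inverse_arrows K f g)"

definition rings_isomorphic ::
  "('o, 'm) smcat \<Rightarrow> ('o, 'm) cmon \<Rightarrow> ('o, 'm) cmon \<Rightarrow> bool" where
  "rings_isomorphic K A B \<longleftrightarrow> (\<exists>f. ring_isomorphism K A B f)"

definition ring_endos :: "('o, 'm) smcat \<Rightarrow> ('o, 'm) cmon \<Rightarrow> 'm set" where
  "ring_endos K A = {f. ring_mor K A A f}"

abbreviation zero_ring :: "('o, 'm) smcat \<Rightarrow> ('o, 'm) cmon \<Rightarrow> bool" where
  "zero_ring K A \<equiv> zero_object K (Car A)"

definition unit_ring :: "('o, 'm) smcat \<Rightarrow> ('o, 'm) cmon" where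
  "unit_ring K = \<lparr>Car = Unit K, Mul = Lun K (Unit K), Unt = Idn K (Unit K)\<rparr>"

text \<open>The swap of the two middle factors, \<open>(a \<odot> b) \<odot> (c \<odot> d) \<rightarrow> (a \<odot> c) \<odot> (b \<odot> d)\<close>.\<close>

definition middle_swap :: "('o, 'm) smcat \<Rightarrow> 'o \<Rightarrow> 'o \<Rightarrow> 'o \<Rightarrow> 'o \<Rightarrow> 'm" where
  "middle_swap K a b c d =
     inv_arrow K (Asc K a c (b \<odot>\<^bsub>K\<^esub> d))
     \<cdot>\<^bsub>K\<^esub> (Idn K a \<boxtimes>\<^bsub>K\<^esub>
            (Asc K c b d \<cdot>\<^bsub>K\<^esub> (Swp K b c \<boxtimes>\<^bsub>K\<^esub> Idn K d) \<cdot>\<^bsub>K\<^esub> inv_arrow K (Asc K b c d)))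
     \<cdot>\<^bsub>K\<^esub> Asc K a b (c \<odot>\<^bsub>K\<^esub> d)"

definition tensor_ring ::
  "('o, 'm) smcat \<Rightarrow> ('o, 'm) cmon \<Rightarrow> ('o, 'm) cmon \<Rightarrow> ('o, 'm) cmon" where
  "tensor_ring K A B =
     \<lparr>Car = Car A \<odot>\<^bsub>K\<^esub> Car B,
      Mul = (Mul A \<boxtimes>\<^bsub>K\<^esub> Mul B) \<cdot>\<^bsub>K\<^esub> middle_swap K (Car A) (Car B) (Car A) (Car B),
      Unt = (Unt A \<boxtimes>\<^bsub>K\<^esub> Unt B) \<cdot>\<^bsub>K\<^esub> inv_arrow K (Lun K (Unit K))\<rparr>"

definition prod_ring ::
  "('o, 'm) smcat \<Rightarrow> 'i set \<Rightarrow> ('i \<Rightarrow> ('o, 'm) cmon) \<Rightarrow> ('o, 'm) cmon" where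
  "prod_ring K I R =
     (let X = (\<lambda>i. Car (R i)); P = prod_ob K I X; p = proj K I X in
      \<lparr>Car = P,
       Mul = tuple K I X (P \<odot>\<^bsub>K\<^esub> P) (\<lambda>i. Mul (R i) \<cdot>\<^bsub>K\<^esub> (p i \<boxtimes>\<^bsub>K\<^esub> p i)),
       Unt = tuple K I X (Unit K) (\<lambda>i. Unt (R i))\<rparr>)"

definition separable_ring :: "('o, 'm) smcat \<Rightarrow> ('o, 'm) cmon \<Rightarrow> bool" where
  "separable_ring K A \<longleftrightarrow> is_ring K A \<and>
     (let a = Car A; m = Mul A in
      \<exists>s \<in> homs K a (a \<odot>\<^bsub>K\<^esub> a).
        m \<cdot>\<^bsub>K\<^esub> s = Idn K a \<and>
        (Idn K a \<boxtimes>\<^bsub>K\<^esub> m) \<cdot>\<^bsub>K\<^esub> Asc K a a a \<cdot>\<^bsub>K\<^esub> (s \<boxtimes>\<^bsub>K\<^esub> Idn K a) = s \<cdot>\<^bsub>K\<^esub> m \<and>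
        (m \<boxtimes>\<^bsub>K\<^esub> Idn K a) \<cdot>\<^bsub>K\<^esub> inv_arrow K (Asc K a a a) \<cdot>\<^bsub>K\<^esub> (Idn K a \<boxtimes>\<^bsub>K\<^esub> s) = s \<cdot>\<^bsub>K\<^esub> m)"

definition indecomposable_ring :: "('o, 'm) smcat \<Rightarrow> ('o, 'm) cmon \<Rightarrow> bool" where
  "indecomposable_ring K A \<longleftrightarrow>
     is_ring K A \<and> \<not> zero_ring K A \<and>
     (\<forall>f \<in> homs K (Car A) (Car A).
        f \<cdot>\<^bsub>K\<^esub> Mul A = Mul A \<cdot>\<^bsub>K\<^esub> (Idn K (Car A) \<boxtimes>\<^bsub>K\<^esub> f) \<and> f \<cdot>\<^bsub>K\<^esub> f = f
        \<longrightarrow> f = Idn K (Car A) \<or> f = Zer K (Car A) (Car A))"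

section \<open>Modules over a separable ring\<close>

definition is_module :: "('o, 'm) smcat \<Rightarrow> ('o, 'm) cmon \<Rightarrow> 'o \<times> 'm \<Rightarrow> bool" where
  "is_module K A M \<longleftrightarrow>
     (case M of (x, a) \<Rightarrow>
        x \<in> Ob K \<and> a \<in> homs K (Car A \<odot>\<^bsub>K\<^esub> x) x \<and>
        a \<cdot>\<^bsub>K\<^esub> (Mul A \<boxtimes>\<^bsub>K\<^esub> Idn K x)
          = a \<cdot>\<^bsub>K\<^esub> (Idn K (Car A) \<boxtimes>\<^bsub>K\<^esub> a) \<cdot>\<^bsub>K\<^esub> Asc K (Car A) (Car A) x \<and>
        a \<cdot>\<^bsub>K\<^esub> (Unt A \<boxtimes>\<^bsub>K\<^esub> Idn K x) = Lun K x)"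

definition linear_mor ::
  "('o, 'm) smcat \<Rightarrow> ('o, 'm) cmon \<Rightarrow> 'o \<times> 'm \<Rightarrow> 'o \<times> 'm \<Rightarrow> 'm \<Rightarrow> bool" where
  "linear_mor K A M N f \<longleftrightarrow>
     is_module K A M \<and> is_module K A N \<and> f \<in> homs K (fst M) (fst N) \<and>
     f \<cdot>\<^bsub>K\<^esub> snd M = snd N \<cdot>\<^bsub>K\<^esub> (Idn K (Car A) \<boxtimes>\<^bsub>K\<^esub> f)"

definition coequaliser :: "('o, 'm) smcat \<Rightarrow> 'm \<Rightarrow> 'm \<Rightarrow> 'm \<Rightarrow> bool" where
  "coequaliser K f g q \<longleftrightarrow>
     f \<in> Ar K \<and> g \<in> homs K (Dom K f) (Cod K f) \<and>
     q \<in> Ar K \<and> Dom K q = Cod K f \<and> q \<cdot>\<^bsub>K\<^esub> f = q \<cdot>\<^bsub>K\<^esub> g \<and>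
     (\<forall>k \<in> Ar K. Dom K k = Cod K f \<and> k \<cdot>\<^bsub>K\<^esub> f = k \<cdot>\<^bsub>K\<^esub> g \<longrightarrow>
        (\<exists>!h. h \<in> homs K (Cod K q) (Cod K k) \<and> h \<cdot>\<^bsub>K\<^esub> q = k))"

text \<open>The arrow through which \<open>k\<close> factors along the epimorphism \<open>q\<close>.\<close>

definition descend :: "('o, 'm) smcat \<Rightarrow> 'm \<Rightarrow> 'm \<Rightarrow> 'm" where
  "descend K q k = (THE h. h \<in> homs K (Cod K q) (Cod K k) \<and> h \<cdot>\<^bsub>K\<^esub> q = k)"

text \<open>The chosen quotient \<open>x \<odot> y \<rightarrow> x \<otimes>\<^sub>A y\<close>, the coequaliser of the two action maps on
  \<open>(x \<odot> A) \<odot> y\<close>. The right action on the left module \<open>x\<close> is obtained through the symmetry.\<close>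

definition mod_quot :: "('o, 'm) smcat \<Rightarrow> ('o, 'm) cmon \<Rightarrow> 'o \<times> 'm \<Rightarrow> 'o \<times> 'm \<Rightarrow> 'm" where
  "mod_quot K A M N =
     (SOME q. coequaliser K
        ((snd M \<cdot>\<^bsub>K\<^esub> Swp K (fst M) (Car A)) \<boxtimes>\<^bsub>K\<^esub> Idn K (fst N))
        ((Idn K (fst M) \<boxtimes>\<^bsub>K\<^esub> snd N) \<cdot>\<^bsub>K\<^esub> Asc K (fst M) (Car A) (fst N))
        q)"

text \<open>\<open>M \<otimes>\<^sub>A N\<close>, with the action induced by the action on the left factor. As \<open>A\<close> is separable, the
  coequaliser above is split and hence preserved by \<open>\<odot>\<close>, so that \<open>descend\<close> applies.\<close>

definition mod_tensor ::
  "('o, 'm) smcat \<Rightarrow> ('o, 'm) cmon \<Rightarrow> 'o \<times> 'm \<Rightarrow> 'o \<times> 'm \<Rightarrow> 'o \<times> 'm" where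
  "mod_tensor K A M N =
     (let q = mod_quot K A M N in
      (Cod K q,
       descend K (Idn K (Car A) \<boxtimes>\<^bsub>K\<^esub> q)
         (q \<cdot>\<^bsub>K\<^esub> (snd M \<boxtimes>\<^bsub>K\<^esub> Idn K (fst N)) \<cdot>\<^bsub>K\<^esub> inv_arrow K (Asc K (Car A) (fst M) (fst N)))))"

definition reg_mod :: "('o, 'm) cmon \<Rightarrow> 'o \<times> 'm" where
  "reg_mod A = (Car A, Mul A)"

type_synonym ('o, 'm) mod_arrow = "('o \<times> 'm) \<times> 'm \<times> ('o \<times> 'm)"

abbreviation und_arrow :: "('o, 'm) mod_arrow \<Rightarrow> 'm" where
  "und_arrow F \<equiv> fst (snd F)"

definition mod_cat ::
  "('o, 'm) smcat \<Rightarrow> ('o, 'm) cmon \<Rightarrow> ('o \<times> 'm, ('o, 'm) mod_arrow) smcat" where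
  "mod_cat K A =
     (let Q = mod_quot K A; T = mod_tensor K A; U = reg_mod A in
      \<lparr>Ob = {M. is_module K A M},
       Ar = {(M, f, N). linear_mor K A M N f},
       Dom = (\<lambda>(M, f, N). M),
       Cod = (\<lambda>(M, f, N). N),
       Idn = (\<lambda>M. (M, Idn K (fst M), M)),
       Comp = (\<lambda>(N', g, P) (M, f, N). (M, g \<cdot>\<^bsub>K\<^esub> f, P)),
       Zer = (\<lambda>M N. (M, Zer K (fst M) (fst N), N)),
       Add = (\<lambda>(M, f, N) (M', g, N'). (M, f \<boxplus>\<^bsub>K\<^esub> g, N)),
       Unit = U,
       TenO = T,
       TenA = (\<lambda>(M, f, N) (M', f', N').
                (T M M', descend K (Q M M') (Q N N' \<cdot>\<^bsub>K\<^esub> (f \<boxtimes>\<^bsub>K\<^esub> f')), T N N')),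
       Asc = (\<lambda>M N P.
                (T (T M N) P,
                 descend K (Q (T M N) P \<cdot>\<^bsub>K\<^esub> (Q M N \<boxtimes>\<^bsub>K\<^esub> Idn K (fst P)))
                   (Q M (T N P) \<cdot>\<^bsub>K\<^esub> (Idn K (fst M) \<boxtimes>\<^bsub>K\<^esub> Q N P)
                      \<cdot>\<^bsub>K\<^esub> Asc K (fst M) (fst N) (fst P)),
                 T M (T N P))),
       Lun = (\<lambda>M. (T U M, descend K (Q U M) (snd M), M)),
       Run = (\<lambda>M. (T M U, descend K (Q M U) (snd M \<cdot>\<^bsub>K\<^esub> Swp K (fst M) (Car A)), M)),
       Swp = (\<lambda>M N. (T M N, descend K (Q M N) (Q N M \<cdot>\<^bsub>K\<^esub> Swp K (fst M) (fst N)), T N M))\<rparr>)"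

text \<open>Extension of scalars \<open>F\<^sub>A\<close> and its monoidal structure
  \<open>F\<^sub>A x \<otimes>\<^sub>A F\<^sub>A y \<rightarrow> F\<^sub>A (x \<odot> y)\<close>, \<open>A \<rightarrow> F\<^sub>A \<one>\<close>, through which \<open>F\<^sub>A\<close> maps rings to rings.\<close>

definition free_mod :: "('o, 'm) smcat \<Rightarrow> ('o, 'm) cmon \<Rightarrow> 'o \<Rightarrow> 'o \<times> 'm" where
  "free_mod K A x =
     (Car A \<odot>\<^bsub>K\<^esub> x,
      (Mul A \<boxtimes>\<^bsub>K\<^esub> Idn K x) \<cdot>\<^bsub>K\<^esub> inv_arrow K (Asc K (Car A) (Car A) x))"

definition free_arrow :: "('o, 'm) smcat \<Rightarrow> ('o, 'm) cmon \<Rightarrow> 'm \<Rightarrow> ('o, 'm) mod_arrow" where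
  "free_arrow K A f =
     (free_mod K A (Dom K f), Idn K (Car A) \<boxtimes>\<^bsub>K\<^esub> f, free_mod K A (Cod K f))"

definition free_tensor :: "('o, 'm) smcat \<Rightarrow> ('o, 'm) cmon \<Rightarrow> 'o \<Rightarrow> 'o \<Rightarrow> ('o, 'm) mod_arrow" where
  "free_tensor K A x y =
     (mod_tensor K A (free_mod K A x) (free_mod K A y),
      descend K (mod_quot K A (free_mod K A x) (free_mod K A y))
        ((Mul A \<boxtimes>\<^bsub>K\<^esub> Idn K (x \<odot>\<^bsub>K\<^esub> y)) \<cdot>\<^bsub>K\<^esub> middle_swap K (Car A) x (Car A) y),
      free_mod K A (x \<odot>\<^bsub>K\<^esub> y))"

definition free_unit :: "('o, 'm) smcat \<Rightarrow> ('o, 'm) cmon \<Rightarrow> ('o, 'm) mod_arrow" where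
  "free_unit K A = (reg_mod A, inv_arrow K (Run K (Car A)), free_mod K A (Unit K))"

definition free_ring ::
  "('o, 'm) smcat \<Rightarrow> ('o, 'm) cmon \<Rightarrow> ('o, 'm) cmon \<Rightarrow> ('o \<times> 'm, ('o, 'm) mod_arrow) cmon" where
  "free_ring K A B =
     \<lparr>Car = free_mod K A (Car B),
      Mul = free_arrow K A (Mul B) \<cdot>\<^bsub>mod_cat K A\<^esub> free_tensor K A (Car B) (Car B),
      Unt = free_arrow K A (Unt B) \<cdot>\<^bsub>mod_cat K A\<^esub> free_unit K A\<rparr>"

text \<open>The correspondence between \<open>A\<close>-algebras \<open>u : A \<rightarrow> B\<close> in \<open>K\<close> and rings in \<open>A\<close>-modules:
  \<open>mod_ring\<close> regards \<open>B\<close> as a ring in \<open>A\<close>-modules, and \<open>und_ring\<close> is the underlying ring in \<open>K\<close>.\<close>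

definition mod_ring ::
  "('o, 'm) smcat \<Rightarrow> ('o, 'm) cmon \<Rightarrow> ('o, 'm) cmon \<Rightarrow> 'm \<Rightarrow> ('o \<times> 'm, ('o, 'm) mod_arrow) cmon"
  where
  "mod_ring K A B u =
     (let M = (Car B, Mul B \<cdot>\<^bsub>K\<^esub> (u \<boxtimes>\<^bsub>K\<^esub> Idn K (Car B))) in
      \<lparr>Car = M,
       Mul = (mod_tensor K A M M, descend K (mod_quot K A M M) (Mul B), M),
       Unt = (reg_mod A, u, M)\<rparr>)"

definition und_ring ::
  "('o, 'm) smcat \<Rightarrow> ('o, 'm) cmon \<Rightarrow> ('o \<times> 'm, ('o, 'm) mod_arrow) cmon \<Rightarrow> ('o, 'm) cmon" where
  "und_ring K A S =
     \<lparr>Car = fst (Car S),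
      Mul = und_arrow (Mul S) \<cdot>\<^bsub>K\<^esub> mod_quot K A (Car S) (Car S),
      Unt = und_arrow (Unt S) \<cdot>\<^bsub>K\<^esub> Unt A\<rparr>"

section \<open>Degree\<close>

text \<open>\<open>splitting_algebra K A A' v\<close>: the separable \<open>A\<close>-algebra \<open>v : A \<rightarrow> A'\<close> is the one (unique up to
  isomorphism) with \<open>A \<otimes> A \<cong> A \<times> A'\<close>. The product is indexed by \<open>bool\<close>, with \<open>A\<close> at \<open>True\<close>.\<close>

definition splitting_algebra ::
  "('o, 'm) smcat \<Rightarrow> ('o, 'm) cmon \<Rightarrow> ('o, 'm) cmon \<Rightarrow> 'm \<Rightarrow> bool" where
  "splitting_algebra K A A' v \<longleftrightarrow>
     separable_ring K A \<and> separable_ring K A' \<and> ring_mor K A A' v \<and>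
     (let R = (\<lambda>b. if b then A else A'); pr = proj K UNIV (\<lambda>b. Car (R b)) in
      \<exists>h. ring_isomorphism K (tensor_ring K A A) (prod_ring K UNIV R) h \<and>
          pr True \<cdot>\<^bsub>K\<^esub> h = Mul A \<and>
          pr False \<cdot>\<^bsub>K\<^esub> h \<cdot>\<^bsub>K\<^esub> (Idn K (Car A) \<boxtimes>\<^bsub>K\<^esub> Unt A) \<cdot>\<^bsub>K\<^esub> inv_arrow K (Run K (Car A)) = v)"

text \<open>\<open>R n\<close> is \<open>A\<^sup>[\<^sup>n\<^sup>]\<close>, and \<open>u n : R n \<rightarrow> R (n + 1)\<close> makes \<open>R (n + 1)\<close> an \<open>R n\<close>-algebra. Each
  step is only determined up to isomorphism, so this is a relation rather than a function.\<close>

definition splitting_tower ::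
  "('o, 'm) smcat \<Rightarrow> ('o, 'm) cmon \<Rightarrow> (nat \<Rightarrow> ('o, 'm) cmon) \<Rightarrow> (nat \<Rightarrow> 'm) \<Rightarrow> bool" where
  "splitting_tower K A R u \<longleftrightarrow>
     R 0 = unit_ring K \<and> R 1 = A \<and> u 0 = Unt A \<and>
     (\<forall>n. \<exists>S w.
        splitting_algebra (mod_cat K (R n)) (mod_ring K (R n) (R (Suc n)) (u n)) S w \<and>
        R (Suc (Suc n)) = und_ring K (R n) S \<and> u (Suc n) = und_arrow w)"

definition has_degree :: "('o, 'm) smcat \<Rightarrow> ('o, 'm) cmon \<Rightarrow> nat \<Rightarrow> bool" where
  "has_degree K A d \<longleftrightarrow>
     (\<exists>R u. splitting_tower K A R u \<and> \<not> zero_ring K (R d) \<and> zero_ring K (R (Suc d)))"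

text \<open>Any two towers of \<open>A\<close> are isomorphic and a tower stays zero once it is zero, so at most one
  \<open>d\<close> satisfies \<open>has_degree K A d\<close>, and none does iff all \<open>A\<^sup>[\<^sup>d\<^sup>]\<close> are nonzero.\<close>

definition degree :: "('o, 'm) smcat \<Rightarrow> ('o, 'm) cmon \<Rightarrow> enat" where
  "degree K A = (if \<exists>d. has_degree K A d then enat (SOME d. has_degree K A d) else \<infinity>)"

section \<open>Quasi-Galois rings\<close>

definition lambda_mor :: "('o, 'm) smcat \<Rightarrow> ('o, 'm) cmon \<Rightarrow> 'm set \<Rightarrow> 'm" where
  "lambda_mor K A G =
     tuple K G (\<lambda>_. Car A) (Car A \<odot>\<^bsub>K\<^esub> Car A) (\<lambda>g. Mul A \<cdot>\<^bsub>K\<^esub> (Idn K (Car A) \<boxtimes>\<^bsub>K\<^esub> g))"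

definition lambda_iso :: "('o, 'm) smcat \<Rightarrow> ('o, 'm) cmon \<Rightarrow> 'm set \<Rightarrow> bool" where
  "lambda_iso K A G \<longleftrightarrow>
     ring_isomorphism K (tensor_ring K A A) (prod_ring K G (\<lambda>_. A)) (lambda_mor K A G)"

definition comp_monoid :: "('o, 'm) smcat \<Rightarrow> ('o, 'm) cmon \<Rightarrow> 'm set \<Rightarrow> 'm monoid" where
  "comp_monoid K A G = \<lparr>carrier = G, mult = Comp K, one = Idn K (Car A)\<rparr>"

definition quasi_Galois :: "('o, 'm) smcat \<Rightarrow> ('o, 'm) cmon \<Rightarrow> 'm set \<Rightarrow> bool" where
  "quasi_Galois K A G \<longleftrightarrow>
     is_ring K A \<and> \<not> zero_ring K A \<and>
     finite G \<and> (\<forall>g\<in>G. ring_isomorphism K A A g) \<and> group (comp_monoid K A G) \<and>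
     lambda_iso K A G"

end

theory Submission imports Defs begin

text \<open>An arrow into \<open>x\<close> is treated as a generalised element of \<open>x\<close>, so that identities in a symmetric
  monoidal category can be checked by computing with variables. Let \<open>\<Sum> x\<^sub>i \<otimes> y\<^sub>i\<close> be the separability
  idempotent of \<open>A\<close>. Ring morphisms \<open>f\<close>, \<open>g\<close> from \<open>A\<close> to \<open>D\<close> agree precisely on the part of \<open>D\<close> cut out by the
  idempotent \<open>\<Sum> f x\<^sub>i \<cdot> g y\<^sub>i\<close>. For distinct endomorphisms of an indecomposable \<open>A\<close> this idempotent of \<open>A\<close>
  vanishes, so that they are disjoint: they agree on no nonzero part.

  By the defining decomposition of \<open>A\<^sup>[\<^sup>n\<^sup>+\<^sup>1\<^sup>]\<close>, \<open>k + 1\<close> pairwise disjoint maps out of \<open>A\<^sup>[\<^sup>n\<^sup>]\<close> that agree on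
  \<open>A\<^sup>[\<^sup>n\<^sup>-\<^sup>1\<^sup>]\<close> give \<open>k\<close> such maps out of \<open>A\<^sup>[\<^sup>n\<^sup>+\<^sup>1\<^sup>]\<close>. As \<open>A\<^sup>[\<^sup>d\<^sup>+\<^sup>1\<^sup>] = 0\<close> for \<open>d = deg A\<close>, there are at most \<open>d\<close> disjoint
  maps from \<open>A\<close> to a nonzero ring; in particular \<open>|\<Gamma>| \<le> d\<close>. The elements \<open>\<Sum> \<gamma> x\<^sub>i \<otimes> y\<^sub>i\<close> for \<open>\<gamma> \<in> \<Gamma>\<close> are
  orthogonal idempotents of \<open>A \<otimes> A\<close> that cut out the factors of \<open>\<lambda>\<^sub>\<Gamma>\<close>. On the complement of their sum the maps
  \<open>a \<mapsto> \<gamma> a \<otimes> 1\<close> and \<open>b \<mapsto> 1 \<otimes> b\<close> are pairwise disjoint, so if \<open>|\<Gamma>| = d\<close> this complement is zero and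
  \<open>\<lambda>\<^sub>\<Gamma>\<close> is an isomorphism. Conversely there are \<open>d\<close> maps \<open>A \<rightarrow> A\<^sup>[\<^sup>d\<^sup>]\<close> no two of which agree on a nonzero part,
  and if \<open>\<lambda>\<^sub>\<Gamma>\<close> is an isomorphism, then on some nonzero part each of them is the first one composed with some
  \<open>\<gamma> \<in> \<Gamma>\<close>, whence \<open>d \<le> |\<Gamma>|\<close>.

  The components of an isomorphism \<open>F\<^sub>A A \<cong> \<one>\<^sub>A\<^sup>t\<close> are \<open>a \<otimes> b \<mapsto> a \<cdot> \<gamma> b\<close> with \<open>\<gamma> \<in> \<Gamma>\<close>, and by
  indecomposability they exhaust \<open>\<Gamma>\<close>. Finally, endomorphisms are left cancellable, so a finite \<open>\<Gamma>\<close> is a group.\<close>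

section \<open>Arrows and their types\<close>

text \<open>The tensor product is not strict and M \<otimes>_A N is a chosen coequaliser, so
  products of ring elements have no direct meaning in K. Naming the variables fixes an order of the
  tensor factors, which makes the coherence isomorphisms act as mere rebracketings. The separability
  idempotent is an element without variables, but not a tensor; calculations with its summands are
  legitimate because both sides are linear in it.

  The degree is defined through rings in a different module category at every level. Each level is
  pushed down once to underlying rings in K, where \<open>splits\<close> records what the counting
  uses.

  A target D may decompose, and distinct maps may still agree on a factor of D; disjointness is the
  notion that survives the passage up the tower. One map is spent per level: it is paired with each
  of the others, and the extensions then share it as their restriction to the lower ring, which the
  next level demands.\<close>

context category
begin

lemma homs_iff: "f \<in> homs K x y \<longleftrightarrow> f \<in> Ar K \<and> Dom K f = x \<and> Cod K f = y"
  by (simp add: homs_def)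

lemma arrow_homs: "f \<in> Ar K \<Longrightarrow> f \<in> homs K (Dom K f) (Cod K f)"
  by (simp add: homs_def)

text \<open>Typing is stated through \<open>Ar\<close>, \<open>Dom\<close> and \<open>Cod\<close>
  instead of \<open>homs\<close>: the simplifier can then compute the ends of a composite and
  discharge the side conditions of \<open>comp_assoc\<close>, which brackets all composites to the
  right.\<close>

lemma comp_typ [simp]:
  assumes "f \<in> Ar K" "g \<in> Ar K" "Dom K g = Cod K f"
  shows "g \<cdot> f \<in> Ar K" "Dom K (g \<cdot> f) = Dom K f" "Cod K (g \<cdot> f) = Cod K g"
  using Comp_homs[of f "Dom K f" "Cod K f" g "Cod K g"] assms by (auto simp: homs_def)

lemma idn_typ [simp]:
  assumes "x \<in> Ob K"
  shows "Idn K x \<in> Ar K" "Dom K (Idn K x) = x" "Cod K (Idn K x) = x"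
  using Idn_homs[OF assms] by (auto simp: homs_def)

lemma Ob_typ [simp]:
  assumes "f \<in> Ar K" shows "Dom K f \<in> Ob K" "Cod K f \<in> Ob K"
  using assms Dom_Ob Cod_Ob by auto

lemma comp_idn [simp]: "f \<in> Ar K \<Longrightarrow> Dom K f = x \<Longrightarrow> f \<cdot> Idn K x = f"
  using Comp_Idn arrow_homs by blast

lemma idn_comp [simp]: "f \<in> Ar K \<Longrightarrow> Cod K f = x \<Longrightarrow> Idn K x \<cdot> f = f"
  using Idn_Comp arrow_homs by blast

lemma comp_assoc [simp]:
  assumes "f \<in> Ar K" "g \<in> Ar K" "h \<in> Ar K" "Dom K g = Cod K f" "Dom K h = Cod K g"
  shows "(h \<cdot> g) \<cdot> f = h \<cdot> (g \<cdot> f)"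
  using assms by (intro Comp_assoc) (auto simp: homs_def)

lemma inv_arrow_eq:
  assumes "inverse_arrows K f g" shows "inv_arrow K f = g"
  unfolding inv_arrow_def
proof (rule the_equality)
  fix g' assume g': "inverse_arrows K f g'"
  have "g' = g' \<cdot> (f \<cdot> g)" using assms g' by (auto simp: inverse_arrows_def homs_def)
  also have "\<dots> = (g' \<cdot> f) \<cdot> g" using assms g' by (intro comp_assoc[symmetric]) (auto simp: inverse_arrows_def homs_def)
  also have "\<dots> = g" using assms g' by (auto simp: inverse_arrows_def homs_def)
  finally show "g' = g" .
qed (fact assms)

lemma inverse_inv:
  assumes "iso_arrow K f" shows "inverse_arrows K f (inv_arrow K f)"
  using assms inv_arrow_eq unfolding iso_arrow_def by auto

lemma iso_Ar: "iso_arrow K f \<Longrightarrow> f \<in> Ar K"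
  by (auto simp: iso_arrow_def inverse_arrows_def)

lemma inv_typ [simp]:
  assumes "iso_arrow K f"
  shows "inv_arrow K f \<in> Ar K" "Dom K (inv_arrow K f) = Cod K f" "Cod K (inv_arrow K f) = Dom K f"
    "inv_arrow K f \<cdot> f = Idn K (Dom K f)" "f \<cdot> inv_arrow K f = Idn K (Cod K f)"
  using inverse_inv[OF assms] by (auto simp: inverse_arrows_def homs_def)

lemma iso_inv [simp]: "iso_arrow K f \<Longrightarrow> iso_arrow K (inv_arrow K f)"
  unfolding iso_arrow_def[of K "inv_arrow K f"]
  by (rule exI[of _ f]) (auto simp: inverse_arrows_def homs_def iso_Ar)

lemma iso_idn [simp]: "x \<in> Ob K \<Longrightarrow> iso_arrow K (Idn K x)"
  unfolding iso_arrow_def by (rule exI[of _ "Idn K x"]) (auto simp: inverse_arrows_def homs_def)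

lemma inv_comp_comp [simp]:
  assumes "iso_arrow K f" "h \<in> Ar K"
  shows "Cod K h = Dom K f \<Longrightarrow> inv_arrow K f \<cdot> (f \<cdot> h) = h"
    "Cod K h = Cod K f \<Longrightarrow> f \<cdot> (inv_arrow K f \<cdot> h) = h"
  using assms iso_Ar[OF assms(1)] by (auto simp: comp_assoc[symmetric] simp del: comp_assoc)

lemma iso_comp [simp]:
  assumes "iso_arrow K f" "iso_arrow K g" "Dom K g = Cod K f"
  shows "iso_arrow K (g \<cdot> f)"
  unfolding iso_arrow_def[of K "g \<cdot> f"]
  using assms iso_Ar[OF assms(1)] iso_Ar[OF assms(2)]
  by (intro exI[of _ "inv_arrow K f \<cdot> inv_arrow K g"]) (auto simp: inverse_arrows_def homs_def)

lemma iso_cancel_right: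
  assumes "iso_arrow K f" "g \<in> Ar K" "h \<in> Ar K" "Dom K g = Cod K f" "Dom K h = Cod K f" "g \<cdot> f = h \<cdot> f"
  shows "g = h"
proof -
  have "(g \<cdot> f) \<cdot> inv_arrow K f = (h \<cdot> f) \<cdot> inv_arrow K f" using assms by simp
  then show ?thesis using assms(1-5) iso_Ar by simp
qed

lemma iso_cancel_left:
  assumes "iso_arrow K f" "g \<in> Ar K" "h \<in> Ar K" "Cod K g = Dom K f" "Cod K h = Dom K f" "f \<cdot> g = f \<cdot> h"
  shows "g = h"
proof -
  have "inv_arrow K f \<cdot> (f \<cdot> g) = inv_arrow K f \<cdot> (f \<cdot> h)" using assms by simp
  then show ?thesis using assms(1-5) by simp
qed

end

section \<open>Coherence of unitors and symmetry\<close>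

context symmetric_monoidal_category
begin

lemma Unit_in [simp]: "Unit K \<in> Ob K" by (rule Unit_Ob)
lemma TenO_in [simp]: "x \<in> Ob K \<Longrightarrow> y \<in> Ob K \<Longrightarrow> x \<odot> y \<in> Ob K" by (rule TenO_Ob)

lemma ten_typ [simp]:
  assumes "f \<in> Ar K" "g \<in> Ar K"
  shows "f \<boxtimes> g \<in> Ar K" "Dom K (f \<boxtimes> g) = Dom K f \<odot> Dom K g" "Cod K (f \<boxtimes> g) = Cod K f \<odot> Cod K g"
  using TenA_homs[OF arrow_homs[OF assms(1)] arrow_homs[OF assms(2)]] by (auto simp: homs_def)

lemma ten_idn [simp]: "x \<in> Ob K \<Longrightarrow> y \<in> Ob K \<Longrightarrow> Idn K x \<boxtimes> Idn K y = Idn K (x \<odot> y)"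
  by (rule TenA_Idn)

lemma ten_comp:
  assumes "f \<in> Ar K" "g \<in> Ar K" "f' \<in> Ar K" "g' \<in> Ar K" "Dom K g = Cod K f" "Dom K g' = Cod K f'"
  shows "(g \<boxtimes> g') \<cdot> (f \<boxtimes> f') = (g \<cdot> f) \<boxtimes> (g' \<cdot> f')"
  using assms by (intro TenA_Comp[symmetric]) (auto simp: homs_def)

lemma ten_comp2:
  assumes "f \<in> Ar K" "g \<in> Ar K" "f' \<in> Ar K" "g' \<in> Ar K" "Dom K g = Cod K f" "Dom K g' = Cod K f'"
    "h \<in> Ar K" "Cod K h = Dom K f \<odot> Dom K f'"
  shows "(g \<boxtimes> g') \<cdot> ((f \<boxtimes> f') \<cdot> h) = ((g \<cdot> f) \<boxtimes> (g' \<cdot> f')) \<cdot> h"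
  using assms by (simp add: ten_comp[symmetric])

lemma asc_typ [simp]:
  assumes "x \<in> Ob K" "y \<in> Ob K" "z \<in> Ob K"
  shows "Asc K x y z \<in> Ar K" "Dom K (Asc K x y z) = (x \<odot> y) \<odot> z" "Cod K (Asc K x y z) = x \<odot> (y \<odot> z)"
    "iso_arrow K (Asc K x y z)"
  using Asc_homs[OF assms] Asc_iso[OF assms] by (auto simp: homs_def)

lemma lun_typ [simp]:
  assumes "x \<in> Ob K"
  shows "Lun K x \<in> Ar K" "Dom K (Lun K x) = Unit K \<odot> x" "Cod K (Lun K x) = x" "iso_arrow K (Lun K x)"
  using Lun_homs[OF assms] Lun_iso[OF assms] by (auto simp: homs_def)

lemma run_typ [simp]:
  assumes "x \<in> Ob K"
  shows "Run K x \<in> Ar K" "Dom K (Run K x) = x \<odot> Unit K" "Cod K (Run K x) = x" "iso_arrow K (Run K x)"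
  using Run_homs[OF assms] Run_iso[OF assms] by (auto simp: homs_def)

lemma swp_typ [simp]:
  assumes "x \<in> Ob K" "y \<in> Ob K"
  shows "Swp K x y \<in> Ar K" "Dom K (Swp K x y) = x \<odot> y" "Cod K (Swp K x y) = y \<odot> x"
  using Swp_homs[OF assms] by (auto simp: homs_def)

lemma swp_iso [simp]:
  assumes "x \<in> Ob K" "y \<in> Ob K" shows "iso_arrow K (Swp K x y)"
  unfolding iso_arrow_def using assms
  by (intro exI[of _ "Swp K y x"]) (auto simp: inverse_arrows_def homs_def Swp_Swp)

lemma ten_iso [simp]:
  assumes "iso_arrow K f" "iso_arrow K g" shows "iso_arrow K (f \<boxtimes> g)"
  unfolding iso_arrow_def[of K "f \<boxtimes> g"]
  using assms iso_Ar[OF assms(1)] iso_Ar[OF assms(2)]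
  by (intro exI[of _ "inv_arrow K f \<boxtimes> inv_arrow K g"]) (auto simp: inverse_arrows_def homs_def ten_comp)

lemma asc_nat:
  assumes "f \<in> Ar K" "g \<in> Ar K" "h \<in> Ar K" "x' = Cod K f" "y' = Cod K g" "z' = Cod K h"
  shows "Asc K x' y' z' \<cdot> ((f \<boxtimes> g) \<boxtimes> h) = (f \<boxtimes> (g \<boxtimes> h)) \<cdot> Asc K (Dom K f) (Dom K g) (Dom K h)"
  using assms by (intro Asc_natural) (auto simp: homs_def)

lemma swp_nat:
  assumes "f \<in> Ar K" "g \<in> Ar K" "x' = Cod K f" "y' = Cod K g"
  shows "Swp K x' y' \<cdot> (f \<boxtimes> g) = (g \<boxtimes> f) \<cdot> Swp K (Dom K f) (Dom K g)"
  using assms by (intro Swp_natural) (auto simp: homs_def)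

lemma lun_nat: "f \<in> Ar K \<Longrightarrow> y = Cod K f \<Longrightarrow> Lun K y \<cdot> (Idn K (Unit K) \<boxtimes> f) = f \<cdot> Lun K (Dom K f)"
  by (intro Lun_natural) (auto simp: homs_def)

lemma run_nat: "f \<in> Ar K \<Longrightarrow> y = Cod K f \<Longrightarrow> Run K y \<cdot> (f \<boxtimes> Idn K (Unit K)) = f \<cdot> Run K (Dom K f)"
  by (intro Run_natural) (auto simp: homs_def)

text \<open>Composites are bracketed to the right, so an equation for \<open>g \<cdot> f\<close>
  does not match inside \<open>g \<cdot> (f \<cdot> h)\<close>; this makes it applicable
  there.\<close>

lemma comp_eq_extend:
  assumes "g \<cdot> f = k" "f \<in> Ar K" "g \<in> Ar K" "Dom K g = Cod K f" "h \<in> Ar K" "Cod K h = Dom K f"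
  shows "g \<cdot> (f \<cdot> h) = k \<cdot> h"
  using assms by (metis comp_assoc)

lemma unit_ten_faithful:
  assumes "f \<in> Ar K" "g \<in> Ar K" "Dom K f = Dom K g" "Cod K f = Cod K g"
    "Idn K (Unit K) \<boxtimes> f = Idn K (Unit K) \<boxtimes> g"
  shows "f = g"
  by (rule iso_cancel_right[of "Lun K (Dom K f)"]) (use assms lun_nat[of f] lun_nat[of g] in auto)

lemma ten_unit_faithful:
  assumes "f \<in> Ar K" "g \<in> Ar K" "Dom K f = Dom K g" "Cod K f = Cod K g"
    "f \<boxtimes> Idn K (Unit K) = g \<boxtimes> Idn K (Unit K)"
  shows "f = g"
  by (rule iso_cancel_right[of "Run K (Dom K f)"]) (use assms run_nat[of f] run_nat[of g] in auto)

text \<open>Kelly's argument: after tensoring with the unit on the left, the pentagon for two units,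
  y and z together with the triangle identity gives the equation, and
  \<open>unit_ten_faithful\<close> removes the extra unit.\<close>

lemma Lun_Asc:
  assumes y: "y \<in> Ob K" and z: "z \<in> Ob K"
  shows "Lun K (y \<odot> z) \<cdot> Asc K (Unit K) y z = Lun K y \<boxtimes> Idn K z"
proof (rule unit_ten_faithful)
  let ?I = "Unit K"
  let ?c = "Asc K ?I (?I \<odot> y) z \<cdot> (Asc K ?I ?I y \<boxtimes> Idn K z)"
  show "Idn K ?I \<boxtimes> (Lun K (y \<odot> z) \<cdot> Asc K ?I y z) = Idn K ?I \<boxtimes> (Lun K y \<boxtimes> Idn K z)"
  proof (rule iso_cancel_right[of ?c])
    have "(Idn K ?I \<boxtimes> (Lun K (y \<odot> z) \<cdot> Asc K ?I y z)) \<cdot> ?c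
       = (Idn K ?I \<boxtimes> Lun K (y \<odot> z)) \<cdot> ((Idn K ?I \<boxtimes> Asc K ?I y z) \<cdot> ?c)"
      using y z by (simp add: ten_comp2)
    also have "\<dots> = (Idn K ?I \<boxtimes> Lun K (y \<odot> z)) \<cdot> (Asc K ?I ?I (y \<odot> z) \<cdot> Asc K (?I \<odot> ?I) y z)"
      using pentagon[of ?I ?I y z] y z by simp
    also have "\<dots> = (Run K ?I \<boxtimes> Idn K (y \<odot> z)) \<cdot> Asc K (?I \<odot> ?I) y z"
      using y z by (intro comp_eq_extend triangle) auto
    also have "\<dots> = Asc K ?I y z \<cdot> ((Run K ?I \<boxtimes> Idn K y) \<boxtimes> Idn K z)"
      using asc_nat[of "Run K ?I" "Idn K y" "Idn K z" ?I y z] y z by simp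
    also have "\<dots> = Asc K ?I y z \<cdot> (((Idn K ?I \<boxtimes> Lun K y) \<boxtimes> Idn K z) \<cdot> (Asc K ?I ?I y \<boxtimes> Idn K z))"
      using triangle[of ?I y] y z by (simp add: ten_comp)
    also have "\<dots> = (Idn K ?I \<boxtimes> (Lun K y \<boxtimes> Idn K z)) \<cdot> ?c"
      using comp_eq_extend[OF asc_nat[of "Idn K ?I" "Lun K y" "Idn K z" ?I y z], of "Asc K ?I ?I y \<boxtimes> Idn K z"] y z
      by simp
    finally show "(Idn K ?I \<boxtimes> (Lun K (y \<odot> z) \<cdot> Asc K ?I y z)) \<cdot> ?c = (Idn K ?I \<boxtimes> (Lun K y \<boxtimes> Idn K z)) \<cdot> ?c" .
  qed (use y z in auto)
qed (use y z in auto)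

text \<open>After tensoring with the unit on the right and composing with the swap, triangle and
  hexagon reduce the claim to \<open>Lun_Asc\<close>. It lets \<open>run_app\<close> follow from
  \<open>lun_app\<close>.\<close>

lemma Run_eq_Lun_Swp:
  assumes x: "x \<in> Ob K"
  shows "Run K x = Lun K x \<cdot> Swp K x (Unit K)"
proof (rule ten_unit_faithful)
  let ?I = "Unit K"
  show "Run K x \<boxtimes> Idn K ?I = (Lun K x \<cdot> Swp K x ?I) \<boxtimes> Idn K ?I"
  proof (rule iso_cancel_left[of "Swp K x ?I"])
    have "Swp K x ?I \<cdot> (Run K x \<boxtimes> Idn K ?I)
        = Swp K x ?I \<cdot> ((Idn K x \<boxtimes> Lun K ?I) \<cdot> Asc K x ?I ?I)"
      using triangle[of x ?I] x by simp
    also have "\<dots> = (Lun K ?I \<boxtimes> Idn K x) \<cdot> (Swp K x (?I \<odot> ?I) \<cdot> Asc K x ?I ?I)"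
      using comp_eq_extend[OF swp_nat[of "Idn K x" "Lun K ?I" x ?I], of "Asc K x ?I ?I"] x by simp
    also have "\<dots> = Lun K (?I \<odot> x) \<cdot> (Asc K ?I ?I x \<cdot> (Swp K x (?I \<odot> ?I) \<cdot> Asc K x ?I ?I))"
      using comp_eq_extend[OF Lun_Asc[of ?I x], of "Swp K x (?I \<odot> ?I) \<cdot> Asc K x ?I ?I"] x by simp
    also have "\<dots> = Lun K (?I \<odot> x) \<cdot> ((Idn K ?I \<boxtimes> Swp K x ?I) \<cdot> (Asc K ?I x ?I \<cdot> (Swp K x ?I \<boxtimes> Idn K ?I)))"
      using hexagon[of x ?I ?I] x by simp
    also have "\<dots> = Swp K x ?I \<cdot> (Lun K (x \<odot> ?I) \<cdot> (Asc K ?I x ?I \<cdot> (Swp K x ?I \<boxtimes> Idn K ?I)))"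
      using comp_eq_extend[OF lun_nat[of "Swp K x ?I" "?I \<odot> x"], of "Asc K ?I x ?I \<cdot> (Swp K x ?I \<boxtimes> Idn K ?I)"] x by simp
    also have "\<dots> = Swp K x ?I \<cdot> ((Lun K x \<cdot> Swp K x ?I) \<boxtimes> Idn K ?I)"
      using comp_eq_extend[OF Lun_Asc[of x ?I], of "Swp K x ?I \<boxtimes> Idn K ?I"] x by (simp add: ten_comp)
    finally show "Swp K x ?I \<cdot> (Run K x \<boxtimes> Idn K ?I) = Swp K x ?I \<cdot> ((Lun K x \<cdot> Swp K x ?I) \<boxtimes> Idn K ?I)" .
  qed (use x in auto)
qed (use x in auto)

text \<open>Naturality of \<open>Lun\<close> at \<open>Lun K (Unit K)\<close> identifies the left
  unitor of a product of two units with \<open>Idn K (Unit K) \<boxtimes> Lun K (Unit K)\<close>;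
  \<open>Lun_Asc\<close> and the triangle identity then describe the same arrow.\<close>

lemma Run_Unit: "Run K (Unit K) = Lun K (Unit K)"
proof (rule ten_unit_faithful)
  let ?I = "Unit K"
  have "Lun K (?I \<odot> ?I) = Idn K ?I \<boxtimes> Lun K ?I"
    by (rule iso_cancel_left[of "Lun K ?I"]) (use lun_nat[of "Lun K ?I" ?I] in auto)
  then show "Run K ?I \<boxtimes> Idn K ?I = Lun K ?I \<boxtimes> Idn K ?I"
    using Lun_Asc[of ?I ?I] triangle[of ?I ?I] by simp
qed auto

lemma Lun_Swp_Unit: "Lun K (Unit K) \<cdot> Swp K (Unit K) (Unit K) = Lun K (Unit K)"
  using Run_eq_Lun_Swp[of "Unit K"] Run_Unit by simp

text \<open>Two ways to reverse three factors. Precomposed with the rotation that moves z to the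
  end, both are evaluated by the hexagons for (z, x, y) and (x, z, y). Needed when the smallest name
  lies in the last of three lists.\<close>

lemma hexagon_reverse:
  assumes "x \<in> Ob K" "y \<in> Ob K" "z \<in> Ob K"
  shows "Asc K z y x \<cdot> (Swp K x (z \<odot> y) \<cdot> ((Idn K x \<boxtimes> Swp K y z) \<cdot> Asc K x y z))
    = Swp K (y \<odot> x) z \<cdot> (Swp K x y \<boxtimes> Idn K z)"
proof -
  let ?b = "Asc K x z y \<cdot> (Swp K z x \<boxtimes> Idn K y)"
  have h: "Asc K x y z \<cdot> (Swp K z (x \<odot> y) \<cdot> Asc K z x y) = (Idn K x \<boxtimes> Swp K z y) \<cdot> ?b"
    using hexagon[of z x y] assms by simp
  have "(Asc K z y x \<cdot> (Swp K x (z \<odot> y) \<cdot> ((Idn K x \<boxtimes> Swp K y z) \<cdot> Asc K x y z))) \<cdot> (Swp K z (x \<odot> y) \<cdot> Asc K z x y)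
    = (Asc K z y x \<cdot> (Swp K x (z \<odot> y) \<cdot> (Idn K x \<boxtimes> Swp K y z))) \<cdot> (Asc K x y z \<cdot> (Swp K z (x \<odot> y) \<cdot> Asc K z x y))"
    using assms by simp
  also have "\<dots> = (Asc K z y x \<cdot> Swp K x (z \<odot> y)) \<cdot> ((Idn K x \<boxtimes> Swp K y z) \<cdot> ((Idn K x \<boxtimes> Swp K z y) \<cdot> ?b))"
    unfolding h using assms by simp
  also have "\<dots> = (Asc K z y x \<cdot> (Swp K x (z \<odot> y) \<cdot> Asc K x z y)) \<cdot> (Swp K z x \<boxtimes> Idn K y)"
    using assms by (simp add: ten_comp2 Swp_Swp)
  also have "\<dots> = ((Idn K z \<boxtimes> Swp K x y) \<cdot> Asc K z x y \<cdot> (Swp K x z \<boxtimes> Idn K y)) \<cdot> (Swp K z x \<boxtimes> Idn K y)"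
    using hexagon[of x z y] assms by simp
  also have "\<dots> = (Idn K z \<boxtimes> Swp K x y) \<cdot> Asc K z x y"
    using assms by (simp add: ten_comp Swp_Swp)
  also have "\<dots> = (Swp K (y \<odot> x) z \<cdot> (Swp K z (y \<odot> x) \<cdot> (Idn K z \<boxtimes> Swp K x y))) \<cdot> Asc K z x y"
    using comp_eq_extend[OF Swp_Swp[of z "y \<odot> x"], of "Idn K z \<boxtimes> Swp K x y"] assms by simp
  also have "\<dots> = (Swp K (y \<odot> x) z \<cdot> (Swp K x y \<boxtimes> Idn K z)) \<cdot> (Swp K z (x \<odot> y) \<cdot> Asc K z x y)"
    using swp_nat[of "Idn K z" "Swp K x y" z "y \<odot> x"] assms by simp
  finally show ?thesis
    by (rule iso_cancel_right[rotated -1]) (use assms in auto)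
qed

end

section \<open>Elements\<close>

text \<open>A stage is a list of named variables with their objects; disjoint stages are merged in the
  order of the names, so that the tensor product of elements is strictly commutative.\<close>

fun stg :: "('o, 'm) smcat \<Rightarrow> (nat \<times> 'o) list \<Rightarrow> 'o" where
  "stg K [] = Unit K"
| "stg K (p # U) = snd p \<odot>\<^bsub>K\<^esub> stg K U"

fun mrg :: "(nat \<times> 'o) list \<Rightarrow> (nat \<times> 'o) list \<Rightarrow> (nat \<times> 'o) list" where
  "mrg [] V = V"
| "mrg (p # U) [] = p # U"
| "mrg (p # U) (r # V) = (if fst p < fst r then p # mrg U (r # V) else r # mrg (p # U) V)"

text \<open>The isomorphism that shuffles the factors of two stages into the order of
  \<open>mrg\<close>. If the second list supplies the first factor, the whole product is swapped,
  that factor is split off, and the rest is swapped back so that the recursive call has its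
  arguments in the original order. The unit case uses \<open>Lun\<close> and a swap, not
  \<open>Run\<close>, so that there exchanging the lists is a swap by definition.\<close>

fun mga :: "('o, 'm) smcat \<Rightarrow> (nat \<times> 'o) list \<Rightarrow> (nat \<times> 'o) list \<Rightarrow> 'm" where
  "mga K [] V = Lun K (stg K V)"
| "mga K (p # U) [] = Lun K (stg K (p # U)) \<cdot>\<^bsub>K\<^esub> Swp K (stg K (p # U)) (Unit K)"
| "mga K (p # U) (r # V) =
    (if fst p < fst r
     then (Idn K (snd p) \<boxtimes>\<^bsub>K\<^esub> mga K U (r # V)) \<cdot>\<^bsub>K\<^esub> Asc K (snd p) (stg K U) (stg K (r # V))
     else (Idn K (snd r) \<boxtimes>\<^bsub>K\<^esub> (mga K (p # U) V \<cdot>\<^bsub>K\<^esub> Swp K (stg K V) (stg K (p # U))))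
          \<cdot>\<^bsub>K\<^esub> (Asc K (snd r) (stg K V) (stg K (p # U)) \<cdot>\<^bsub>K\<^esub> Swp K (stg K (p # U)) (stg K (r # V))))"

lemma mrg_Nil [simp]: "mrg U [] = U" by (cases U) auto

lemma set_mrg [simp]: "set (mrg U V) = set U \<union> set V"
  by (induction U V rule: mrg.induct) auto

lemma mrg_commute: "fst ` set U \<inter> fst ` set V = {} \<Longrightarrow> mrg U V = mrg V U"
  by (induction U V rule: mrg.induct) (auto simp: not_less)

lemma mrg_assoc: "mrg (mrg U V) W = mrg U (mrg V W)"
proof (induction "length U + length V + length W" arbitrary: U V W rule: less_induct)
  case less
  show ?case
  proof (cases U; cases V; cases W)
    fix p U' r V' s W' assume [simp]: "U = p # U'" "V = r # V'" "W = s # W'"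
    have "mrg (mrg U' V) W = mrg U' (mrg V W)" "mrg (mrg U V') W = mrg U (mrg V' W)"
      "mrg (mrg U V) W' = mrg U (mrg V W')" by (rule less; simp)+
    then show ?thesis by auto
  qed auto
qed

context symmetric_monoidal_category
begin

definition obs :: "(nat \<times> 'a) list \<Rightarrow> bool" where "obs U \<longleftrightarrow> snd ` set U \<subseteq> Ob K"

lemma obs_simps [simp]:
  "obs []" "obs (p # U) \<longleftrightarrow> snd p \<in> Ob K \<and> obs U" "obs (mrg U V) \<longleftrightarrow> obs U \<and> obs V"
  by (auto simp: obs_def)

lemma stg_in [simp]: "obs U \<Longrightarrow> stg K U \<in> Ob K"
  by (induction U) auto

lemma mga_typ_aux:
  assumes "obs U" "obs V"
  shows "mga K U V \<in> Ar K \<and> Dom K (mga K U V) = stg K U \<odot> stg K V \<and> Cod K (mga K U V) = stg K (mrg U V)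
    \<and> iso_arrow K (mga K U V)"
  using assms by (induction U V rule: mrg.induct) auto

lemma mga_typ [simp]:
  assumes "obs U" "obs V"
  shows "mga K U V \<in> Ar K" "Dom K (mga K U V) = stg K U \<odot> stg K V" "Cod K (mga K U V) = stg K (mrg U V)"
    "iso_arrow K (mga K U V)"
  using mga_typ_aux[OF assms] by auto

lemma mga_commute_less:
  assumes "obs (p # U)" "obs (r # V)" "fst p < fst r" "mga K (r # V) U \<cdot> Swp K (stg K U) (stg K (r # V)) = mga K U (r # V)"
  shows "mga K (r # V) (p # U) \<cdot> Swp K (stg K (p # U)) (stg K (r # V)) = mga K (p # U) (r # V)"
  using assms by (simp add: Swp_Swp)

text \<open>Swaps are involutive, so the claims for (U, V) and (V, U) are equivalent, and
  \<open>mga_commute_less\<close> covers the one whose first list has the smaller head. For two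
  empty lists the swap of the unit with itself must be invisible to \<open>Lun\<close>.\<close>

lemma mga_commute:
  assumes "obs U" "obs V" "fst ` set U \<inter> fst ` set V = {}"
  shows "mga K V U \<cdot> Swp K (stg K U) (stg K V) = mga K U V"
  using assms
proof (induction U V rule: mrg.induct)
  case (1 V) then show ?case by (cases V) (auto simp: Lun_Swp_Unit Swp_Swp)
next
  case (2 p U) then show ?case by simp
next
  case (3 p U r V)
  show ?case
  proof (cases "fst p < fst r")
    case True then show ?thesis using 3 by (intro mga_commute_less) auto
  next
    case False
    then have "fst r < fst p" using 3 by (auto simp: not_less le_less)
    moreover have "mga K (p # U) V \<cdot> Swp K (stg K V) (stg K (p # U)) = mga K V (p # U)"
    proof -
      have e: "mga K V (p # U) \<cdot> Swp K (stg K (p # U)) (stg K V) = mga K (p # U) V"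
        using 3 False by auto
      show ?thesis unfolding e[symmetric] using 3(3,4) by (simp add: Swp_Swp)
    qed
    ultimately have "mga K (p # U) (r # V) \<cdot> Swp K (stg K (r # V)) (stg K (p # U)) = mga K (r # V) (p # U)"
      using 3 by (intro mga_commute_less) auto
    from this[symmetric] show ?thesis using 3(3,4) by (simp add: Swp_Swp del: mga.simps)
  qed
qed

section \<open>Associativity of merging\<close>

definition mga_assoc where
  "mga_assoc X Y Z \<longleftrightarrow>
     mga K X (mrg Y Z) \<cdot> ((Idn K (stg K X) \<boxtimes> mga K Y Z) \<cdot> Asc K (stg K X) (stg K Y) (stg K Z))
     = mga K (mrg X Y) Z \<cdot> (mga K X Y \<boxtimes> Idn K (stg K Z))"

abbreviation apart :: "(nat \<times> 'a) list \<Rightarrow> (nat \<times> 'a) list \<Rightarrow> bool" where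
  "apart U V \<equiv> fst ` set U \<inter> fst ` set V = {}"

text \<open>The hexagon reduces the claim to the orders in which \<open>X\<close> stands behind
  \<open>Y\<close> or behind both other lists. With \<open>mga_assoc_reverse\<close> this allows the
  list with the smallest name to be placed first.\<close>

lemma mga_assoc_rotate:
  assumes o: "obs X" "obs Y" "obs Z" and d: "apart X Y" "apart X Z" "apart Y Z"
    and a1: "mga_assoc Y Z X" and a2: "mga_assoc Y X Z"
  shows "mga_assoc X Y Z"
proof -
  let ?x = "stg K X" and ?y = "stg K Y" and ?z = "stg K Z"
  have x: "?x \<in> Ob K" "?y \<in> Ob K" "?z \<in> Ob K" using o by auto
  have e: "mrg Z X = mrg X Z" "mrg Y X = mrg X Y"
    using mrg_commute[OF d(2)] mrg_commute[OF d(1)] by simp_all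
  have c: "mga K (mrg Y Z) X \<cdot> Swp K ?x (stg K (mrg Y Z)) = mga K X (mrg Y Z)"
    "mga K Z X \<cdot> Swp K ?x ?z = mga K X Z" "mga K Y X \<cdot> Swp K ?x ?y = mga K X Y"
    using o d by (intro mga_commute; auto)+
  let ?s = "Swp K ?x (?y \<odot> ?z) \<cdot> Asc K ?x ?y ?z"
  have "mga K X (mrg Y Z) \<cdot> ((Idn K ?x \<boxtimes> mga K Y Z) \<cdot> Asc K ?x ?y ?z)
     = mga K (mrg Y Z) X \<cdot> ((Swp K ?x (stg K (mrg Y Z)) \<cdot> (Idn K ?x \<boxtimes> mga K Y Z)) \<cdot> Asc K ?x ?y ?z)"
    unfolding c(1)[symmetric] using o x by simp
  also have "\<dots> = (mga K (mrg Y Z) X \<cdot> (mga K Y Z \<boxtimes> Idn K ?x)) \<cdot> ?s"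
    using o x swp_nat[of "Idn K ?x" "mga K Y Z" ?x "stg K (mrg Y Z)"] by simp
  also have "\<dots> = mga K Y (mrg Z X) \<cdot> ((Idn K ?y \<boxtimes> mga K Z X) \<cdot> (Asc K ?y ?z ?x \<cdot> ?s))"
    using a1[unfolded mga_assoc_def, symmetric] o x by simp
  also have "\<dots> = mga K Y (mrg Z X) \<cdot> ((Idn K ?y \<boxtimes> mga K Z X) \<cdot> ((Idn K ?y \<boxtimes> Swp K ?x ?z) \<cdot> (Asc K ?y ?x ?z \<cdot> (Swp K ?x ?y \<boxtimes> Idn K ?z))))"
    using hexagon[OF x] by simp
  also have "\<dots> = (mga K Y (mrg X Z) \<cdot> ((Idn K ?y \<boxtimes> mga K X Z) \<cdot> Asc K ?y ?x ?z)) \<cdot> (Swp K ?x ?y \<boxtimes> Idn K ?z)"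
    using o x c(2) by (simp add: ten_comp2 e)
  also have "\<dots> = mga K (mrg X Y) Z \<cdot> (mga K X Y \<boxtimes> Idn K ?z)"
    using a2[unfolded mga_assoc_def] o x c(3) e by (simp add: ten_comp)
  finally show ?thesis unfolding mga_assoc_def .
qed

lemma mga_assoc_reverse:
  assumes o: "obs X" "obs Y" "obs Z" and d: "apart X Y" "apart X Z" "apart Y Z"
    and a: "mga_assoc Z Y X"
  shows "mga_assoc X Y Z"
proof -
  let ?x = "stg K X" and ?y = "stg K Y" and ?z = "stg K Z"
  have x: "?x \<in> Ob K" "?y \<in> Ob K" "?z \<in> Ob K" using o by auto
  have e: "mrg Z Y = mrg Y Z" "mrg Y X = mrg X Y"
    using mrg_commute[OF d(3)] mrg_commute[OF d(1)] by simp_all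
  have c: "mga K (mrg Y Z) X \<cdot> Swp K ?x (stg K (mrg Y Z)) = mga K X (mrg Y Z)"
    "mga K Z (mrg X Y) \<cdot> Swp K (stg K (mrg X Y)) ?z = mga K (mrg X Y) Z"
    "mga K Z Y \<cdot> Swp K ?y ?z = mga K Y Z" "mga K Y X \<cdot> Swp K ?x ?y = mga K X Y"
    using o d by (intro mga_commute; auto)+
  have "mga K X (mrg Y Z) \<cdot> ((Idn K ?x \<boxtimes> mga K Y Z) \<cdot> Asc K ?x ?y ?z)
     = mga K (mrg Z Y) X \<cdot> ((Swp K ?x (stg K (mrg Z Y)) \<cdot> (Idn K ?x \<boxtimes> mga K Z Y)) \<cdot> ((Idn K ?x \<boxtimes> Swp K ?y ?z) \<cdot> Asc K ?x ?y ?z))"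
    unfolding c(1)[symmetric] using o x c(3) by (simp add: ten_comp2 e)
  also have "\<dots> = (mga K (mrg Z Y) X \<cdot> (mga K Z Y \<boxtimes> Idn K ?x)) \<cdot> (Swp K ?x (?z \<odot> ?y) \<cdot> ((Idn K ?x \<boxtimes> Swp K ?y ?z) \<cdot> Asc K ?x ?y ?z))"
    using o x swp_nat[of "Idn K ?x" "mga K Z Y" ?x "stg K (mrg Z Y)"] by simp
  also have "\<dots> = mga K Z (mrg Y X) \<cdot> ((Idn K ?z \<boxtimes> mga K Y X) \<cdot> (Asc K ?z ?y ?x \<cdot> (Swp K ?x (?z \<odot> ?y) \<cdot> ((Idn K ?x \<boxtimes> Swp K ?y ?z) \<cdot> Asc K ?x ?y ?z))))"
    using a[unfolded mga_assoc_def, symmetric] o x by simp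
  also have "\<dots> = mga K Z (mrg Y X) \<cdot> (((Idn K ?z \<boxtimes> mga K Y X) \<cdot> Swp K (?y \<odot> ?x) ?z) \<cdot> (Swp K ?x ?y \<boxtimes> Idn K ?z))"
    using hexagon_reverse[OF x] o x by simp
  also have "\<dots> = mga K Z (mrg X Y) \<cdot> ((Swp K (stg K (mrg X Y)) ?z \<cdot> (mga K Y X \<boxtimes> Idn K ?z)) \<cdot> (Swp K ?x ?y \<boxtimes> Idn K ?z))"
    using o x swp_nat[of "mga K Y X" "Idn K ?z" "stg K (mrg Y X)" ?z] by (simp add: e)
  also have "\<dots> = mga K (mrg X Y) Z \<cdot> (mga K X Y \<boxtimes> Idn K ?z)"
    unfolding c(2)[symmetric] using c(4) o x e by (simp add: ten_comp)
  finally show ?thesis unfolding mga_assoc_def .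
qed

lemma mga_assoc_Nil:
  assumes "obs Y" "obs Z" shows "mga_assoc [] Y Z"
  unfolding mga_assoc_def using assms Lun_Asc[of "stg K Y" "stg K Z"]
  comp_eq_extend[OF lun_nat[of "mga K Y Z" "stg K (mrg Y Z)"], of "Asc K (Unit K) (stg K Y) (stg K Z)"]
  by simp

text \<open>If the head of the first list is smallest, every merge keeps it in front; naturality and
  the pentagon split it off and leave the claim for the tail.\<close>

lemma mga_assoc_Cons:
  assumes o: "obs (p # U)" "obs (r # V)" "obs (s # W)"
    and l: "fst p < fst r" "fst p < fst s"
    and a: "mga_assoc U (r # V) (s # W)"
  shows "mga_assoc (p # U) (r # V) (s # W)"
proof -
  define Y Z where "Y = r # V" and "Z = s # W"
  let ?p = "snd p" and ?x = "stg K U" and ?y = "stg K Y" and ?z = "stg K Z"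
  have oY: "obs Y" "obs Z" "obs U" using o by (auto simp: Y_def Z_def)
  have x: "?p \<in> Ob K" "?x \<in> Ob K" "?y \<in> Ob K" "?z \<in> Ob K" using o oY by auto
  \<comment> \<open>The head of the merged list is again larger than \<open>p\<close>, so that
    \<open>mga\<close> takes its first branch on it.\<close>
  obtain t T where tT: "mrg Y Z = t # T" "fst p < fst t" unfolding Y_def Z_def using l
    by (cases "fst r < fst s") auto
  have m: "mga K (p # U) (mrg Y Z) = (Idn K ?p \<boxtimes> mga K U (mrg Y Z)) \<cdot> Asc K ?p ?x (stg K (mrg Y Z))"
    "mga K (p # U) Y = (Idn K ?p \<boxtimes> mga K U Y) \<cdot> Asc K ?p ?x ?y"
    "mrg (p # U) Y = p # mrg U Y"
    "mga K (p # mrg U Y) Z = (Idn K ?p \<boxtimes> mga K (mrg U Y) Z) \<cdot> Asc K ?p (stg K (mrg U Y)) ?z"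
    using l tT(2) by (simp_all add: tT(1)) (simp_all add: Y_def Z_def)
  have "mga K (p # U) (mrg Y Z) \<cdot> ((Idn K (?p \<odot> ?x) \<boxtimes> mga K Y Z) \<cdot> Asc K (?p \<odot> ?x) ?y ?z)
    = (Idn K ?p \<boxtimes> mga K U (mrg Y Z)) \<cdot> ((Asc K ?p ?x (stg K (mrg Y Z)) \<cdot> ((Idn K ?p \<boxtimes> Idn K ?x) \<boxtimes> mga K Y Z)) \<cdot> Asc K (?p \<odot> ?x) ?y ?z)"
    unfolding m using x oY by simp
  also have "\<dots> = (Idn K ?p \<boxtimes> (mga K U (mrg Y Z) \<cdot> (Idn K ?x \<boxtimes> mga K Y Z))) \<cdot> (Asc K ?p ?x (?y \<odot> ?z) \<cdot> Asc K (?p \<odot> ?x) ?y ?z)"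
    using asc_nat[of "Idn K ?p" "Idn K ?x" "mga K Y Z" ?p ?x "stg K (mrg Y Z)"] x oY by (simp add: ten_comp2)
  also have "\<dots> = (Idn K ?p \<boxtimes> (mga K U (mrg Y Z) \<cdot> ((Idn K ?x \<boxtimes> mga K Y Z) \<cdot> Asc K ?x ?y ?z))) \<cdot> (Asc K ?p (?x \<odot> ?y) ?z \<cdot> (Asc K ?p ?x ?y \<boxtimes> Idn K ?z))"
    using pentagon[OF x, symmetric] x oY by (simp add: ten_comp2)
  also have "\<dots> = (Idn K ?p \<boxtimes> mga K (mrg U Y) Z) \<cdot> (((Idn K ?p \<boxtimes> (mga K U Y \<boxtimes> Idn K ?z)) \<cdot> Asc K ?p (?x \<odot> ?y) ?z) \<cdot> (Asc K ?p ?x ?y \<boxtimes> Idn K ?z))"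
    using a[folded Y_def Z_def, unfolded mga_assoc_def] x oY by (simp add: ten_comp2)
  also have "\<dots> = (Idn K ?p \<boxtimes> mga K (mrg U Y) Z) \<cdot> ((Asc K ?p (stg K (mrg U Y)) ?z \<cdot> ((Idn K ?p \<boxtimes> mga K U Y) \<boxtimes> Idn K ?z)) \<cdot> (Asc K ?p ?x ?y \<boxtimes> Idn K ?z))"
    using asc_nat[of "Idn K ?p" "mga K U Y" "Idn K ?z" ?p "stg K (mrg U Y)" ?z] x oY by simp
  also have "\<dots> = mga K (p # mrg U Y) Z \<cdot> (mga K (p # U) Y \<boxtimes> Idn K ?z)"
    unfolding m using x oY by (simp add: ten_comp)
  finally show ?thesis unfolding mga_assoc_def Y_def[symmetric] Z_def[symmetric] m(3) by simp
qed

lemma mga_associative: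
  assumes "obs X" "obs Y" "obs Z" and "apart X Y" "apart X Z" "apart Y Z"
  shows "mga_assoc X Y Z"
  using assms
proof (induction "length X + length Y + length Z" arbitrary: X Y Z rule: less_induct)
  case less
  note o = less.prems(1-3) and d = less.prems(4-6)
  have d': "apart Y X" "apart Z X" "apart Z Y" using d by auto
  show ?case
  proof (cases "X = [] \<or> Y = [] \<or> Z = []")
    case True
    then consider "X = []" | "Y = []" | "Z = []" by blast
    then show ?thesis
    proof cases
      case 1 then show ?thesis using o mga_assoc_Nil by simp
    next
      case 2
      then have "mga_assoc Y Z X" "mga_assoc Y X Z" using o mga_assoc_Nil by simp_all
      then show ?thesis by (rule mga_assoc_rotate[OF o d])
    next
      case 3
      then have "mga_assoc Z Y X" using o mga_assoc_Nil by simp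
      then show ?thesis by (rule mga_assoc_reverse[OF o d])
    qed
  next
    case False
    then obtain p U r V s W where [simp]: "X = p # U" "Y = r # V" "Z = s # W"
      by (metis list.exhaust)
    \<comment> \<open>The induction hypothesis enters only here: the smallest name stands in front
      and is removed.\<close>
    have first: "mga_assoc (p' # U') (r' # V') (s' # W')"
      if "obs (p' # U')" "obs (r' # V')" "obs (s' # W')" "apart (p' # U') (r' # V')" "apart (p' # U') (s' # W')" "apart (r' # V') (s' # W')"
        "fst p' < fst r'" "fst p' < fst s'"
        "length (p' # U') + length (r' # V') + length (s' # W') = length X + length Y + length Z"
      for p' U' r' V' s' W'
      using that by (intro mga_assoc_Cons less.hyps) auto
    have ne: "fst p \<noteq> fst r" "fst p \<noteq> fst s" "fst r \<noteq> fst s" using d by auto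
    \<comment> \<open>With the smallest name in \<open>Y\<close>, both orders (Y, Z, X) and (Y, X,
      Z) demanded by the rotation start with \<open>Y\<close>; with it in \<open>Z\<close>, the
      reversed order starts with \<open>Z\<close>.\<close>
    consider "fst p < fst r" "fst p < fst s" | "fst r < fst p" "fst r < fst s" | "fst s < fst r" "fst s < fst p"
      using ne by linarith
    then show ?thesis
    proof cases
      case 1
      show ?thesis unfolding \<open>X = _\<close> \<open>Y = _\<close> \<open>Z = _\<close> by (rule first) (use 1 o d in auto)
    next
      case 2
      have "mga_assoc Y Z X" "mga_assoc Y X Z" unfolding \<open>X = _\<close> \<open>Y = _\<close> \<open>Z = _\<close>
        by (rule first; use 2 o d d' in auto)+
      then show ?thesis by (rule mga_assoc_rotate[OF o d])
    next
      case 3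
      have "mga_assoc Z Y X" unfolding \<open>X = _\<close> \<open>Y = _\<close> \<open>Z = _\<close>
        by (rule first; use 3 o d d' in auto)
      then show ?thesis by (rule mga_assoc_reverse[OF o d])
    qed
  qed
qed

text \<open>An element of \<open>x\<close> is a stage together with an arrow from the tensor product of its variables to \<open>x\<close>.
  The product \<open>a \<star> b\<close> is meaningful only for elements at disjoint stages.\<close>

definition el :: "(nat \<times> 'a) list \<times> 'b \<Rightarrow> bool" where
  "el a \<longleftrightarrow> obs (fst a) \<and> snd a \<in> Ar K \<and> Dom K (snd a) = stg K (fst a)"

definition ob :: "(nat \<times> 'a) list \<times> 'b \<Rightarrow> 'a" where
  "ob a = Cod K (snd a)"

definition app :: "'b \<Rightarrow> (nat \<times> 'a) list \<times> 'b \<Rightarrow> (nat \<times> 'a) list \<times> 'b" (infixr "\<bullet>" 75) where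
  "f \<bullet> a = (fst a, f \<cdot> snd a)"

definition ten :: "(nat \<times> 'a) list \<times> 'b \<Rightarrow> (nat \<times> 'a) list \<times> 'b \<Rightarrow> (nat \<times> 'a) list \<times> 'b" (infixl "\<star>" 70) where
  "a \<star> b = (mrg (fst a) (fst b), (snd a \<boxtimes> snd b) \<cdot> inv_arrow K (mga K (fst a) (fst b)))"

definition un :: "(nat \<times> 'a) list \<times> 'b" where "un = ([], Idn K (Unit K))"

text \<open>Kept folded, unlike \<open>apart\<close>, so that disjointness of merged stages is
  decided by \<open>dst_simps\<close> without passing to sets.\<close>

definition dst :: "(nat \<times> 'a) list \<Rightarrow> (nat \<times> 'a) list \<Rightarrow> bool" where
  "dst U V \<longleftrightarrow> fst ` set U \<inter> fst ` set V = {}"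

abbreviation dj :: "(nat \<times> 'a) list \<times> 'b \<Rightarrow> (nat \<times> 'a) list \<times> 'b \<Rightarrow> bool" where
  "dj a b \<equiv> dst (fst a) (fst b)"

lemma dst_simps [simp]:
  "dst [] U" "dst U []" "dst (mrg U V) W \<longleftrightarrow> dst U W \<and> dst V W" "dst W (mrg U V) \<longleftrightarrow> dst W U \<and> dst W V"
  by (auto simp: dst_def)

lemma dst_sym: "dst U V \<Longrightarrow> dst V U"
  by (auto simp: dst_def)

section \<open>Structure isomorphisms acting on elements\<close>

lemma fst_app [simp]: "fst (f \<bullet> a) = fst a" by (simp add: app_def)
lemma fst_ten [simp]: "fst (a \<star> b) = mrg (fst a) (fst b)" by (simp add: ten_def)
lemma fst_un [simp]: "fst un = []" by (simp add: un_def)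

lemma el_app [simp]: "el a \<Longrightarrow> f \<in> Ar K \<Longrightarrow> Dom K f = ob a \<Longrightarrow> el (f \<bullet> a)"
  by (simp add: el_def app_def ob_def)

lemma ob_app [simp]: "el a \<Longrightarrow> f \<in> Ar K \<Longrightarrow> Dom K f = ob a \<Longrightarrow> ob (f \<bullet> a) = Cod K f"
  by (simp add: el_def app_def ob_def)

lemma el_ten [simp]: "el a \<Longrightarrow> el b \<Longrightarrow> el (a \<star> b)"
  by (simp add: el_def ten_def ob_def)

lemma ob_ten [simp]: "el a \<Longrightarrow> el b \<Longrightarrow> ob (a \<star> b) = ob a \<odot> ob b"
  by (simp add: el_def ten_def ob_def)

lemma ob_in [simp]: "el a \<Longrightarrow> ob a \<in> Ob K"
  by (simp add: el_def ob_def)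

lemma el_un [simp]: "el un" and ob_un [simp]: "ob un = Unit K"
  by (simp_all add: el_def ob_def un_def)

lemma comp_app [simp]:
  "el a \<Longrightarrow> f \<in> Ar K \<Longrightarrow> g \<in> Ar K \<Longrightarrow> Dom K g = ob a \<Longrightarrow> Dom K f = Cod K g \<Longrightarrow> (f \<cdot> g) \<bullet> a = f \<bullet> g \<bullet> a"
  by (simp add: el_def app_def ob_def)

lemma idn_app [simp]: "el a \<Longrightarrow> ob a = x \<Longrightarrow> Idn K x \<bullet> a = a"
  by (auto simp add: el_def app_def ob_def)

lemma ten_app [simp]:
  "el a \<Longrightarrow> el b \<Longrightarrow> f \<in> Ar K \<Longrightarrow> g \<in> Ar K \<Longrightarrow> Dom K f = ob a \<Longrightarrow> Dom K g = ob b
    \<Longrightarrow> (f \<boxtimes> g) \<bullet> (a \<star> b) = (f \<bullet> a) \<star> (g \<bullet> b)"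
  by (simp add: el_def app_def ten_def ob_def ten_comp2)

text \<open>Both sides live at the same stage because \<open>mrg\<close> is associative. After
  cancelling the invertible merging arrows, naturality of the associator leaves exactly
  \<open>mga_associative\<close>.\<close>

lemma asc_app [simp]:
  assumes "el a" "el b" "el c" "dj a b" "dj a c" "dj b c" "x = ob a" "y = ob b" "z = ob c"
  shows "Asc K x y z \<bullet> ((a \<star> b) \<star> c) = a \<star> (b \<star> c)"
proof -
  obtain U f where a: "a = (U, f)" by force
  obtain V g where b: "b = (V, g)" by force
  obtain W h where c: "c = (W, h)" by force
  have o: "obs U" "obs V" "obs W" using assms by (auto simp: el_def a b c)
  have t: "f \<in> Ar K" "g \<in> Ar K" "h \<in> Ar K" "Dom K f = stg K U" "Dom K g = stg K V" "Dom K h = stg K W"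
    "x = Cod K f" "y = Cod K g" "z = Cod K h"
    using assms by (auto simp: el_def ob_def a b c)
  have as: "mga K U (mrg V W) \<cdot> ((Idn K (stg K U) \<boxtimes> mga K V W) \<cdot> Asc K (stg K U) (stg K V) (stg K W))
     = mga K (mrg U V) W \<cdot> (mga K U V \<boxtimes> Idn K (stg K W))"
    using mga_associative[of U V W] assms(4-6) o by (simp add: mga_assoc_def a b c dst_def)
  have sx: "stg K U \<in> Ob K" "stg K V \<in> Ob K" "stg K W \<in> Ob K" using o by auto
  have "Asc K x y z \<cdot> ((((f \<boxtimes> g) \<cdot> inv_arrow K (mga K U V)) \<boxtimes> h) \<cdot> inv_arrow K (mga K (mrg U V) W))
      = (f \<boxtimes> ((g \<boxtimes> h) \<cdot> inv_arrow K (mga K V W))) \<cdot> inv_arrow K (mga K U (mrg V W))"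
    (is "?l = ?r")
  proof (rule iso_cancel_right)
    let ?m = "mga K (mrg U V) W \<cdot> (mga K U V \<boxtimes> Idn K (stg K W))"
    show "iso_arrow K ?m" using o sx by simp
    have "?l \<cdot> ?m = Asc K x y z \<cdot> ((f \<boxtimes> g) \<boxtimes> h)"
      using o t sx by (simp add: ten_comp ten_comp2)
    also have "\<dots> = (f \<boxtimes> (g \<boxtimes> h)) \<cdot> Asc K (stg K U) (stg K V) (stg K W)"
      using asc_nat[of f g h x y z] t by simp
    also have "\<dots> = ?r \<cdot> (mga K U (mrg V W) \<cdot> ((Idn K (stg K U) \<boxtimes> mga K V W) \<cdot> Asc K (stg K U) (stg K V) (stg K W)))"
      using o t sx by (simp add: ten_comp2)
    finally show "?l \<cdot> ?m = ?r \<cdot> ?m" unfolding as .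
  qed (use o t sx in \<open>simp_all add: mrg_assoc\<close>)
  then show ?thesis using o t by (simp add: a b c app_def ten_def mrg_assoc)
qed

lemma swp_app [simp]:
  assumes "el a" "el b" "dj a b" "x = ob a" "y = ob b"
  shows "Swp K x y \<bullet> (a \<star> b) = b \<star> a"
proof -
  obtain U f where a: "a = (U, f)" by force
  obtain V g where b: "b = (V, g)" by force
  have o: "obs U" "obs V" using assms by (auto simp: el_def a b)
  have t: "f \<in> Ar K" "g \<in> Ar K" "Dom K f = stg K U" "Dom K g = stg K V" "x = Cod K f" "y = Cod K g"
    using assms by (auto simp: el_def ob_def a b)
  have sx: "stg K U \<in> Ob K" "stg K V \<in> Ob K" using o by auto
  have m: "mrg V U = mrg U V" using assms(3) mrg_commute[of U V] by (simp add: dst_def a b)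
  have c: "mga K V U \<cdot> Swp K (stg K U) (stg K V) = mga K U V"
    using mga_commute[of U V] o assms(3) by (simp add: dst_def a b)
  have "Swp K x y \<cdot> ((f \<boxtimes> g) \<cdot> inv_arrow K (mga K U V)) = (g \<boxtimes> f) \<cdot> inv_arrow K (mga K V U)" (is "?l = ?r")
  proof (rule iso_cancel_right)
    show "iso_arrow K (mga K U V)" using o by simp
    have "?l \<cdot> mga K U V = Swp K x y \<cdot> (f \<boxtimes> g)" using o t sx by simp
    also have "\<dots> = (g \<boxtimes> f) \<cdot> Swp K (stg K U) (stg K V)" using swp_nat[of f g x y] t by simp
    also have "\<dots> = ?r \<cdot> (mga K V U \<cdot> Swp K (stg K U) (stg K V))" using o t sx by simp
    finally show "?l \<cdot> mga K U V = ?r \<cdot> mga K U V" unfolding c .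
  qed (use o t sx m in simp_all)
  then show ?thesis by (simp add: a b app_def ten_def m)
qed

lemma lun_app [simp]:
  assumes "el a" "x = ob a" shows "Lun K x \<bullet> (un \<star> a) = a"
proof -
  obtain U f where a: "a = (U, f)" by force
  have t: "obs U" "f \<in> Ar K" "Dom K f = stg K U" "x = Cod K f" "stg K U \<in> Ob K"
    using assms by (auto simp: el_def ob_def a)
  have "Lun K x \<cdot> ((Idn K (Unit K) \<boxtimes> f) \<cdot> inv_arrow K (Lun K (stg K U))) = f"
    using comp_eq_extend[OF lun_nat[of f x], of "inv_arrow K (Lun K (stg K U))"] t by simp
  then show ?thesis by (simp add: a app_def ten_def un_def)
qed

lemma run_app [simp]:
  assumes "el a" "x = ob a" shows "Run K x \<bullet> (a \<star> un) = a"
proof -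
  have "Run K x \<bullet> (a \<star> un) = Lun K x \<bullet> (Swp K x (Unit K) \<bullet> (a \<star> un))"
    using assms by (simp add: Run_eq_Lun_Swp del: swp_app)
  then show ?thesis using assms by simp
qed

lemma inv_app [simp]: "el a \<Longrightarrow> iso_arrow K f \<Longrightarrow> ob a = Dom K f \<Longrightarrow> inv_arrow K f \<bullet> f \<bullet> a = a"
  by (simp add: iso_Ar flip: comp_app)

lemma app_inv [simp]: "el a \<Longrightarrow> iso_arrow K f \<Longrightarrow> ob a = Cod K f \<Longrightarrow> f \<bullet> inv_arrow K f \<bullet> a = a"
  by (simp add: iso_Ar flip: comp_app)

lemma inv_app_eq: "f \<bullet> a = b \<Longrightarrow> el a \<Longrightarrow> iso_arrow K f \<Longrightarrow> ob a = Dom K f \<Longrightarrow> inv_arrow K f \<bullet> b = a"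
  by auto

lemma inv_asc_app [simp]:
  assumes "el a" "el b" "el c" "dj a b" "dj a c" "dj b c" "x = ob a" "y = ob b" "z = ob c"
  shows "inv_arrow K (Asc K x y z) \<bullet> (a \<star> (b \<star> c)) = a \<star> b \<star> c"
  by (rule inv_app_eq) (use assms in auto)

lemma inv_lun_app [simp]: "el a \<Longrightarrow> x = ob a \<Longrightarrow> inv_arrow K (Lun K x) \<bullet> a = un \<star> a"
  by (rule inv_app_eq) auto

lemma inv_run_app [simp]: "el a \<Longrightarrow> x = ob a \<Longrightarrow> inv_arrow K (Run K x) \<bullet> a = a \<star> un"
  by (rule inv_app_eq) auto

lemma un_ten_un [simp]: "inv_arrow K (Lun K (Unit K)) \<bullet> un = un \<star> un"
  by simp

lemma middle_swap_typ [simp]: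
  assumes "a \<in> Ob K" "b \<in> Ob K" "c \<in> Ob K" "d \<in> Ob K"
  shows "middle_swap K a b c d \<in> Ar K" "Dom K (middle_swap K a b c d) = a \<odot> b \<odot> (c \<odot> d)"
    "Cod K (middle_swap K a b c d) = a \<odot> c \<odot> (b \<odot> d)"
  using assms by (auto simp: middle_swap_def)

lemma middle_swap_app [simp]:
  assumes "el a" "el b" "el c" "el d" "dj a b" "dj a c" "dj a d" "dj b c" "dj b d" "dj c d"
    "x = ob a" "y = ob b" "z = ob c" "w = ob d"
  shows "middle_swap K x y z w \<bullet> (a \<star> b \<star> (c \<star> d)) = a \<star> c \<star> (b \<star> d)"
  using assms by (simp add: middle_swap_def dst_sym[of "fst b" "fst c"])

text \<open>Generic elements: their arrow can be cancelled, so an equation of arrows may be tested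
  on a single one of them.\<close>

definition isoel where "isoel a \<longleftrightarrow> el a \<and> iso_arrow K (snd a)"

lemma isoel_ten [simp]: "isoel a \<Longrightarrow> isoel b \<Longrightarrow> isoel (a \<star> b)"
  by (simp add: isoel_def) (simp add: el_def ten_def)

lemma isoel_ext:
  assumes "isoel t" "f \<in> homs K (ob t) z" "g \<in> homs K (ob t) z'" "f \<bullet> t = g \<bullet> t"
  shows "f = g"
  by (rule iso_cancel_right[of "snd t"]) (use assms in \<open>auto simp: isoel_def homs_def app_def ob_def\<close>)

text \<open>A stage ends in the unit object, so the tautological element of x at a stage with one
  variable is the right unitor.\<close>

definition var where "var n x = ([(n, x)], Run K x)"
definition idel where "idel V = (V, Idn K (stg K V))"

lemma var_simps [simp]:
  assumes "x \<in> Ob K" shows "isoel (var n x)" "el (var n x)" "ob (var n x) = x"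
  using assms by (auto simp: isoel_def el_def var_def ob_def)

lemma fst_var [simp]: "fst (var n x) = [(n, x)]"
  by (simp add: var_def)

lemma idel_simps [simp]:
  assumes "obs V" shows "isoel (idel V)" "el (idel V)" "ob (idel V) = stg K V"
  using assms by (auto simp: isoel_def el_def idel_def ob_def)

lemma fst_idel [simp]: "fst (idel V) = V" by (simp add: idel_def)

lemma idel_Nil: "idel [] = un" by (simp add: idel_def un_def)

lemma snd_idel: "el a \<Longrightarrow> snd a \<bullet> idel (fst a) = a"
  by (cases a) (simp add: el_def app_def idel_def)

lemma el_obs [simp]: "el a \<Longrightarrow> obs (fst a)"
  by (simp add: el_def)

lemma snd_typ [simp]: "el a \<Longrightarrow> snd a \<in> Ar K" "el a \<Longrightarrow> Dom K (snd a) = stg K (fst a)" "el a \<Longrightarrow> Cod K (snd a) = ob a"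
  by (simp_all add: el_def ob_def)

lemma ext1:
  assumes "f \<in> homs K x z" "g \<in> homs K x z'" "\<And>a. el a \<Longrightarrow> ob a = x \<Longrightarrow> f \<bullet> a = g \<bullet> a"
  shows "f = g"
proof -
  have "x \<in> Ob K" using assms(1) Dom_Ob by (auto simp: homs_def)
  then show ?thesis using assms by (intro isoel_ext[of "var 0 x"]) auto
qed

text \<open>Disjointness is supplied in both directions because the rules for elements ask for it in
  either order and the simplifier does not turn it around.\<close>

lemma ext2:
  assumes "f \<in> homs K (x \<odot> y) z" "g \<in> homs K (x \<odot> y) z'" "x \<in> Ob K" "y \<in> Ob K"
    "\<And>a b. \<lbrakk>el a; el b; ob a = x; ob b = y; dj a b; dj b a\<rbrakk> \<Longrightarrow> f \<bullet> (a \<star> b) = g \<bullet> (a \<star> b)"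
  shows "f = g"
  by (rule isoel_ext[of "var 0 x \<star> var 1 y"]) (use assms in \<open>auto simp: dst_def\<close>)

lemma ext3l:
  assumes "f \<in> homs K (x \<odot> y \<odot> z) w" "g \<in> homs K (x \<odot> y \<odot> z) w'" "x \<in> Ob K" "y \<in> Ob K" "z \<in> Ob K"
    "\<And>a b c. \<lbrakk>el a; el b; el c; ob a = x; ob b = y; ob c = z; dj a b; dj b a; dj a c; dj c a; dj b c; dj c b\<rbrakk>
      \<Longrightarrow> f \<bullet> (a \<star> b \<star> c) = g \<bullet> (a \<star> b \<star> c)"
  shows "f = g"
  by (rule isoel_ext[of "var 0 x \<star> var 1 y \<star> var 2 z"]) (use assms in \<open>auto simp: dst_def\<close>)

lemma ext3r:
  assumes "f \<in> homs K (x \<odot> (y \<odot> z)) w" "g \<in> homs K (x \<odot> (y \<odot> z)) w'" "x \<in> Ob K" "y \<in> Ob K" "z \<in> Ob K"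
    "\<And>a b c. \<lbrakk>el a; el b; el c; ob a = x; ob b = y; ob c = z; dj a b; dj b a; dj a c; dj c a; dj b c; dj c b\<rbrakk>
      \<Longrightarrow> f \<bullet> (a \<star> (b \<star> c)) = g \<bullet> (a \<star> (b \<star> c))"
  shows "f = g"
  by (rule isoel_ext[of "var 0 x \<star> (var 1 y \<star> var 2 z)"]) (use assms in \<open>auto simp: dst_def\<close>)

text \<open>An operation on elements is linear if it is given by an arrow, with further variables \<open>V\<close> as parameters.\<close>

definition lin where
  "lin V x z L \<longleftrightarrow> obs V \<and> x \<in> Ob K \<and>
     (\<exists>F \<in> homs K (stg K V \<odot> x) z. \<forall>e. el e \<and> ob e = x \<and> dst V (fst e) \<longrightarrow> L e = F \<bullet> (idel V \<star> e))"

lemma lin_id: "x \<in> Ob K \<Longrightarrow> lin [] x x (\<lambda>e. e)"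
  unfolding lin_def by (intro conjI bexI[of _ "Lun K x"]) (auto simp: homs_def idel_Nil)

lemma lin_app: "lin V x z L \<Longrightarrow> f \<in> Ar K \<Longrightarrow> Dom K f = z \<Longrightarrow> lin V x (Cod K f) (\<lambda>e. f \<bullet> L e)"
  unfolding lin_def
proof (elim conjE bexE, intro conjI)
  fix F assume f: "f \<in> Ar K" "Dom K f = z" and F: "F \<in> homs K (stg K V \<odot> x) z"
    and V: "obs V" "x \<in> Ob K"
    and L: "\<forall>e. el e \<and> ob e = x \<and> dst V (fst e) \<longrightarrow> L e = F \<bullet> (idel V \<star> e)"
  show "\<exists>F\<in>homs K (stg K V \<odot> x) (Cod K f). \<forall>e. el e \<and> ob e = x \<and> dst V (fst e) \<longrightarrow> f \<bullet> L e = F \<bullet> (idel V \<star> e)"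
    using f F V L by (intro bexI[of _ "f \<cdot> F"]) (auto simp: homs_def)
qed

lemma lin_tenl:
  assumes "lin V x z L" "el c" "dst (fst c) V"
  shows "lin (mrg (fst c) V) x (ob c \<odot> z) (\<lambda>e. c \<star> L e)"
proof -
  from assms(1) obtain F where F: "F \<in> Ar K" "Dom K F = stg K V \<odot> x" "Cod K F = z" and V: "obs V" "x \<in> Ob K"
    and L: "\<And>e. el e \<Longrightarrow> ob e = x \<Longrightarrow> dst V (fst e) \<Longrightarrow> L e = F \<bullet> (idel V \<star> e)"
    by (auto simp: lin_def homs_def)
  let ?s = "snd (c \<star> idel V)"
  let ?G = "(Idn K (ob c) \<boxtimes> F) \<cdot> (Asc K (ob c) (stg K V) x \<cdot> (?s \<boxtimes> Idn K x))"
  have s: "?s \<bullet> idel (mrg (fst c) V) = c \<star> idel V"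
    using snd_idel[of "c \<star> idel V"] assms V by simp
  have "c \<star> L e = ?G \<bullet> (idel (mrg (fst c) V) \<star> e)" if "el e" "ob e = x" "dst (mrg (fst c) V) (fst e)" for e
    using that assms V L[of e] F s by simp
  then show ?thesis unfolding lin_def using assms V F
    by (intro conjI bexI[of _ ?G]) (auto simp: homs_def)
qed

text \<open>All parameters stand in front of the variable, while \<open>L\<close> expects only those
  of \<open>V\<close> there; the symmetry therefore carries \<open>c\<close> past the
  variable.\<close>

lemma lin_tenr:
  assumes "lin V x z L" "el c" "dst V (fst c)"
  shows "lin (mrg V (fst c)) x (z \<odot> ob c) (\<lambda>e. L e \<star> c)"
proof -
  from assms(1) obtain F where F: "F \<in> Ar K" "Dom K F = stg K V \<odot> x" "Cod K F = z" and V: "obs V" "x \<in> Ob K"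
    and L: "\<And>e. el e \<Longrightarrow> ob e = x \<Longrightarrow> dst V (fst e) \<Longrightarrow> L e = F \<bullet> (idel V \<star> e)"
    by (auto simp: lin_def homs_def)
  let ?s = "snd (idel V \<star> c)"
  let ?G = "(F \<boxtimes> Idn K (ob c)) \<cdot> (inv_arrow K (Asc K (stg K V) x (ob c)) \<cdot> ((Idn K (stg K V) \<boxtimes> Swp K (ob c) x) \<cdot>
     (Asc K (stg K V) (ob c) x \<cdot> (?s \<boxtimes> Idn K x))))"
  have s: "?s \<bullet> idel (mrg V (fst c)) = idel V \<star> c"
    using snd_idel[of "idel V \<star> c"] assms V by simp
  have "L e \<star> c = ?G \<bullet> (idel (mrg V (fst c)) \<star> e)" if "el e" "ob e = x" "dst (mrg V (fst c)) (fst e)" for e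
    using that assms V L[of e] F s dst_sym[of "fst c" "fst e"] by simp
  then show ?thesis unfolding lin_def using assms V F
    by (intro conjI bexI[of _ ?G]) (auto simp: homs_def)
qed

lemmas lin_intros = lin_id lin_app lin_tenl lin_tenr

lemma mrg_append: "(\<And>p r. p \<in> set U \<Longrightarrow> r \<in> set V \<Longrightarrow> fst p < fst r) \<Longrightarrow> mrg U V = U @ V"
  by (induction U V rule: mrg.induct) auto

text \<open>To prove an identity that is linear in an element of \<open>x \<odot> y\<close>, it suffices to check it on
  tensors of elements.\<close>

lemma lin_ext:
  assumes "lin V (x \<odot> y) z L" "lin V' (x \<odot> y) z' R" "el e" "ob e = x \<odot> y" "x \<in> Ob K" "y \<in> Ob K"
    "dst V (fst e)" "dst V' (fst e)"
    "\<And>a b. \<lbrakk>el a; el b; ob a = x; ob b = y; dj a b; dj b a; dst V (fst a); dst V (fst b); dst V' (fst a); dst V' (fst b);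
       dst (fst a) V; dst (fst b) V; dst (fst a) V'; dst (fst b) V'\<rbrakk> \<Longrightarrow> L (a \<star> b) = R (a \<star> b)"
  shows "L e = R e"
proof -
  from assms(1) obtain F where F: "F \<in> homs K (stg K V \<odot> (x \<odot> y)) z" and V: "obs V"
    and L: "\<And>e. el e \<Longrightarrow> ob e = x \<odot> y \<Longrightarrow> dst V (fst e) \<Longrightarrow> L e = F \<bullet> (idel V \<star> e)"
    by (auto simp: lin_def)
  from assms(2) obtain G where G: "G \<in> homs K (stg K V' \<odot> (x \<odot> y)) z'" and V': "obs V'"
    and R: "\<And>e. el e \<Longrightarrow> ob e = x \<odot> y \<Longrightarrow> dst V' (fst e) \<Longrightarrow> R e = G \<bullet> (idel V' \<star> e)"
    by (auto simp: lin_def)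
  \<comment> \<open>A number above all parameter names, so that the test variables \<open>n\<close>
    and \<open>Suc n\<close> come last in every merged stage.\<close>
  obtain n where n: "\<And>p. p \<in> set V \<union> set V' \<Longrightarrow> fst p < n"
  proof -
    have "finite (fst ` (set V \<union> set V'))" by simp
    then obtain n where "\<forall>m\<in>fst ` (set V \<union> set V'). m < n" using finite_nat_set_iff_bounded by blast
    then show ?thesis using that by auto
  qed
  let ?t = "var n x \<star> var (Suc n) y"
  have ft: "fst ?t = [(n, x), (Suc n, y)]" by simp
  have m: "n \<notin> fst ` set V" "Suc n \<notin> fst ` set V" "n \<notin> fst ` set V'" "Suc n \<notin> fst ` set V'"
    using n by fastforce+
  have d: "dst V (fst ?t)" "dst V' (fst ?t)" using m unfolding ft dst_def by simp_all
  have t: "el ?t" "ob ?t = x \<odot> y" using assms by auto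
  have "L ?t = R ?t"
    using assms(5,6) m by (intro assms(9)) (simp_all add: dst_def)
  then have eq: "F \<bullet> (idel V \<star> ?t) = G \<bullet> (idel V' \<star> ?t)"
    using L[OF t d(1)] R[OF t d(2)] by simp
  have "mrg V (fst ?t) = V @ fst ?t" "mrg V' (fst ?t) = V' @ fst ?t"
    unfolding ft by (rule mrg_append; use n in fastforce)+
  \<comment> \<open>Equal elements have equal stages; removing the common test variables shows that
    both sides have the same parameters.\<close>
  moreover from eq have "mrg V (fst ?t) = mrg V' (fst ?t)" by (metis fst_app fst_ten fst_idel)
  ultimately have VV: "V = V'" by simp
  have "F = G"
    using F G V assms(5,6) eq unfolding VV by (intro isoel_ext[of "idel V' \<star> ?t"]) auto
  then show ?thesis using L[of e] R[of e] assms VV by simp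
qed

end

section \<open>Additive structure\<close>

context additive_category
begin

abbreviation hgrp where "hgrp x y \<equiv> \<lparr>carrier = homs K x y, mult = Add K, one = Zer K x y\<rparr>"

lemma zer_typ [simp]:
  assumes "x \<in> Ob K" "y \<in> Ob K"
  shows "Zer K x y \<in> Ar K" "Dom K (Zer K x y) = x" "Cod K (Zer K x y) = y"
  using homs_comm_group[OF assms] monoid.one_closed[of "hgrp x y"]
  by (auto simp: homs_iff comm_group_def comm_monoid_def)

lemma add_typ [simp]:
  assumes "f \<in> Ar K" "g \<in> Ar K" "Dom K f = Dom K g" "Cod K f = Cod K g"
  shows "f \<boxplus> g \<in> Ar K" "Dom K (f \<boxplus> g) = Dom K f" "Cod K (f \<boxplus> g) = Cod K f"
proof -
  have "comm_group (hgrp (Dom K g) (Cod K g))" using assms by (intro homs_comm_group) auto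
  then have "f \<boxplus> g \<in> homs K (Dom K g) (Cod K g)"
    using monoid.m_closed[of "hgrp (Dom K g) (Cod K g)" f g] assms
    by (auto simp: homs_iff comm_group_def comm_monoid_def)
  then show "f \<boxplus> g \<in> Ar K" "Dom K (f \<boxplus> g) = Dom K f" "Cod K (f \<boxplus> g) = Cod K f"
    using assms by (auto simp: homs_iff)
qed

lemma add_zer [simp]:
  assumes "f \<in> Ar K" "x = Dom K f" "y = Cod K f"
  shows "f \<boxplus> Zer K x y = f" "Zer K x y \<boxplus> f = f"
proof -
  have "comm_group (hgrp x y)" using assms by (intro homs_comm_group) auto
  then have "monoid (hgrp x y)" by (auto simp: comm_group_def comm_monoid_def)
  then show "f \<boxplus> Zer K x y = f" "Zer K x y \<boxplus> f = f"
    using monoid.r_one[of "hgrp x y" f] monoid.l_one[of "hgrp x y" f] assms by (auto simp: homs_iff)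
qed

lemma add_self_zer:
  assumes "f \<in> Ar K" "f \<boxplus> f = f" "x = Dom K f" "y = Cod K f"
  shows "f = Zer K x y"
proof -
  have "group (hgrp x y)" using homs_comm_group assms by (auto simp: comm_group_def)
  then show ?thesis using group.l_cancel_one'[of "hgrp x y" f f] assms by (auto simp: homs_iff)
qed

lemma ex_neg:
  assumes "f \<in> Ar K"
  obtains g where "g \<in> Ar K" "Dom K g = Dom K f" "Cod K g = Cod K f" "f \<boxplus> g = Zer K (Dom K f) (Cod K f)"
proof -
  have G: "group (hgrp (Dom K f) (Cod K f))" using homs_comm_group assms by (auto simp: comm_group_def)
  from group.r_inv_ex[OF G, of f] assms that show ?thesis by (auto simp: homs_iff)
qed

lemma add_commute:
  assumes "f \<in> Ar K" "g \<in> Ar K" "Dom K f = Dom K g" "Cod K f = Cod K g"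
  shows "f \<boxplus> g = g \<boxplus> f"
proof -
  have "comm_group (hgrp (Dom K g) (Cod K g))" using assms by (intro homs_comm_group) auto
  then show ?thesis using comm_monoid.m_comm[of "hgrp (Dom K g) (Cod K g)" f g] assms
    by (auto simp: homs_iff comm_group_def)
qed

lemma comp_add:
  "f \<in> Ar K \<Longrightarrow> f' \<in> Ar K \<Longrightarrow> g \<in> Ar K \<Longrightarrow> Dom K f = Dom K f' \<Longrightarrow> Cod K f = Cod K f' \<Longrightarrow> Dom K g = Cod K f'
   \<Longrightarrow> g \<cdot> (f \<boxplus> f') = (g \<cdot> f) \<boxplus> (g \<cdot> f')"
  using Comp_Add_right[of f "Dom K f" "Cod K f" f' g "Cod K g"] by (auto simp: homs_iff)

lemma add_comp:
  "f \<in> Ar K \<Longrightarrow> g \<in> Ar K \<Longrightarrow> g' \<in> Ar K \<Longrightarrow> Dom K g = Dom K g' \<Longrightarrow> Cod K g = Cod K g' \<Longrightarrow> Dom K g' = Cod K f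
   \<Longrightarrow> (g \<boxplus> g') \<cdot> f = (g \<cdot> f) \<boxplus> (g' \<cdot> f)"
  using Comp_Add_left[of f "Dom K f" "Cod K f" g "Cod K g" g'] by (auto simp: homs_iff)

lemma comp_zer [simp]: "f \<in> Ar K \<Longrightarrow> x \<in> Ob K \<Longrightarrow> y = Dom K f \<Longrightarrow> f \<cdot> Zer K x y = Zer K x (Cod K f)"
  by (rule add_self_zer) (auto simp: comp_add[symmetric])

lemma zer_comp [simp]: "f \<in> Ar K \<Longrightarrow> z \<in> Ob K \<Longrightarrow> y = Cod K f \<Longrightarrow> Zer K y z \<cdot> f = Zer K (Dom K f) z"
  by (rule add_self_zer) (auto simp: add_comp[symmetric])

lemma zero_objectI:
  assumes "x \<in> Ob K" "Idn K x = Zer K x x" shows "zero_object K x"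
proof -
  have "f = Zer K x y" if "f \<in> homs K x y" for f y
    using that comp_idn[of f x] assms by (auto simp: homs_iff)
  moreover have "f = Zer K y x" if "f \<in> homs K y x" for f y
    using that idn_comp[of f x] assms by (auto simp: homs_iff)
  moreover have "Zer K x y \<in> homs K x y" "Zer K y x \<in> homs K y x" if "y \<in> Ob K" for y
    using that assms(1) by (auto simp: homs_iff)
  ultimately have "(\<exists>!f. f \<in> homs K x y) \<and> (\<exists>!f. f \<in> homs K y x)" if "y \<in> Ob K" for y
    using that by metis
  then show ?thesis unfolding zero_object_def using assms(1) by blast
qed

lemma zero_objectD:
  assumes "zero_object K x" "f \<in> Ar K"
  shows "Dom K f = x \<Longrightarrow> f = Zer K x (Cod K f)" "Cod K f = x \<Longrightarrow> f = Zer K (Dom K f) x"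
proof -
  have x: "x \<in> Ob K" using assms by (auto simp: zero_object_def)
  { assume "Dom K f = x"
    moreover have "\<exists>!g. g \<in> homs K x (Cod K f)" using assms unfolding zero_object_def by auto
    ultimately show "f = Zer K x (Cod K f)" using assms(2) x by (auto simp: homs_iff) }
  { assume "Cod K f = x"
    moreover have "\<exists>!g. g \<in> homs K (Dom K f) x" using assms unfolding zero_object_def by auto
    ultimately show "f = Zer K (Dom K f) x" using assms(2) x by (auto simp: homs_iff) }
qed

end

section \<open>Products\<close>

context category
begin

lemma cone_typ:
  assumes "product_cone K I X P p"
  shows "P \<in> Ob K" "i \<in> I \<Longrightarrow> p i \<in> Ar K" "i \<in> I \<Longrightarrow> Dom K (p i) = P" "i \<in> I \<Longrightarrow> Cod K (p i) = X i"
  using assms by (auto simp: product_cone_def homs_iff)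

lemma cone_ex:
  assumes "product_cone K I X P p" "y \<in> Ob K" "\<And>i. i \<in> I \<Longrightarrow> f i \<in> homs K y (X i)"
  obtains h where "h \<in> Ar K" "Dom K h = y" "Cod K h = P" "\<And>i. i \<in> I \<Longrightarrow> p i \<cdot> h = f i"
proof -
  have "\<exists>!h. h \<in> homs K y P \<and> (\<forall>i\<in>I. p i \<cdot> h = f i)"
    using assms unfolding product_cone_def by blast
  then show ?thesis using that by (auto simp: homs_iff)
qed

lemma cone_eq:
  assumes c: "product_cone K I X P p" and "f \<in> homs K y P" "g \<in> homs K y P" "\<And>i. i \<in> I \<Longrightarrow> p i \<cdot> f = p i \<cdot> g"
  shows "f = g"
proof -
  have "y \<in> Ob K" using assms by (auto simp: homs_iff)
  moreover have "\<forall>i\<in>I. p i \<cdot> f \<in> homs K y (X i)" using assms cone_typ[OF c] by (auto simp: homs_iff)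
  ultimately have "\<exists>!h. h \<in> homs K y P \<and> (\<forall>i\<in>I. p i \<cdot> h = p i \<cdot> f)"
    using c unfolding product_cone_def by simp
  moreover have "f \<in> homs K y P \<and> (\<forall>i\<in>I. p i \<cdot> f = p i \<cdot> f)" "g \<in> homs K y P \<and> (\<forall>i\<in>I. p i \<cdot> g = p i \<cdot> f)"
    using assms by auto
  ultimately show ?thesis by blast
qed

lemma chosen_cone:
  assumes "product_cone K I X P p" shows "product_cone K I X (prod_ob K I X) (proj K I X)"
  unfolding chosen_product_def by (rule someI[of "\<lambda>c. product_cone K I X (fst c) (snd c)" "(P, p)"]) (use assms in simp)

lemma tuple_props:
  assumes c: "product_cone K I X P p" and y: "y \<in> Ob K" and f: "\<And>i. i \<in> I \<Longrightarrow> f i \<in> homs K y (X i)"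
  shows "tuple K I X y f \<in> homs K y (prod_ob K I X)" "i \<in> I \<Longrightarrow> proj K I X i \<cdot> tuple K I X y f = f i"
proof -
  note d = chosen_cone[OF c]
  have "\<exists>!h. h \<in> homs K y (prod_ob K I X) \<and> (\<forall>i\<in>I. proj K I X i \<cdot> h = f i)"
    using d y f unfolding product_cone_def by simp
  from theI'[OF this] show "tuple K I X y f \<in> homs K y (prod_ob K I X)" "i \<in> I \<Longrightarrow> proj K I X i \<cdot> tuple K I X y f = f i"
    unfolding tuple_def by auto
qed

lemma cone_iso:
  assumes c: "product_cone K I X P p" and d: "product_cone K I X Q q"
    and h: "h \<in> homs K P Q" "\<And>i. i \<in> I \<Longrightarrow> q i \<cdot> h = p i"
  shows "iso_arrow K h"
proof -
  obtain g where g: "g \<in> Ar K" "Dom K g = Q" "Cod K g = P" "\<And>i. i \<in> I \<Longrightarrow> p i \<cdot> g = q i"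
    using cone_ex[OF c, of Q q] cone_typ[OF d] by (auto simp: homs_iff)
  have "g \<cdot> h = Idn K P"
    by (rule cone_eq[OF c]) (use g h cone_typ[OF c] cone_typ[OF d] in \<open>auto simp: homs_iff comp_assoc[symmetric] simp del: comp_assoc\<close>)
  moreover have "h \<cdot> g = Idn K Q"
    by (rule cone_eq[OF d]) (use g h cone_typ[OF c] cone_typ[OF d] in \<open>auto simp: homs_iff comp_assoc[symmetric] simp del: comp_assoc\<close>)
  ultimately show ?thesis unfolding iso_arrow_def inverse_arrows_def using g h by (auto simp: homs_iff)
qed

lemma iso_cone:
  assumes c: "product_cone K I X P p" and h: "iso_arrow K h" "Cod K h = P"
  shows "product_cone K I X (Dom K h) (\<lambda>i. p i \<cdot> h)"
  unfolding product_cone_def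
proof (intro conjI ballI allI impI)
  note hA = iso_Ar[OF h(1)]
  show "Dom K h \<in> Ob K" using hA by simp
  fix i assume "i \<in> I" then show "p i \<cdot> h \<in> homs K (Dom K h) (X i)"
    using cone_typ[OF c] h hA by (auto simp: homs_iff)
next
  note hA = iso_Ar[OF h(1)]
  fix y f assume y: "y \<in> Ob K" and f: "\<forall>i\<in>I. f i \<in> homs K y (X i)"
  obtain g where g: "g \<in> Ar K" "Dom K g = y" "Cod K g = P" "\<And>i. i \<in> I \<Longrightarrow> p i \<cdot> g = f i"
    using cone_ex[OF c y, of f] f by auto
  show "\<exists>!k. k \<in> homs K y (Dom K h) \<and> (\<forall>i\<in>I. (p i \<cdot> h) \<cdot> k = f i)"
  proof (rule ex1I[of _ "inv_arrow K h \<cdot> g"])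
    show "inv_arrow K h \<cdot> g \<in> homs K y (Dom K h) \<and> (\<forall>i\<in>I. (p i \<cdot> h) \<cdot> (inv_arrow K h \<cdot> g) = f i)"
      using cone_typ[OF c] h hA g by (auto simp: homs_iff)
    fix k assume k: "k \<in> homs K y (Dom K h) \<and> (\<forall>i\<in>I. (p i \<cdot> h) \<cdot> k = f i)"
    have "h \<cdot> k = g"
      by (rule cone_eq[OF c, of _ y]) (use k g h hA cone_typ[OF c] in \<open>auto simp: homs_iff\<close>)
    then show "k = inv_arrow K h \<cdot> g" using k h hA by (auto simp: homs_iff)
  qed
qed

end

context symmetric_monoidal_category
begin

lemma ten_add:
  "f \<in> Ar K \<Longrightarrow> g \<in> Ar K \<Longrightarrow> g' \<in> Ar K \<Longrightarrow> Dom K g = Dom K g' \<Longrightarrow> Cod K g = Cod K g'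
   \<Longrightarrow> f \<boxtimes> (g \<boxplus> g') = (f \<boxtimes> g) \<boxplus> (f \<boxtimes> g')"
  using TenA_Add_right[of f "Dom K f" "Cod K f" g "Dom K g" "Cod K g" g'] by (auto simp: homs_iff)

lemma add_ten:
  "f \<in> Ar K \<Longrightarrow> g \<in> Ar K \<Longrightarrow> f' \<in> Ar K \<Longrightarrow> Dom K f = Dom K f' \<Longrightarrow> Cod K f = Cod K f'
   \<Longrightarrow> (f \<boxplus> f') \<boxtimes> g = (f \<boxtimes> g) \<boxplus> (f' \<boxtimes> g)"
  using TenA_Add_left[of f "Dom K f" "Cod K f" f' g "Dom K g" "Cod K g"] by (auto simp: homs_iff)

lemma ten_zer [simp]:
  "f \<in> Ar K \<Longrightarrow> x \<in> Ob K \<Longrightarrow> y \<in> Ob K \<Longrightarrow> f \<boxtimes> Zer K x y = Zer K (Dom K f \<odot> x) (Cod K f \<odot> y)"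
  by (rule add_self_zer) (auto simp: ten_add[symmetric])

lemma zer_ten [simp]:
  "f \<in> Ar K \<Longrightarrow> x \<in> Ob K \<Longrightarrow> y \<in> Ob K \<Longrightarrow> Zer K x y \<boxtimes> f = Zer K (x \<odot> Dom K f) (y \<odot> Cod K f)"
  by (rule add_self_zer) (auto simp: add_ten[symmetric])

text \<open>A product cone \<open>p\<close> together with injections \<open>j\<close> that make it a direct sum preserved by tensoring.\<close>

definition biprod where
  "biprod I X P p j \<longleftrightarrow> product_cone K I X P p \<and>
     (\<forall>i\<in>I. j i \<in> homs K (X i) P) \<and>
     (\<forall>i\<in>I. \<forall>k\<in>I. p i \<cdot> j k = (if i = k then Idn K (X i) else Zer K (X k) (X i))) \<and>
     (\<forall>y f. y \<in> Ob K \<longrightarrow> (\<forall>i\<in>I. f i \<in> homs K (X i) y) \<longrightarrow> (\<exists>h\<in>homs K P y. \<forall>i\<in>I. h \<cdot> j i = f i)) \<and>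
     (\<forall>T\<in>Ob K. \<forall>y f g. f \<in> homs K (T \<odot> P) y \<longrightarrow> g \<in> homs K (T \<odot> P) y \<longrightarrow>
        (\<forall>i\<in>I. f \<cdot> (Idn K T \<boxtimes> j i) = g \<cdot> (Idn K T \<boxtimes> j i)) \<longrightarrow> f = g)"

lemma biprod_empty: "zero_object K z \<Longrightarrow> biprod {} X z p j"
proof -
  assume z: "zero_object K z"
  then have zO: "z \<in> Ob K" by (simp add: zero_object_def)
  have u: "\<exists>!f. f \<in> homs K y z" if "y \<in> Ob K" for y using z that by (auto simp: zero_object_def)
  have i: "Idn K z = Zer K z z" using zero_objectD(1)[OF z, of "Idn K z"] zO by simp
  have *: "f = Zer K (T \<odot> z) y" if "T \<in> Ob K" "f \<in> homs K (T \<odot> z) y" for f T y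
  proof -
    have "f = f \<cdot> (Idn K T \<boxtimes> Idn K z)" using that zO by (simp add: homs_iff)
    also have "\<dots> = Zer K (T \<odot> z) y" unfolding i using that zO by (auto simp: homs_iff)
    finally show ?thesis .
  qed
  have "\<exists>h. h \<in> homs K z y" if "y \<in> Ob K" for y using that zO by (intro exI[of _ "Zer K z y"]) (simp add: homs_iff)
  moreover have "f = g" if "T \<in> Ob K" "f \<in> homs K (T \<odot> z) y" "g \<in> homs K (T \<odot> z) y" for f g T y
    using *[OF that(1,2)] *[OF that(1,3)] by simp
  ultimately show ?thesis unfolding biprod_def product_cone_def using zO u by (simp add: Bex_def)
qed

text \<open>The last clause of \<open>biprod\<close> survives because \<open>\<boxtimes>\<close> is
  additive: the decomposition of the identity of \<open>Q\<close> into its two projections persists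
  after tensoring with \<open>T\<close>, so arrows out of \<open>T \<odot> Q\<close> are detected on
  the summands.\<close>

lemma biprod_insert:
  assumes B: "biprod I X P p j" and k: "k \<notin> I" and xk: "X k \<in> Ob K"
    and b: "biproduct K P (X k) Q i1 i2 p1 p2"
  shows "biprod (insert k I) X Q (\<lambda>i. if i = k then p2 else p i \<cdot> p1) (\<lambda>i. if i = k then i2 else i1 \<cdot> j i)"
proof -
  from B have c: "product_cone K I X P p" by (simp add: biprod_def)
  note ct = cone_typ[OF c]
  have jt: "j i \<in> Ar K" "Dom K (j i) = X i" "Cod K (j i) = P" if "i \<in> I" for i
    using B that by (auto simp: biprod_def homs_iff)
  have Xi: "X i \<in> Ob K" if "i \<in> I" for i using ct(2,4)[OF that] Ob_typ(2)[of "p i"] by simp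
  have pj: "p i \<cdot> j l = (if i = l then Idn K (X i) else Zer K (X l) (X i))" if "i \<in> I" "l \<in> I" for i l
    using B that by (simp add: biprod_def)
  have t: "Q \<in> Ob K" "P \<in> Ob K" "i1 \<in> Ar K" "Dom K i1 = P" "Cod K i1 = Q" "i2 \<in> Ar K" "Dom K i2 = X k" "Cod K i2 = Q"
    "p1 \<in> Ar K" "Dom K p1 = Q" "Cod K p1 = P" "p2 \<in> Ar K" "Dom K p2 = Q" "Cod K p2 = X k"
    and e: "p1 \<cdot> i1 = Idn K P" "p2 \<cdot> i2 = Idn K (X k)" "p1 \<cdot> i2 = Zer K (X k) P" "p2 \<cdot> i1 = Zer K P (X k)"
      "(i1 \<cdot> p1) \<boxplus> (i2 \<cdot> p2) = Idn K Q"
    using b by (auto simp: biproduct_def homs_iff)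
  have e2: "p1 \<cdot> (i1 \<cdot> h) = h" "p2 \<cdot> (i1 \<cdot> h) = Zer K (Dom K h) (X k)" if "h \<in> Ar K" "Cod K h = P" for h
    using comp_eq_extend[OF e(1), of h] comp_eq_extend[OF e(4), of h] that t xk by auto
  have e3: "p2 \<cdot> (i2 \<cdot> h) = h" "p1 \<cdot> (i2 \<cdot> h) = Zer K (Dom K h) P" if "h \<in> Ar K" "Cod K h = X k" for h
    using comp_eq_extend[OF e(2), of h] comp_eq_extend[OF e(3), of h] that t xk by auto
  have eqI: "f = g" if "f \<in> homs K y Q" "g \<in> homs K y Q" "p1 \<cdot> f = p1 \<cdot> g" "p2 \<cdot> f = p2 \<cdot> g" for f g y
  proof -
    have "f = ((i1 \<cdot> p1) \<boxplus> (i2 \<cdot> p2)) \<cdot> f" unfolding e using that t by (simp add: homs_iff)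
    also have "\<dots> = ((i1 \<cdot> p1) \<boxplus> (i2 \<cdot> p2)) \<cdot> g" using that t by (simp add: homs_iff add_comp)
    also have "\<dots> = g" unfolding e using that t by (simp add: homs_iff)
    finally show ?thesis .
  qed
  let ?p = "\<lambda>i. if i = k then p2 else p i \<cdot> p1" and ?j = "\<lambda>i. if i = k then i2 else i1 \<cdot> j i"
  have ki: "i \<noteq> k" if "i \<in> I" for i using that k by auto
  have cone: "product_cone K (insert k I) X Q ?p"
    unfolding product_cone_def
  proof (intro conjI ballI allI impI)
    show "Q \<in> Ob K" by (rule t)
    fix i assume "i \<in> insert k I" then show "?p i \<in> homs K Q (X i)" using t ct by (auto simp: homs_iff)
  next
    fix y f assume y: "y \<in> Ob K" and f: "\<forall>i\<in>insert k I. f i \<in> homs K y (X i)"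
    obtain g where g: "g \<in> Ar K" "Dom K g = y" "Cod K g = P" "\<And>i. i \<in> I \<Longrightarrow> p i \<cdot> g = f i"
      using cone_ex[OF c y, of f] f by auto
    have fk: "f k \<in> Ar K" "Dom K (f k) = y" "Cod K (f k) = X k" using f by (auto simp: homs_iff)
    have fi: "f i \<in> Ar K" "Dom K (f i) = y" "Cod K (f i) = X i" if "i \<in> I" for i using f that by (auto simp: homs_iff)
    show "\<exists>!h. h \<in> homs K y Q \<and> (\<forall>i\<in>insert k I. ?p i \<cdot> h = f i)"
    proof (rule ex1I[of _ "(i1 \<cdot> g) \<boxplus> (i2 \<cdot> f k)"])
      show "(i1 \<cdot> g) \<boxplus> (i2 \<cdot> f k) \<in> homs K y Q \<and> (\<forall>i\<in>insert k I. ?p i \<cdot> ((i1 \<cdot> g) \<boxplus> (i2 \<cdot> f k)) = f i)"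
        using t e2 e3 g fk fi ct xk y Xi by (auto simp: homs_iff comp_add ki)
      fix h assume h: "h \<in> homs K y Q \<and> (\<forall>i\<in>insert k I. ?p i \<cdot> h = f i)"
      show "h = (i1 \<cdot> g) \<boxplus> (i2 \<cdot> f k)"
      proof (rule eqI[of _ y])
        have "p1 \<cdot> h = g"
        proof (rule cone_eq[OF c, of _ y])
          fix i assume i: "i \<in> I"
          then have "(p i \<cdot> p1) \<cdot> h = f i" using h ki by auto
          then show "p i \<cdot> (p1 \<cdot> h) = p i \<cdot> g" using g i t ct h by (simp add: homs_iff)
        qed (use h g t in \<open>auto simp: homs_iff\<close>)
        then show "p1 \<cdot> h = p1 \<cdot> ((i1 \<cdot> g) \<boxplus> (i2 \<cdot> f k))" using t e2 e3 g fk by (simp add: comp_add)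
        have "p2 \<cdot> h = f k" using h by auto
        then show "p2 \<cdot> h = p2 \<cdot> ((i1 \<cdot> g) \<boxplus> (i2 \<cdot> f k))" using t e2 e3 g fk y xk by (simp add: comp_add)
      qed (use h t g fk in \<open>auto simp: homs_iff\<close>)
    qed
  qed
  moreover have "\<forall>i\<in>insert k I. ?j i \<in> homs K (X i) Q"
    using jt t ki by (auto simp: homs_iff)
  moreover have "\<forall>i\<in>insert k I. \<forall>l\<in>insert k I. ?p i \<cdot> ?j l = (if i = l then Idn K (X i) else Zer K (X l) (X i))"
    using jt t ki e e2 e3 ct pj xk Xi k by auto
  moreover have "\<exists>h\<in>homs K Q y. \<forall>i\<in>insert k I. h \<cdot> ?j i = f i"
    if y: "y \<in> Ob K" and f: "\<forall>i\<in>insert k I. f i \<in> homs K (X i) y" for y f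
  proof -
    have "\<exists>g\<in>homs K P y. \<forall>i\<in>I. g \<cdot> j i = f i" using B y f unfolding biprod_def by blast
    then obtain g where g: "g \<in> Ar K" "Dom K g = P" "Cod K g = y" "\<And>i. i \<in> I \<Longrightarrow> g \<cdot> j i = f i"
      by (auto simp: homs_iff)
    have fi: "f i \<in> Ar K" "Dom K (f i) = X i" "Cod K (f i) = y" if "i \<in> insert k I" for i using f that by (auto simp: homs_iff)
    show ?thesis
      using t g fi[of k] fi e e2 e3 jt y xk Xi ki
      by (intro bexI[of _ "(g \<cdot> p1) \<boxplus> (f k \<cdot> p2)"]) (auto simp: homs_iff add_comp)
  qed
  moreover have "f = g"
    if T: "T \<in> Ob K" and f: "f \<in> homs K (T \<odot> Q) y" and g: "g \<in> homs K (T \<odot> Q) y"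
      and eq: "\<forall>i\<in>insert k I. f \<cdot> (Idn K T \<boxtimes> ?j i) = g \<cdot> (Idn K T \<boxtimes> ?j i)" for T y f g
  proof -
    have k2: "f \<cdot> (Idn K T \<boxtimes> i2) = g \<cdot> (Idn K T \<boxtimes> i2)" using eq by auto
    have "f \<cdot> (Idn K T \<boxtimes> i1) = g \<cdot> (Idn K T \<boxtimes> i1)"
    proof -
      have "(f \<cdot> (Idn K T \<boxtimes> i1)) \<cdot> (Idn K T \<boxtimes> j i) = (g \<cdot> (Idn K T \<boxtimes> i1)) \<cdot> (Idn K T \<boxtimes> j i)" if "i \<in> I" for i
        using eq[THEN bspec, of i] that ki[OF that] T f g t jt[OF that] by (simp add: homs_iff ten_comp)
      moreover have "f \<cdot> (Idn K T \<boxtimes> i1) \<in> homs K (T \<odot> P) y" "g \<cdot> (Idn K T \<boxtimes> i1) \<in> homs K (T \<odot> P) y"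
        using T f g t by (auto simp: homs_iff)
      ultimately show ?thesis using B T unfolding biprod_def by blast
    qed
    then have k1: "f \<cdot> ((Idn K T \<boxtimes> i1) \<cdot> (Idn K T \<boxtimes> p1)) = g \<cdot> ((Idn K T \<boxtimes> i1) \<cdot> (Idn K T \<boxtimes> p1))"
      using T f g t by (simp add: homs_iff flip: comp_assoc)
    have k2: "f \<cdot> ((Idn K T \<boxtimes> i2) \<cdot> (Idn K T \<boxtimes> p2)) = g \<cdot> ((Idn K T \<boxtimes> i2) \<cdot> (Idn K T \<boxtimes> p2))"
      using T f g t xk k2 by (simp add: homs_iff flip: comp_assoc)
    have "f = f \<cdot> (Idn K T \<boxtimes> ((i1 \<cdot> p1) \<boxplus> (i2 \<cdot> p2)))" unfolding e using T f t by (simp add: homs_iff)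
    also have "\<dots> = g \<cdot> (Idn K T \<boxtimes> ((i1 \<cdot> p1) \<boxplus> (i2 \<cdot> p2)))"
      using k1 k2 T f g t by (simp add: homs_iff ten_add comp_add ten_comp)
    also have "\<dots> = g" unfolding e using T g t by (simp add: homs_iff)
    finally show ?thesis .
  qed
  ultimately show ?thesis unfolding biprod_def by blast
qed

lemma ex_biprod:
  assumes "finite I" "\<And>i. i \<in> I \<Longrightarrow> X i \<in> Ob K"
  shows "\<exists>P p j. biprod I X P p j"
  using assms
proof (induction I rule: finite_induct)
  case empty show ?case using ex_zero_object biprod_empty by blast
next
  case (insert k I)
  then obtain P p j where B: "biprod I X P p j" by blast
  then have "P \<in> Ob K" by (simp add: biprod_def product_cone_def)
  then obtain Q i1 i2 p1 p2 where "biproduct K P (X k) Q i1 i2 p1 p2" using ex_biproduct insert.prems by blast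
  from biprod_insert[OF B insert.hyps(2) _ this] insert.prems show ?case by blast
qed

lemma finite_cone:
  assumes "finite I" "\<And>i. i \<in> I \<Longrightarrow> X i \<in> Ob K"
  shows "product_cone K I X (prod_ob K I X) (proj K I X)"
proof -
  have "\<exists>P p j. biprod I X P p j" using ex_biprod assms by blast
  then show ?thesis using chosen_cone unfolding biprod_def by blast
qed

text \<open>The comparison with a constructed direct sum of the same objects is invertible, and the
  injections are transported along it.\<close>

lemma cone_biprod:
  assumes "finite I" and c: "product_cone K I X P p"
  obtains j where "biprod I X P p j"
proof -
  have X: "X i \<in> Ob K" if "i \<in> I" for i using cone_typ(2,4)[OF c that] Ob_typ(2)[of "p i"] by simp
  then obtain Q q j where B: "biprod I X Q q j" using ex_biprod assms by metis
  then have d: "product_cone K I X Q q" by (simp add: biprod_def)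
  note ct = cone_typ[OF c] and dt = cone_typ[OF d]
  obtain h where h: "h \<in> Ar K" "Dom K h = Q" "Cod K h = P" "\<And>i. i \<in> I \<Longrightarrow> p i \<cdot> h = q i"
    using cone_ex[OF c, of Q q] dt by (auto simp: homs_iff)
  have hi: "iso_arrow K h" by (rule cone_iso[OF d c]) (use h in \<open>auto simp: homs_iff\<close>)
  have jt: "j i \<in> Ar K" "Dom K (j i) = X i" "Cod K (j i) = Q" if "i \<in> I" for i
    using B that by (auto simp: biprod_def homs_iff)
  have "biprod I X P p (\<lambda>i. h \<cdot> j i)"
    unfolding biprod_def
  proof (intro conjI ballI allI impI c)
    fix i assume i: "i \<in> I" then show "h \<cdot> j i \<in> homs K (X i) P" using h jt by (auto simp: homs_iff)
    fix k assume k: "k \<in> I"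
    have "p i \<cdot> (h \<cdot> j k) = q i \<cdot> j k" by (rule comp_eq_extend) (use h i k jt ct in auto)
    then show "p i \<cdot> (h \<cdot> j k) = (if i = k then Idn K (X i) else Zer K (X k) (X i))"
      using B i k by (simp add: biprod_def)
  next
    fix y f assume y: "y \<in> Ob K" and f: "\<forall>i\<in>I. f i \<in> homs K (X i) y"
    then have "\<exists>g\<in>homs K Q y. \<forall>i\<in>I. g \<cdot> j i = f i" using B unfolding biprod_def by blast
    then obtain g where g: "g \<in> homs K Q y" "\<And>i. i \<in> I \<Longrightarrow> g \<cdot> j i = f i" by auto
    then show "\<exists>g\<in>homs K P y. \<forall>i\<in>I. g \<cdot> (h \<cdot> j i) = f i"
      using h hi jt by (intro bexI[of _ "g \<cdot> inv_arrow K h"]) (auto simp: homs_iff)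
  next
    fix T y f g assume T: "T \<in> Ob K" and f: "f \<in> homs K (T \<odot> P) y" and g: "g \<in> homs K (T \<odot> P) y"
      and eq: "\<forall>i\<in>I. f \<cdot> (Idn K T \<boxtimes> (h \<cdot> j i)) = g \<cdot> (Idn K T \<boxtimes> (h \<cdot> j i))"
    have "(f \<cdot> (Idn K T \<boxtimes> h)) \<cdot> (Idn K T \<boxtimes> j i) = (g \<cdot> (Idn K T \<boxtimes> h)) \<cdot> (Idn K T \<boxtimes> j i)" if "i \<in> I" for i
      using eq[THEN bspec, of i] that T f g h jt[OF that] by (simp add: homs_iff ten_comp)
    moreover have "f \<cdot> (Idn K T \<boxtimes> h) \<in> homs K (T \<odot> Q) y" "g \<cdot> (Idn K T \<boxtimes> h) \<in> homs K (T \<odot> Q) y"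
      using T f g h by (auto simp: homs_iff)
    ultimately have "f \<cdot> (Idn K T \<boxtimes> h) = g \<cdot> (Idn K T \<boxtimes> h)" using B T unfolding biprod_def by blast
    then show "f = g" by (rule iso_cancel_right[rotated -1]) (use T f g h hi in \<open>auto simp: homs_iff\<close>)
  qed
  then show ?thesis by (rule that)
qed

end

section \<open>Rings by elements\<close>

context symmetric_monoidal_category
begin

lemma ext_unit:
  assumes "f \<in> homs K (Unit K) z" "g \<in> homs K (Unit K) z'" "f \<bullet> un = g \<bullet> un" shows "f = g"
  by (rule isoel_ext[of un]) (use assms in \<open>auto simp: isoel_def\<close>, simp add: un_def)

lemma ext_unit_ten:
  assumes "f \<in> homs K (Unit K \<odot> x) z" "g \<in> homs K (Unit K \<odot> x) z'" "x \<in> Ob K"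
    "\<And>a. el a \<Longrightarrow> ob a = x \<Longrightarrow> f \<bullet> (un \<star> a) = g \<bullet> (un \<star> a)"
  shows "f = g"
proof -
  have "isoel un" by (simp add: isoel_def) (simp add: un_def)
  then show ?thesis by (intro isoel_ext[of "un \<star> var 0 x"]) (use assms in auto)
qed

lemma ext_ten_unit:
  assumes "f \<in> homs K (x \<odot> Unit K) z" "g \<in> homs K (x \<odot> Unit K) z'" "x \<in> Ob K"
    "\<And>a. el a \<Longrightarrow> ob a = x \<Longrightarrow> f \<bullet> (a \<star> un) = g \<bullet> (a \<star> un)"
  shows "f = g"
proof -
  have "isoel un" by (simp add: isoel_def) (simp add: un_def)
  then show ?thesis by (intro isoel_ext[of "var 0 x \<star> un"]) (use assms in auto)
qed

lemma ext4:
  assumes "f \<in> homs K (x \<odot> y \<odot> (z \<odot> w)) u" "g \<in> homs K (x \<odot> y \<odot> (z \<odot> w)) u'"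
    "x \<in> Ob K" "y \<in> Ob K" "z \<in> Ob K" "w \<in> Ob K"
    "\<And>a b c d. \<lbrakk>el a; el b; el c; el d; ob a = x; ob b = y; ob c = z; ob d = w; dj a b; dj b a; dj a c; dj c a; dj b c; dj c b;
       dj a d; dj b d; dj c d; dj d a; dj d b; dj d c\<rbrakk>
      \<Longrightarrow> f \<bullet> (a \<star> b \<star> (c \<star> d)) = g \<bullet> (a \<star> b \<star> (c \<star> d))"
  shows "f = g"
  by (rule isoel_ext[of "var 0 x \<star> var 1 y \<star> (var 2 z \<star> var 3 w)"]) (use assms in \<open>auto simp: dst_def\<close>)

text \<open>An element at the empty stage is disjoint from every element, itself included, so it may
  occur several times in a product.\<close>

abbreviation one :: "('a, 'b) cmon \<Rightarrow> (nat \<times> 'a) list \<times> 'b" where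
  "one A \<equiv> Unt A \<bullet> un"

abbreviation rel :: "('a, 'b) cmon \<Rightarrow> (nat \<times> 'a) list \<times> 'b \<Rightarrow> bool" where
  "rel A a \<equiv> el a \<and> ob a = Car A"

lemma ring_typ [simp]:
  assumes "is_ring K A"
  shows "Car A \<in> Ob K" "Mul A \<in> Ar K" "Dom K (Mul A) = Car A \<odot> Car A" "Cod K (Mul A) = Car A"
    "Unt A \<in> Ar K" "Dom K (Unt A) = Unit K" "Cod K (Unt A) = Car A"
  using assms by (auto simp: is_ring_def homs_iff)

lemma mul_assoc:
  assumes "is_ring K A" "el a" "el b" "el c" "ob a = Car A" "ob b = Car A" "ob c = Car A" "dj a b" "dj a c" "dj b c"
  shows "Mul A \<bullet> ((Mul A \<bullet> (a \<star> b)) \<star> c) = Mul A \<bullet> (a \<star> (Mul A \<bullet> (b \<star> c)))"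
proof -
  have "(Mul A \<cdot> (Mul A \<boxtimes> Idn K (Car A))) \<bullet> (a \<star> b \<star> c)
      = (Mul A \<cdot> ((Idn K (Car A) \<boxtimes> Mul A) \<cdot> Asc K (Car A) (Car A) (Car A))) \<bullet> (a \<star> b \<star> c)"
    using assms by (simp add: is_ring_def)
  then show ?thesis using assms by simp
qed

lemma mul_unl:
  assumes "is_ring K A" "el a" "ob a = Car A" shows "Mul A \<bullet> (one A \<star> a) = a"
proof -
  have "(Mul A \<cdot> (Unt A \<boxtimes> Idn K (Car A))) \<bullet> (un \<star> a) = Lun K (Car A) \<bullet> (un \<star> a)"
    using assms by (simp add: is_ring_def)
  then show ?thesis using assms by simp
qed

lemma mul_unr:
  assumes "is_ring K A" "el a" "ob a = Car A" shows "Mul A \<bullet> (a \<star> one A) = a"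
proof -
  have "(Mul A \<cdot> (Idn K (Car A) \<boxtimes> Unt A)) \<bullet> (a \<star> un) = Run K (Car A) \<bullet> (a \<star> un)"
    using assms by (simp add: is_ring_def)
  then show ?thesis using assms by simp
qed

lemma mul_comm:
  assumes "is_ring K A" "el a" "el b" "ob a = Car A" "ob b = Car A" "dj b a"
  shows "Mul A \<bullet> (a \<star> b) = Mul A \<bullet> (b \<star> a)"
proof -
  have "(Mul A \<cdot> Swp K (Car A) (Car A)) \<bullet> (b \<star> a) = Mul A \<bullet> (b \<star> a)"
    using assms by (simp add: is_ring_def)
  then show ?thesis using assms by simp
qed

lemma mul_lcomm:
  assumes "is_ring K A" "el a" "el b" "el c" "ob a = Car A" "ob b = Car A" "ob c = Car A" "dj b a" "dj b c" "dj a c"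
  shows "Mul A \<bullet> (a \<star> (Mul A \<bullet> (b \<star> c))) = Mul A \<bullet> (b \<star> (Mul A \<bullet> (a \<star> c)))"
  using mul_assoc[of A a b c] mul_assoc[of A b a c] mul_comm[of A a b] assms dst_sym[of "fst b" "fst a"] by simp

lemmas mul_simps = mul_assoc mul_unl mul_unr
lemmas mul_ac = mul_assoc mul_unl mul_unr mul_comm mul_lcomm

lemma ringI:
  assumes "Car A \<in> Ob K" "Mul A \<in> homs K (Car A \<odot> Car A) (Car A)" "Unt A \<in> homs K (Unit K) (Car A)"
    and as: "\<And>a b c. \<lbrakk>el a; el b; el c; ob a = Car A; ob b = Car A; ob c = Car A; dj a b; dj b a; dj a c; dj c a; dj b c; dj c b\<rbrakk>
      \<Longrightarrow> Mul A \<bullet> ((Mul A \<bullet> (a \<star> b)) \<star> c) = Mul A \<bullet> (a \<star> (Mul A \<bullet> (b \<star> c)))"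
    and u: "\<And>a. el a \<Longrightarrow> ob a = Car A \<Longrightarrow> Mul A \<bullet> (one A \<star> a) = a"
    and cm: "\<And>a b. \<lbrakk>el a; el b; ob a = Car A; ob b = Car A; dj a b; dj b a\<rbrakk> \<Longrightarrow> Mul A \<bullet> (a \<star> b) = Mul A \<bullet> (b \<star> a)"
  shows "is_ring K A"
  unfolding is_ring_def
proof (intro conjI assms(1-3))
  have t: "Mul A \<in> Ar K" "Dom K (Mul A) = Car A \<odot> Car A" "Cod K (Mul A) = Car A"
    "Unt A \<in> Ar K" "Dom K (Unt A) = Unit K" "Cod K (Unt A) = Car A" using assms(2,3) by (auto simp: homs_iff)
  show "Mul A \<cdot> (Mul A \<boxtimes> Idn K (Car A)) = Mul A \<cdot> (Idn K (Car A) \<boxtimes> Mul A) \<cdot> Asc K (Car A) (Car A) (Car A)"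
    by (rule ext3l) (use t assms(1) in \<open>auto simp: homs_iff as\<close>)
  show "Mul A \<cdot> (Unt A \<boxtimes> Idn K (Car A)) = Lun K (Car A)"
    by (rule ext_unit_ten) (use t assms(1) in \<open>auto simp: homs_iff u\<close>)
  show "Mul A \<cdot> (Idn K (Car A) \<boxtimes> Unt A) = Run K (Car A)"
  proof (rule ext_ten_unit)
    fix a assume a: "el a" "ob a = Car A"
    then show "(Mul A \<cdot> (Idn K (Car A) \<boxtimes> Unt A)) \<bullet> (a \<star> un) = Run K (Car A) \<bullet> (a \<star> un)"
      using t assms(1) cm[of a "one A"] u[of a] by simp
  qed (use t assms(1) in \<open>auto simp: homs_iff\<close>)
  show "Mul A \<cdot> Swp K (Car A) (Car A) = Mul A"
    by (rule ext2[of _ "Car A" "Car A"]) (use t assms(1) in \<open>auto simp: homs_iff intro: cm\<close>)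
qed

text \<open>No condition on units: such arrows arise as a \<mapsto> f a \<cdot> c for an idempotent
  c, see \<open>cut\<close>.\<close>

definition mmor where
  "mmor A B f \<longleftrightarrow> is_ring K A \<and> is_ring K B \<and> f \<in> homs K (Car A) (Car B) \<and> f \<cdot> Mul A = Mul B \<cdot> (f \<boxtimes> f)"

lemma mmor_typ:
  assumes "mmor A B f"
  shows "is_ring K A" "is_ring K B" "f \<in> Ar K" "Dom K f = Car A" "Cod K f = Car B"
  using assms by (auto simp: mmor_def homs_iff)

lemma mmor_mul:
  assumes "mmor A B f" "el a" "el b" "ob a = Car A" "ob b = Car A"
  shows "f \<bullet> (Mul A \<bullet> (a \<star> b)) = Mul B \<bullet> ((f \<bullet> a) \<star> (f \<bullet> b))"
proof -
  have "(f \<cdot> Mul A) \<bullet> (a \<star> b) = (Mul B \<cdot> (f \<boxtimes> f)) \<bullet> (a \<star> b)" using assms by (simp add: mmor_def)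
  then show ?thesis using assms mmor_typ[OF assms(1)] by simp
qed

lemma mmorI:
  assumes "is_ring K A" "is_ring K B" "f \<in> homs K (Car A) (Car B)"
    and "\<And>a b. \<lbrakk>el a; el b; ob a = Car A; ob b = Car A; dj a b; dj b a\<rbrakk>
      \<Longrightarrow> f \<bullet> (Mul A \<bullet> (a \<star> b)) = Mul B \<bullet> ((f \<bullet> a) \<star> (f \<bullet> b))"
  shows "mmor A B f"
  unfolding mmor_def
proof (intro conjI assms(1-3))
  show "f \<cdot> Mul A = Mul B \<cdot> (f \<boxtimes> f)"
    by (rule ext2[of _ "Car A" "Car A"]) (use assms in \<open>auto simp: homs_iff\<close>)
qed

lemma ring_mor_iff: "ring_mor K A B f \<longleftrightarrow> mmor A B f \<and> f \<bullet> one A = one B"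
proof
  assume "ring_mor K A B f" then show "mmor A B f \<and> f \<bullet> one A = one B"
    by (auto simp: ring_mor_def mmor_def homs_iff simp flip: comp_app)
next
  assume *: "mmor A B f \<and> f \<bullet> one A = one B"
  have "f \<cdot> Unt A = Unt B"
    by (rule ext_unit) (use * mmor_typ[of A B f] in \<open>auto simp: homs_iff\<close>)
  then show "ring_mor K A B f" using * by (auto simp: ring_mor_def mmor_def)
qed

lemma ring_mor_mmor: "ring_mor K A B f \<Longrightarrow> mmor A B f" by (simp add: ring_mor_iff)
lemma ring_mor_one: "ring_mor K A B f \<Longrightarrow> f \<bullet> one A = one B" by (simp add: ring_mor_iff)

lemma mmor_comp:
  assumes "mmor A B f" "mmor B C g" shows "mmor A C (g \<cdot> f)"
  by (rule mmorI) (use mmor_typ[OF assms(1)] mmor_typ[OF assms(2)] in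
      \<open>auto simp: homs_iff mmor_mul[OF assms(1)] mmor_mul[OF assms(2)]\<close>)

lemma ring_mor_comp:
  assumes "ring_mor K A B f" "ring_mor K B C g" shows "ring_mor K A C (g \<cdot> f)"
  using assms mmor_comp[of A B f C g] mmor_typ[of A B f] mmor_typ[of B C g] by (simp add: ring_mor_iff)

lemma ring_mor_Idn: "is_ring K A \<Longrightarrow> ring_mor K A A (Idn K (Car A))"
  by (simp add: ring_mor_def homs_iff)

lemma ring_mor_inverse:
  assumes "ring_mor K A B f" "inverse_arrows K f g" shows "ring_mor K B A g"
proof -
  note m = ring_mor_mmor[OF assms(1)] and o = ring_mor_one[OF assms(1)]
  note t = mmor_typ[OF m]
  have g: "g \<in> Ar K" "Dom K g = Car B" "Cod K g = Car A" "g \<cdot> f = Idn K (Car A)" "f \<cdot> g = Idn K (Car B)"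
    using assms t by (auto simp: inverse_arrows_def homs_iff)
  have gf: "g \<bullet> f \<bullet> a = a" if "el a" "ob a = Car A" for a
    using that g t by (simp flip: comp_app)
  have fg: "f \<bullet> g \<bullet> a = a" if "el a" "ob a = Car B" for a
    using that g t by (simp flip: comp_app)
  have "mmor B A g"
  proof (rule mmorI)
    fix a b assume ab: "el a" "el b" "ob a = Car B" "ob b = Car B" "dj a b" "dj b a"
    have "f \<bullet> (Mul A \<bullet> ((g \<bullet> a) \<star> (g \<bullet> b))) = Mul B \<bullet> (a \<star> b)"
      using mmor_mul[OF m, of "g \<bullet> a" "g \<bullet> b"] ab g fg t by simp
    then have "g \<bullet> (Mul B \<bullet> (a \<star> b)) = g \<bullet> f \<bullet> (Mul A \<bullet> ((g \<bullet> a) \<star> (g \<bullet> b)))" by simp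
    then show "g \<bullet> (Mul B \<bullet> (a \<star> b)) = Mul A \<bullet> ((g \<bullet> a) \<star> (g \<bullet> b))"
      using ab g t by (simp add: gf)
  qed (use g t in \<open>auto simp: homs_iff\<close>)
  moreover have "g \<bullet> one B = one A" using gf[of "one A"] o t by simp
  ultimately show ?thesis by (simp add: ring_mor_iff)
qed

lemma ring_isomorphism_iff: "ring_isomorphism K A B f \<longleftrightarrow> ring_mor K A B f \<and> iso_arrow K f"
  unfolding ring_isomorphism_def iso_arrow_def using ring_mor_inverse by blast

lemma unit_ring_is_ring: "is_ring K (unit_ring K)"
proof (rule ringI)
  let ?U = "unit_ring K"
  have [simp]: "Car ?U = Unit K" "Mul ?U = Lun K (Unit K)" "Unt ?U = Idn K (Unit K)" by (simp_all add: unit_ring_def)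
  show "Car ?U \<in> Ob K" "Mul ?U \<in> homs K (Car ?U \<odot> Car ?U) (Car ?U)" "Unt ?U \<in> homs K (Unit K) (Car ?U)"
    by (auto simp: homs_iff)
  fix a assume "el a" "ob a = Car ?U" then show "Mul ?U \<bullet> (one ?U \<star> a) = a" by simp
next
  let ?U = "unit_ring K"
  have [simp]: "Car ?U = Unit K" "Mul ?U = Lun K (Unit K)" by (simp_all add: unit_ring_def)
  fix a b assume "el a" "el b" "ob a = Car ?U" "ob b = Car ?U" "dj a b" "dj b a"
  \<comment> \<open>\<open>a\<close> and \<open>b\<close> need not be \<open>un\<close>, so
    commutativity comes from the coherence law \<open>Lun_Swp_Unit\<close> rather than from
    \<open>lun_app\<close>.\<close>
  then have "Lun K (Unit K) \<bullet> Swp K (Unit K) (Unit K) \<bullet> (b \<star> a) = Lun K (Unit K) \<bullet> (b \<star> a)"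
    by (simp flip: comp_app add: Lun_Swp_Unit del: swp_app)
  then show "Mul ?U \<bullet> (a \<star> b) = Mul ?U \<bullet> (b \<star> a)"
    using \<open>el a\<close> \<open>el b\<close> \<open>ob a = Car ?U\<close> \<open>ob b = Car ?U\<close> \<open>dj b a\<close> by simp
next
  let ?U = "unit_ring K"
  have [simp]: "Car ?U = Unit K" "Mul ?U = Lun K (Unit K)" by (simp_all add: unit_ring_def)
  fix a b c assume e: "el a" "el b" "el c" "ob a = Car ?U" "ob b = Car ?U" "ob c = Car ?U"
    "dj a b" "dj b a" "dj a c" "dj c a" "dj b c" "dj c b"
  have "Lun K (Unit K \<odot> Unit K) \<bullet> (a \<star> (b \<star> c)) = (Lun K (Unit K) \<bullet> (a \<star> b)) \<star> c"
  proof -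
    have "(Lun K (Unit K \<odot> Unit K) \<cdot> Asc K (Unit K) (Unit K) (Unit K)) \<bullet> (a \<star> b \<star> c)
      = (Lun K (Unit K) \<boxtimes> Idn K (Unit K)) \<bullet> (a \<star> b \<star> c)" by (simp add: Lun_Asc)
    then show ?thesis using e by simp
  qed
  moreover have "Lun K (Unit K) \<bullet> (a \<star> (Lun K (Unit K) \<bullet> (b \<star> c))) = Lun K (Unit K) \<bullet> Lun K (Unit K \<odot> Unit K) \<bullet> (a \<star> (b \<star> c))"
  proof -
    have "(Lun K (Unit K) \<cdot> (Idn K (Unit K) \<boxtimes> Lun K (Unit K))) \<bullet> (a \<star> (b \<star> c)) = (Lun K (Unit K) \<cdot> Lun K (Unit K \<odot> Unit K)) \<bullet> (a \<star> (b \<star> c))"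
      by (simp add: lun_nat)
    then show ?thesis using e by simp
  qed
  ultimately show "Mul ?U \<bullet> ((Mul ?U \<bullet> (a \<star> b)) \<star> c) = Mul ?U \<bullet> (a \<star> (Mul ?U \<bullet> (b \<star> c)))" by simp
qed

subsection \<open>Tensor products of rings\<close>

lemma tensor_ring_simps [simp]:
  "Car (tensor_ring K A B) = Car A \<odot> Car B"
  by (simp add: tensor_ring_def)

lemma tensor_ring_typ:
  assumes "is_ring K A" "is_ring K B"
  shows "Mul (tensor_ring K A B) \<in> homs K (Car A \<odot> Car B \<odot> (Car A \<odot> Car B)) (Car A \<odot> Car B)"
    "Unt (tensor_ring K A B) \<in> homs K (Unit K) (Car A \<odot> Car B)"
  using assms by (auto simp: tensor_ring_def homs_iff)

lemma tensor_mul [simp]: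
  assumes "is_ring K A" "is_ring K B" "el a" "el b" "el c" "el d" "ob a = Car A" "ob b = Car B" "ob c = Car A" "ob d = Car B"
    "dj a b" "dj a c" "dj a d" "dj b c" "dj b d" "dj c d"
  shows "Mul (tensor_ring K A B) \<bullet> (a \<star> b \<star> (c \<star> d)) = (Mul A \<bullet> (a \<star> c)) \<star> (Mul B \<bullet> (b \<star> d))"
  using assms by (simp add: tensor_ring_def)

lemma tensor_one: "is_ring K A \<Longrightarrow> is_ring K B \<Longrightarrow> one (tensor_ring K A B) = one A \<star> one B"
  by (simp add: tensor_ring_def)

lemma tensor_ring_is_ring:
  assumes "is_ring K A" "is_ring K B" shows "is_ring K (tensor_ring K A B)"
proof (rule ringI)
  let ?T = "tensor_ring K A B" and ?x = "Car A \<odot> Car B"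
  note t = tensor_ring_typ[OF assms, unfolded homs_iff]
  show "Car ?T \<in> Ob K" "Mul ?T \<in> homs K (Car ?T \<odot> Car ?T) (Car ?T)" "Unt ?T \<in> homs K (Unit K) (Car ?T)"
    using assms t by (auto simp: homs_iff)
  fix a assume a: "el a" "ob a = Car ?T"
  \<comment> \<open>\<open>a\<close> lies in a tensor product but need not be a tensor. Both sides
    are linear in it, as \<open>lin_intros\<close> verifies, so \<open>lin_ext\<close> reduces the
    claim to tensors. The same pattern recurs whenever such an element has to be taken
    apart.\<close>
  show "Mul ?T \<bullet> (one ?T \<star> a) = a"
    by (rule lin_ext[where x = "Car A" and y = "Car B" and L = "\<lambda>a. Mul ?T \<bullet> (one ?T \<star> a)" and R = "\<lambda>a. a"],
       (rule lin_intros | use a assms t in \<open>simp add: tensor_one mul_simps; fail\<close>)+)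
next
  let ?T = "tensor_ring K A B" and ?x = "Car A \<odot> Car B"
  note t = tensor_ring_typ[OF assms, unfolded homs_iff]
  fix a b assume ab: "el a" "el b" "ob a = Car ?T" "ob b = Car ?T" "dj a b" "dj b a"
  have "Mul ?T = Mul ?T \<cdot> Swp K ?x ?x"
    by (rule ext4[of _ "Car A" "Car B" "Car A" "Car B"]) (use assms t in \<open>auto simp: homs_iff mul_comm\<close>)
  then have "Mul ?T \<bullet> (a \<star> b) = (Mul ?T \<cdot> Swp K ?x ?x) \<bullet> (a \<star> b)" by simp
  then show "Mul ?T \<bullet> (a \<star> b) = Mul ?T \<bullet> (b \<star> a)" using ab assms t by simp
next
  let ?T = "tensor_ring K A B" and ?x = "Car A \<odot> Car B"
  note t = tensor_ring_typ[OF assms, unfolded homs_iff]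
  fix a b c assume abc: "el a" "el b" "el c" "ob a = Car ?T" "ob b = Car ?T" "ob c = Car ?T"
    "dj a b" "dj b a" "dj a c" "dj c a" "dj b c" "dj c b"
  \<comment> \<open>Six independent variables, two for each factor, form a generic element of the
    triple product.\<close>
  have "Mul ?T \<cdot> (Mul ?T \<boxtimes> Idn K ?x) = Mul ?T \<cdot> ((Idn K ?x \<boxtimes> Mul ?T) \<cdot> Asc K ?x ?x ?x)"
    by (rule isoel_ext[of "(var 0 (Car A) \<star> var 1 (Car B)) \<star> (var 2 (Car A) \<star> var 3 (Car B)) \<star> (var 4 (Car A) \<star> var 5 (Car B))"])
      (use assms t in \<open>simp_all add: homs_iff dst_def mul_assoc\<close>)
  then have "(Mul ?T \<cdot> (Mul ?T \<boxtimes> Idn K ?x)) \<bullet> (a \<star> b \<star> c) = (Mul ?T \<cdot> ((Idn K ?x \<boxtimes> Mul ?T) \<cdot> Asc K ?x ?x ?x)) \<bullet> (a \<star> b \<star> c)"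
    by simp
  then show "Mul ?T \<bullet> ((Mul ?T \<bullet> (a \<star> b)) \<star> c) = Mul ?T \<bullet> (a \<star> (Mul ?T \<bullet> (b \<star> c)))"
    using abc assms t by simp
qed

lemma pair_mmor:
  assumes f: "mmor A D f" and g: "mmor B D g"
  shows "mmor (tensor_ring K A B) D (Mul D \<cdot> (f \<boxtimes> g))"
proof -
  let ?T = "tensor_ring K A B" and ?h = "Mul D \<cdot> (f \<boxtimes> g)"
  note ft = mmor_typ[OF f] and gt = mmor_typ[OF g]
  note t = tensor_ring_typ[OF ft(1) gt(1), unfolded homs_iff]
  have h: "?h \<in> homs K (Car ?T) (Car D)" using ft gt by (simp add: homs_iff)
  have "?h \<cdot> Mul ?T = Mul D \<cdot> (?h \<boxtimes> ?h)"
    by (rule ext4[of _ "Car A" "Car B" "Car A" "Car B"])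
      (use ft gt t in \<open>auto simp: homs_iff mmor_mul[OF f] mmor_mul[OF g] mul_ac\<close>)
  then show ?thesis using tensor_ring_is_ring ft gt h by (auto simp: mmor_def)
qed

lemma pair_ring_mor:
  assumes f: "ring_mor K A D f" and g: "ring_mor K B D g"
  shows "ring_mor K (tensor_ring K A B) D (Mul D \<cdot> (f \<boxtimes> g))"
  using pair_mmor[OF ring_mor_mmor[OF f] ring_mor_mmor[OF g]] ring_mor_one[OF f] ring_mor_one[OF g]
    mmor_typ[OF ring_mor_mmor[OF f]] mmor_typ[OF ring_mor_mmor[OF g]]
  by (simp add: ring_mor_iff tensor_one mul_simps)

subsection \<open>Products of rings\<close>

lemma cone_el_eq:
  assumes c: "product_cone K I X P p" and "el a" "el b" "ob a = P" "ob b = P" "fst a = fst b"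
    "\<And>i. i \<in> I \<Longrightarrow> p i \<bullet> a = p i \<bullet> b"
  shows "a = b"
proof -
  have "snd a = snd b"
    by (rule cone_eq[OF c, of _ "stg K (fst a)"]) (use assms in \<open>auto simp: homs_iff app_def\<close>)
  then show ?thesis using assms by (simp add: prod_eq_iff)
qed

lemma prod_ring_props:
  assumes c: "product_cone K I (\<lambda>i. Car (R i)) P p" and R: "\<And>i. i \<in> I \<Longrightarrow> is_ring K (R i)"
  shows "is_ring K (prod_ring K I R)"
    "i \<in> I \<Longrightarrow> ring_mor K (prod_ring K I R) (R i) (proj K I (\<lambda>i. Car (R i)) i)"
proof -
  let ?Q = "prod_ring K I R" and ?X = "\<lambda>i. Car (R i)"
  let ?P = "prod_ob K I ?X" and ?p = "proj K I ?X"
  note d = chosen_cone[OF c]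
  note dt = cone_typ[OF d]
  have Q: "Car ?Q = ?P" "Mul ?Q = tuple K I ?X (?P \<odot> ?P) (\<lambda>i. Mul (R i) \<cdot> (?p i \<boxtimes> ?p i))"
    "Unt ?Q = tuple K I ?X (Unit K) (\<lambda>i. Unt (R i))" by (simp_all add: prod_ring_def Let_def)
  have mi: "Mul (R i) \<cdot> (?p i \<boxtimes> ?p i) \<in> homs K (?P \<odot> ?P) (?X i)" if "i \<in> I" for i
    using that dt R by (auto simp: homs_iff)
  have m: "Mul ?Q \<in> homs K (?P \<odot> ?P) ?P" and pm: "\<And>i. i \<in> I \<Longrightarrow> ?p i \<cdot> Mul ?Q = Mul (R i) \<cdot> (?p i \<boxtimes> ?p i)"
    unfolding Q using tuple_props[OF c, of "?P \<odot> ?P", OF _ mi] dt(1) by auto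
  have u: "Unt ?Q \<in> homs K (Unit K) ?P" and pu: "\<And>i. i \<in> I \<Longrightarrow> ?p i \<cdot> Unt ?Q = Unt (R i)"
    unfolding Q using tuple_props[OF c, of "Unit K" "\<lambda>i. Unt (R i)"] R by (auto simp: homs_iff)
  have pm': "?p i \<bullet> (Mul ?Q \<bullet> (a \<star> b)) = Mul (R i) \<bullet> ((?p i \<bullet> a) \<star> (?p i \<bullet> b))"
    if "i \<in> I" "el a" "el b" "ob a = ?P" "ob b = ?P" for i a b
  proof -
    have "(?p i \<cdot> Mul ?Q) \<bullet> (a \<star> b) = (Mul (R i) \<cdot> (?p i \<boxtimes> ?p i)) \<bullet> (a \<star> b)" using pm that by simp
    then show ?thesis using that dt m R by (simp add: homs_iff)
  qed
  have pu': "?p i \<bullet> one ?Q = one (R i)" if "i \<in> I" for i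
    using pu[OF that] that dt u by (simp add: homs_iff flip: comp_app)
  have mt: "Mul ?Q \<in> Ar K" "Dom K (Mul ?Q) = ?P \<odot> ?P" "Cod K (Mul ?Q) = ?P" "Unt ?Q \<in> Ar K" "Dom K (Unt ?Q) = Unit K" "Cod K (Unt ?Q) = ?P"
    using m u by (auto simp: homs_iff)
  show ring: "is_ring K ?Q"
  proof (rule ringI, unfold Q(1))
    fix a b c assume abc: "el a" "el b" "el c" "ob a = ?P" "ob b = ?P" "ob c = ?P"
      "dj a b" "dj b a" "dj a c" "dj c a" "dj b c" "dj c b"
    show "Mul ?Q \<bullet> ((Mul ?Q \<bullet> (a \<star> b)) \<star> c) = Mul ?Q \<bullet> (a \<star> (Mul ?Q \<bullet> (b \<star> c)))"
      by (rule cone_el_eq[OF d]) (use abc mt R dt in \<open>auto simp: pm' mul_assoc mrg_assoc\<close>)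
  next
    fix a assume a: "el a" "ob a = ?P"
    show "Mul ?Q \<bullet> (one ?Q \<star> a) = a"
      by (rule cone_el_eq[OF d]) (use a mt R dt in \<open>auto simp: pm' pu' mul_simps\<close>)
  next
    fix a b assume ab: "el a" "el b" "ob a = ?P" "ob b = ?P" "dj a b" "dj b a"
    then have mm: "mrg (fst a) (fst b) = mrg (fst b) (fst a)" using mrg_commute[of "fst a" "fst b"] by (simp add: dst_def)
    show "Mul ?Q \<bullet> (a \<star> b) = Mul ?Q \<bullet> (b \<star> a)"
      by (rule cone_el_eq[OF d]) (use mm ab mt R dt in \<open>auto simp: pm' mul_comm\<close>)
  qed (use dt m u in auto)
  show "ring_mor K ?Q (R i) (?p i)" if "i \<in> I"
    unfolding ring_mor_iff
  proof (intro conjI mmorI ring, unfold Q(1))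
    show "is_ring K (R i)" using R that .
    show "?p i \<in> homs K ?P (Car (R i))" using dt that by (simp add: homs_iff)
    show "?p i \<bullet> one ?Q = one (R i)" by (rule pu'[OF that])
  qed (rule pm'[OF that])
qed

text \<open>Together with \<open>ring_iso_cone\<close> this trades an isomorphism with a product
  ring for a product cone of ring morphisms, which no longer depends on the chosen product.\<close>

lemma ring_cone_iso:
  assumes S: "is_ring K S" and f: "\<And>i. i \<in> I \<Longrightarrow> ring_mor K S (R i) (f i)" and c: "product_cone K I (\<lambda>i. Car (R i)) (Car S) f"
  shows "ring_isomorphism K S (prod_ring K I R) (tuple K I (\<lambda>i. Car (R i)) (Car S) f)"
proof -
  let ?Q = "prod_ring K I R" and ?X = "\<lambda>i. Car (R i)" and ?h = "tuple K I (\<lambda>i. Car (R i)) (Car S) f"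
  let ?P = "prod_ob K I ?X" and ?p = "proj K I ?X"
  note d = chosen_cone[OF c]
  have R: "is_ring K (R i)" if "i \<in> I" for i using f[OF that] by (simp add: ring_mor_def)
  have Q: "Car ?Q = ?P" by (simp add: prod_ring_def Let_def)
  have h: "?h \<in> homs K (Car S) ?P" "\<And>i. i \<in> I \<Longrightarrow> ?p i \<cdot> ?h = f i"
    using tuple_props[OF c, of "Car S" f] S cone_typ[OF c] by (auto simp: homs_iff)
  have ring: "is_ring K ?Q" and pr: "\<And>i. i \<in> I \<Longrightarrow> ring_mor K ?Q (R i) (?p i)"
    using prod_ring_props[OF c R] by auto
  have iso: "iso_arrow K ?h" by (rule cone_iso[OF c d h])
  have ph: "?p i \<bullet> ?h \<bullet> a = f i \<bullet> a" if "i \<in> I" "el a" "ob a = Car S" for i a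
    using h that cone_typ[OF d] by (simp add: homs_iff flip: comp_app)
  have ht: "?h \<in> Ar K" "Dom K ?h = Car S" "Cod K ?h = ?P" using h by (auto simp: homs_iff)
  have "mmor S ?Q ?h"
  proof (rule mmorI[OF S ring], unfold Q)
    fix a b assume ab: "el a" "el b" "ob a = Car S" "ob b = Car S" "dj a b" "dj b a"
    show "?h \<bullet> (Mul S \<bullet> (a \<star> b)) = Mul ?Q \<bullet> ((?h \<bullet> a) \<star> (?h \<bullet> b))"
    proof (rule cone_el_eq[OF d])
      fix i assume i: "i \<in> I"
      have "?p i \<bullet> (Mul ?Q \<bullet> ((?h \<bullet> a) \<star> (?h \<bullet> b))) = Mul (R i) \<bullet> ((f i \<bullet> a) \<star> (f i \<bullet> b))"
        using mmor_mul[OF ring_mor_mmor[OF pr[OF i]]] ab ht Q ph i by simp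
      then show "?p i \<bullet> ?h \<bullet> (Mul S \<bullet> (a \<star> b)) = ?p i \<bullet> (Mul ?Q \<bullet> ((?h \<bullet> a) \<star> (?h \<bullet> b)))"
        using ph i ab S mmor_mul[OF ring_mor_mmor[OF f[OF i]]] by simp
    qed (use ab ht S ring Q in auto)
  qed (rule h)
  moreover have "?h \<bullet> one S = one ?Q"
  proof (rule cone_el_eq[OF d])
    fix i assume i: "i \<in> I"
    show "?p i \<bullet> ?h \<bullet> one S = ?p i \<bullet> one ?Q"
      using ph i S ring_mor_one[OF f[OF i]] ring_mor_one[OF pr[OF i]] by simp
  qed (use ht S ring Q in auto)
  ultimately show ?thesis using iso by (simp add: ring_isomorphism_iff ring_mor_iff)
qed

lemma ring_iso_cone:
  assumes h: "ring_isomorphism K S (prod_ring K I R) h" and R: "\<And>i. i \<in> I \<Longrightarrow> is_ring K (R i)"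
    and c: "product_cone K I (\<lambda>i. Car (R i)) P p"
  shows "product_cone K I (\<lambda>i. Car (R i)) (Car S) (\<lambda>i. proj K I (\<lambda>i. Car (R i)) i \<cdot> h)"
    "i \<in> I \<Longrightarrow> ring_mor K S (R i) (proj K I (\<lambda>i. Car (R i)) i \<cdot> h)"
proof -
  have h': "ring_mor K S (prod_ring K I R) h" "iso_arrow K h" using h by (auto simp: ring_isomorphism_iff)
  have t: "Dom K h = Car S" "Cod K h = prod_ob K I (\<lambda>i. Car (R i))"
    using h'(1) by (auto simp: ring_mor_def prod_ring_def Let_def homs_iff)
  show "product_cone K I (\<lambda>i. Car (R i)) (Car S) (\<lambda>i. proj K I (\<lambda>i. Car (R i)) i \<cdot> h)"
    using iso_cone[OF chosen_cone[OF c] h'(2) t(2)] t by simp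
  show "ring_mor K S (R i) (proj K I (\<lambda>i. Car (R i)) i \<cdot> h)" if "i \<in> I"
    using ring_mor_comp[OF h'(1) prod_ring_props(2)[OF c R that]] by simp
qed

subsection \<open>Zero elements\<close>

text \<open>A predicate instead of a constant, since every stage and every object has its own zero
  element.\<close>

definition zero where "zero a \<longleftrightarrow> snd a = Zer K (Dom K (snd a)) (Cod K (snd a))"

lemma zero_app [simp]: "el a \<Longrightarrow> zero a \<Longrightarrow> f \<in> Ar K \<Longrightarrow> Dom K f = ob a \<Longrightarrow> zero (f \<bullet> a)"
  by (simp add: zero_def app_def)

lemma zero_ten [simp]:
  assumes "el a" "el b" "zero a \<or> zero b" shows "zero (a \<star> b)"
proof -
  have "snd a \<boxtimes> snd b = Zer K (stg K (fst a) \<odot> stg K (fst b)) (ob a \<odot> ob b)"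
    using assms by (elim disjE) (simp_all add: zero_def)
  then show ?thesis using assms by (simp add: zero_def ten_def)
qed

lemma zero_Zer [simp]: "el a \<Longrightarrow> ob a = x \<Longrightarrow> y \<in> Ob K \<Longrightarrow> zero (Zer K x y \<bullet> a)"
  by (auto simp: zero_def app_def)

lemma zero_unique: "el a \<Longrightarrow> el b \<Longrightarrow> zero a \<Longrightarrow> zero b \<Longrightarrow> fst a = fst b \<Longrightarrow> ob a = ob b \<Longrightarrow> a = b"
  by (simp add: zero_def prod_eq_iff)

lemma zero_ring_zero: "zero_object K (Car A) \<Longrightarrow> el a \<Longrightarrow> ob a = Car A \<Longrightarrow> zero a"
  using zero_objectD(2)[of "Car A" "snd a"] by (auto simp: zero_def zero_object_def)

lemma zero_ring_one:
  assumes "is_ring K A" "zero (one A)" shows "zero_object K (Car A)"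
proof (rule zero_objectI)
  show "Idn K (Car A) = Zer K (Car A) (Car A)"
  proof (rule ext1)
    fix a assume a: "el a" "ob a = Car A"
    then have "zero (Mul A \<bullet> (one A \<star> a))" using assms by simp
    then have "zero a" using a assms by (simp add: mul_simps)
    then show "Idn K (Car A) \<bullet> a = Zer K (Car A) (Car A) \<bullet> a"
      using a assms by (intro zero_unique) auto
  qed (use assms in \<open>auto simp: homs_iff\<close>)
qed (use assms in simp)

end

section \<open>Modules over a separable ring\<close>

context symmetric_monoidal_category
begin

lemma module_typ [simp]:
  assumes "is_module K A M"
  shows "fst M \<in> Ob K" "snd M \<in> Ar K" "Dom K (snd M) = Car A \<odot> fst M" "Cod K (snd M) = fst M"
  using assms by (auto simp: is_module_def homs_iff split: prod.splits)

lemma act_mul: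
  assumes "is_ring K A" "is_module K A M" "el r" "el s" "el m" "ob r = Car A" "ob s = Car A" "ob m = fst M" "dj r s" "dj r m" "dj s m"
  shows "snd M \<bullet> ((Mul A \<bullet> (r \<star> s)) \<star> m) = snd M \<bullet> (r \<star> (snd M \<bullet> (s \<star> m)))"
proof -
  have "(snd M \<cdot> (Mul A \<boxtimes> Idn K (fst M))) \<bullet> (r \<star> s \<star> m)
    = (snd M \<cdot> ((Idn K (Car A) \<boxtimes> snd M) \<cdot> Asc K (Car A) (Car A) (fst M))) \<bullet> (r \<star> s \<star> m)"
    using assms(2) by (simp add: is_module_def split: prod.splits)
  then show ?thesis using assms by simp
qed

lemma act_one:
  assumes "is_ring K A" "is_module K A M" "el m" "ob m = fst M"
  shows "snd M \<bullet> (one A \<star> m) = m"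
proof -
  have "(snd M \<cdot> (Unt A \<boxtimes> Idn K (fst M))) \<bullet> (un \<star> m) = Lun K (fst M) \<bullet> (un \<star> m)"
    using assms(2) by (simp add: is_module_def split: prod.splits)
  then show ?thesis using assms by simp
qed

lemma act_comm:
  assumes "is_ring K A" "is_module K A M" "el r" "el s" "el m" "ob r = Car A" "ob s = Car A" "ob m = fst M"
    "dj s r" "dj r s" "dj r m" "dj s m"
  shows "snd M \<bullet> (r \<star> (snd M \<bullet> (s \<star> m))) = snd M \<bullet> (s \<star> (snd M \<bullet> (r \<star> m)))"
  using act_mul[of A M r s m] act_mul[of A M s r m] mul_comm[of A r s] assms by simp

lemma moduleI:
  assumes A: "is_ring K A" and t: "x \<in> Ob K" "a \<in> homs K (Car A \<odot> x) x"
    and m: "\<And>r s m. \<lbrakk>el r; el s; el m; ob r = Car A; ob s = Car A; ob m = x; dj r s; dj s r; dj r m; dj m r; dj s m; dj m s\<rbrakk>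
      \<Longrightarrow> a \<bullet> ((Mul A \<bullet> (r \<star> s)) \<star> m) = a \<bullet> (r \<star> (a \<bullet> (s \<star> m)))"
    and u: "\<And>m. el m \<Longrightarrow> ob m = x \<Longrightarrow> a \<bullet> (one A \<star> m) = m"
  shows "is_module K A (x, a)"
  unfolding is_module_def prod.case
proof (intro conjI t)
  have t': "a \<in> Ar K" "Dom K a = Car A \<odot> x" "Cod K a = x" using t by (auto simp: homs_iff)
  show "a \<cdot> (Mul A \<boxtimes> Idn K x) = a \<cdot> (Idn K (Car A) \<boxtimes> a) \<cdot> Asc K (Car A) (Car A) x"
    by (rule ext3l[of _ "Car A" "Car A" x]) (use A t t' m in \<open>auto simp: homs_iff\<close>)
  show "a \<cdot> (Unt A \<boxtimes> Idn K x) = Lun K x"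
    by (rule ext_unit_ten) (use A t t' u in \<open>auto simp: homs_iff\<close>)
qed

lemma linear_typ:
  assumes "linear_mor K A M N f"
  shows "is_module K A M" "is_module K A N" "f \<in> Ar K" "Dom K f = fst M" "Cod K f = fst N"
  using assms by (auto simp: linear_mor_def homs_iff)

lemma linear_act:
  assumes "is_ring K A" "linear_mor K A M N f" "el r" "el m" "ob r = Car A" "ob m = fst M"
  shows "f \<bullet> snd M \<bullet> (r \<star> m) = snd N \<bullet> (r \<star> (f \<bullet> m))"
proof -
  have "(f \<cdot> snd M) \<bullet> (r \<star> m) = (snd N \<cdot> (Idn K (Car A) \<boxtimes> f)) \<bullet> (r \<star> m)"
    using assms by (simp add: linear_mor_def)
  then show ?thesis using assms linear_typ[OF assms(2)] by simp
qed

lemma linearI: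
  assumes "is_ring K A" "is_module K A M" "is_module K A N" "f \<in> homs K (fst M) (fst N)"
    "\<And>r m. \<lbrakk>el r; el m; ob r = Car A; ob m = fst M; dj r m; dj m r\<rbrakk> \<Longrightarrow> f \<bullet> snd M \<bullet> (r \<star> m) = snd N \<bullet> (r \<star> (f \<bullet> m))"
  shows "linear_mor K A M N f"
  unfolding linear_mor_def
proof (intro conjI assms(2-4))
  show "f \<cdot> snd M = snd N \<cdot> (Idn K (Car A) \<boxtimes> f)"
    by (rule ext2[of _ "Car A" "fst M"]) (use assms in \<open>auto simp: homs_iff\<close>)
qed

lemma reg_module [simp]: "is_ring K A \<Longrightarrow> is_module K A (reg_mod A)"
  unfolding reg_mod_def by (rule moduleI) (auto simp: homs_iff mul_simps)

lemma reg_mod_simps [simp]: "fst (reg_mod A) = Car A" "snd (reg_mod A) = Mul A"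
  by (simp_all add: reg_mod_def)

text \<open>A factorisation along a split epimorphism is recovered by composing with the section, so
  any arrow that factors \<open>k\<close> is the one chosen by \<open>descend\<close>.\<close>

lemma descend_eq:
  assumes q: "q \<in> Ar K" "s \<in> homs K (Cod K q) (Dom K q)" "q \<cdot> s = Idn K (Cod K q)"
    and h: "h \<in> homs K (Cod K q) (Cod K k)" "h \<cdot> q = k"
  shows "descend K q k = h"
  unfolding descend_def
proof (rule the_equality)
  show "h \<in> homs K (Cod K q) (Cod K k) \<and> h \<cdot> q = k" using h by simp
  have "h' = k \<cdot> s" if "h' \<in> homs K (Cod K q) (Cod K k) \<and> h' \<cdot> q = k" for h'
  proof -
    have "h' = h' \<cdot> (q \<cdot> s)" using that q by (simp add: homs_iff)
    also have "\<dots> = (h' \<cdot> q) \<cdot> s" by (rule comp_assoc[symmetric]) (use that q in \<open>auto simp: homs_iff\<close>)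
    finally show ?thesis using that by (simp only:)
  qed
  then show "h' = h" if "h' \<in> homs K (Cod K q) (Cod K k) \<and> h' \<cdot> q = k" for h' using that h by blast
qed

end

locale separable = idempotent_complete_smc +
  fixes A
  assumes separable: "separable_ring K A"
begin

lemma A_ring [simp]: "is_ring K A" using separable by (simp add: separable_ring_def)

lemmas amod_typ [simp] = module_typ[where A = A]
lemmas a_act_mul = act_mul[OF A_ring] and a_act_comm = act_comm[OF A_ring] and a_act_one = act_one[OF A_ring]
  and a_linear_act = linear_act[OF A_ring]

definition sg where
  "sg = (SOME s. s \<in> homs K (Car A) (Car A \<odot> Car A) \<and> Mul A \<cdot> s = Idn K (Car A) \<and>
        (Idn K (Car A) \<boxtimes> Mul A) \<cdot> Asc K (Car A) (Car A) (Car A) \<cdot> (s \<boxtimes> Idn K (Car A)) = s \<cdot> Mul A \<and>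
        (Mul A \<boxtimes> Idn K (Car A)) \<cdot> inv_arrow K (Asc K (Car A) (Car A) (Car A)) \<cdot> (Idn K (Car A) \<boxtimes> s) = s \<cdot> Mul A)"

lemma sg_props: "sg \<in> homs K (Car A) (Car A \<odot> Car A) \<and> Mul A \<cdot> sg = Idn K (Car A) \<and>
        (Idn K (Car A) \<boxtimes> Mul A) \<cdot> Asc K (Car A) (Car A) (Car A) \<cdot> (sg \<boxtimes> Idn K (Car A)) = sg \<cdot> Mul A \<and>
        (Mul A \<boxtimes> Idn K (Car A)) \<cdot> inv_arrow K (Asc K (Car A) (Car A) (Car A)) \<cdot> (Idn K (Car A) \<boxtimes> sg) = sg \<cdot> Mul A"
proof -
  have "\<exists>s. s \<in> homs K (Car A) (Car A \<odot> Car A) \<and> Mul A \<cdot> s = Idn K (Car A) \<and>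
        (Idn K (Car A) \<boxtimes> Mul A) \<cdot> Asc K (Car A) (Car A) (Car A) \<cdot> (s \<boxtimes> Idn K (Car A)) = s \<cdot> Mul A \<and>
        (Mul A \<boxtimes> Idn K (Car A)) \<cdot> inv_arrow K (Asc K (Car A) (Car A) (Car A)) \<cdot> (Idn K (Car A) \<boxtimes> s) = s \<cdot> Mul A"
    using separable unfolding separable_ring_def Let_def by blast
  then show ?thesis unfolding sg_def by (rule someI_ex)
qed

lemma sg_typ [simp]: "sg \<in> Ar K" "Dom K sg = Car A" "Cod K sg = Car A \<odot> Car A"
  using sg_props by (auto simp: homs_iff)

lemma mul_sg [simp]: "el a \<Longrightarrow> ob a = Car A \<Longrightarrow> Mul A \<bullet> sg \<bullet> a = a"
  using sg_props by (simp flip: comp_app)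

lemma sg_mul_right:
  assumes "el a" "el b" "ob a = Car A" "ob b = Car A"
  shows "sg \<bullet> Mul A \<bullet> (a \<star> b) = (Idn K (Car A) \<boxtimes> Mul A) \<bullet> Asc K (Car A) (Car A) (Car A) \<bullet> ((sg \<bullet> a) \<star> b)"
proof -
  have "((Idn K (Car A) \<boxtimes> Mul A) \<cdot> Asc K (Car A) (Car A) (Car A) \<cdot> (sg \<boxtimes> Idn K (Car A))) \<bullet> (a \<star> b) = (sg \<cdot> Mul A) \<bullet> (a \<star> b)"
    using sg_props by simp
  then show ?thesis using assms by simp
qed

lemma sg_mul_left:
  assumes "el a" "el b" "ob a = Car A" "ob b = Car A"
  shows "sg \<bullet> Mul A \<bullet> (a \<star> b) = (Mul A \<boxtimes> Idn K (Car A)) \<bullet> inv_arrow K (Asc K (Car A) (Car A) (Car A)) \<bullet> (a \<star> (sg \<bullet> b))"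
proof -
  have "((Mul A \<boxtimes> Idn K (Car A)) \<cdot> inv_arrow K (Asc K (Car A) (Car A) (Car A)) \<cdot> (Idn K (Car A) \<boxtimes> sg)) \<bullet> (a \<star> b) = (sg \<cdot> Mul A) \<bullet> (a \<star> b)"
    using sg_props by simp
  then show ?thesis using assms by simp
qed

text \<open>The separability idempotent \<open>\<Sum> x\<^sub>i \<otimes> y\<^sub>i\<close> of \<open>A \<otimes> A\<close>.\<close>

definition se where "se = sg \<bullet> one A"

lemma se_simps [simp]: "el se" "ob se = Car A \<odot> Car A" "fst se = []"
  by (simp_all add: se_def)

lemma mul_se [simp]: "Mul A \<bullet> se = one A"
  by (simp add: se_def)

text \<open>As a map of bimodules \<open>sg\<close> is determined by its value \<open>se\<close> at
  1. With \<open>sg_se_right\<close> this yields \<Sum> a x_i \<otimes> y_i = \<Sum> x_i \<otimes>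
  y_i a, the identity behind every use of \<open>se\<close>.\<close>

lemma sg_se_left:
  assumes "el a" "ob a = Car A"
  shows "sg \<bullet> a = (Mul A \<boxtimes> Idn K (Car A)) \<bullet> inv_arrow K (Asc K (Car A) (Car A) (Car A)) \<bullet> (a \<star> se)"
  unfolding se_def using sg_mul_left[of a "one A"] assms by (simp add: mul_simps)

lemma sg_se_right:
  assumes "el a" "ob a = Car A"
  shows "sg \<bullet> a = (Idn K (Car A) \<boxtimes> Mul A) \<bullet> Asc K (Car A) (Car A) (Car A) \<bullet> (se \<star> a)"
  unfolding se_def using sg_mul_right[of "one A" a] assms by (simp add: mul_simps)

text \<open>\<open>eps M N\<close> maps \<open>m \<otimes> n\<close> to \<open>\<Sum> x\<^sub>i m \<otimes> y\<^sub>i n\<close>; it is the idempotent whose image is \<open>M \<otimes>\<^sub>A N\<close>.\<close>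

definition eps where
  "eps M N = (snd M \<boxtimes> snd N) \<cdot> (middle_swap K (Car A) (Car A) (fst M) (fst N) \<cdot> ((snd se \<boxtimes> Idn K (fst M \<odot> fst N))
     \<cdot> inv_arrow K (Lun K (fst M \<odot> fst N))))"

lemma snd_se_un: "snd se \<bullet> un = se"
  using snd_idel[of se] by (simp add: idel_Nil)

section \<open>The idempotent of M \<otimes>_A N and its splitting\<close>

context
  fixes M N assumes M [simp]: "is_module K A M" and N [simp]: "is_module K A N"
begin

lemma eps_typ [simp]: "eps M N \<in> Ar K" "Dom K (eps M N) = fst M \<odot> fst N" "Cod K (eps M N) = fst M \<odot> fst N"
  by (simp_all add: eps_def)

lemma eps_app:
  assumes "el t" "ob t = fst M \<odot> fst N"
  shows "eps M N \<bullet> t = (snd M \<boxtimes> snd N) \<bullet> middle_swap K (Car A) (Car A) (fst M) (fst N) \<bullet> (se \<star> t)"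
  using assms by (simp add: eps_def snd_se_un)

abbreviation (input) Phi where
  "Phi t s \<equiv> (snd M \<boxtimes> snd N) \<bullet> middle_swap K (Car A) (Car A) (fst M) (fst N) \<bullet> (t \<star> s)"

text \<open>\<Sum> x_i r m \<otimes> y_i n = \<Sum> x_i m \<otimes> y_i r n, because multiplying
  \<open>se\<close> by r on either side gives \<open>sg \<bullet> r\<close>.\<close>

lemma eps_balanced:
  assumes "el r" "el m" "el n" "ob r = Car A" "ob m = fst M" "ob n = fst N"
    "dj r m" "dj m r" "dj r n" "dj n r" "dj m n" "dj n m"
  shows "eps M N \<bullet> ((snd M \<bullet> (r \<star> m)) \<star> n) = eps M N \<bullet> (m \<star> (snd N \<bullet> (r \<star> n)))"
proof -
  have "eps M N \<bullet> ((snd M \<bullet> (r \<star> m)) \<star> n)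
      = Phi ((Mul A \<boxtimes> Idn K (Car A)) \<bullet> inv_arrow K (Asc K (Car A) (Car A) (Car A)) \<bullet> (r \<star> se)) (m \<star> n)"
    by (subst eps_app, use assms in simp, use assms in simp,
        rule lin_ext[where x = "Car A" and y = "Car A" and e = se and
         L = "\<lambda>e. Phi e ((snd M \<bullet> (r \<star> m)) \<star> n)" and
         R = "\<lambda>e. Phi ((Mul A \<boxtimes> Idn K (Car A)) \<bullet> inv_arrow K (Asc K (Car A) (Car A) (Car A)) \<bullet> (r \<star> e)) (m \<star> n)"],
       (rule lin_intros | use assms in \<open>simp add: a_act_mul a_act_comm; fail\<close>)+)
  also have "\<dots> = Phi ((Idn K (Car A) \<boxtimes> Mul A) \<bullet> Asc K (Car A) (Car A) (Car A) \<bullet> (se \<star> r)) (m \<star> n)"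
    using sg_se_left[of r] sg_se_right[of r] assms by simp
  also have "\<dots> = eps M N \<bullet> (m \<star> (snd N \<bullet> (r \<star> n)))"
    by (subst eps_app, use assms in simp, use assms in simp,
        rule lin_ext[where x = "Car A" and y = "Car A" and e = se and
         R = "\<lambda>e. Phi e (m \<star> (snd N \<bullet> (r \<star> n)))" and
         L = "\<lambda>e. Phi ((Idn K (Car A) \<boxtimes> Mul A) \<bullet> Asc K (Car A) (Car A) (Car A) \<bullet> (e \<star> r)) (m \<star> n)"],
       (rule lin_intros | use assms in \<open>simp add: a_act_mul; fail\<close>)+)
  finally show ?thesis .
qed

lemma eps_linear:
  assumes "el r" "el m" "el n" "ob r = Car A" "ob m = fst M" "ob n = fst N"
    "dj r m" "dj m r" "dj r n" "dj n r" "dj m n" "dj n m"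
  shows "(snd M \<boxtimes> Idn K (fst N)) \<bullet> inv_arrow K (Asc K (Car A) (fst M) (fst N)) \<bullet> (r \<star> (eps M N \<bullet> (m \<star> n)))
    = eps M N \<bullet> ((snd M \<bullet> (r \<star> m)) \<star> n)"
  by (subst eps_app, use assms in simp, use assms in simp, subst eps_app, use assms in simp, use assms in simp,
        rule lin_ext[where x = "Car A" and y = "Car A" and e = se and
         L = "\<lambda>e. (snd M \<boxtimes> Idn K (fst N)) \<bullet> inv_arrow K (Asc K (Car A) (fst M) (fst N)) \<bullet> (r \<star> Phi e (m \<star> n))" and
         R = "\<lambda>e. Phi e ((snd M \<bullet> (r \<star> m)) \<star> n)"],
       (rule lin_intros | use assms in \<open>simp add: a_act_comm; fail\<close>)+)

definition balanced where
  "balanced k \<longleftrightarrow> k \<in> Ar K \<and> Dom K k = fst M \<odot> fst N \<and>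
     (\<forall>r m n. el r \<and> el m \<and> el n \<and> ob r = Car A \<and> ob m = fst M \<and> ob n = fst N \<and> dj r m \<and> dj m r \<and> dj r n \<and> dj n r \<and> dj m n \<and> dj n m
       \<longrightarrow> k \<bullet> ((snd M \<bullet> (r \<star> m)) \<star> n) = k \<bullet> (m \<star> (snd N \<bullet> (r \<star> n))))"

lemma balanced_eps: "balanced (eps M N)"
  unfolding balanced_def by (auto intro: eps_balanced)

text \<open>A balanced \<open>k\<close> has the same value at \<Sum> x_i m \<otimes> y_i n and at
  \<Sum> m \<otimes> x_i y_i n, and \<Sum> x_i y_i = 1 by \<open>mul_se\<close>.\<close>

lemma balanced_comp_eps:
  assumes k: "balanced k" shows "k \<cdot> eps M N = k"
proof (rule ext2[of _ "fst M" "fst N"])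
  have kt: "k \<in> Ar K" "Dom K k = fst M \<odot> fst N" using k by (auto simp: balanced_def)
  show "k \<cdot> eps M N \<in> homs K (fst M \<odot> fst N) (Cod K k)" "k \<in> homs K (fst M \<odot> fst N) (Cod K k)"
    using kt by (auto simp: homs_iff)
  fix m n assume mn: "el m" "el n" "ob m = fst M" "ob n = fst N" "dj m n" "dj n m"
  have kb: "k \<bullet> ((snd M \<bullet> (r \<star> m)) \<star> n') = k \<bullet> (m \<star> (snd N \<bullet> (r \<star> n')))"
    if "el r" "el n'" "ob r = Car A" "ob n' = fst N" "dj r m" "dj m r" "dj r n'" "dj n' r" "dj m n'" "dj n' m" for r n'
    using k that mn unfolding balanced_def by blast
  have "k \<bullet> Phi se (m \<star> n) = k \<bullet> (m \<star> (snd N \<bullet> ((Mul A \<bullet> se) \<star> n)))"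
    by (rule lin_ext[where x = "Car A" and y = "Car A" and e = se and
         L = "\<lambda>e. k \<bullet> Phi e (m \<star> n)" and
         R = "\<lambda>e. k \<bullet> (m \<star> (snd N \<bullet> ((Mul A \<bullet> e) \<star> n)))"],
       (rule lin_intros | use mn kt in \<open>simp add: a_act_mul kb; fail\<close>)+)
  then show "(k \<cdot> eps M N) \<bullet> (m \<star> n) = k \<bullet> (m \<star> n)"
    using mn kt by (simp add: eps_app a_act_one del: ten_app middle_swap_app)
qed (use M N module_typ in auto)

definition act_left where "act_left = (snd M \<cdot> Swp K (fst M) (Car A)) \<boxtimes> Idn K (fst N)"
definition act_right where "act_right = (Idn K (fst M) \<boxtimes> snd N) \<cdot> Asc K (fst M) (Car A) (fst N)"

lemma act_typ [simp]:
  "act_left \<in> Ar K" "Dom K act_left = fst M \<odot> Car A \<odot> fst N" "Cod K act_left = fst M \<odot> fst N"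
  "act_right \<in> Ar K" "Dom K act_right = fst M \<odot> Car A \<odot> fst N" "Cod K act_right = fst M \<odot> fst N"
  by (auto simp: act_left_def act_right_def)

lemma balanced_iff: "balanced k \<longleftrightarrow> k \<in> Ar K \<and> Dom K k = fst M \<odot> fst N \<and> k \<cdot> act_left = k \<cdot> act_right"
proof
  assume k: "balanced k"
  then have kt: "k \<in> Ar K" "Dom K k = fst M \<odot> fst N" by (auto simp: balanced_def)
  have "k \<cdot> act_left = k \<cdot> act_right"
    by (rule ext3l[of _ "fst M" "Car A" "fst N"])
      (use k kt in \<open>auto simp: homs_iff balanced_def act_left_def act_right_def\<close>)
  then show "k \<in> Ar K \<and> Dom K k = fst M \<odot> fst N \<and> k \<cdot> act_left = k \<cdot> act_right" using kt by simp
next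
  assume k: "k \<in> Ar K \<and> Dom K k = fst M \<odot> fst N \<and> k \<cdot> act_left = k \<cdot> act_right"
  show "balanced k" unfolding balanced_def
  proof (intro conjI allI impI)
    fix r m n
    assume a: "el r \<and> el m \<and> el n \<and> ob r = Car A \<and> ob m = fst M \<and> ob n = fst N \<and> dj r m \<and> dj m r \<and> dj r n \<and> dj n r \<and> dj m n \<and> dj n m"
    have "(k \<cdot> act_left) \<bullet> (m \<star> r \<star> n) = (k \<cdot> act_right) \<bullet> (m \<star> r \<star> n)" using k by simp
    then show "k \<bullet> ((snd M \<bullet> (r \<star> m)) \<star> n) = k \<bullet> (m \<star> (snd N \<bullet> (r \<star> n)))"
      using a k by (simp add: act_left_def act_right_def)
  qed (use k in auto)
qed

text \<open>\<open>eps M N\<close> is itself balanced, hence idempotent, and composing with it fixes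
  every balanced arrow; the projection of a splitting is therefore the coequaliser.\<close>

lemma ex_coequaliser: "\<exists>q. coequaliser K act_left act_right q"
proof -
  have ee: "eps M N \<cdot> eps M N = eps M N" by (rule balanced_comp_eps[OF balanced_eps])
  have "eps M N \<in> homs K (fst M \<odot> fst N) (fst M \<odot> fst N)" by (simp add: homs_iff)
  from idempotent_complete[OF this ee] obtain x1 x2 i1 i2 p1 p2
    where b: "biproduct K x1 x2 (fst M \<odot> fst N) i1 i2 p1 p2" and e: "eps M N = i1 \<cdot> p1" by blast
  have t: "i1 \<in> Ar K" "Dom K i1 = x1" "Cod K i1 = fst M \<odot> fst N" "p1 \<in> Ar K" "Dom K p1 = fst M \<odot> fst N" "Cod K p1 = x1" "p1 \<cdot> i1 = Idn K x1"
    using b by (auto simp: biproduct_def homs_iff)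
  have "coequaliser K act_left act_right p1"
    unfolding coequaliser_def
  proof (intro conjI ballI impI)
    have "p1 \<cdot> (eps M N \<cdot> act_left) = p1 \<cdot> (eps M N \<cdot> act_right)" using balanced_eps balanced_iff by simp
    then show "p1 \<cdot> act_left = p1 \<cdot> act_right"
      using t by (simp add: e) (simp add: t flip: comp_assoc)
    fix k assume k: "k \<in> Ar K" and k2: "Dom K k = Cod K act_left \<and> k \<cdot> act_left = k \<cdot> act_right"
    then have "k \<cdot> eps M N = k" by (intro balanced_comp_eps) (auto simp: balanced_iff)
    then have kk: "(k \<cdot> i1) \<cdot> p1 = k" using k k2 t by (simp add: e)
    show "\<exists>!h. h \<in> homs K (Cod K p1) (Cod K k) \<and> h \<cdot> p1 = k"
    proof (rule ex1I[of _ "k \<cdot> i1"])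
      show "k \<cdot> i1 \<in> homs K (Cod K p1) (Cod K k) \<and> (k \<cdot> i1) \<cdot> p1 = k" using kk k k2 t by (auto simp: homs_iff)
      fix h assume h: "h \<in> homs K (Cod K p1) (Cod K k) \<and> h \<cdot> p1 = k"
      then have "h = h \<cdot> (p1 \<cdot> i1)" using t by (simp add: homs_iff)
      also have "\<dots> = (h \<cdot> p1) \<cdot> i1" by (rule comp_assoc[symmetric]) (use t h in \<open>auto simp: homs_iff\<close>)
      finally show "h = k \<cdot> i1" using h by (simp only:)
    qed
  qed (use t in \<open>auto simp: homs_iff\<close>)
  then show ?thesis by blast
qed

abbreviation QQ where "QQ \<equiv> mod_quot K A M N"

lemma quot_coequaliser: "coequaliser K act_left act_right QQ"
  using someI_ex[OF ex_coequaliser] unfolding mod_quot_def act_left_def act_right_def .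

lemma fst_mod_tensor: "fst (mod_tensor K A M N) = Cod K QQ"
  by (simp add: mod_tensor_def Let_def)

lemma quot_typ [simp]: "QQ \<in> Ar K" "Dom K QQ = fst M \<odot> fst N" "Cod K QQ = fst (mod_tensor K A M N)"
  using quot_coequaliser by (auto simp: coequaliser_def fst_mod_tensor)

lemma quot_in [simp]: "fst (mod_tensor K A M N) \<in> Ob K"
  unfolding fst_mod_tensor by (rule Cod_Ob) simp

lemma balanced_quot: "balanced QQ"
  using quot_coequaliser unfolding balanced_iff by (simp add: coequaliser_def)

lemma quot_balanced:
  assumes "el r" "el m" "el n" "ob r = Car A" "ob m = fst M" "ob n = fst N"
    "dj r m" "dj m r" "dj r n" "dj n r" "dj m n" "dj n m"
  shows "QQ \<bullet> ((snd M \<bullet> (r \<star> m)) \<star> n) = QQ \<bullet> (m \<star> (snd N \<bullet> (r \<star> n)))"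
  using balanced_quot assms unfolding balanced_def by blast

lemma quot_factor:
  assumes "balanced k"
  shows "\<exists>!h. h \<in> homs K (Cod K QQ) (Cod K k) \<and> h \<cdot> QQ = k"
  using quot_coequaliser assms unfolding coequaliser_def balanced_iff by auto

text \<open>A section of the chosen quotient. It makes the quotient a split epimorphism, which stays
  one after tensoring.\<close>

definition sct where "sct = descend K QQ (eps M N)"

lemma sct_typ [simp]: "sct \<in> Ar K" "Dom K sct = fst (mod_tensor K A M N)" "Cod K sct = fst M \<odot> fst N"
  and sct_quot: "sct \<cdot> QQ = eps M N"
  using theI'[OF quot_factor[OF balanced_eps]] unfolding sct_def descend_def by (auto simp: homs_iff)

lemma quot_sct [simp]: "QQ \<cdot> sct = Idn K (fst (mod_tensor K A M N))"
proof -
  have "(QQ \<cdot> sct) \<cdot> QQ = QQ"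
    using balanced_comp_eps[OF balanced_quot] by (simp add: sct_quot)
  moreover from quot_factor[OF balanced_quot] obtain h
    where "\<And>g. g \<in> homs K (Cod K QQ) (Cod K QQ) \<and> g \<cdot> QQ = QQ \<Longrightarrow> g = h"
    by (elim ex1E) blast
  then have "g = g'" if "g \<in> homs K (Cod K QQ) (Cod K QQ)" "g \<cdot> QQ = QQ" "g' \<in> homs K (Cod K QQ) (Cod K QQ)" "g' \<cdot> QQ = QQ" for g g'
    using that by metis
  ultimately show ?thesis by (metis Comp_homs Idn_Comp Idn_homs arrow_homs quot_in quot_typ sct_typ)
qed

lemma quot_sct_app [simp]: "el t \<Longrightarrow> ob t = fst (mod_tensor K A M N) \<Longrightarrow> QQ \<bullet> sct \<bullet> t = t"
  by (simp flip: comp_app)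

lemma sct_quot_app [simp]: "el t \<Longrightarrow> ob t = fst M \<odot> fst N \<Longrightarrow> sct \<bullet> QQ \<bullet> t = eps M N \<bullet> t"
  by (simp add: sct_quot flip: comp_app)

lemma quot_eps_app: "el t \<Longrightarrow> ob t = fst M \<odot> fst N \<Longrightarrow> QQ \<bullet> eps M N \<bullet> t = QQ \<bullet> t"
  using balanced_comp_eps[OF balanced_quot] by (simp flip: comp_app)

lemma descend_props:
  assumes "balanced k"
  shows "descend K QQ k \<in> homs K (fst (mod_tensor K A M N)) (Cod K k)" "descend K QQ k \<cdot> QQ = k"
  using theI'[OF quot_factor[OF assms]] unfolding descend_def by auto

lemma descend_app:
  assumes "balanced k" "el t" "ob t = fst M \<odot> fst N"
  shows "descend K QQ k \<bullet> QQ \<bullet> t = k \<bullet> t"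
  using descend_props[OF assms(1)] assms(2,3) by (simp add: homs_iff flip: comp_app)

lemma descend_quot_eq:
  assumes "h \<in> homs K (fst (mod_tensor K A M N)) (Cod K k)" "h \<cdot> QQ = k"
  shows "descend K QQ k = h"
  by (rule descend_eq[of _ sct]) (use assms in \<open>auto simp: homs_iff\<close>)

lemma quot_ext:
  assumes "f \<in> homs K (fst (mod_tensor K A M N)) z" "g \<in> homs K (fst (mod_tensor K A M N)) z'"
    "\<And>m n. \<lbrakk>el m; el n; ob m = fst M; ob n = fst N; dj m n; dj n m\<rbrakk> \<Longrightarrow> f \<bullet> QQ \<bullet> (m \<star> n) = g \<bullet> QQ \<bullet> (m \<star> n)"
  shows "f = g"
proof -
  have "f \<cdot> QQ = g \<cdot> QQ"
    by (rule ext2[of _ "fst M" "fst N"]) (use assms in \<open>auto simp: homs_iff\<close>)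
  then have "(f \<cdot> QQ) \<cdot> sct = (g \<cdot> QQ) \<cdot> sct" by simp
  then show ?thesis using assms(1,2) by (simp add: homs_iff)
qed

text \<open>An element of M \<otimes>_A N is the class of its image under \<open>sct\<close>, to
  which \<open>lin_ext\<close> applies. Proofs may thus treat it as the class of a tensor.\<close>

lemma quot_wlog:
  assumes "lin V (fst M \<odot> fst N) z (\<lambda>e. L (QQ \<bullet> e))" "lin V' (fst M \<odot> fst N) z' (\<lambda>e. R (QQ \<bullet> e))"
    "el t" "ob t = fst (mod_tensor K A M N)" "dst V (fst t)" "dst V' (fst t)"
    "\<And>a b. \<lbrakk>el a; el b; ob a = fst M; ob b = fst N; dj a b; dj b a; dst V (fst a); dst V (fst b); dst V' (fst a); dst V' (fst b);
       dst (fst a) V; dst (fst b) V; dst (fst a) V'; dst (fst b) V'\<rbrakk> \<Longrightarrow> L (QQ \<bullet> (a \<star> b)) = R (QQ \<bullet> (a \<star> b))"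
  shows "L t = R t"
proof -
  have "L (QQ \<bullet> sct \<bullet> t) = R (QQ \<bullet> sct \<bullet> t)"
  proof (rule lin_ext[OF assms(1) assms(2)])
    show "el (sct \<bullet> t)" "ob (sct \<bullet> t) = fst M \<odot> fst N" "dst V (fst (sct \<bullet> t))" "dst V' (fst (sct \<bullet> t))"
      using assms(3-6) by simp_all
  qed (simp, simp, rule assms(7))
  then show ?thesis using assms(3,4) by simp
qed

text \<open>The action descends along \<open>Idn K (Car A) \<boxtimes> QQ\<close>, which is split by
  \<open>Idn K (Car A) \<boxtimes> sct\<close>; that the required factorisation exists is
  \<open>eps_linear\<close>.\<close>

lemma tensor_act:
  shows "snd (mod_tensor K A M N) \<in> homs K (Car A \<odot> fst (mod_tensor K A M N)) (fst (mod_tensor K A M N))"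
    and "\<And>r m n. \<lbrakk>el r; el m; el n; ob r = Car A; ob m = fst M; ob n = fst N; dj r m; dj r n; dj m n\<rbrakk> \<Longrightarrow>
      snd (mod_tensor K A M N) \<bullet> (r \<star> (QQ \<bullet> (m \<star> n))) = QQ \<bullet> ((snd M \<bullet> (r \<star> m)) \<star> n)"
proof -
  let ?T = "fst (mod_tensor K A M N)"
  define k where "k = QQ \<cdot> ((snd M \<boxtimes> Idn K (fst N)) \<cdot> inv_arrow K (Asc K (Car A) (fst M) (fst N)))"
  have kt: "k \<in> Ar K" "Dom K k = Car A \<odot> (fst M \<odot> fst N)" "Cod K k = ?T" by (auto simp: k_def)
  have ka: "k \<bullet> (r \<star> (m \<star> n)) = QQ \<bullet> ((snd M \<bullet> (r \<star> m)) \<star> n)"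
    if "el r" "el m" "el n" "ob r = Car A" "ob m = fst M" "ob n = fst N" "dj r m" "dj r n" "dj m n" for r m n
    using that by (simp add: k_def)
  let ?h = "k \<cdot> (Idn K (Car A) \<boxtimes> sct)"
  have hq: "?h \<cdot> (Idn K (Car A) \<boxtimes> QQ) = k"
  proof (rule ext3r[of _ "Car A" "fst M" "fst N"])
    fix r m n assume a: "el r" "el m" "el n" "ob r = Car A" "ob m = fst M" "ob n = fst N"
      "dj r m" "dj m r" "dj r n" "dj n r" "dj m n" "dj n m"
    have "k \<bullet> (r \<star> (eps M N \<bullet> (m \<star> n))) = QQ \<bullet> ((snd M \<bullet> (r \<star> m)) \<star> n)"
      using a eps_linear[of r m n] by (simp add: k_def quot_eps_app)
    then show "(?h \<cdot> (Idn K (Car A) \<boxtimes> QQ)) \<bullet> (r \<star> (m \<star> n)) = k \<bullet> (r \<star> (m \<star> n))"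
      using a kt ka by simp
  qed (use kt in \<open>auto simp: homs_iff\<close>)
  have eq: "snd (mod_tensor K A M N) = ?h"
    unfolding mod_tensor_def Let_def snd_conv k_def[symmetric]
    by (rule descend_eq[of _ "Idn K (Car A) \<boxtimes> sct"]) (use kt hq in \<open>auto simp: homs_iff ten_comp\<close>)
  show "snd (mod_tensor K A M N) \<in> homs K (Car A \<odot> ?T) ?T"
    unfolding eq using kt by (auto simp: homs_iff)
  fix r m n assume a: "el r" "el m" "el n" "ob r = Car A" "ob m = fst M" "ob n = fst N" "dj r m" "dj r n" "dj m n"
  have "(?h \<cdot> (Idn K (Car A) \<boxtimes> QQ)) \<bullet> (r \<star> (m \<star> n)) = QQ \<bullet> ((snd M \<bullet> (r \<star> m)) \<star> n)"
    unfolding hq using ka a by simp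
  then show "snd (mod_tensor K A M N) \<bullet> (r \<star> (QQ \<bullet> (m \<star> n))) = QQ \<bullet> ((snd M \<bullet> (r \<star> m)) \<star> n)"
    unfolding eq using a kt by simp
qed

lemma tensor_act_typ [simp]: "snd (mod_tensor K A M N) \<in> Ar K"
  "Dom K (snd (mod_tensor K A M N)) = Car A \<odot> fst (mod_tensor K A M N)"
  "Cod K (snd (mod_tensor K A M N)) = fst (mod_tensor K A M N)"
  using tensor_act(1) by (auto simp: homs_iff)

lemma tensor_module [simp]: "is_module K A (mod_tensor K A M N)"
proof -
  let ?T = "fst (mod_tensor K A M N)" and ?a = "snd (mod_tensor K A M N)"
  have "is_module K A (?T, ?a)"
  proof (rule moduleI)
    fix r s t assume a: "el r" "el s" "el t" "ob r = Car A" "ob s = Car A" "ob t = ?T" "dj r s" "dj s r" "dj r t" "dj t r" "dj s t" "dj t s"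
    show "?a \<bullet> ((Mul A \<bullet> (r \<star> s)) \<star> t) = ?a \<bullet> (r \<star> (?a \<bullet> (s \<star> t)))"
      by (rule quot_wlog[where L = "\<lambda>t. ?a \<bullet> ((Mul A \<bullet> (r \<star> s)) \<star> t)" and R = "\<lambda>t. ?a \<bullet> (r \<star> (?a \<bullet> (s \<star> t)))"],
        (rule lin_intros | use a in \<open>simp add: tensor_act(2) a_act_mul; fail\<close>)+)
  next
    fix t assume a: "el t" "ob t = ?T"
    show "?a \<bullet> (one A \<star> t) = t"
      by (rule quot_wlog[where L = "\<lambda>t. ?a \<bullet> (one A \<star> t)" and R = "\<lambda>t. t"],
        (rule lin_intros | use a in \<open>simp add: tensor_act(2) a_act_one; fail\<close>)+)
  qed (use tensor_act(1) in auto)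
  then show ?thesis by simp
qed

end
end

section \<open>The symmetric monoidal category of modules\<close>

context additive_category
begin

lemma biproduct_eqI:
  assumes b: "biproduct K x1 x2 x i1 i2 p1 p2" and "f \<in> homs K y x" "g \<in> homs K y x" "p1 \<cdot> f = p1 \<cdot> g" "p2 \<cdot> f = p2 \<cdot> g"
  shows "f = g"
proof -
  have t: "i1 \<in> Ar K" "Dom K i1 = x1" "Cod K i1 = x" "i2 \<in> Ar K" "Dom K i2 = x2" "Cod K i2 = x"
    "p1 \<in> Ar K" "Dom K p1 = x" "Cod K p1 = x1" "p2 \<in> Ar K" "Dom K p2 = x" "Cod K p2 = x2"
    and e: "(i1 \<cdot> p1) \<boxplus> (i2 \<cdot> p2) = Idn K x"
    using b by (auto simp: biproduct_def homs_iff)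
  have "f = ((i1 \<cdot> p1) \<boxplus> (i2 \<cdot> p2)) \<cdot> f" unfolding e using assms by (simp add: homs_iff)
  also have "\<dots> = ((i1 \<cdot> p1) \<boxplus> (i2 \<cdot> p2)) \<cdot> g" using t assms by (simp add: homs_iff add_comp)
  also have "\<dots> = g" unfolding e using assms by (simp add: homs_iff)
  finally show ?thesis .
qed

lemma add_assoc:
  assumes "f \<in> Ar K" "g \<in> Ar K" "h \<in> Ar K" "Dom K f = Dom K h" "Cod K f = Cod K h" "Dom K g = Dom K h" "Cod K g = Cod K h"
  shows "(f \<boxplus> g) \<boxplus> h = f \<boxplus> (g \<boxplus> h)"
proof -
  have "comm_group (hgrp (Dom K h) (Cod K h))" using assms by (intro homs_comm_group) auto
  then show ?thesis using monoid.m_assoc[of "hgrp (Dom K h) (Cod K h)" f g h] assms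
    by (auto simp: homs_iff comm_group_def comm_monoid_def)
qed

lemma neg_unique:
  assumes "f \<in> Ar K" "g \<in> Ar K" "g' \<in> Ar K" "Dom K g = Dom K f" "Cod K g = Cod K f" "Dom K g' = Dom K f" "Cod K g' = Cod K f"
    "f \<boxplus> g = Zer K (Dom K f) (Cod K f)" "f \<boxplus> g' = Zer K (Dom K f) (Cod K f)"
  shows "g = g'"
proof -
  have "g = g \<boxplus> (f \<boxplus> g')" unfolding assms(9) using assms(1-7) by simp
  also have "\<dots> = (g \<boxplus> f) \<boxplus> g'" by (rule add_assoc[symmetric]) (use assms(1-7) in auto)
  also have "g \<boxplus> f = f \<boxplus> g" by (rule add_commute) (use assms(1-7) in auto)
  also have "(f \<boxplus> g) \<boxplus> g' = g'" unfolding assms(8) using assms(1-7) by simp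
  finally show ?thesis .
qed

end

context separable
begin

section \<open>Structure maps of the category of modules\<close>

abbreviation MC where "MC \<equiv> mod_cat K A"
abbreviation Q where "Q \<equiv> mod_quot K A"
abbreviation T where "T \<equiv> mod_tensor K A"
abbreviation U where "U \<equiv> reg_mod A"

text \<open>The underlying arrows of the operations of \<open>mod_cat\<close> are named to keep
  their \<open>descend\<close> terms folded; later they are used mainly through their effect on
  classes of tensors.\<close>

definition tnA where "tnA M f N M' f' N' = descend K (Q M M') (Q N N' \<cdot> (f \<boxtimes> f'))"
definition asM where "asM M N P = descend K (Q (T M N) P \<cdot> (Q M N \<boxtimes> Idn K (fst P)))
                   (Q M (T N P) \<cdot> (Idn K (fst M) \<boxtimes> Q N P) \<cdot> Asc K (fst M) (fst N) (fst P))"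
definition luM where "luM M = descend K (Q U M) (snd M)"
definition ruM where "ruM M = descend K (Q M U) (snd M \<cdot> Swp K (fst M) (Car A))"
definition swM where "swM M N = descend K (Q M N) (Q N M \<cdot> Swp K (fst M) (fst N))"

lemma mod_cat_simps [simp]:
  "Ob MC = {M. is_module K A M}" "(M, f, N) \<in> Ar MC \<longleftrightarrow> linear_mor K A M N f"
  "Dom MC (M, f, N) = M" "Cod MC (M, f, N) = N" "Idn MC M = (M, Idn K (fst M), M)"
  "Comp MC (N', g, P) (M, f, N) = (M, g \<cdot> f, P)" "Zer MC M N = (M, Zer K (fst M) (fst N), N)"
  "Add MC (M, f, N) (M', g, N') = (M, f \<boxplus> g, N)" "Unit MC = U" "TenO MC = T"
  "TenA MC (M, f, N) (M', f', N') = (T M M', tnA M f N M' f' N', T N N')"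
  "Asc MC M N P = (T (T M N) P, asM M N P, T M (T N P))"
  "Lun MC M = (T U M, luM M, M)" "Run MC M = (T M U, ruM M, M)" "Swp MC M N = (T M N, swM M N, T N M)"
  by (simp_all add: mod_cat_def Let_def tnA_def asM_def luM_def ruM_def swM_def)

lemma homs_MC: "F \<in> homs MC X Y \<longleftrightarrow> (\<exists>f. F = (X, f, Y) \<and> linear_mor K A X Y f)"
  by (cases F) (auto simp: homs_def)

lemma Ar_MC: "F \<in> Ar MC \<longleftrightarrow> (\<exists>X f Y. F = (X, f, Y) \<and> linear_mor K A X Y f)"
  by (cases F) auto

lemmas lt = linear_typ[where A = A]

lemma linear_Idn [simp]: "is_module K A M \<Longrightarrow> linear_mor K A M M (Idn K (fst M))"
  by (rule linearI) (auto simp: homs_iff)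

lemma linear_comp [simp]: "linear_mor K A M N f \<Longrightarrow> linear_mor K A N P g \<Longrightarrow> linear_mor K A M P (g \<cdot> f)"
  using lt[of M N f] lt[of N P g] by (intro linearI) (auto simp: homs_iff a_linear_act)

lemma linear_Zer [simp]: "is_module K A M \<Longrightarrow> is_module K A N \<Longrightarrow> linear_mor K A M N (Zer K (fst M) (fst N))"
  by (simp add: linear_mor_def homs_iff)

lemma linear_add:
  assumes f: "linear_mor K A M N f" and g: "linear_mor K A M N g" shows "linear_mor K A M N (f \<boxplus> g)"
  using f g lt[OF f] lt[OF g] by (simp add: linear_mor_def homs_iff comp_add add_comp ten_add)

lemma linear_neg:
  assumes f: "linear_mor K A M N f" and g: "g \<in> Ar K" "Dom K g = fst M" "Cod K g = fst N" "f \<boxplus> g = Zer K (fst M) (fst N)"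
  shows "linear_mor K A M N g"
proof -
  note ft = lt[OF f]
  have e: "f \<cdot> snd M = snd N \<cdot> (Idn K (Car A) \<boxtimes> f)" using f by (simp add: linear_mor_def)
  have "g \<cdot> snd M = snd N \<cdot> (Idn K (Car A) \<boxtimes> g)"
  proof (rule neg_unique[of "f \<cdot> snd M"])
    show "(f \<cdot> snd M) \<boxplus> (g \<cdot> snd M) = Zer K (Dom K (f \<cdot> snd M)) (Cod K (f \<cdot> snd M))"
      using ft g add_comp[of "snd M" f g] by simp
    show "(f \<cdot> snd M) \<boxplus> (snd N \<cdot> (Idn K (Car A) \<boxtimes> g)) = Zer K (Dom K (f \<cdot> snd M)) (Cod K (f \<cdot> snd M))"
    proof -
      have "(f \<cdot> snd M) \<boxplus> (snd N \<cdot> (Idn K (Car A) \<boxtimes> g)) = snd N \<cdot> (Idn K (Car A) \<boxtimes> (f \<boxplus> g))"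
        unfolding e using ft g(1-3) by (simp add: comp_add ten_add)
      then show ?thesis using ft g by simp
    qed
  qed (use ft g in auto)
  then show ?thesis using ft g by (simp add: linear_mor_def homs_iff)
qed

lemma linear_inverse:
  assumes f: "linear_mor K A M N f" and i: "iso_arrow K f" shows "linear_mor K A N M (inv_arrow K f)"
proof (rule linearI)
  note ft = lt[OF f]
  fix r n assume a: "el r" "el n" "ob r = Car A" "ob n = fst N" "dj r n" "dj n r"
  have "f \<bullet> snd M \<bullet> (r \<star> (inv_arrow K f \<bullet> n)) = snd N \<bullet> (r \<star> n)"
    using a_linear_act[OF f, of r "inv_arrow K f \<bullet> n"] a ft i by simp
  then show "inv_arrow K f \<bullet> snd N \<bullet> (r \<star> n) = snd M \<bullet> (r \<star> (inv_arrow K f \<bullet> n))"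
    using a ft i by (intro inv_app_eq) auto
qed (use lt[OF f] i in \<open>auto simp: homs_iff\<close>)

lemma balancedI:
  assumes "is_module K A M" "is_module K A N" "k \<in> Ar K" "Dom K k = fst M \<odot> fst N"
    "\<And>r m n. \<lbrakk>el r; el m; el n; ob r = Car A; ob m = fst M; ob n = fst N; dj r m; dj m r; dj r n; dj n r; dj m n; dj n m\<rbrakk>
      \<Longrightarrow> k \<bullet> ((snd M \<bullet> (r \<star> m)) \<star> n) = k \<bullet> (m \<star> (snd N \<bullet> (r \<star> n)))"
  shows "balanced M N k"
  unfolding balanced_def[OF assms(1,2)] using assms(3-5) by blast

lemma quot_act:
  assumes "is_module K A M" "is_module K A N" "el r" "el m" "el n" "ob r = Car A" "ob m = fst M" "ob n = fst N"
    "dj r m" "dj m r" "dj r n" "dj n r" "dj m n" "dj n m"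
  shows "Q M N \<bullet> (m \<star> (snd N \<bullet> (r \<star> n))) = Q M N \<bullet> ((snd M \<bullet> (r \<star> m)) \<star> n)"
  using quot_balanced[OF assms] by simp

lemma tnA_props:
  assumes f: "linear_mor K A M N f" and f': "linear_mor K A M' N' f'"
  shows "tnA M f N M' f' N' \<in> homs K (fst (T M M')) (fst (T N N'))"
    "\<And>m m'. \<lbrakk>el m; el m'; ob m = fst M; ob m' = fst M'\<rbrakk> \<Longrightarrow> tnA M f N M' f' N' \<bullet> Q M M' \<bullet> (m \<star> m') = Q N N' \<bullet> ((f \<bullet> m) \<star> (f' \<bullet> m'))"
    "linear_mor K A (T M M') (T N N') (tnA M f N M' f' N')"
proof -
  note t = lt[OF f] lt[OF f']
  let ?k = "Q N N' \<cdot> (f \<boxtimes> f')"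
  have b: "balanced M M' ?k"
    by (rule balancedI) (use t in \<open>auto simp: a_linear_act[OF f] a_linear_act[OF f'] quot_act\<close>)
  show h: "tnA M f N M' f' N' \<in> homs K (fst (T M M')) (fst (T N N'))"
    using descend_props(1)[OF _ _ b] t by (simp add: tnA_def)
  show q: "tnA M f N M' f' N' \<bullet> Q M M' \<bullet> (m \<star> m') = Q N N' \<bullet> ((f \<bullet> m) \<star> (f' \<bullet> m'))"
    if "el m" "el m'" "ob m = fst M" "ob m' = fst M'" for m m'
    using descend_app[OF _ _ b, of "m \<star> m'"] t that by (simp add: tnA_def)
  show "linear_mor K A (T M M') (T N N') (tnA M f N M' f' N')"
  proof (rule linearI)
    fix r s assume a: "el r" "el s" "ob r = Car A" "ob s = fst (T M M')" "dj r s" "dj s r"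
    show "tnA M f N M' f' N' \<bullet> snd (T M M') \<bullet> (r \<star> s) = snd (T N N') \<bullet> (r \<star> (tnA M f N M' f' N' \<bullet> s))"
      by (rule quot_wlog[where M = M and N = M' and t = s and L = "\<lambda>s. tnA M f N M' f' N' \<bullet> snd (T M M') \<bullet> (r \<star> s)" and
          R = "\<lambda>s. snd (T N N') \<bullet> (r \<star> (tnA M f N M' f' N' \<bullet> s))"],
        (rule lin_intros | use a t h in \<open>simp add: homs_iff q tensor_act(2) a_linear_act[OF f]; fail\<close>)+)
  qed (use t h in auto)
qed

lemma tnA_typ [simp]:
  assumes "linear_mor K A M N f" "linear_mor K A M' N' f'"
  shows "tnA M f N M' f' N' \<in> Ar K" "Dom K (tnA M f N M' f' N') = fst (T M M')" "Cod K (tnA M f N M' f' N') = fst (T N N')"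
    "linear_mor K A (T M M') (T N N') (tnA M f N M' f' N')"
  using tnA_props[OF assms] by (auto simp: homs_iff)

lemma tnA_app [simp]:
  assumes "linear_mor K A M N f" "linear_mor K A M' N' f'" "el m" "el m'" "ob m = fst M" "ob m' = fst M'"
  shows "tnA M f N M' f' N' \<bullet> Q M M' \<bullet> (m \<star> m') = Q N N' \<bullet> ((f \<bullet> m) \<star> (f' \<bullet> m'))"
  by (rule tnA_props(2)) (use assms in auto)

lemma swM_props:
  assumes M: "is_module K A M" and N: "is_module K A N"
  shows "swM M N \<in> homs K (fst (T M N)) (fst (T N M))"
    "\<And>m n. \<lbrakk>el m; el n; ob m = fst M; ob n = fst N; dj m n\<rbrakk> \<Longrightarrow> swM M N \<bullet> Q M N \<bullet> (m \<star> n) = Q N M \<bullet> (n \<star> m)"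
    "linear_mor K A (T M N) (T N M) (swM M N)"
proof -
  let ?k = "Q N M \<cdot> Swp K (fst M) (fst N)"
  have b: "balanced M N ?k"
    by (rule balancedI) (use M N in \<open>auto simp: quot_act\<close>)
  show h: "swM M N \<in> homs K (fst (T M N)) (fst (T N M))"
    using descend_props(1)[OF _ _ b] M N by (simp add: swM_def)
  show q: "swM M N \<bullet> Q M N \<bullet> (m \<star> n) = Q N M \<bullet> (n \<star> m)"
    if "el m" "el n" "ob m = fst M" "ob n = fst N" "dj m n" for m n
    using descend_app[OF _ _ b, of "m \<star> n"] M N that by (simp add: swM_def)
  show "linear_mor K A (T M N) (T N M) (swM M N)"
  proof (rule linearI)
    fix r s assume a: "el r" "el s" "ob r = Car A" "ob s = fst (T M N)" "dj r s" "dj s r"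
    show "swM M N \<bullet> snd (T M N) \<bullet> (r \<star> s) = snd (T N M) \<bullet> (r \<star> (swM M N \<bullet> s))"
      by (rule quot_wlog[where M = M and N = N and t = s and L = "\<lambda>s. swM M N \<bullet> snd (T M N) \<bullet> (r \<star> s)" and
          R = "\<lambda>s. snd (T N M) \<bullet> (r \<star> (swM M N \<bullet> s))"],
        (rule lin_intros | use a M N h in \<open>simp add: homs_iff q tensor_act(2) quot_act; fail\<close>)+)
  qed (use M N h in auto)
qed

lemma swM_typ [simp]:
  assumes "is_module K A M" "is_module K A N"
  shows "swM M N \<in> Ar K" "Dom K (swM M N) = fst (T M N)" "Cod K (swM M N) = fst (T N M)" "linear_mor K A (T M N) (T N M) (swM M N)"
  using swM_props[OF assms] by (auto simp: homs_iff)

lemma swM_app [simp]: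
  assumes "is_module K A M" "is_module K A N" "el m" "el n" "ob m = fst M" "ob n = fst N" "dj m n"
  shows "swM M N \<bullet> Q M N \<bullet> (m \<star> n) = Q N M \<bullet> (n \<star> m)"
  by (rule swM_props(2)) (use assms in auto)

lemma luM_props:
  assumes M: "is_module K A M"
  shows "luM M \<in> homs K (fst (T U M)) (fst M)"
    "\<And>r m. \<lbrakk>el r; el m; ob r = Car A; ob m = fst M\<rbrakk> \<Longrightarrow> luM M \<bullet> Q U M \<bullet> (r \<star> m) = snd M \<bullet> (r \<star> m)"
    "linear_mor K A (T U M) M (luM M)" "iso_arrow K (luM M)"
proof -
  have b: "balanced U M (snd M)"
    by (rule balancedI) (use M in \<open>auto simp: a_act_mul a_act_comm\<close>)
  show h: "luM M \<in> homs K (fst (T U M)) (fst M)"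
    using descend_props(1)[OF _ _ b] M by (simp add: luM_def)
  show q: "luM M \<bullet> Q U M \<bullet> (r \<star> m) = snd M \<bullet> (r \<star> m)" if "el r" "el m" "ob r = Car A" "ob m = fst M" for r m
    using descend_app[OF _ _ b, of "r \<star> m"] M that by (simp add: luM_def)
  show "linear_mor K A (T U M) M (luM M)"
  proof (rule linearI)
    fix r s assume a: "el r" "el s" "ob r = Car A" "ob s = fst (T U M)" "dj r s" "dj s r"
    show "luM M \<bullet> snd (T U M) \<bullet> (r \<star> s) = snd M \<bullet> (r \<star> (luM M \<bullet> s))"
      by (rule quot_wlog[where M = U and N = M and t = s and L = "\<lambda>s. luM M \<bullet> snd (T U M) \<bullet> (r \<star> s)" and
          R = "\<lambda>s. snd M \<bullet> (r \<star> (luM M \<bullet> s))"],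
        (rule lin_intros | use a M h in \<open>simp add: homs_iff q tensor_act(2) a_act_mul; fail\<close>)+)
  qed (use M h in auto)
  \<comment> \<open>\<open>?g\<close> sends m to the class of \<open>one A \<star> m\<close>; it is
    inverse because ring elements can be moved across the quotient.\<close>
  let ?g = "Q U M \<cdot> ((Unt A \<boxtimes> Idn K (fst M)) \<cdot> inv_arrow K (Lun K (fst M)))"
  have g: "?g \<in> homs K (fst M) (fst (T U M))" using M by (auto simp: homs_iff)
  have "luM M \<cdot> ?g = Idn K (fst M)"
    by (rule ext1[of _ "fst M"]) (use M h q in \<open>auto simp: homs_iff a_act_one\<close>)
  moreover have "?g \<cdot> luM M = Idn K (fst (T U M))"
  proof (rule quot_ext[of U M])
    fix r m assume a: "el r" "el m" "ob r = fst U" "ob m = fst M" "dj r m" "dj m r"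
    have "Q U M \<bullet> (one A \<star> (snd M \<bullet> (r \<star> m))) = Q U M \<bullet> (r \<star> m)"
      using quot_act[of U M r "one A" m] a M by (simp add: mul_simps)
    then show "(?g \<cdot> luM M) \<bullet> Q U M \<bullet> (r \<star> m) = Idn K (fst (T U M)) \<bullet> Q U M \<bullet> (r \<star> m)"
      using a M h q by (simp add: homs_iff)
  qed (use M h in \<open>auto simp: homs_iff\<close>)
  ultimately show "iso_arrow K (luM M)"
    unfolding iso_arrow_def inverse_arrows_def using h g by (intro exI[of _ ?g]) (simp add: homs_iff)
qed

lemma ruM_props:
  assumes M: "is_module K A M"
  shows "ruM M = luM M \<cdot> swM M U"
proof -
  have h: "luM M \<cdot> swM M U \<in> homs K (fst (T M U)) (fst M)" using luM_props[OF M] M by (simp add: homs_iff)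
  show ?thesis unfolding ruM_def
  proof (rule descend_quot_eq)
    show "(luM M \<cdot> swM M U) \<cdot> Q M U = snd M \<cdot> Swp K (fst M) (Car A)"
      by (rule ext2[of _ "fst M" "Car A"]) (use luM_props[OF M] M in \<open>auto simp: homs_iff\<close>)
  qed (use M h in auto)
qed

lemma luM_typ [simp]:
  assumes "is_module K A M"
  shows "luM M \<in> Ar K" "Dom K (luM M) = fst (T U M)" "Cod K (luM M) = fst M" "linear_mor K A (T U M) M (luM M)" "iso_arrow K (luM M)"
  using luM_props[OF assms] by (auto simp: homs_iff)

lemma luM_app [simp]: "\<lbrakk>is_module K A M; el r; el m; ob r = Car A; ob m = fst M\<rbrakk> \<Longrightarrow> luM M \<bullet> Q U M \<bullet> (r \<star> m) = snd M \<bullet> (r \<star> m)"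
  using luM_props(2) by blast

lemma swM_swM:
  assumes "is_module K A M" "is_module K A N" shows "swM N M \<cdot> swM M N = Idn K (fst (T M N))"
  by (rule quot_ext[of M N]) (use assms in \<open>auto simp: homs_iff\<close>)

lemma swM_iso [simp]: "is_module K A M \<Longrightarrow> is_module K A N \<Longrightarrow> iso_arrow K (swM M N)"
  unfolding iso_arrow_def inverse_arrows_def
  by (rule exI[of _ "swM N M"]) (simp add: homs_iff swM_swM)

lemma ruM_typ [simp]:
  assumes "is_module K A M"
  shows "ruM M \<in> Ar K" "Dom K (ruM M) = fst (T M U)" "Cod K (ruM M) = fst M" "linear_mor K A (T M U) M (ruM M)" "iso_arrow K (ruM M)"
  using assms linear_comp[OF swM_typ(4)[of M U] luM_typ(4)[of M]] by (auto simp: ruM_props)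

lemma ruM_app [simp]: "\<lbrakk>is_module K A M; el r; el m; ob r = Car A; ob m = fst M; dj m r\<rbrakk> \<Longrightarrow> ruM M \<bullet> Q M U \<bullet> (m \<star> r) = snd M \<bullet> (r \<star> m)"
  by (simp add: ruM_props)

context
  fixes M N P assumes M [simp]: "is_module K A M" and N [simp]: "is_module K A N" and P [simp]: "is_module K A P"
begin

lemma quot_ext3:
  assumes f: "f \<in> homs K (fst (T (T M N) P)) z" and g: "g \<in> homs K (fst (T (T M N) P)) z'"
    and e: "\<And>m n p. \<lbrakk>el m; el n; el p; ob m = fst M; ob n = fst N; ob p = fst P; dj m n; dj n m; dj m p; dj p m; dj n p; dj p n\<rbrakk>
       \<Longrightarrow> f \<bullet> Q (T M N) P \<bullet> ((Q M N \<bullet> (m \<star> n)) \<star> p) = g \<bullet> Q (T M N) P \<bullet> ((Q M N \<bullet> (m \<star> n)) \<star> p)"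
  shows "f = g"
proof (rule quot_ext[OF _ _ f g])
  fix t p assume a: "el t" "el p" "ob t = fst (T M N)" "ob p = fst P" "dj t p" "dj p t"
  show "f \<bullet> Q (T M N) P \<bullet> (t \<star> p) = g \<bullet> Q (T M N) P \<bullet> (t \<star> p)"
    by (rule quot_wlog[where M = M and N = N and t = t and L = "\<lambda>t. f \<bullet> Q (T M N) P \<bullet> (t \<star> p)" and R = "\<lambda>t. g \<bullet> Q (T M N) P \<bullet> (t \<star> p)"],
      (rule lin_intros | use a f g in \<open>simp add: homs_iff e; fail\<close>)+)
qed auto

text \<open>The section represents the class of m \<otimes> n by \<Sum> x_i m \<otimes> y_i n. As
  \<open>T N P\<close> carries the action on its left factor, the classes of y_i n \<otimes> p are
  y_i times the class of n \<otimes> p, so \<open>eps M (T N P)\<close> appears and is absorbed by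
  the outer quotient.\<close>

lemma asM_aux:
  assumes "el m" "el n" "el p" "ob m = fst M" "ob n = fst N" "ob p = fst P" "dj m n" "dj n m" "dj m p" "dj p m" "dj n p" "dj p n"
  shows "Q M (T N P) \<bullet> (Idn K (fst M) \<boxtimes> Q N P) \<bullet> Asc K (fst M) (fst N) (fst P) \<bullet> ((eps M N \<bullet> (m \<star> n)) \<star> p)
     = Q M (T N P) \<bullet> (m \<star> (Q N P \<bullet> (n \<star> p)))"
proof -
  have "Q M (T N P) \<bullet> (Idn K (fst M) \<boxtimes> Q N P) \<bullet> Asc K (fst M) (fst N) (fst P) \<bullet> ((eps M N \<bullet> (m \<star> n)) \<star> p)
     = Q M (T N P) \<bullet> (eps M (T N P) \<bullet> (m \<star> (Q N P \<bullet> (n \<star> p))))"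
    by (subst eps_app, use assms in simp, use assms in simp, use assms in simp, use assms in simp,
        subst eps_app, use assms in simp, use assms in simp, use assms in simp, use assms in simp,
        rule lin_ext[where x = "Car A" and y = "Car A" and e = se and
         L = "\<lambda>e. Q M (T N P) \<bullet> (Idn K (fst M) \<boxtimes> Q N P) \<bullet> Asc K (fst M) (fst N) (fst P) \<bullet>
           (((snd M \<boxtimes> snd N) \<bullet> middle_swap K (Car A) (Car A) (fst M) (fst N) \<bullet> (e \<star> (m \<star> n))) \<star> p)" and
         R = "\<lambda>e. Q M (T N P) \<bullet> (snd M \<boxtimes> snd (T N P)) \<bullet> middle_swap K (Car A) (Car A) (fst M) (fst (T N P)) \<bullet> (e \<star> (m \<star> (Q N P \<bullet> (n \<star> p))))"],
       (rule lin_intros | use assms in \<open>simp add: tensor_act(2); fail\<close>)+)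
  also have "\<dots> = Q M (T N P) \<bullet> (m \<star> (Q N P \<bullet> (n \<star> p)))"
    using assms by (simp add: quot_eps_app)
  finally show ?thesis .
qed

lemma asM_props:
  shows "asM M N P \<in> homs K (fst (T (T M N) P)) (fst (T M (T N P)))"
    "\<And>m n p. \<lbrakk>el m; el n; el p; ob m = fst M; ob n = fst N; ob p = fst P; dj m n; dj n m; dj m p; dj p m; dj n p; dj p n\<rbrakk>
       \<Longrightarrow> asM M N P \<bullet> Q (T M N) P \<bullet> ((Q M N \<bullet> (m \<star> n)) \<star> p) = Q M (T N P) \<bullet> (m \<star> (Q N P \<bullet> (n \<star> p)))"
    "linear_mor K A (T (T M N) P) (T M (T N P)) (asM M N P)"
proof -
  let ?k = "Q M (T N P) \<cdot> (Idn K (fst M) \<boxtimes> Q N P) \<cdot> Asc K (fst M) (fst N) (fst P)"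
  \<comment> \<open>The inner quotient is undone by its section, so that only the outer one has to
    be descended along. The double quotient in \<open>asM\<close> is split as well, hence
    \<open>descend_eq\<close> identifies the two constructions.\<close>
  let ?h2 = "?k \<cdot> (sct M N \<boxtimes> Idn K (fst P))"
  let ?h = "descend K (Q (T M N) P) ?h2"
  let ?q = "Q (T M N) P \<cdot> (Q M N \<boxtimes> Idn K (fst P))"
  have k2: "?h2 \<bullet> ((Q M N \<bullet> (m \<star> n)) \<star> p) = Q M (T N P) \<bullet> (m \<star> (Q N P \<bullet> (n \<star> p)))"
    if "el m" "el n" "el p" "ob m = fst M" "ob n = fst N" "ob p = fst P" "dj m n" "dj n m" "dj m p" "dj p m" "dj n p" "dj p n" for m n p
    using asM_aux[of m n p] that by simp
  have b: "balanced (T M N) P ?h2"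
  proof (rule balancedI)
    fix r t p assume a: "el r" "el t" "el p" "ob r = Car A" "ob t = fst (T M N)" "ob p = fst P"
      "dj r t" "dj t r" "dj r p" "dj p r" "dj t p" "dj p t"
    show "?h2 \<bullet> ((snd (T M N) \<bullet> (r \<star> t)) \<star> p) = ?h2 \<bullet> (t \<star> (snd P \<bullet> (r \<star> p)))"
    proof (rule quot_wlog[where M = M and N = N and t = t and L = "\<lambda>t. ?h2 \<bullet> ((snd (T M N) \<bullet> (r \<star> t)) \<star> p)" and R = "\<lambda>t. ?h2 \<bullet> (t \<star> (snd P \<bullet> (r \<star> p)))"],
      (rule lin_intros | use a in \<open>simp; fail\<close>)+)
      fix m n assume mn: "el m" "el n" "ob m = fst M" "ob n = fst N" "dj m n" "dj n m"
        "dst (mrg (mrg (fst r) []) (fst p)) (fst m)" "dst (mrg (mrg (fst r) []) (fst p)) (fst n)"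
        "dst (fst m) (mrg (mrg (fst r) []) (fst p))" "dst (fst n) (mrg (mrg (fst r) []) (fst p))"
      have "?h2 \<bullet> ((Q M N \<bullet> ((snd M \<bullet> (r \<star> m)) \<star> n)) \<star> p) = ?h2 \<bullet> ((Q M N \<bullet> (m \<star> n)) \<star> (snd P \<bullet> (r \<star> p)))"
        using k2[of "snd M \<bullet> (r \<star> m)" n p] k2[of m n "snd P \<bullet> (r \<star> p)"] a mn
          quot_act[of N P r n p] quot_act[of M "T N P" r m "Q N P \<bullet> (n \<star> p)"]
        by (simp add: tensor_act(2))
      then show "?h2 \<bullet> ((snd (T M N) \<bullet> (r \<star> (Q M N \<bullet> (m \<star> n)))) \<star> p) = ?h2 \<bullet> ((Q M N \<bullet> (m \<star> n)) \<star> (snd P \<bullet> (r \<star> p)))"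
        using a mn by (simp add: tensor_act(2))
    qed
  qed auto
  have ht: "?h \<in> homs K (fst (T (T M N) P)) (fst (T M (T N P)))"
    using descend_props(1)[OF _ _ b] by simp
  have hq: "?h \<bullet> Q (T M N) P \<bullet> ((Q M N \<bullet> (m \<star> n)) \<star> p) = Q M (T N P) \<bullet> (m \<star> (Q N P \<bullet> (n \<star> p)))"
    if "el m" "el n" "el p" "ob m = fst M" "ob n = fst N" "ob p = fst P" "dj m n" "dj n m" "dj m p" "dj p m" "dj n p" "dj p n" for m n p
    using descend_app[OF _ _ b, of "(Q M N \<bullet> (m \<star> n)) \<star> p"] k2[of m n p] that by simp
  have eq: "asM M N P = ?h"
    unfolding asM_def
  proof (rule descend_eq[of _ "(sct M N \<boxtimes> Idn K (fst P)) \<cdot> sct (T M N) P"])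
    show "?h \<cdot> ?q = ?k"
      by (rule ext3l[of _ "fst M" "fst N" "fst P"]) (use ht hq in \<open>auto simp: homs_iff\<close>)
    show "?q \<cdot> ((sct M N \<boxtimes> Idn K (fst P)) \<cdot> sct (T M N) P) = Idn K (Cod K ?q)"
      by (simp add: ten_comp2)
  qed (use ht in \<open>auto simp: homs_iff\<close>)
  show h: "asM M N P \<in> homs K (fst (T (T M N) P)) (fst (T M (T N P)))" unfolding eq by (rule ht)
  show q: "asM M N P \<bullet> Q (T M N) P \<bullet> ((Q M N \<bullet> (m \<star> n)) \<star> p) = Q M (T N P) \<bullet> (m \<star> (Q N P \<bullet> (n \<star> p)))"
    if "el m" "el n" "el p" "ob m = fst M" "ob n = fst N" "ob p = fst P" "dj m n" "dj n m" "dj m p" "dj p m" "dj n p" "dj p n" for m n p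
    unfolding eq using hq[of m n p] that by blast
  show "linear_mor K A (T (T M N) P) (T M (T N P)) (asM M N P)"
  proof (rule linearI)
    fix r s assume a: "el r" "el s" "ob r = Car A" "ob s = fst (T (T M N) P)" "dj r s" "dj s r"
    show "asM M N P \<bullet> snd (T (T M N) P) \<bullet> (r \<star> s) = snd (T M (T N P)) \<bullet> (r \<star> (asM M N P \<bullet> s))"
    proof (rule quot_wlog[where M = "T M N" and N = P and t = s and L = "\<lambda>s. asM M N P \<bullet> snd (T (T M N) P) \<bullet> (r \<star> s)" and
          R = "\<lambda>s. snd (T M (T N P)) \<bullet> (r \<star> (asM M N P \<bullet> s))"],
        (rule lin_intros | use a h in \<open>simp add: homs_iff; fail\<close>)+)
      fix t p assume tp: "el t" "el p" "ob t = fst (T M N)" "ob p = fst P" "dj t p" "dj p t"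
        "dst (mrg (fst r) []) (fst t)" "dst (mrg (fst r) []) (fst p)" "dst (fst t) (mrg (fst r) [])" "dst (fst p) (mrg (fst r) [])"
      show "asM M N P \<bullet> snd (T (T M N) P) \<bullet> (r \<star> (Q (T M N) P \<bullet> (t \<star> p))) = snd (T M (T N P)) \<bullet> (r \<star> (asM M N P \<bullet> Q (T M N) P \<bullet> (t \<star> p)))"
        by (rule quot_wlog[where M = M and N = N and t = t and L = "\<lambda>t. asM M N P \<bullet> snd (T (T M N) P) \<bullet> (r \<star> (Q (T M N) P \<bullet> (t \<star> p)))" and
          R = "\<lambda>t. snd (T M (T N P)) \<bullet> (r \<star> (asM M N P \<bullet> Q (T M N) P \<bullet> (t \<star> p)))"],
          (rule lin_intros | use a tp h in \<open>simp add: homs_iff tensor_act(2) q; fail\<close>)+)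
    qed
  qed (use h in auto)
qed

lemma asM_typ [simp]: "asM M N P \<in> Ar K" "Dom K (asM M N P) = fst (T (T M N) P)" "Cod K (asM M N P) = fst (T M (T N P))"
    "linear_mor K A (T (T M N) P) (T M (T N P)) (asM M N P)"
  using asM_props by (auto simp: homs_iff)

lemma asM_app [simp]:
  assumes "el m" "el n" "el p" "ob m = fst M" "ob n = fst N" "ob p = fst P" "dj m n" "dj m p" "dj n p"
  shows "asM M N P \<bullet> Q (T M N) P \<bullet> ((Q M N \<bullet> (m \<star> n)) \<star> p) = Q M (T N P) \<bullet> (m \<star> (Q N P \<bullet> (n \<star> p)))"
  by (rule asM_props(2)) (use assms dst_sym[of "fst m" "fst n"] dst_sym[of "fst m" "fst p"] dst_sym[of "fst n" "fst p"] in simp_all)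

lemma quot_ext3r:
  assumes f: "f \<in> homs K (fst (T M (T N P))) z" and g: "g \<in> homs K (fst (T M (T N P))) z'"
    and e: "\<And>m n p. \<lbrakk>el m; el n; el p; ob m = fst M; ob n = fst N; ob p = fst P; dj m n; dj n m; dj m p; dj p m; dj n p; dj p n\<rbrakk>
       \<Longrightarrow> f \<bullet> Q M (T N P) \<bullet> (m \<star> (Q N P \<bullet> (n \<star> p))) = g \<bullet> Q M (T N P) \<bullet> (m \<star> (Q N P \<bullet> (n \<star> p)))"
  shows "f = g"
proof (rule quot_ext[OF _ _ f g])
  fix m t assume a: "el m" "el t" "ob m = fst M" "ob t = fst (T N P)" "dj m t" "dj t m"
  show "f \<bullet> Q M (T N P) \<bullet> (m \<star> t) = g \<bullet> Q M (T N P) \<bullet> (m \<star> t)"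
    by (rule quot_wlog[where M = N and N = P and t = t and L = "\<lambda>t. f \<bullet> Q M (T N P) \<bullet> (m \<star> t)" and R = "\<lambda>t. g \<bullet> Q M (T N P) \<bullet> (m \<star> t)"],
      (rule lin_intros | use a f g in \<open>simp add: homs_iff e; fail\<close>)+)
qed auto

end

lemma asM_iso [simp]:
  assumes M: "is_module K A M" and N: "is_module K A N" and P: "is_module K A P"
  shows "iso_arrow K (asM M N P)"
proof -
  \<comment> \<open>The inverse reverses, reassociates and reverses again: m(np), (np)m, (pn)m,
    p(nm), (nm)p, (mn)p.\<close>
  let ?g = "tnA (T N M) (swM N M) (T M N) P (Idn K (fst P)) P \<cdot> (swM P (T N M) \<cdot> (asM P N M \<cdot>
    (tnA (T N P) (swM N P) (T P N) M (Idn K (fst M)) M \<cdot> swM M (T N P))))"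
  have g: "?g \<in> homs K (fst (T M (T N P))) (fst (T (T M N) P))" using M N P by (simp add: homs_iff)
  have "?g \<cdot> asM M N P = Idn K (fst (T (T M N) P))"
    by (rule quot_ext3[OF M N P]) (use M N P in \<open>auto simp: homs_iff\<close>)
  moreover have "asM M N P \<cdot> ?g = Idn K (fst (T M (T N P)))"
    by (rule quot_ext3r[OF M N P]) (use M N P in \<open>auto simp: homs_iff\<close>)
  ultimately show ?thesis unfolding iso_arrow_def inverse_arrows_def using M N P g by (intro exI[of _ ?g]) simp
qed

section \<open>Axioms of an additive symmetric monoidal category for modules\<close>

lemma homs_MC_elim:
  assumes "F \<in> homs MC X Y"
  obtains f where "F = (X, f, Y)" "linear_mor K A X Y f" "is_module K A X" "is_module K A Y" "f \<in> Ar K" "Dom K f = fst X" "Cod K f = fst Y"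
  using assms lt by (auto simp: homs_MC)

lemma homs_MC_I: "linear_mor K A X Y f \<Longrightarrow> (X, f, Y) \<in> homs MC X Y"
  by (simp add: homs_MC)

lemma MC_category: "category MC"
proof (rule category.intro)
  show "Dom MC f \<in> Ob MC" if "f \<in> Ar MC" for f using that lt by (auto simp: Ar_MC)
  show "Cod MC f \<in> Ob MC" if "f \<in> Ar MC" for f using that lt by (auto simp: Ar_MC)
  show "Idn MC x \<in> homs MC x x" if "x \<in> Ob MC" for x using that by (simp add: homs_MC)
next
  fix f x y g z assume "f \<in> homs MC x y" "g \<in> homs MC y z"
  then show "Comp MC g f \<in> homs MC x z" by (elim homs_MC_elim) (auto intro!: homs_MC_I intro: linear_comp)
next
  fix f x y assume "f \<in> homs MC x y"
  then show "Comp MC f (Idn MC x) = f" by (elim homs_MC_elim) auto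
next
  fix f x y assume "f \<in> homs MC x y"
  then show "Comp MC (Idn MC y) f = f" by (elim homs_MC_elim) auto
next
  fix f w x g y h z assume "f \<in> homs MC w x" "g \<in> homs MC x y" "h \<in> homs MC y z"
  then show "Comp MC (Comp MC h g) f = Comp MC h (Comp MC g f)" by (elim homs_MC_elim) auto
qed

lemma MC_hom_group:
  assumes X: "is_module K A X" and Y: "is_module K A Y"
  shows "comm_group \<lparr>carrier = homs MC X Y, mult = Add MC, one = Zer MC X Y\<rparr>"
proof (rule comm_groupI, simp_all only: monoid.simps partial_object.simps)
  show "Zer MC X Y \<in> homs MC X Y" using X Y by (simp add: homs_MC)
next
  fix f g assume "f \<in> homs MC X Y" "g \<in> homs MC X Y"
  then show "Add MC f g \<in> homs MC X Y" by (elim homs_MC_elim) (auto intro!: homs_MC_I linear_add)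
next
  fix f g h assume "f \<in> homs MC X Y" "g \<in> homs MC X Y" "h \<in> homs MC X Y"
  then show "Add MC (Add MC f g) h = Add MC f (Add MC g h)" by (elim homs_MC_elim) (auto simp: add_assoc)
next
  fix f g assume "f \<in> homs MC X Y" "g \<in> homs MC X Y"
  then obtain f0 g0 where "f = (X, f0, Y)" "g = (X, g0, Y)" and t: "f0 \<in> Ar K" "Dom K f0 = fst X" "Cod K f0 = fst Y"
    "g0 \<in> Ar K" "Dom K g0 = fst X" "Cod K g0 = fst Y" by (elim homs_MC_elim) auto
  then show "Add MC f g = Add MC g f" using add_commute[of f0 g0] by simp
next
  fix f assume "f \<in> homs MC X Y"
  then show "Add MC (Zer MC X Y) f = f" by (elim homs_MC_elim) auto
next
  fix f assume "f \<in> homs MC X Y"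
  then obtain f0 where f: "f = (X, f0, Y)" and l: "linear_mor K A X Y f0" and t: "f0 \<in> Ar K" "Dom K f0 = fst X" "Cod K f0 = fst Y"
    by (elim homs_MC_elim) auto
  from ex_neg[OF t(1)] obtain g where g: "g \<in> Ar K" "Dom K g = fst X" "Cod K g = fst Y" "f0 \<boxplus> g = Zer K (fst X) (fst Y)"
    using t by auto
  have "linear_mor K A X Y g" by (rule linear_neg[OF l]) (use g in auto)
  moreover have "g \<boxplus> f0 = Zer K (fst X) (fst Y)" using add_commute[of g f0] g t by simp
  ultimately show "\<exists>g\<in>homs MC X Y. Add MC g f = Zer MC X Y"
    using f by (intro bexI[of _ "(X, g, Y)"]) (auto simp: homs_MC)
qed

lemma MC_zero_object: "\<exists>z. zero_object MC z"
proof -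
  obtain z where z: "zero_object K z" using ex_zero_object by blast
  then have zO: "z \<in> Ob K" by (simp add: zero_object_def)
  have zel: "zero a" if "el a" "ob a = z" for a
    using zero_objectD(2)[OF z, of "snd a"] that zO by (auto simp: zero_def)
  let ?Z = "(z, Zer K (Car A \<odot> z) z)"
  have Z: "is_module K A ?Z"
  proof (rule moduleI)
    fix r s m assume "el r" "el s" "el m" "ob r = Car A" "ob s = Car A" "ob m = z"
    then show "Zer K (Car A \<odot> z) z \<bullet> ((Mul A \<bullet> (r \<star> s)) \<star> m) = Zer K (Car A \<odot> z) z \<bullet> (r \<star> (Zer K (Car A \<odot> z) z \<bullet> (s \<star> m)))"
      using zO by (intro zero_unique) (auto simp: mrg_assoc)
  next
    fix m assume "el m" "ob m = z"
    then show "Zer K (Car A \<odot> z) z \<bullet> (one A \<star> m) = m"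
      using zO zel by (intro zero_unique) auto
  qed (use zO in \<open>auto simp: homs_iff\<close>)
  have "(\<exists>!f. f \<in> homs MC ?Z X) \<and> (\<exists>!f. f \<in> homs MC X ?Z)" if X: "is_module K A X" for X
  proof
    show "\<exists>!f. f \<in> homs MC ?Z X"
    proof (rule ex1I[of _ "(?Z, Zer K z (fst X), X)"])
      show "(?Z, Zer K z (fst X), X) \<in> homs MC ?Z X" using linear_Zer[OF Z X] by (simp add: homs_MC)
      fix f assume "f \<in> homs MC ?Z X"
      then obtain f0 where f: "f = (?Z, f0, X)" "f0 \<in> Ar K" "Dom K f0 = z" "Cod K f0 = fst X"
        by (elim homs_MC_elim) auto
      then show "f = (?Z, Zer K z (fst X), X)" using zero_objectD(1)[OF z f(2)] by simp
    qed
    show "\<exists>!f. f \<in> homs MC X ?Z"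
    proof (rule ex1I[of _ "(X, Zer K (fst X) z, ?Z)"])
      show "(X, Zer K (fst X) z, ?Z) \<in> homs MC X ?Z" using linear_Zer[OF X Z] by (simp add: homs_MC)
      fix f assume "f \<in> homs MC X ?Z"
      then obtain f0 where f: "f = (X, f0, ?Z)" "f0 \<in> Ar K" "Dom K f0 = fst X" "Cod K f0 = z"
        by (elim homs_MC_elim) auto
      then show "f = (X, Zer K (fst X) z, ?Z)" using zero_objectD(2)[OF z f(2)] by simp
    qed
  qed
  then show ?thesis unfolding zero_object_def using Z by (intro exI[of _ ?Z]) auto
qed

lemma MC_biproduct:
  assumes X1: "is_module K A X1" and X2: "is_module K A X2"
  shows "\<exists>x i1 i2 p1 p2. biproduct MC X1 X2 x i1 i2 p1 p2"
proof -
  have "fst X1 \<in> Ob K" "fst X2 \<in> Ob K" using X1 X2 by auto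
  then obtain x i1 i2 p1 p2 where b: "biproduct K (fst X1) (fst X2) x i1 i2 p1 p2" using ex_biproduct by blast
  have t: "x \<in> Ob K" "i1 \<in> Ar K" "Dom K i1 = fst X1" "Cod K i1 = x" "i2 \<in> Ar K" "Dom K i2 = fst X2" "Cod K i2 = x"
    "p1 \<in> Ar K" "Dom K p1 = x" "Cod K p1 = fst X1" "p2 \<in> Ar K" "Dom K p2 = x" "Cod K p2 = fst X2"
    and e: "p1 \<cdot> i1 = Idn K (fst X1)" "p2 \<cdot> i2 = Idn K (fst X2)" "p1 \<cdot> i2 = Zer K (fst X2) (fst X1)" "p2 \<cdot> i1 = Zer K (fst X1) (fst X2)"
      "(i1 \<cdot> p1) \<boxplus> (i2 \<cdot> p2) = Idn K x"
    using b by (auto simp: biproduct_def homs_iff)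
  have e2: "p1 \<cdot> (i1 \<cdot> h) = h" "p2 \<cdot> (i1 \<cdot> h) = Zer K (Dom K h) (fst X2)" if "h \<in> Ar K" "Cod K h = fst X1" for h
    using comp_eq_extend[OF e(1), of h] comp_eq_extend[OF e(4), of h] that t X1 X2 by auto
  have e3: "p2 \<cdot> (i2 \<cdot> h) = h" "p1 \<cdot> (i2 \<cdot> h) = Zer K (Dom K h) (fst X1)" if "h \<in> Ar K" "Cod K h = fst X2" for h
    using comp_eq_extend[OF e(2), of h] comp_eq_extend[OF e(3), of h] that t X1 X2 by auto
  let ?I = "Idn K (Car A)"
  \<comment> \<open>The only action on the sum for which both projections are linear.\<close>
  define a where "a = (i1 \<cdot> (snd X1 \<cdot> (?I \<boxtimes> p1))) \<boxplus> (i2 \<cdot> (snd X2 \<cdot> (?I \<boxtimes> p2)))"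
  have at: "a \<in> Ar K" "Dom K a = Car A \<odot> x" "Cod K a = x" using t X1 X2 by (auto simp: a_def)
  have pa: "p1 \<cdot> a = snd X1 \<cdot> (?I \<boxtimes> p1)" "p2 \<cdot> a = snd X2 \<cdot> (?I \<boxtimes> p2)"
    using t X1 X2 by (simp_all add: a_def comp_add e2 e3)
  have pa': "p1 \<bullet> a \<bullet> (r \<star> m) = snd X1 \<bullet> (r \<star> (p1 \<bullet> m))" "p2 \<bullet> a \<bullet> (r \<star> m) = snd X2 \<bullet> (r \<star> (p2 \<bullet> m))"
    if "el r" "el m" "ob r = Car A" "ob m = x" for r m
  proof -
    have "(p1 \<cdot> a) \<bullet> (r \<star> m) = (snd X1 \<cdot> (?I \<boxtimes> p1)) \<bullet> (r \<star> m)" "(p2 \<cdot> a) \<bullet> (r \<star> m) = (snd X2 \<cdot> (?I \<boxtimes> p2)) \<bullet> (r \<star> m)"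
      unfolding pa by simp_all
    then show "p1 \<bullet> a \<bullet> (r \<star> m) = snd X1 \<bullet> (r \<star> (p1 \<bullet> m))" "p2 \<bullet> a \<bullet> (r \<star> m) = snd X2 \<bullet> (r \<star> (p2 \<bullet> m))"
      using that t at X1 X2 by simp_all
  qed
  have eqI: "s = s'" if "el s" "el s'" "ob s = x" "ob s' = x" "fst s = fst s'" "p1 \<bullet> s = p1 \<bullet> s'" "p2 \<bullet> s = p2 \<bullet> s'" for s s'
  proof -
    have "snd s = snd s'"
      by (rule biproduct_eqI[OF b, of _ "stg K (fst s)"]) (use that in \<open>auto simp: homs_iff app_def\<close>)
    then show ?thesis using that by (simp add: prod_eq_iff)
  qed
  let ?X = "(x, a)"
  have X: "is_module K A ?X"
  proof (rule moduleI)
    fix r s m assume e: "el r" "el s" "el m" "ob r = Car A" "ob s = Car A" "ob m = x" "dj r s" "dj s r" "dj r m" "dj m r" "dj s m" "dj m s"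
    show "a \<bullet> ((Mul A \<bullet> (r \<star> s)) \<star> m) = a \<bullet> (r \<star> (a \<bullet> (s \<star> m)))"
      by (rule eqI) (use at t X1 X2 e in \<open>auto simp: mrg_assoc pa' a_act_mul\<close>)
  next
    fix m assume e: "el m" "ob m = x"
    show "a \<bullet> (one A \<star> m) = m"
      by (rule eqI) (use at t X1 X2 e in \<open>auto simp: pa' a_act_one\<close>)
  qed (use t at in \<open>auto simp: homs_iff\<close>)
  have lp: "linear_mor K A ?X X1 p1" "linear_mor K A ?X X2 p2"
    using X X1 X2 pa t by (simp_all add: linear_mor_def homs_iff)
  have "i1 \<cdot> snd X1 = a \<cdot> (?I \<boxtimes> i1)"
  proof (rule biproduct_eqI[OF b, of _ "Car A \<odot> fst X1"])
    show "p1 \<cdot> (i1 \<cdot> snd X1) = p1 \<cdot> (a \<cdot> (?I \<boxtimes> i1))"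
      using comp_eq_extend[OF pa(1), of "?I \<boxtimes> i1"] t at X1 X2 by (simp add: e2 ten_comp e)
    show "p2 \<cdot> (i1 \<cdot> snd X1) = p2 \<cdot> (a \<cdot> (?I \<boxtimes> i1))"
      using comp_eq_extend[OF pa(2), of "?I \<boxtimes> i1"] t at X1 X2 by (simp add: e2 ten_comp e)
  qed (use t at X1 X2 in \<open>auto simp: homs_iff\<close>)
  then have li1: "linear_mor K A X1 ?X i1" using X X1 t by (simp add: linear_mor_def homs_iff)
  have "i2 \<cdot> snd X2 = a \<cdot> (?I \<boxtimes> i2)"
  proof (rule biproduct_eqI[OF b, of _ "Car A \<odot> fst X2"])
    show "p1 \<cdot> (i2 \<cdot> snd X2) = p1 \<cdot> (a \<cdot> (?I \<boxtimes> i2))"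
      using comp_eq_extend[OF pa(1), of "?I \<boxtimes> i2"] t at X1 X2 by (simp add: e3 ten_comp e)
    show "p2 \<cdot> (i2 \<cdot> snd X2) = p2 \<cdot> (a \<cdot> (?I \<boxtimes> i2))"
      using comp_eq_extend[OF pa(2), of "?I \<boxtimes> i2"] t at X1 X2 by (simp add: e3 ten_comp e)
  qed (use t at X1 X2 in \<open>auto simp: homs_iff\<close>)
  then have li2: "linear_mor K A X2 ?X i2" using X X2 t by (simp add: linear_mor_def homs_iff)
  have "biproduct MC X1 X2 ?X (X1, i1, ?X) (X2, i2, ?X) (?X, p1, X1) (?X, p2, X2)"
    unfolding biproduct_def using X X1 X2 lp li1 li2 e by (simp add: homs_MC)
  then show ?thesis by blast
qed

lemma MC_additive: "additive_category MC"
proof (intro additive_category.intro MC_category additive_category_axioms.intro)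
  fix x y assume "x \<in> Ob MC" "y \<in> Ob MC"
  then show "comm_group \<lparr>carrier = homs MC x y, mult = Add MC, one = Zer MC x y\<rparr>" using MC_hom_group by auto
next
  fix f x y g z g' assume "f \<in> homs MC x y" "g \<in> homs MC y z" "g' \<in> homs MC y z"
  then show "Comp MC (Add MC g g') f = Add MC (Comp MC g f) (Comp MC g' f)"
    by (elim homs_MC_elim) (auto simp: add_comp)
next
  fix f x y f' g z assume "f \<in> homs MC x y" "f' \<in> homs MC x y" "g \<in> homs MC y z"
  then show "Comp MC g (Add MC f f') = Add MC (Comp MC g f) (Comp MC g f')"
    by (elim homs_MC_elim) (auto simp: comp_add)
next
  show "\<exists>z. zero_object MC z" by (rule MC_zero_object)
next
  fix x1 x2 assume "x1 \<in> Ob MC" "x2 \<in> Ob MC"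
  then show "\<exists>x i1 i2 p1 p2. biproduct MC x1 x2 x i1 i2 p1 p2" using MC_biproduct by auto
qed

lemma iso_MC:
  assumes "linear_mor K A X Y f" "iso_arrow K f"
  shows "inverse_arrows MC (X, f, Y) (Y, inv_arrow K f, X)" "iso_arrow MC (X, f, Y)" "inv_arrow MC (X, f, Y) = (Y, inv_arrow K f, X)"
proof -
  interpret MC: category MC by (rule MC_category)
  show 1: "inverse_arrows MC (X, f, Y) (Y, inv_arrow K f, X)"
    unfolding inverse_arrows_def using assms lt[OF assms(1)] linear_inverse[OF assms] by (simp add: homs_MC)
  then show "iso_arrow MC (X, f, Y)" unfolding iso_arrow_def by blast
  show "inv_arrow MC (X, f, Y) = (Y, inv_arrow K f, X)" by (rule MC.inv_arrow_eq[OF 1])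
qed

lemma tnA_add_left:
  assumes "linear_mor K A M N f" "linear_mor K A M N g" "linear_mor K A M' N' h"
  shows "tnA M (f \<boxplus> g) N M' h N' = tnA M f N M' h N' \<boxplus> tnA M g N M' h N'"
proof -
  note t = lt[OF assms(1)] lt[OF assms(2)] lt[OF assms(3)]
  have e: "tnA M f N M' h N' \<cdot> Q M M' = Q N N' \<cdot> (f \<boxtimes> h)" "tnA M g N M' h N' \<cdot> Q M M' = Q N N' \<cdot> (g \<boxtimes> h)"
    by (rule ext2[of _ "fst M" "fst M'"]; use t assms in \<open>simp add: homs_iff\<close>)+
  show ?thesis unfolding tnA_def[of _ "f \<boxplus> g"]
    by (rule descend_quot_eq) (use t assms e in \<open>simp_all add: homs_iff add_comp comp_add add_ten\<close>)
qed

lemma tnA_add_right: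
  assumes "linear_mor K A M' N' h" "linear_mor K A M N f" "linear_mor K A M N g"
  shows "tnA M' h N' M (f \<boxplus> g) N = tnA M' h N' M f N \<boxplus> tnA M' h N' M g N"
proof -
  note t = lt[OF assms(1)] lt[OF assms(2)] lt[OF assms(3)]
  have e: "tnA M' h N' M f N \<cdot> Q M' M = Q N' N \<cdot> (h \<boxtimes> f)" "tnA M' h N' M g N \<cdot> Q M' M = Q N' N \<cdot> (h \<boxtimes> g)"
    by (rule ext2[of _ "fst M'" "fst M"]; use t assms in \<open>simp add: homs_iff\<close>)+
  show ?thesis unfolding tnA_def[of _ _ _ _ "f \<boxplus> g"]
    by (rule descend_quot_eq) (use t assms e in \<open>simp_all add: homs_iff add_comp comp_add ten_add\<close>)
qed

lemma quot_ext4: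
  assumes W: "is_module K A W" and X: "is_module K A X" and Y: "is_module K A Y" and Z: "is_module K A Z"
    and f: "f \<in> homs K (fst (T (T (T W X) Y) Z)) z" and g: "g \<in> homs K (fst (T (T (T W X) Y) Z)) z'"
    and e: "\<And>w x y z. \<lbrakk>el w; el x; el y; el z; ob w = fst W; ob x = fst X; ob y = fst Y; ob z = fst Z;
       dj w x; dj x w; dj w y; dj y w; dj w z; dj z w; dj x y; dj y x; dj x z; dj z x; dj y z; dj z y\<rbrakk>
       \<Longrightarrow> f \<bullet> Q (T (T W X) Y) Z \<bullet> ((Q (T W X) Y \<bullet> ((Q W X \<bullet> (w \<star> x)) \<star> y)) \<star> z)
         = g \<bullet> Q (T (T W X) Y) Z \<bullet> ((Q (T W X) Y \<bullet> ((Q W X \<bullet> (w \<star> x)) \<star> y)) \<star> z)"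
  shows "f = g"
proof (rule quot_ext3[OF _ _ _ f g])
  fix t y z' assume a: "el t" "el y" "el z'" "ob t = fst (T W X)" "ob y = fst Y" "ob z' = fst Z" "dj t y" "dj y t" "dj t z'" "dj z' t" "dj y z'" "dj z' y"
  show "f \<bullet> Q (T (T W X) Y) Z \<bullet> ((Q (T W X) Y \<bullet> (t \<star> y)) \<star> z') = g \<bullet> Q (T (T W X) Y) Z \<bullet> ((Q (T W X) Y \<bullet> (t \<star> y)) \<star> z')"
    by (rule quot_wlog[where M = W and N = X and t = t and L = "\<lambda>t. f \<bullet> Q (T (T W X) Y) Z \<bullet> ((Q (T W X) Y \<bullet> (t \<star> y)) \<star> z')"
          and R = "\<lambda>t. g \<bullet> Q (T (T W X) Y) Z \<bullet> ((Q (T W X) Y \<bullet> (t \<star> y)) \<star> z')"],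
      (rule lin_intros | use a f g W X Y Z in \<open>simp add: homs_iff e; fail\<close>)+)
qed (use W X Y Z in auto)

text \<open>The naturality and coherence axioms are equations between arrows out of iterated
  quotients. It suffices to evaluate them on classes of tensors, where the rules for
  \<open>tnA\<close>, \<open>asM\<close>, \<open>luM\<close>, \<open>ruM\<close> and
  \<open>swM\<close> yield the same class on both sides.\<close>

lemma MC_smc: "symmetric_monoidal_category MC"
proof (intro symmetric_monoidal_category.intro MC_additive symmetric_monoidal_category_axioms.intro)
  show "Unit MC \<in> Ob MC" by simp
  show "TenO MC x y \<in> Ob MC" if "x \<in> Ob MC" "y \<in> Ob MC" for x y using that by simp
next
  fix f x y g x' y' assume "f \<in> homs MC x y" "g \<in> homs MC x' y'"
  then show "TenA MC f g \<in> homs MC (TenO MC x x') (TenO MC y y')"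
    by (elim homs_MC_elim) (auto intro!: homs_MC_I)
next
  fix x y assume "x \<in> Ob MC" "y \<in> Ob MC"
  then have m: "is_module K A x" "is_module K A y" by auto
  have "tnA x (Idn K (fst x)) x y (Idn K (fst y)) y = Idn K (fst (T x y))"
    by (rule quot_ext[OF m]) (use m in \<open>auto simp: homs_iff\<close>)
  then show "TenA MC (Idn MC x) (Idn MC y) = Idn MC (TenO MC x y)" by simp
next
  fix f x y g z f' x' y' g' z' assume "f \<in> homs MC x y" "g \<in> homs MC y z" "f' \<in> homs MC x' y'" "g' \<in> homs MC y' z'"
  then show "TenA MC (Comp MC g f) (Comp MC g' f') = Comp MC (TenA MC g g') (TenA MC f f')"
  proof (elim homs_MC_elim)
    fix f0 g0 f0' g0' assume e: "f = (x, f0, y)" "g = (y, g0, z)" "f' = (x', f0', y')" "g' = (y', g0', z')"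
      and m: "is_module K A x" "is_module K A y" "is_module K A z" "is_module K A x'" "is_module K A y'" "is_module K A z'"
      and l: "linear_mor K A x y f0" "linear_mor K A y z g0" "linear_mor K A x' y' f0'" "linear_mor K A y' z' g0'"
      and t: "f0 \<in> Ar K" "Dom K f0 = fst x" "Cod K f0 = fst y" "g0 \<in> Ar K" "Dom K g0 = fst y" "Cod K g0 = fst z"
        "f0' \<in> Ar K" "Dom K f0' = fst x'" "Cod K f0' = fst y'" "g0' \<in> Ar K" "Dom K g0' = fst y'" "Cod K g0' = fst z'"
    have c: "linear_mor K A x z (g0 \<cdot> f0)" "linear_mor K A x' z' (g0' \<cdot> f0')" using l linear_comp by blast+
    have "tnA x (g0 \<cdot> f0) z x' (g0' \<cdot> f0') z' = tnA y g0 z y' g0' z' \<cdot> tnA x f0 y x' f0' y'"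
      by (rule quot_ext[OF m(1,4)]) (use m l t c in \<open>auto simp: homs_iff\<close>)
    then show ?thesis unfolding e by simp
  qed
next
  fix f x y f' g x' y' assume "f \<in> homs MC x y" "f' \<in> homs MC x y" "g \<in> homs MC x' y'"
  then show "TenA MC (Add MC f f') g = Add MC (TenA MC f g) (TenA MC f' g)"
    by (elim homs_MC_elim) (auto simp: tnA_add_left)
next
  fix f x y g x' y' g' assume "f \<in> homs MC x y" "g \<in> homs MC x' y'" "g' \<in> homs MC x' y'"
  then show "TenA MC f (Add MC g g') = Add MC (TenA MC f g) (TenA MC f g')"
    by (elim homs_MC_elim) (auto simp: tnA_add_right)
next
  fix x y z assume "x \<in> Ob MC" "y \<in> Ob MC" "z \<in> Ob MC"
  then have m: "is_module K A x" "is_module K A y" "is_module K A z" by auto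
  show "Asc MC x y z \<in> homs MC (TenO MC (TenO MC x y) z) (TenO MC x (TenO MC y z))"
    using m by (simp add: homs_MC)
  show "iso_arrow MC (Asc MC x y z)" using m by (simp add: iso_MC)
next
  fix f x x' g y y' h z z' assume "f \<in> homs MC x x'" "g \<in> homs MC y y'" "h \<in> homs MC z z'"
  then show "Comp MC (Asc MC x' y' z') (TenA MC (TenA MC f g) h) = Comp MC (TenA MC f (TenA MC g h)) (Asc MC x y z)"
  proof (elim homs_MC_elim)
    fix f0 g0 h0 assume e: "f = (x, f0, x')" "g = (y, g0, y')" "h = (z, h0, z')"
      and m: "is_module K A x" "is_module K A x'" "is_module K A y" "is_module K A y'" "is_module K A z" "is_module K A z'"
      and l: "linear_mor K A x x' f0" "linear_mor K A y y' g0" "linear_mor K A z z' h0"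
      and t: "f0 \<in> Ar K" "Dom K f0 = fst x" "Cod K f0 = fst x'" "g0 \<in> Ar K" "Dom K g0 = fst y" "Cod K g0 = fst y'"
        "h0 \<in> Ar K" "Dom K h0 = fst z" "Cod K h0 = fst z'"
    have "asM x' y' z' \<cdot> tnA (T x y) (tnA x f0 x' y g0 y') (T x' y') z h0 z'
      = tnA x f0 x' (T y z) (tnA y g0 y' z h0 z') (T y' z') \<cdot> asM x y z"
      by (rule quot_ext3[OF m(1,3,5)]) (use m l t in \<open>auto simp: homs_iff\<close>)
    then show ?thesis unfolding e by simp
  qed
next
  fix x assume "x \<in> Ob MC"
  then have m: "is_module K A x" by auto
  show "Lun MC x \<in> homs MC (TenO MC (Unit MC) x) x" "iso_arrow MC (Lun MC x)"
    "Run MC x \<in> homs MC (TenO MC x (Unit MC)) x" "iso_arrow MC (Run MC x)"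
    using m by (simp_all add: homs_MC iso_MC)
next
  fix f x y assume "f \<in> homs MC x y"
  then show "Comp MC (Lun MC y) (TenA MC (Idn MC (Unit MC)) f) = Comp MC f (Lun MC x)"
  proof (elim homs_MC_elim)
    fix f0 assume e: "f = (x, f0, y)" and l: "linear_mor K A x y f0" and m: "is_module K A x" "is_module K A y"
      and t: "f0 \<in> Ar K" "Dom K f0 = fst x" "Cod K f0 = fst y"
    have lU: "linear_mor K A U U (Idn K (Car A))" using linear_Idn[of U] by simp
    have "luM y \<cdot> tnA U (Idn K (Car A)) U x f0 y = f0 \<cdot> luM x"
      by (rule quot_ext[OF _ m(1)]) (use m l t lU in \<open>auto simp: homs_iff a_linear_act[OF l]\<close>)
    then show ?thesis unfolding e by simp
  qed
next
  fix f x y assume "f \<in> homs MC x y"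
  then show "Comp MC (Run MC y) (TenA MC f (Idn MC (Unit MC))) = Comp MC f (Run MC x)"
  proof (elim homs_MC_elim)
    fix f0 assume e: "f = (x, f0, y)" and l: "linear_mor K A x y f0" and m: "is_module K A x" "is_module K A y"
      and t: "f0 \<in> Ar K" "Dom K f0 = fst x" "Cod K f0 = fst y"
    have lU: "linear_mor K A U U (Idn K (Car A))" using linear_Idn[of U] by simp
    have "ruM y \<cdot> tnA x f0 y U (Idn K (Car A)) U = f0 \<cdot> ruM x"
      by (rule quot_ext[OF m(1), of U]) (use m l t lU in \<open>auto simp: homs_iff a_linear_act[OF l]\<close>)
    then show ?thesis unfolding e by simp
  qed
next
  fix w x y z assume "w \<in> Ob MC" "x \<in> Ob MC" "y \<in> Ob MC" "z \<in> Ob MC"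
  then have m: "is_module K A w" "is_module K A x" "is_module K A y" "is_module K A z" by auto
  have "tnA w (Idn K (fst w)) w (T (T x y) z) (asM x y z) (T x (T y z)) \<cdot> (asM w (T x y) z \<cdot>
      tnA (T (T w x) y) (asM w x y) (T w (T x y)) z (Idn K (fst z)) z)
    = asM w x (T y z) \<cdot> asM (T w x) y z"
    by (rule quot_ext4[OF m]) (use m in \<open>auto simp: homs_iff\<close>)
  then show "Comp MC (TenA MC (Idn MC w) (Asc MC x y z)) (Comp MC (Asc MC w (TenO MC x y) z) (TenA MC (Asc MC w x y) (Idn MC z)))
    = Comp MC (Asc MC w x (TenO MC y z)) (Asc MC (TenO MC w x) y z)" by simp
next
  fix x y assume "x \<in> Ob MC" "y \<in> Ob MC"
  then have m: "is_module K A x" "is_module K A y" by auto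
  have "tnA x (Idn K (fst x)) x (T U y) (luM y) y \<cdot> asM x U y = tnA (T x U) (ruM x) x y (Idn K (fst y)) y"
    by (rule quot_ext3[OF m(1) _ m(2), of U]) (use m in \<open>auto simp: homs_iff quot_act\<close>)
  then show "Comp MC (TenA MC (Idn MC x) (Lun MC y)) (Asc MC x (Unit MC) y) = TenA MC (Run MC x) (Idn MC y)" by simp
next
  fix x y assume "x \<in> Ob MC" "y \<in> Ob MC"
  then have m: "is_module K A x" "is_module K A y" by auto
  then show "Swp MC x y \<in> homs MC (TenO MC x y) (TenO MC y x)" by (simp add: homs_MC)
  show "Comp MC (Swp MC y x) (Swp MC x y) = Idn MC (TenO MC x y)" using m by (simp add: swM_swM)
next
  fix f x x' g y y' assume "f \<in> homs MC x x'" "g \<in> homs MC y y'"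
  then show "Comp MC (Swp MC x' y') (TenA MC f g) = Comp MC (TenA MC g f) (Swp MC x y)"
  proof (elim homs_MC_elim)
    fix f0 g0 assume e: "f = (x, f0, x')" "g = (y, g0, y')"
      and m: "is_module K A x" "is_module K A x'" "is_module K A y" "is_module K A y'"
      and l: "linear_mor K A x x' f0" "linear_mor K A y y' g0"
      and t: "f0 \<in> Ar K" "Dom K f0 = fst x" "Cod K f0 = fst x'" "g0 \<in> Ar K" "Dom K g0 = fst y" "Cod K g0 = fst y'"
    have "swM x' y' \<cdot> tnA x f0 x' y g0 y' = tnA y g0 y' x f0 x' \<cdot> swM x y"
      by (rule quot_ext[OF m(1,3)]) (use m l t in \<open>auto simp: homs_iff\<close>)
    then show ?thesis unfolding e by simp
  qed
next
  fix x y z assume "x \<in> Ob MC" "y \<in> Ob MC" "z \<in> Ob MC"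
  then have m: "is_module K A x" "is_module K A y" "is_module K A z" by auto
  have "asM y z x \<cdot> (swM x (T y z) \<cdot> asM x y z)
    = tnA y (Idn K (fst y)) y (T x z) (swM x z) (T z x) \<cdot> (asM y x z \<cdot> tnA (T x y) (swM x y) (T y x) z (Idn K (fst z)) z)"
    by (rule quot_ext3[OF m]) (use m in \<open>auto simp: homs_iff\<close>)
  then show "Comp MC (Asc MC y z x) (Comp MC (Swp MC x (TenO MC y z)) (Asc MC x y z))
    = Comp MC (TenA MC (Idn MC y) (Swp MC x z)) (Comp MC (Asc MC y x z) (TenA MC (Swp MC x y) (Idn MC z)))" by simp
qed

end

section \<open>Rings of modules and their underlying rings\<close>

context separable
begin

abbreviation UR where "UR \<equiv> und_ring K A"

lemma und_simps [simp]:
  "Car (UR S) = fst (Car S)" "Mul (UR S) = und_arrow (Mul S) \<cdot> Q (Car S) (Car S)" "Unt (UR S) = und_arrow (Unt S) \<cdot> Unt A"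
  by (simp_all add: und_ring_def)

text \<open>Arrows of modules carry their ends, so the underlying arrows describe a record only once
  these ends are known to match; this typing is isolated from the ring axioms.\<close>

definition mtyp where
  "mtyp S \<longleftrightarrow> is_module K A (Car S) \<and> Mul S = (T (Car S) (Car S), und_arrow (Mul S), Car S) \<and>
     linear_mor K A (T (Car S) (Car S)) (Car S) (und_arrow (Mul S)) \<and>
     Unt S = (U, und_arrow (Unt S), Car S) \<and> linear_mor K A U (Car S) (und_arrow (Unt S))"

lemma is_ring_mtyp: "is_ring MC S \<Longrightarrow> mtyp S"
  unfolding is_ring_def mtyp_def homs_MC by auto

lemma mtyp_typ:
  assumes "mtyp S"
  shows "is_module K A (Car S)" "und_arrow (Mul S) \<in> Ar K" "Dom K (und_arrow (Mul S)) = fst (T (Car S) (Car S))"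
    "Cod K (und_arrow (Mul S)) = fst (Car S)" "und_arrow (Unt S) \<in> Ar K" "Dom K (und_arrow (Unt S)) = Car A"
    "Cod K (und_arrow (Unt S)) = fst (Car S)" "linear_mor K A (T (Car S) (Car S)) (Car S) (und_arrow (Mul S))"
    "linear_mor K A U (Car S) (und_arrow (Unt S))" "linear_mor K A (Car S) (Car S) (Idn K (fst (Car S)))"
  using assms lt[of "T (Car S) (Car S)" "Car S" "und_arrow (Mul S)"] lt[of U "Car S" "und_arrow (Unt S)"] unfolding mtyp_def by auto

lemma mtyp_record:
  assumes "mtyp S"
  shows "\<lparr>Car = Car S, Mul = (T (Car S) (Car S), und_arrow (Mul S), Car S), Unt = (U, und_arrow (Unt S), Car S)\<rparr> = S"
  using assms unfolding mtyp_def by (intro cmon.equality) auto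

lemma is_ring_MC_record:
  assumes "is_module K A X" "linear_mor K A (T X X) X m" "linear_mor K A U X u"
  shows "is_ring MC \<lparr>Car = X, Mul = (T X X, m, X), Unt = (U, u, X)\<rparr> \<longleftrightarrow>
     m \<cdot> tnA (T X X) m X X (Idn K (fst X)) X = m \<cdot> (tnA X (Idn K (fst X)) X (T X X) m X \<cdot> asM X X X) \<and>
     m \<cdot> tnA U u X X (Idn K (fst X)) X = luM X \<and> m \<cdot> tnA X (Idn K (fst X)) X U u X = ruM X \<and> m \<cdot> swM X X = m"
  unfolding is_ring_def using assms by (simp add: homs_MC)

text \<open>The multiplication of the underlying ring is that of the module ring on classes of
  tensors, and arrows out of the iterated quotients are determined by such classes; the axioms
  therefore translate one by one.\<close>

lemma is_ring_MC_iff: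
  assumes S: "mtyp S"
  shows "is_ring MC S \<longleftrightarrow> is_ring K (UR S)"
proof -
  let ?X = "Car S" and ?m = "und_arrow (Mul S)" and ?u = "und_arrow (Unt S)"
  let ?I = "Idn K (fst ?X)"
  note t = mtyp_typ[OF S]
  have X: "is_module K A ?X" by (rule t)
  have eqs: "is_ring MC S \<longleftrightarrow>
     ?m \<cdot> tnA (T ?X ?X) ?m ?X ?X ?I ?X = ?m \<cdot> (tnA ?X ?I ?X (T ?X ?X) ?m ?X \<cdot> asM ?X ?X ?X) \<and>
     ?m \<cdot> tnA U ?u ?X ?X ?I ?X = luM ?X \<and> ?m \<cdot> tnA ?X ?I ?X U ?u ?X = ruM ?X \<and> ?m \<cdot> swM ?X ?X = ?m"
    using is_ring_MC_record[OF t(1,8,9)] unfolding mtyp_record[OF S] .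
  have one: "one (UR S) = ?u \<bullet> one A" using t by simp
  show ?thesis
  proof
    assume "is_ring MC S"
    then have q: "?m \<cdot> tnA (T ?X ?X) ?m ?X ?X ?I ?X = ?m \<cdot> (tnA ?X ?I ?X (T ?X ?X) ?m ?X \<cdot> asM ?X ?X ?X)"
      "?m \<cdot> tnA U ?u ?X ?X ?I ?X = luM ?X" "?m \<cdot> swM ?X ?X = ?m" using eqs by auto
    show "is_ring K (UR S)"
    proof (rule ringI)
      fix a b c assume abc: "el a" "el b" "el c" "ob a = Car (UR S)" "ob b = Car (UR S)" "ob c = Car (UR S)"
        "dj a b" "dj b a" "dj a c" "dj c a" "dj b c" "dj c b"
      have "(?m \<cdot> tnA (T ?X ?X) ?m ?X ?X ?I ?X) \<bullet> Q (T ?X ?X) ?X \<bullet> ((Q ?X ?X \<bullet> (a \<star> b)) \<star> c)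
        = (?m \<cdot> (tnA ?X ?I ?X (T ?X ?X) ?m ?X \<cdot> asM ?X ?X ?X)) \<bullet> Q (T ?X ?X) ?X \<bullet> ((Q ?X ?X \<bullet> (a \<star> b)) \<star> c)"
        using q by simp
      then show "Mul (UR S) \<bullet> ((Mul (UR S) \<bullet> (a \<star> b)) \<star> c) = Mul (UR S) \<bullet> (a \<star> (Mul (UR S) \<bullet> (b \<star> c)))"
        using abc t by simp
    next
      fix a assume a: "el a" "ob a = Car (UR S)"
      have "(?m \<cdot> tnA U ?u ?X ?X ?I ?X) \<bullet> Q U ?X \<bullet> (one A \<star> a) = luM ?X \<bullet> Q U ?X \<bullet> (one A \<star> a)"
        using q by simp
      then show "Mul (UR S) \<bullet> (one (UR S) \<star> a) = a"
        using a t by (simp add: a_act_one)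
    next
      fix a b assume ab: "el a" "el b" "ob a = Car (UR S)" "ob b = Car (UR S)" "dj a b" "dj b a"
      have "(?m \<cdot> swM ?X ?X) \<bullet> Q ?X ?X \<bullet> (b \<star> a) = ?m \<bullet> Q ?X ?X \<bullet> (b \<star> a)"
        using q by simp
      then show "Mul (UR S) \<bullet> (a \<star> b) = Mul (UR S) \<bullet> (b \<star> a)"
        using ab t by simp
    qed (use t in \<open>auto simp: homs_iff\<close>)
  next
    assume R: "is_ring K (UR S)"
    have as: "?m \<bullet> Q ?X ?X \<bullet> ((?m \<bullet> Q ?X ?X \<bullet> (a \<star> b)) \<star> c) = ?m \<bullet> Q ?X ?X \<bullet> (a \<star> (?m \<bullet> Q ?X ?X \<bullet> (b \<star> c)))"
      if "el a" "el b" "el c" "ob a = fst ?X" "ob b = fst ?X" "ob c = fst ?X" "dj a b" "dj a c" "dj b c" for a b c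
      using mul_assoc[OF R, of a b c] that t by simp
    have cm: "?m \<bullet> Q ?X ?X \<bullet> (b \<star> a) = ?m \<bullet> Q ?X ?X \<bullet> (a \<star> b)"
      if "el a" "el b" "ob a = fst ?X" "ob b = fst ?X" "dj a b" for a b
      using mul_comm[OF R, of b a] that t by simp
    have un1: "?m \<bullet> Q ?X ?X \<bullet> ((?u \<bullet> one A) \<star> a) = a" if "el a" "ob a = fst ?X" for a
      using mul_unl[OF R, of a] that t by simp
    \<comment> \<open>In the module category the unit law concerns every r of A. By linearity
      \<open>?u\<close> at r is r times its value at 1, so the law at 1 spreads to all r.\<close>
    have un: "?m \<bullet> Q ?X ?X \<bullet> ((?u \<bullet> r) \<star> a) = snd ?X \<bullet> (r \<star> a)"
      if "el r" "el a" "ob r = Car A" "ob a = fst ?X" "dj r a" for r a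
    proof -
      have u: "?u \<bullet> r = snd ?X \<bullet> (r \<star> (?u \<bullet> one A))"
        using a_linear_act[OF t(9), of r "one A"] that t by (simp add: mul_simps)
      have "Q ?X ?X \<bullet> ((snd ?X \<bullet> (r \<star> (?u \<bullet> one A))) \<star> a) = snd (T ?X ?X) \<bullet> (r \<star> (Q ?X ?X \<bullet> ((?u \<bullet> one A) \<star> a)))"
        using that t by (simp add: tensor_act(2))
      then have "?m \<bullet> Q ?X ?X \<bullet> ((?u \<bullet> r) \<star> a) = ?m \<bullet> snd (T ?X ?X) \<bullet> (r \<star> (Q ?X ?X \<bullet> ((?u \<bullet> one A) \<star> a)))"
        using u by simp
      also have "\<dots> = snd ?X \<bullet> (r \<star> a)"
        using a_linear_act[OF t(8), of r "Q ?X ?X \<bullet> ((?u \<bullet> one A) \<star> a)"] that t un1 by simp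
      finally show ?thesis .
    qed
    have "?m \<cdot> tnA (T ?X ?X) ?m ?X ?X ?I ?X = ?m \<cdot> (tnA ?X ?I ?X (T ?X ?X) ?m ?X \<cdot> asM ?X ?X ?X)"
      by (rule quot_ext3[OF X X X]) (use t in \<open>auto simp: homs_iff as\<close>)
    moreover have "?m \<cdot> tnA U ?u ?X ?X ?I ?X = luM ?X"
      by (rule quot_ext[of U ?X]) (use t in \<open>auto simp: homs_iff un\<close>)
    moreover have "?m \<cdot> tnA ?X ?I ?X U ?u ?X = ruM ?X"
    proof (rule quot_ext[of ?X U])
      fix a r assume a: "el a" "el r" "ob a = fst ?X" "ob r = fst U" "dj a r" "dj r a"
      then show "(?m \<cdot> tnA ?X ?I ?X U ?u ?X) \<bullet> Q ?X U \<bullet> (a \<star> r) = ruM ?X \<bullet> Q ?X U \<bullet> (a \<star> r)"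
        using t cm[of "?u \<bullet> r" a] un[of r a] by simp
    qed (use t in \<open>auto simp: homs_iff\<close>)
    moreover have "?m \<cdot> swM ?X ?X = ?m"
      by (rule quot_ext[OF X X]) (use t cm in \<open>auto simp: homs_iff\<close>)
    ultimately show "is_ring MC S" using eqs by blast
  qed
qed

lemma und_is_ring: "is_ring MC S \<Longrightarrow> is_ring K (UR S)"
  using is_ring_MC_iff[OF is_ring_mtyp] by blast

lemma ring_mor_MC_record:
  assumes "is_ring MC \<lparr>Car = X, Mul = (T X X, m, X), Unt = (U, u, X)\<rparr>" "is_ring MC \<lparr>Car = X', Mul = (T X' X', m', X'), Unt = (U, u', X')\<rparr>"
    "linear_mor K A X X' f"
  shows "ring_mor MC \<lparr>Car = X, Mul = (T X X, m, X), Unt = (U, u, X)\<rparr> \<lparr>Car = X', Mul = (T X' X', m', X'), Unt = (U, u', X')\<rparr> (X, f, X')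
    \<longleftrightarrow> f \<cdot> m = m' \<cdot> tnA X f X' X f X' \<and> f \<cdot> u = u'"
  unfolding ring_mor_def using assms by (simp add: homs_MC)

lemma ring_mor_MC_iff:
  assumes S: "is_ring MC S" and S': "is_ring MC S'" and f: "linear_mor K A (Car S) (Car S') f"
  shows "ring_mor MC S S' (Car S, f, Car S') \<longleftrightarrow> ring_mor K (UR S) (UR S') f"
proof -
  let ?X = "Car S" and ?m = "und_arrow (Mul S)" and ?u = "und_arrow (Unt S)"
  let ?X' = "Car S'" and ?m' = "und_arrow (Mul S')" and ?u' = "und_arrow (Unt S')"
  note t = mtyp_typ[OF is_ring_mtyp[OF S]] and t' = mtyp_typ[OF is_ring_mtyp[OF S']]
  note ft = lt[OF f]
  have eqs: "ring_mor MC S S' (?X, f, ?X') \<longleftrightarrow> f \<cdot> ?m = ?m' \<cdot> tnA ?X f ?X' ?X f ?X' \<and> f \<cdot> ?u = ?u'"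
    using ring_mor_MC_record[OF _ _ f, unfolded mtyp_record[OF is_ring_mtyp[OF S]] mtyp_record[OF is_ring_mtyp[OF S']], of "?m" "?u" "?m'" "?u'",
        unfolded mtyp_record[OF is_ring_mtyp[OF S]] mtyp_record[OF is_ring_mtyp[OF S']], OF S S'] .
  note R = und_is_ring[OF S] and R' = und_is_ring[OF S']
  show ?thesis
  proof
    assume "ring_mor MC S S' (?X, f, ?X')"
    then have q: "f \<cdot> ?m = ?m' \<cdot> tnA ?X f ?X' ?X f ?X'" "f \<cdot> ?u = ?u'" using eqs by auto
    show "ring_mor K (UR S) (UR S') f"
      unfolding ring_mor_iff
    proof (intro conjI mmorI R R')
      fix a b assume ab: "el a" "el b" "ob a = Car (UR S)" "ob b = Car (UR S)" "dj a b" "dj b a"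
      have "(f \<cdot> ?m) \<bullet> Q ?X ?X \<bullet> (a \<star> b) = (?m' \<cdot> tnA ?X f ?X' ?X f ?X') \<bullet> Q ?X ?X \<bullet> (a \<star> b)" using q by simp
      then show "f \<bullet> Mul (UR S) \<bullet> (a \<star> b) = Mul (UR S') \<bullet> ((f \<bullet> a) \<star> (f \<bullet> b))"
        using ab t t' f ft by simp
    next
      have "(f \<cdot> ?u) \<bullet> one A = ?u' \<bullet> one A" using q by simp
      then show "f \<bullet> one (UR S) = one (UR S')" using t t' ft by simp
    qed (use ft in \<open>simp add: homs_iff\<close>)
  next
    assume r: "ring_mor K (UR S) (UR S') f"
    note m = ring_mor_mmor[OF r] and o = ring_mor_one[OF r]
    have "f \<cdot> ?m = ?m' \<cdot> tnA ?X f ?X' ?X f ?X'"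
    proof (rule quot_ext[OF t(1) t(1)])
      fix a b assume ab: "el a" "el b" "ob a = fst ?X" "ob b = fst ?X" "dj a b" "dj b a"
      then show "(f \<cdot> ?m) \<bullet> Q ?X ?X \<bullet> (a \<star> b) = (?m' \<cdot> tnA ?X f ?X' ?X f ?X') \<bullet> Q ?X ?X \<bullet> (a \<star> b)"
        using mmor_mul[OF m, of a b] t t' f ft by simp
    qed (use t t' f ft in \<open>auto simp: homs_iff\<close>)
    moreover have "f \<cdot> ?u = ?u'"
    proof (rule ext1[of _ "Car A"])
      fix a assume a: "el a" "ob a = Car A"
      \<comment> \<open>A linear map out of A is determined by its value at 1.\<close>
      have "?u \<bullet> a = snd ?X \<bullet> (a \<star> (?u \<bullet> one A))" "?u' \<bullet> a = snd ?X' \<bullet> (a \<star> (?u' \<bullet> one A))"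
        using a_linear_act[OF t(9), of a "one A"] a_linear_act[OF t'(9), of a "one A"] a t t' by (simp_all add: mul_simps)
      then show "(f \<cdot> ?u) \<bullet> a = ?u' \<bullet> a"
        using a_linear_act[OF f, of a "?u \<bullet> one A"] o a t t' ft by simp
    qed (use t t' ft in \<open>auto simp: homs_iff\<close>)
    ultimately show "ring_mor MC S S' (?X, f, ?X')" using eqs by blast
  qed
qed

lemma ring_mor_MC_und:
  assumes "ring_mor MC S S' w"
  shows "ring_mor K (UR S) (UR S') (und_arrow w)" "linear_mor K A (Car S) (Car S') (und_arrow w)" "w = (Car S, und_arrow w, Car S')"
proof -
  have "w \<in> homs MC (Car S) (Car S')" and r: "is_ring MC S" "is_ring MC S'" using assms by (auto simp: ring_mor_def)
  then show "linear_mor K A (Car S) (Car S') (und_arrow w)" "w = (Car S, und_arrow w, Car S')" by (auto simp: homs_MC)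
  then show "ring_mor K (UR S) (UR S') (und_arrow w)" using assms ring_mor_MC_iff[OF r] by metis
qed

lemma und_unit_ring: "UR (unit_ring MC) = A"
proof (rule cmon.equality)
  show "Mul (UR (unit_ring MC)) = Mul A"
    by (rule ext2[of _ "Car A" "Car A"]) (auto simp: unit_ring_def homs_iff)
qed (auto simp: unit_ring_def)

lemma algebra_module:
  assumes u: "ring_mor K A B u"
  shows "is_module K A (Car B, Mul B \<cdot> (u \<boxtimes> Idn K (Car B)))"
proof -
  note m = ring_mor_mmor[OF u] and o = ring_mor_one[OF u]
  note t = mmor_typ[OF m]
  show ?thesis
  proof (rule moduleI)
    fix r s b assume "el r" "el s" "el b" "ob r = Car A" "ob s = Car A" "ob b = Car B" "dj r s" "dj s r" "dj r b" "dj b r" "dj s b" "dj b s"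
    then show "(Mul B \<cdot> (u \<boxtimes> Idn K (Car B))) \<bullet> ((Mul A \<bullet> (r \<star> s)) \<star> b) =
      (Mul B \<cdot> (u \<boxtimes> Idn K (Car B))) \<bullet> (r \<star> ((Mul B \<cdot> (u \<boxtimes> Idn K (Car B))) \<bullet> (s \<star> b)))"
      using t mmor_mul[OF m, of r s] by (simp add: mul_assoc)
  qed (use t o in \<open>auto simp: homs_iff mul_simps\<close>)
qed

lemma mod_ring_simps:
  "Car (mod_ring K A B u) = (Car B, Mul B \<cdot> (u \<boxtimes> Idn K (Car B)))"
  "Mul (mod_ring K A B u) = (T (Car (mod_ring K A B u)) (Car (mod_ring K A B u)), descend K (Q (Car (mod_ring K A B u)) (Car (mod_ring K A B u))) (Mul B), Car (mod_ring K A B u))"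
  "Unt (mod_ring K A B u) = (U, u, Car (mod_ring K A B u))"
  by (simp_all add: mod_ring_def Let_def)

lemma und_mod_ring:
  assumes u: "ring_mor K A B u" shows "UR (mod_ring K A B u) = B"
proof -
  let ?X = "(Car B, Mul B \<cdot> (u \<boxtimes> Idn K (Car B)))"
  note X = algebra_module[OF u]
  note m = ring_mor_mmor[OF u]
  note t = mmor_typ[OF m]
  have b: "balanced ?X ?X (Mul B)"
    by (rule balancedI[OF X X]) (use t in \<open>auto simp: mul_ac\<close>)
  have "u \<cdot> Unt A = Unt B" using u by (simp add: ring_mor_def)
  then show ?thesis
    using descend_props(2)[OF X X b] by (auto intro!: cmon.equality simp: mod_ring_simps)
qed

section \<open>Free modules and extension of scalars\<close>

lemma free_module [simp]:
  assumes "x \<in> Ob K" shows "is_module K A (free_mod K A x)"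
  unfolding free_mod_def
proof (rule moduleI)
  let ?a = "(Mul A \<boxtimes> Idn K x) \<cdot> inv_arrow K (Asc K (Car A) (Car A) x)"
  fix r s m assume a: "el r" "el s" "el m" "ob r = Car A" "ob s = Car A" "ob m = Car A \<odot> x" "dj r s" "dj s r" "dj r m" "dj m r" "dj s m" "dj m s"
  show "?a \<bullet> ((Mul A \<bullet> (r \<star> s)) \<star> m) = ?a \<bullet> (r \<star> (?a \<bullet> (s \<star> m)))"
    by (rule lin_ext[where e = m and x = "Car A" and y = x and L = "\<lambda>m. ?a \<bullet> ((Mul A \<bullet> (r \<star> s)) \<star> m)" and R = "\<lambda>m. ?a \<bullet> (r \<star> (?a \<bullet> (s \<star> m)))"],
      (rule lin_intros | use a assms in \<open>simp add: mul_assoc; fail\<close>)+)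
next
  let ?a = "(Mul A \<boxtimes> Idn K x) \<cdot> inv_arrow K (Asc K (Car A) (Car A) x)"
  fix m assume a: "el m" "ob m = Car A \<odot> x"
  show "?a \<bullet> (one A \<star> m) = m"
    by (rule lin_ext[where e = m and x = "Car A" and y = x and L = "\<lambda>m. ?a \<bullet> (one A \<star> m)" and R = "\<lambda>m. m"],
      (rule lin_intros | use a assms in \<open>simp add: mul_simps; fail\<close>)+)
qed (use assms in \<open>auto simp: homs_iff\<close>)

lemma free_mod_simps [simp]: "fst (free_mod K A x) = Car A \<odot> x"
  by (simp add: free_mod_def)

lemma free_act [simp]:
  assumes "el r" "el a" "el b" "ob r = Car A" "ob a = Car A" "ob b = x" "dj r a" "dj r b" "dj a b"
  shows "snd (free_mod K A x) \<bullet> (r \<star> (a \<star> b)) = (Mul A \<bullet> (r \<star> a)) \<star> b"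
  using assms by (auto simp: free_mod_def)

lemma free_linear:
  assumes f: "f \<in> homs K x y" shows "linear_mor K A (free_mod K A x) (free_mod K A y) (Idn K (Car A) \<boxtimes> f)"
proof -
  have t: "f \<in> Ar K" "Dom K f = x" "Cod K f = y" "x \<in> Ob K" "y \<in> Ob K" using f by (auto simp: homs_iff)
  show ?thesis
  proof (rule linearI)
    fix r m assume a: "el r" "el m" "ob r = Car A" "ob m = fst (free_mod K A x)" "dj r m" "dj m r"
    show "(Idn K (Car A) \<boxtimes> f) \<bullet> snd (free_mod K A x) \<bullet> (r \<star> m) = snd (free_mod K A y) \<bullet> (r \<star> ((Idn K (Car A) \<boxtimes> f) \<bullet> m))"
      by (rule lin_ext[where e = m and x = "Car A" and y = x and L = "\<lambda>m. (Idn K (Car A) \<boxtimes> f) \<bullet> snd (free_mod K A x) \<bullet> (r \<star> m)"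
          and R = "\<lambda>m. snd (free_mod K A y) \<bullet> (r \<star> ((Idn K (Car A) \<boxtimes> f) \<bullet> m))"],
        (rule lin_intros | use a t in \<open>simp; fail\<close>)+)
  qed (use t in \<open>auto simp: homs_iff\<close>)
qed

lemma free_tensor_props:
  assumes x: "x \<in> Ob K" and y: "y \<in> Ob K"
  shows "und_arrow (free_tensor K A x y) \<cdot> Q (free_mod K A x) (free_mod K A y) = (Mul A \<boxtimes> Idn K (x \<odot> y)) \<cdot> middle_swap K (Car A) x (Car A) y"
    "linear_mor K A (T (free_mod K A x) (free_mod K A y)) (free_mod K A (x \<odot> y)) (und_arrow (free_tensor K A x y))"
proof -
  let ?X = "free_mod K A x" and ?Y = "free_mod K A y"
  let ?k = "(Mul A \<boxtimes> Idn K (x \<odot> y)) \<cdot> middle_swap K (Car A) x (Car A) y"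
  have X: "is_module K A ?X" and Y: "is_module K A ?Y" using x y by auto
  have b: "balanced ?X ?Y ?k"
  proof (rule balancedI[OF X Y])
    fix r m n assume a: "el r" "el m" "el n" "ob r = Car A" "ob m = fst ?X" "ob n = fst ?Y" "dj r m" "dj m r" "dj r n" "dj n r" "dj m n" "dj n m"
    show "?k \<bullet> ((snd ?X \<bullet> (r \<star> m)) \<star> n) = ?k \<bullet> (m \<star> (snd ?Y \<bullet> (r \<star> n)))"
    proof (rule lin_ext[where e = m and x = "Car A" and y = x and L = "\<lambda>m. ?k \<bullet> ((snd ?X \<bullet> (r \<star> m)) \<star> n)" and R = "\<lambda>m. ?k \<bullet> (m \<star> (snd ?Y \<bullet> (r \<star> n)))"],
       (rule lin_intros | use a x y in \<open>simp; fail\<close>)+)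
      fix c d assume cd: "el c" "el d" "ob c = Car A" "ob d = x" "dj c d" "dj d c"
        "dst (mrg (mrg (fst r) []) (fst n)) (fst c)" "dst (mrg (mrg (fst r) []) (fst n)) (fst d)"
        "dst (mrg [] (fst (snd ?Y \<bullet> (r \<star> n)))) (fst c)" "dst (mrg [] (fst (snd ?Y \<bullet> (r \<star> n)))) (fst d)"
        "dst (fst c) (mrg (mrg (fst r) []) (fst n))" "dst (fst d) (mrg (mrg (fst r) []) (fst n))"
      show "?k \<bullet> ((snd ?X \<bullet> (r \<star> (c \<star> d))) \<star> n) = ?k \<bullet> (c \<star> d \<star> (snd ?Y \<bullet> (r \<star> n)))"
        by (rule lin_ext[where e = n and x = "Car A" and y = y and L = "\<lambda>n. ?k \<bullet> ((snd ?X \<bullet> (r \<star> (c \<star> d))) \<star> n)" and R = "\<lambda>n. ?k \<bullet> (c \<star> d \<star> (snd ?Y \<bullet> (r \<star> n)))"],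
          (rule lin_intros | use a x y cd in \<open>simp add: mul_ac; fail\<close>)+)
    qed
  qed (use x y in auto)
  note d = descend_props[OF X Y b]
  show q: "und_arrow (free_tensor K A x y) \<cdot> Q ?X ?Y = ?k" using d(2) by (simp add: free_tensor_def)
  let ?h = "und_arrow (free_tensor K A x y)"
  have ht: "?h \<in> Ar K" "Dom K ?h = fst (T ?X ?Y)" "Cod K ?h = Car A \<odot> (x \<odot> y)"
    using d(1) x y by (auto simp: free_tensor_def homs_iff)
  have qa: "?h \<bullet> Q ?X ?Y \<bullet> s = ?k \<bullet> s" if "el s" "ob s = Car A \<odot> x \<odot> (Car A \<odot> y)" for s
    using q that ht X Y by (simp del: comp_app flip: comp_app)
  show "linear_mor K A (T ?X ?Y) (free_mod K A (x \<odot> y)) ?h"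
  proof (rule linearI)
    fix r t assume a: "el r" "el t" "ob r = Car A" "ob t = fst (T ?X ?Y)" "dj r t" "dj t r"
    show "?h \<bullet> snd (T ?X ?Y) \<bullet> (r \<star> t) = snd (free_mod K A (x \<odot> y)) \<bullet> (r \<star> (?h \<bullet> t))"
    proof (rule quot_wlog[OF X Y, where t = t and L = "\<lambda>t. ?h \<bullet> snd (T ?X ?Y) \<bullet> (r \<star> t)" and R = "\<lambda>t. snd (free_mod K A (x \<odot> y)) \<bullet> (r \<star> (?h \<bullet> t))"],
        (rule lin_intros | use a x y X Y ht in \<open>simp; fail\<close>)+)
      fix m n assume mn: "el m" "el n" "ob m = fst ?X" "ob n = fst ?Y" "dj m n" "dj n m"
        "dst (mrg (fst r) []) (fst m)" "dst (mrg (fst r) []) (fst n)" "dst (fst m) (mrg (fst r) [])" "dst (fst n) (mrg (fst r) [])"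
      have "?k \<bullet> ((snd ?X \<bullet> (r \<star> m)) \<star> n) = snd (free_mod K A (x \<odot> y)) \<bullet> (r \<star> (?k \<bullet> (m \<star> n)))"
      proof (rule lin_ext[where e = m and x = "Car A" and y = x and L = "\<lambda>m. ?k \<bullet> ((snd ?X \<bullet> (r \<star> m)) \<star> n)" and R = "\<lambda>m. snd (free_mod K A (x \<odot> y)) \<bullet> (r \<star> (?k \<bullet> (m \<star> n)))"],
        (rule lin_intros | use a x y mn X Y in \<open>simp; fail\<close>)+)
        fix c d assume cd: "el c" "el d" "ob c = Car A" "ob d = x" "dj c d" "dj d c"
          "dst (mrg (mrg (fst r) []) (fst n)) (fst c)" "dst (mrg (mrg (fst r) []) (fst n)) (fst d)"
          "dst (fst c) (mrg (mrg (fst r) []) (fst n))" "dst (fst d) (mrg (mrg (fst r) []) (fst n))"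
        show "?k \<bullet> ((snd ?X \<bullet> (r \<star> (c \<star> d))) \<star> n) = snd (free_mod K A (x \<odot> y)) \<bullet> (r \<star> (?k \<bullet> (c \<star> d \<star> n)))"
          by (rule lin_ext[where e = n and x = "Car A" and y = y and L = "\<lambda>n. ?k \<bullet> ((snd ?X \<bullet> (r \<star> (c \<star> d))) \<star> n)" and R = "\<lambda>n. snd (free_mod K A (x \<odot> y)) \<bullet> (r \<star> (?k \<bullet> (c \<star> d \<star> n)))"],
            (rule lin_intros | use a x y mn cd X Y in \<open>simp add: mul_assoc; fail\<close>)+)
      qed
      then show "?h \<bullet> snd (T ?X ?Y) \<bullet> (r \<star> (Q ?X ?Y \<bullet> (m \<star> n))) = snd (free_mod K A (x \<odot> y)) \<bullet> (r \<star> (?h \<bullet> Q ?X ?Y \<bullet> (m \<star> n)))"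
        using a x y mn X Y by (simp add: tensor_act(2) qa del: comp_app)
    qed
  qed (use x y X Y ht in \<open>auto simp: homs_iff\<close>)
qed

text \<open>By this the isomorphism in condition (ii) becomes one with domain A \<otimes> A, the
  domain of \<open>lambda_mor\<close>.\<close>

lemma und_free_ring:
  assumes B: "is_ring K B"
  shows "UR (free_ring K A B) = tensor_ring K A B" and "mtyp (free_ring K A B)"
proof -
  let ?X = "free_mod K A (Car B)"
  have e: "Car (free_ring K A B) = ?X"
    "Mul (free_ring K A B) = (T ?X ?X, (Idn K (Car A) \<boxtimes> Mul B) \<cdot> und_arrow (free_tensor K A (Car B) (Car B)), ?X)"
    "Unt (free_ring K A B) = (U, (Idn K (Car A) \<boxtimes> Unt B) \<cdot> inv_arrow K (Run K (Car A)), ?X)"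
    using B by (simp_all add: free_ring_def free_arrow_def free_tensor_def free_unit_def)
  note ft = free_tensor_props[of "Car B" "Car B"]
  have X: "is_module K A ?X" using B by simp
  have ftl: "linear_mor K A (T ?X ?X) (free_mod K A (Car B \<odot> Car B)) (und_arrow (free_tensor K A (Car B) (Car B)))" using ft B by simp
  note ftt = lt[OF ftl]
  have mul: "((Idn K (Car A) \<boxtimes> Mul B) \<cdot> und_arrow (free_tensor K A (Car B) (Car B))) \<cdot> Q ?X ?X
     = (Mul A \<boxtimes> Mul B) \<cdot> middle_swap K (Car A) (Car B) (Car A) (Car B)"
    using ftt ft(1) B X by (simp add: ten_comp2)
  have unt: "(Idn K (Car A) \<boxtimes> Unt B) \<cdot> (inv_arrow K (Run K (Car A)) \<cdot> Unt A) = (Unt A \<boxtimes> Unt B) \<cdot> inv_arrow K (Lun K (Unit K))"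
    by (rule ext_unit) (use B in \<open>auto simp: homs_iff\<close>)
  show "UR (free_ring K A B) = tensor_ring K A B"
    using mul unt B by (auto intro!: cmon.equality simp: e tensor_ring_def)
  have "linear_mor K A ?X ?X (Idn K (Car A \<odot> Car B))" using linear_Idn[OF X] by simp
  have "linear_mor K A U (free_mod K A (Unit K)) (inv_arrow K (Run K (Car A)))"
    by (rule linearI) (use B in \<open>auto simp: homs_iff\<close>)
  then have "linear_mor K A U ?X ((Idn K (Car A) \<boxtimes> Unt B) \<cdot> inv_arrow K (Run K (Car A)))"
    by (rule linear_comp) (rule free_linear, use B in \<open>simp add: homs_iff\<close>)
  moreover have "linear_mor K A (T ?X ?X) ?X ((Idn K (Car A) \<boxtimes> Mul B) \<cdot> und_arrow (free_tensor K A (Car B) (Car B)))"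
    using ftl by (rule linear_comp) (rule free_linear, use B in \<open>simp add: homs_iff\<close>)
  ultimately show "mtyp (free_ring K A B)" unfolding mtyp_def using X by (simp add: e)
qed

lemma free_ring_is_ring: "is_ring K B \<Longrightarrow> is_ring MC (free_ring K A B)"
  using is_ring_MC_iff[OF und_free_ring(2)] und_free_ring(1) tensor_ring_is_ring by simp

subsection \<open>Products of modules\<close>

text \<open>The forgetful functor has the left adjoint \<open>free_mod\<close>, so it preserves
  products: arrows from y into the cone correspond to linear maps out of the free module on
  y.\<close>

lemma und_product_cone:
  assumes c: "product_cone MC I X P p"
  shows "product_cone K I (\<lambda>i. fst (X i)) (fst P) (\<lambda>i. und_arrow (p i))"
    and "is_module K A P" and "i \<in> I \<Longrightarrow> p i = (P, und_arrow (p i), X i)" and "i \<in> I \<Longrightarrow> linear_mor K A P (X i) (und_arrow (p i))"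
proof -
  have P: "is_module K A P" using c by (simp add: product_cone_def)
  have pi: "p i = (P, und_arrow (p i), X i) \<and> linear_mor K A P (X i) (und_arrow (p i))" if "i \<in> I" for i
  proof -
    have "p i \<in> homs MC P (X i)" using c that by (simp add: product_cone_def)
    then show ?thesis by (auto simp: homs_MC)
  qed
  show "is_module K A P" by (rule P)
  show "p i = (P, und_arrow (p i), X i)" "linear_mor K A P (X i) (und_arrow (p i))" if "i \<in> I" using pi[OF that] by auto
  have pt: "und_arrow (p i) \<in> Ar K" "Dom K (und_arrow (p i)) = fst P" "Cod K (und_arrow (p i)) = fst (X i)" "is_module K A (X i)" if "i \<in> I" for i
    using lt[of P "X i" "und_arrow (p i)"] pi[OF that] by auto
  have ext: "\<exists>!h. linear_mor K A Y P h \<and> (\<forall>i\<in>I. und_arrow (p i) \<cdot> h = g i)"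
    if Y: "is_module K A Y" and g: "\<And>i. i \<in> I \<Longrightarrow> linear_mor K A Y (X i) (g i)" for Y g
  proof -
    have "\<exists>!h. h \<in> homs MC Y P \<and> (\<forall>i\<in>I. Comp MC (p i) h = (Y, g i, X i))"
    proof -
      have c3: "\<forall>Y\<in>Ob MC. \<forall>f. (\<forall>i\<in>I. f i \<in> homs MC Y (X i)) \<longrightarrow> (\<exists>!h. h \<in> homs MC Y P \<and> (\<forall>i\<in>I. Comp MC (p i) h = f i))"
        using c unfolding product_cone_def by blast
      have "Y \<in> Ob MC" and g1: "\<forall>i\<in>I. (Y, g i, X i) \<in> homs MC Y (X i)" using Y g by (auto simp: homs_MC)
      from c3[THEN bspec, OF this(1), THEN spec, of "\<lambda>i. (Y, g i, X i)", THEN mp, OF g1] show ?thesis .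
    qed
    then obtain h where h: "h \<in> homs MC Y P" "\<And>i. i \<in> I \<Longrightarrow> Comp MC (p i) h = (Y, g i, X i)"
      and u: "\<And>h'. h' \<in> homs MC Y P \<Longrightarrow> (\<And>i. i \<in> I \<Longrightarrow> Comp MC (p i) h' = (Y, g i, X i)) \<Longrightarrow> h' = h"
      by (elim ex1E) blast
    obtain h0 where h0: "h = (Y, h0, P)" "linear_mor K A Y P h0" using h(1) by (auto simp: homs_MC)
    have cmp: "Comp MC (p i) (Y, h', P) = (Y, und_arrow (p i) \<cdot> h', X i)" if "i \<in> I" for h' i
      by (subst pi[OF that, THEN conjunct1]) simp
    show ?thesis
    proof (rule ex1I[of _ h0])
      show "linear_mor K A Y P h0 \<and> (\<forall>i\<in>I. und_arrow (p i) \<cdot> h0 = g i)" using h h0 cmp by auto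
      fix h' assume "linear_mor K A Y P h' \<and> (\<forall>i\<in>I. und_arrow (p i) \<cdot> h' = g i)"
      then have "(Y, h', P) = h" by (intro u) (auto simp: homs_MC cmp)
      then show "h' = h0" using h0 by simp
    qed
  qed
  show "product_cone K I (\<lambda>i. fst (X i)) (fst P) (\<lambda>i. und_arrow (p i))"
    unfolding product_cone_def
  proof (intro conjI ballI allI impI)
    show "fst P \<in> Ob K" using P by simp
    show "und_arrow (p i) \<in> homs K (fst P) (fst (X i))" if "i \<in> I" for i using pt[OF that] by (simp add: homs_iff)
    fix y f assume y: "y \<in> Ob K" and f: "\<forall>i\<in>I. f i \<in> homs K y (fst (X i))"
    have ft: "f i \<in> Ar K" "Dom K (f i) = y" "Cod K (f i) = fst (X i)" if "i \<in> I" for i using f that by (auto simp: homs_iff)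
    let ?F = "free_mod K A y"
    have F: "is_module K A ?F" using y by simp
    \<comment> \<open>\<open>fl Z k\<close> is the linear map a \<otimes> y \<mapsto> a k(y) adjoint
      to k, and \<open>?e\<close> below is the unit y \<mapsto> 1 \<otimes> y of the
      adjunction.\<close>
    define fl where "fl Z k = snd Z \<cdot> (Idn K (Car A) \<boxtimes> k)" for Z :: "'a \<times> 'b" and k
    have fl: "linear_mor K A ?F Z (fl Z k)" if "is_module K A Z" "k \<in> homs K y (fst Z)" for Z k
    proof (rule linearI)
      have kt: "k \<in> Ar K" "Dom K k = y" "Cod K k = fst Z" using that by (auto simp: homs_iff)
      fix r m assume a: "el r" "el m" "ob r = Car A" "ob m = fst ?F" "dj r m" "dj m r"
      show "fl Z k \<bullet> snd ?F \<bullet> (r \<star> m) = snd Z \<bullet> (r \<star> (fl Z k \<bullet> m))"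
        by (rule lin_ext[where e = m and x = "Car A" and y = y and L = "\<lambda>m. fl Z k \<bullet> snd ?F \<bullet> (r \<star> m)" and R = "\<lambda>m. snd Z \<bullet> (r \<star> (fl Z k \<bullet> m))"],
          (rule lin_intros | use a y F kt that in \<open>simp add: fl_def a_act_mul; fail\<close>)+)
    qed (use that F y in \<open>auto simp: homs_iff fl_def\<close>)
    have flp: "und_arrow (p i) \<cdot> fl P k = fl (X i) (und_arrow (p i) \<cdot> k)" if "k \<in> homs K y (fst P)" "i \<in> I" for k i
      by (rule ext2[of _ "Car A" y])
        (use that pt[OF that(2)] P pi[OF that(2)] in \<open>auto simp: homs_iff fl_def a_linear_act\<close>)
    let ?e = "(Unt A \<boxtimes> Idn K y) \<cdot> inv_arrow K (Lun K y)"
    have fle: "fl Z k \<cdot> ?e = k" if "is_module K A Z" "k \<in> homs K y (fst Z)" for Z k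
      by (rule ext1[of _ y]) (use that y in \<open>auto simp: homs_iff fl_def a_act_one\<close>)
    have "\<exists>!h. linear_mor K A ?F P h \<and> (\<forall>i\<in>I. und_arrow (p i) \<cdot> h = fl (X i) (f i))"
      by (rule ext[OF F fl]) (use pt f in auto)
    then obtain h where h: "linear_mor K A ?F P h" "\<And>i. i \<in> I \<Longrightarrow> und_arrow (p i) \<cdot> h = fl (X i) (f i)"
      and u: "\<And>h'. linear_mor K A ?F P h' \<Longrightarrow> (\<And>i. i \<in> I \<Longrightarrow> und_arrow (p i) \<cdot> h' = fl (X i) (f i)) \<Longrightarrow> h' = h"
      by (elim ex1E) blast
    note ht = lt[OF h(1)]
    show "\<exists>!h. h \<in> homs K y (fst P) \<and> (\<forall>i\<in>I. und_arrow (p i) \<cdot> h = f i)"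
    proof (rule ex1I[of _ "h \<cdot> ?e"])
      have "und_arrow (p i) \<cdot> (h \<cdot> ?e) = f i" if "i \<in> I" for i
      proof -
        have "und_arrow (p i) \<cdot> (h \<cdot> ?e) = fl (X i) (f i) \<cdot> ?e"
          by (rule comp_eq_extend[OF h(2)[OF that]]) (use ht pt[OF that] y in auto)
        then show ?thesis using fle[of "X i" "f i"] pt[OF that] f that by simp
      qed
      then show "h \<cdot> ?e \<in> homs K y (fst P) \<and> (\<forall>i\<in>I. und_arrow (p i) \<cdot> (h \<cdot> ?e) = f i)"
        using ht y by (simp add: homs_iff)
      fix k assume k: "k \<in> homs K y (fst P) \<and> (\<forall>i\<in>I. und_arrow (p i) \<cdot> k = f i)"
      have "fl P k = h" by (rule u) (use k P fl flp in auto)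
      then show "k = h \<cdot> ?e" using fle[OF P, of k] k by simp
    qed
  qed
qed

text \<open>Linearity of the induced arrow may be tested after the projections, which are linear and
  jointly cancellable.\<close>

lemma MC_product_cone:
  assumes c: "product_cone K I (\<lambda>i. fst (X i)) (fst P) p" and P: "is_module K A P"
    and l: "\<And>i. i \<in> I \<Longrightarrow> linear_mor K A P (X i) (p i)"
  shows "product_cone MC I X P (\<lambda>i. (P, p i, X i))"
  unfolding product_cone_def
proof (intro conjI ballI allI impI)
  show "P \<in> Ob MC" using P by simp
  show "(P, p i, X i) \<in> homs MC P (X i)" if "i \<in> I" for i using l[OF that] by (simp add: homs_MC)
  fix Y f assume Y: "Y \<in> Ob MC" and f: "\<forall>i\<in>I. f i \<in> homs MC Y (X i)"
  have Ym: "is_module K A Y" using Y by simp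
  have fi: "f i = (Y, und_arrow (f i), X i)" "linear_mor K A Y (X i) (und_arrow (f i))" if "i \<in> I" for i
    using f that by (auto simp: homs_MC)
  have fh: "und_arrow (f i) \<in> homs K (fst Y) (fst (X i))" if "i \<in> I" for i
    using lt[OF fi(2)[OF that]] by (simp add: homs_iff)
  obtain h where h: "h \<in> Ar K" "Dom K h = fst Y" "Cod K h = fst P" "\<And>i. i \<in> I \<Longrightarrow> p i \<cdot> h = und_arrow (f i)"
    using cone_ex[OF c, of "fst Y" "\<lambda>i. und_arrow (f i)"] fh Ym by auto
  have hl: "linear_mor K A Y P h"
    unfolding linear_mor_def
  proof (intro conjI Ym P)
    show "h \<in> homs K (fst Y) (fst P)" using h by (simp add: homs_iff)
    show "h \<cdot> snd Y = snd P \<cdot> (Idn K (Car A) \<boxtimes> h)"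
    proof (rule cone_eq[OF c, of _ "Car A \<odot> fst Y"])
      fix i assume i: "i \<in> I"
      note lti = lt[OF l[OF i]]
      have 1: "p i \<cdot> (h \<cdot> snd Y) = und_arrow (f i) \<cdot> snd Y"
        by (rule comp_eq_extend[OF h(4)[OF i]]) (use h lti Ym in auto)
      have "p i \<cdot> snd P = snd (X i) \<cdot> (Idn K (Car A) \<boxtimes> p i)" using l[OF i] by (simp add: linear_mor_def)
      then have "p i \<cdot> (snd P \<cdot> (Idn K (Car A) \<boxtimes> h)) = (snd (X i) \<cdot> (Idn K (Car A) \<boxtimes> p i)) \<cdot> (Idn K (Car A) \<boxtimes> h)"
        by (rule comp_eq_extend) (use h lti P in auto)
      also have "\<dots> = snd (X i) \<cdot> (Idn K (Car A) \<boxtimes> und_arrow (f i))"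
        using h(1-3) h(4)[OF i] lti by (simp add: ten_comp)
      also have "\<dots> = und_arrow (f i) \<cdot> snd Y" using fi(2)[OF i] by (simp add: linear_mor_def)
      finally show "p i \<cdot> (h \<cdot> snd Y) = p i \<cdot> (snd P \<cdot> (Idn K (Car A) \<boxtimes> h))" using 1 by simp
    qed (use h Ym P in \<open>auto simp: homs_iff\<close>)
  qed
  show "\<exists>!h. h \<in> homs MC Y P \<and> (\<forall>i\<in>I. Comp MC (P, p i, X i) h = f i)"
  proof (rule ex1I[of _ "(Y, h, P)"])
    have "(Y, p i \<cdot> h, X i) = f i" if "i \<in> I" for i using h(4)[OF that] fi(1)[OF that] by simp
    then show "(Y, h, P) \<in> homs MC Y P \<and> (\<forall>i\<in>I. Comp MC (P, p i, X i) (Y, h, P) = f i)"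
      using hl by (simp add: homs_MC)
    fix k assume k: "k \<in> homs MC Y P \<and> (\<forall>i\<in>I. Comp MC (P, p i, X i) k = f i)"
    then obtain k0 where k0: "k = (Y, k0, P)" "linear_mor K A Y P k0" by (auto simp: homs_MC)
    have "k0 = h"
    proof (rule cone_eq[OF c, of _ "fst Y"])
      fix i assume i: "i \<in> I"
      then have "(Y, p i \<cdot> k0, X i) = f i" using k k0 by auto
      then have "p i \<cdot> k0 = und_arrow (f i)" by (metis fst_conv snd_conv)
      then show "p i \<cdot> k0 = p i \<cdot> h" using h(4)[OF i] by simp
    qed (use h lt[OF k0(2)] in \<open>auto simp: homs_iff\<close>)
    then show "k = (Y, h, P)" using k0 by simp
  qed
qed

end

section \<open>The splitting of a separable algebra\<close>

context symmetric_monoidal_category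
begin

lemma biprod_props:
  assumes "biprod I X P p j" "i \<in> I"
  shows "j i \<in> Ar K" "Dom K (j i) = X i" "Cod K (j i) = P" "p i \<in> Ar K" "Dom K (p i) = P" "Cod K (p i) = X i" "P \<in> Ob K"
    "X i \<in> Ob K" "k \<in> I \<Longrightarrow> p i \<cdot> j k = (if i = k then Idn K (X i) else Zer K (X k) (X i))"
proof -
  have c: "product_cone K I X P p" using assms by (simp add: biprod_def)
  show 1: "j i \<in> Ar K" "Dom K (j i) = X i" "Cod K (j i) = P" using assms by (auto simp: biprod_def homs_iff)
  show "p i \<in> Ar K" "Dom K (p i) = P" "Cod K (p i) = X i" "P \<in> Ob K" using cone_typ[OF c] assms(2) by auto
  show "X i \<in> Ob K" using Ob_typ(1)[OF 1(1)] 1(2) by simp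
  show "p i \<cdot> j k = (if i = k then Idn K (X i) else Zer K (X k) (X i))" if "k \<in> I" using assms that by (simp add: biprod_def)
qed

lemma biprod_ext_ten:
  assumes b: "biprod I X P p j" and T: "T \<in> Ob K" and f: "f \<in> homs K (T \<odot> P) y" and g: "g \<in> homs K (T \<odot> P) y"
    and e: "\<And>i. i \<in> I \<Longrightarrow> f \<cdot> (Idn K T \<boxtimes> j i) = g \<cdot> (Idn K T \<boxtimes> j i)"
  shows "f = g"
  using b T f g e unfolding biprod_def by blast

text \<open>The tensored detection of \<open>biprod\<close> for T the unit object, brought back by
  the left unitor.\<close>

lemma biprod_ext:
  assumes b: "biprod I X P p j" and P: "P \<in> Ob K" and f: "f \<in> homs K P y" and g: "g \<in> homs K P y"
    and e: "\<And>i. i \<in> I \<Longrightarrow> f \<cdot> j i = g \<cdot> j i"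
  shows "f = g"
proof -
  have "f \<cdot> Lun K P = g \<cdot> Lun K P"
  proof (rule biprod_ext_ten[OF b, of "Unit K" _ y])
    fix i assume i: "i \<in> I"
    note t = biprod_props[OF b i]
    have "(f \<cdot> Lun K P) \<cdot> (Idn K (Unit K) \<boxtimes> j i) = (f \<cdot> j i) \<cdot> Lun K (X i)"
      using lun_nat[of "j i" P] f t by (simp add: homs_iff)
    moreover have "(g \<cdot> Lun K P) \<cdot> (Idn K (Unit K) \<boxtimes> j i) = (g \<cdot> j i) \<cdot> Lun K (X i)"
      using lun_nat[of "j i" P] g t by (simp add: homs_iff)
    ultimately show "(f \<cdot> Lun K P) \<cdot> (Idn K (Unit K) \<boxtimes> j i) = (g \<cdot> Lun K P) \<cdot> (Idn K (Unit K) \<boxtimes> j i)"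
      using e[OF i] by simp
  qed (use P f g in \<open>auto simp: homs_iff\<close>)
  then show ?thesis by (rule iso_cancel_right[rotated -1]) (use P f g in \<open>auto simp: homs_iff\<close>)
qed

text \<open>The data of \<open>B \<otimes>\<^sub>A B \<cong> B \<times> C\<close> for an \<open>A\<close>-algebra \<open>u : A \<rightarrow> B\<close>: \<open>E\<close> is \<open>B \<otimes>\<^sub>A B\<close>, as a split quotient of
  \<open>B \<odot> B\<close>, and \<open>m\<close>, \<open>n\<close> are the projections.\<close>

definition splits where
  "splits A B C u v E q j m n \<longleftrightarrow>
     ring_mor K A B u \<and> ring_mor K B C v \<and> ring_mor K (tensor_ring K B B) E q \<and>
     j \<in> homs K (Car E) (Car B \<odot> Car B) \<and> q \<cdot> j = Idn K (Car E) \<and>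
     (\<forall>k z. k \<in> homs K (Car B \<odot> Car B) z \<longrightarrow>
        (\<forall>r a b. rel A r \<and> rel B a \<and> rel B b \<and> dj r a \<and> dj a r \<and> dj r b \<and> dj b r \<and> dj a b \<and> dj b a \<longrightarrow>
          k \<bullet> ((Mul B \<bullet> ((u \<bullet> r) \<star> a)) \<star> b) = k \<bullet> (a \<star> (Mul B \<bullet> ((u \<bullet> r) \<star> b)))) \<longrightarrow>
        (\<exists>k'\<in>homs K (Car E) z. k' \<cdot> q = k)) \<and>
     (\<forall>r. rel A r \<longrightarrow> q \<bullet> ((u \<bullet> r) \<star> one B) = q \<bullet> (one B \<star> (u \<bullet> r))) \<and>
     ring_mor K E B m \<and> m \<cdot> q = Mul B \<and> ring_mor K E C n \<and>
     (\<forall>b. rel B b \<longrightarrow> n \<bullet> q \<bullet> (b \<star> one B) = v \<bullet> b) \<and>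
     product_cone K UNIV (\<lambda>i. if i then Car B else Car C) (Car E) (\<lambda>i. if i then m else n)"

text \<open>z is any element without variables, not only an idempotent. Since f need not preserve
  units, z is only required to vanish after multiplication with f(1).\<close>

definition disjoint_maps where
  "disjoint_maps B D f f' \<longleftrightarrow> (\<forall>z. el z \<and> fst z = [] \<and> ob z = Car D \<and>
      (\<forall>b. el b \<and> ob b = Car B \<longrightarrow> Mul D \<bullet> (z \<star> (f \<bullet> b)) = Mul D \<bullet> (z \<star> (f' \<bullet> b))) \<longrightarrow> zero (Mul D \<bullet> (z \<star> (f \<bullet> one B))))"

text \<open>The second structure map B \<rightarrow> C, from the right factor of B \<otimes>_A B;
  the given \<open>v\<close> comes from the left factor.\<close>

definition snd_map where "snd_map B q n = n \<cdot> (q \<cdot> ((Unt B \<boxtimes> Idn K (Car B)) \<cdot> inv_arrow K (Lun K (Car B))))"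

context
  fixes A B C u v E q j m n assumes splits: "splits A B C u v E q j m n"
begin

abbreviation v' where "v' \<equiv> snd_map B q n"

lemma split_mors:
  "ring_mor K A B u" "ring_mor K B C v" "ring_mor K (tensor_ring K B B) E q" "ring_mor K E B m" "ring_mor K E C n"
  using splits by (auto simp: splits_def)

lemmas split_mmors = split_mors[THEN ring_mor_mmor]
lemmas split_ones = split_mors[THEN ring_mor_one]

lemma split_typ [simp]:
  "is_ring K A" "is_ring K B" "is_ring K C" "is_ring K E"
  "u \<in> Ar K" "Dom K u = Car A" "Cod K u = Car B" "v \<in> Ar K" "Dom K v = Car B" "Cod K v = Car C"
  "q \<in> Ar K" "Dom K q = Car B \<odot> Car B" "Cod K q = Car E" "m \<in> Ar K" "Dom K m = Car E" "Cod K m = Car B"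
  "n \<in> Ar K" "Dom K n = Car E" "Cod K n = Car C"
  using split_mmors[unfolded mmor_def homs_iff] by auto

lemma j_typ [simp]: "j \<in> Ar K" "Dom K j = Car E" "Cod K j = Car B \<odot> Car B"
  using splits by (auto simp: splits_def homs_iff)

lemma q_surj: "el t \<Longrightarrow> ob t = Car E \<Longrightarrow> q \<bullet> j \<bullet> t = t"
  using splits by (simp add: splits_def flip: comp_app)

lemma m_q [simp]: "el s \<Longrightarrow> ob s = Car B \<odot> Car B \<Longrightarrow> m \<bullet> q \<bullet> s = Mul B \<bullet> s"
  using splits by (simp add: splits_def flip: comp_app)

lemma q_mul:
  assumes "el a" "el b" "el c" "el d" "ob a = Car B" "ob b = Car B" "ob c = Car B" "ob d = Car B"
    "dj a b" "dj a c" "dj a d" "dj b c" "dj b d" "dj c d"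
  shows "Mul E \<bullet> ((q \<bullet> (a \<star> b)) \<star> (q \<bullet> (c \<star> d))) = q \<bullet> ((Mul B \<bullet> (a \<star> c)) \<star> (Mul B \<bullet> (b \<star> d)))"
  using mmor_mul[OF split_mmors(3), of "a \<star> b" "c \<star> d"] assms by simp

lemma n_q_left [simp]: "el b \<Longrightarrow> ob b = Car B \<Longrightarrow> n \<bullet> q \<bullet> (b \<star> one B) = v \<bullet> b"
  using splits unfolding splits_def by blast

lemma v'_typ [simp]: "v' \<in> Ar K" "Dom K v' = Car B" "Cod K v' = Car C"
  by (simp_all add: snd_map_def)

lemma n_q_right [simp]: "el b \<Longrightarrow> ob b = Car B \<Longrightarrow> n \<bullet> q \<bullet> (one B \<star> b) = v' \<bullet> b"
  by (simp add: snd_map_def)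

lemma v'_ring_mor: "ring_mor K B C v'"
  unfolding ring_mor_iff
proof (intro conjI mmorI)
  fix a b assume a: "el a" "el b" "ob a = Car B" "ob b = Car B" "dj a b" "dj b a"
  have "q \<bullet> (one B \<star> (Mul B \<bullet> (a \<star> b))) = Mul E \<bullet> ((q \<bullet> (one B \<star> a)) \<star> (q \<bullet> (one B \<star> b)))"
    using q_mul[of "one B" a "one B" b] a by (simp add: mul_simps)
  then have "n \<bullet> q \<bullet> (one B \<star> (Mul B \<bullet> (a \<star> b))) = n \<bullet> Mul E \<bullet> ((q \<bullet> (one B \<star> a)) \<star> (q \<bullet> (one B \<star> b)))" by simp
  then show "v' \<bullet> Mul B \<bullet> (a \<star> b) = Mul C \<bullet> ((v' \<bullet> a) \<star> (v' \<bullet> b))"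
    using a mmor_mul[OF split_mmors(5), of "q \<bullet> (one B \<star> a)" "q \<bullet> (one B \<star> b)"] by simp
next
  show "v' \<bullet> one B = one C"
    using n_q_left[of "one B"] n_q_right[of "one B"] split_ones(2) by simp
qed (auto simp: homs_iff)

lemma n_q:
  assumes "el a" "el b" "ob a = Car B" "ob b = Car B" "dj a b" "dj b a"
  shows "n \<bullet> q \<bullet> (a \<star> b) = Mul C \<bullet> ((v \<bullet> a) \<star> (v' \<bullet> b))"
proof -
  have "q \<bullet> (a \<star> b) = Mul E \<bullet> ((q \<bullet> (a \<star> one B)) \<star> (q \<bullet> (one B \<star> b)))"
    using q_mul[of a "one B" "one B" b] assms by (simp add: mul_simps)
  then show ?thesis
    using assms mmor_mul[OF split_mmors(5), of "q \<bullet> (a \<star> one B)" "q \<bullet> (one B \<star> b)"] by simp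
qed

lemma v_u: assumes "el r" "ob r = Car A" shows "v \<bullet> u \<bullet> r = v' \<bullet> u \<bullet> r"
proof -
  have "q \<bullet> ((u \<bullet> r) \<star> one B) = q \<bullet> (one B \<star> (u \<bullet> r))" using splits assms unfolding splits_def by blast
  then have "n \<bullet> q \<bullet> ((u \<bullet> r) \<star> one B) = n \<bullet> q \<bullet> (one B \<star> (u \<bullet> r))" by simp
  then show ?thesis using assms by simp
qed

lemma ex_injections:
  obtains iB iC where "iB \<in> homs K (Car B) (Car E)" "iC \<in> homs K (Car C) (Car E)"
    "m \<cdot> iB = Idn K (Car B)" "n \<cdot> iB = Zer K (Car B) (Car C)" "m \<cdot> iC = Zer K (Car C) (Car B)" "n \<cdot> iC = Idn K (Car C)"
    "\<And>f g y. f \<in> homs K (Car E) y \<Longrightarrow> g \<in> homs K (Car E) y \<Longrightarrow> f \<cdot> iB = g \<cdot> iB \<Longrightarrow> f \<cdot> iC = g \<cdot> iC \<Longrightarrow> f = g"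
    "\<And>a b. \<lbrakk>el a; el b; ob a = Car E; ob b = Car E; fst a = fst b; m \<bullet> a = m \<bullet> b; n \<bullet> a = n \<bullet> b\<rbrakk> \<Longrightarrow> a = b"
proof -
  have c: "product_cone K UNIV (\<lambda>i. if i then Car B else Car C) (Car E) (\<lambda>i. if i then m else n)"
    using splits by (simp add: splits_def)
  obtain i where b: "biprod UNIV (\<lambda>i. if i then Car B else Car C) (Car E) (\<lambda>i. if i then m else n) i"
    using cone_biprod[OF _ c] by auto
  note p1 = biprod_props(1-6)[OF b, of True, simplified] and p2 = biprod_props(1-6)[OF b, of False, simplified]
    and p = biprod_props(9)[OF b, OF UNIV_I UNIV_I]
  show ?thesis
  proof (rule that[of "i True" "i False"])
    show "i True \<in> homs K (Car B) (Car E)" "i False \<in> homs K (Car C) (Car E)" using p1 p2 by (auto simp: homs_iff)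
    show "m \<cdot> i True = Idn K (Car B)" "n \<cdot> i True = Zer K (Car B) (Car C)" "m \<cdot> i False = Zer K (Car C) (Car B)" "n \<cdot> i False = Idn K (Car C)"
      using p[of True True] p[of True False] p[of False True] p[of False False] by auto
    fix f g y assume "f \<in> homs K (Car E) y" "g \<in> homs K (Car E) y" "f \<cdot> i True = g \<cdot> i True" "f \<cdot> i False = g \<cdot> i False"
    then have "f \<cdot> i x = g \<cdot> i x" for x by (cases x) auto
    then show "f = g" using biprod_ext[OF b _ \<open>f \<in> _\<close> \<open>g \<in> _\<close>] by simp
  next
    fix a b assume "el a" "el b" "ob a = Car E" "ob b = Car E" "fst a = fst b" "m \<bullet> a = m \<bullet> b" "n \<bullet> a = n \<bullet> b"
    then show "a = b" using cone_el_eq[OF c, of a b] by auto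
  qed
qed

text \<open>\<open>v\<close> and \<open>v'\<close> agree on no nonzero part of \<open>C\<close>.\<close>

lemma split_disjoint:
  assumes g: "ring_mor K C D g" and c: "el c" "fst c = []" "ob c = Car D"
    and e: "\<And>b. el b \<Longrightarrow> ob b = Car B \<Longrightarrow> Mul D \<bullet> (c \<star> (g \<bullet> v \<bullet> b)) = Mul D \<bullet> (c \<star> (g \<bullet> v' \<bullet> b))"
  shows "zero c"
proof -
  note gm = ring_mor_mmor[OF g]
  note gt = mmor_typ[OF gm]
  obtain iB iC where i: "iB \<in> homs K (Car B) (Car E)" "m \<cdot> iB = Idn K (Car B)" "n \<cdot> iB = Zer K (Car B) (Car C)"
    using ex_injections by metis
  have it: "iB \<in> Ar K" "Dom K iB = Car B" "Cod K iB = Car E" using i by (auto simp: homs_iff)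
  \<comment> \<open>Once c identifies \<open>v\<close> with \<open>v'\<close>, the image v a \<cdot>
    v' b of a tensor depends only on the product a b, that is on \<open>m\<close>. The element
    \<open>iB \<bullet> one B\<close>, where \<open>m\<close> is 1 and \<open>n\<close> is 0, then
    gives c = 0.\<close>
  have step: "Mul D \<bullet> (c \<star> (g \<bullet> n \<bullet> q \<bullet> s)) = Mul D \<bullet> (c \<star> (g \<bullet> v' \<bullet> m \<bullet> q \<bullet> s))"
    if s: "el s" "ob s = Car B \<odot> Car B" for s
  proof (rule lin_ext[where e = s and x = "Car B" and y = "Car B" and L = "\<lambda>s. Mul D \<bullet> (c \<star> (g \<bullet> n \<bullet> q \<bullet> s))" and R = "\<lambda>s. Mul D \<bullet> (c \<star> (g \<bullet> v' \<bullet> m \<bullet> q \<bullet> s))"],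
      (rule lin_intros | use c gt s in \<open>simp; fail\<close>)+)
    fix a b assume ab: "el a" "el b" "ob a = Car B" "ob b = Car B" "dj a b" "dj b a"
    have "Mul D \<bullet> (c \<star> (g \<bullet> n \<bullet> q \<bullet> (a \<star> b))) = Mul D \<bullet> ((Mul D \<bullet> (c \<star> (g \<bullet> v \<bullet> a))) \<star> (g \<bullet> v' \<bullet> b))"
      using ab c gt by (simp add: n_q mmor_mul[OF gm] mul_assoc)
    also have "\<dots> = Mul D \<bullet> ((Mul D \<bullet> (c \<star> (g \<bullet> v' \<bullet> a))) \<star> (g \<bullet> v' \<bullet> b))" using e ab by simp
    also have "\<dots> = Mul D \<bullet> (c \<star> (g \<bullet> v' \<bullet> m \<bullet> q \<bullet> (a \<star> b)))"
      using ab c gt by (simp add: mmor_mul[OF gm] mmor_mul[OF ring_mor_mmor[OF v'_ring_mor]] mul_assoc)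
    finally show "Mul D \<bullet> (c \<star> (g \<bullet> n \<bullet> q \<bullet> (a \<star> b))) = Mul D \<bullet> (c \<star> (g \<bullet> v' \<bullet> m \<bullet> q \<bullet> (a \<star> b)))" .
  qed
  have t: "Mul D \<bullet> (c \<star> (g \<bullet> n \<bullet> t)) = Mul D \<bullet> (c \<star> (g \<bullet> v' \<bullet> m \<bullet> t))" if "el t" "ob t = Car E" for t
    using step[of "j \<bullet> t"] that q_surj by simp
  have "n \<bullet> iB \<bullet> b = Zer K (Car B) (Car C) \<bullet> b" "m \<bullet> iB \<bullet> b = b" if "el b" "ob b = Car B" for b
    using i it that by (simp_all flip: comp_app del: comp_app)
  from this[of "one B"] have "Mul D \<bullet> (c \<star> (g \<bullet> (Zer K (Car B) (Car C) \<bullet> one B))) = c"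
    using t[of "iB \<bullet> one B"] it ring_mor_one[OF v'_ring_mor] ring_mor_one[OF g] c gt by (simp add: mul_simps)
  moreover have "zero (Mul D \<bullet> (c \<star> (g \<bullet> (Zer K (Car B) (Car C) \<bullet> one B))))" using c gt by simp
  ultimately show ?thesis by simp
qed

text \<open>\<open>v\<close> and \<open>v'\<close> generate \<open>C\<close>.\<close>

lemma split_generate:
  assumes g: "ring_mor K C D g" and g': "ring_mor K C D g'" and c: "el c" "fst c = []" "ob c = Car D"
    and e: "\<And>b. el b \<Longrightarrow> ob b = Car B \<Longrightarrow> Mul D \<bullet> (c \<star> (g \<bullet> v \<bullet> b)) = Mul D \<bullet> (c \<star> (g' \<bullet> v \<bullet> b))"
    and e': "\<And>b. el b \<Longrightarrow> ob b = Car B \<Longrightarrow> Mul D \<bullet> (c \<star> (g \<bullet> v' \<bullet> b)) = Mul D \<bullet> (c \<star> (g' \<bullet> v' \<bullet> b))"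
    and x: "el x" "ob x = Car C"
  shows "Mul D \<bullet> (c \<star> (g \<bullet> x)) = Mul D \<bullet> (c \<star> (g' \<bullet> x))"
proof -
  note gm = ring_mor_mmor[OF g] and gm' = ring_mor_mmor[OF g']
  note gt = mmor_typ[OF gm] mmor_typ[OF gm']
  \<comment> \<open>Every x of C is the image under \<open>n\<close> of
    \<open>iC \<bullet> x\<close>, and \<open>n\<close> sends the class of a \<otimes> b to v a
    \<cdot> v' b.\<close>
  obtain iC where i: "iC \<in> homs K (Car C) (Car E)" "n \<cdot> iC = Idn K (Car C)"
    using ex_injections by metis
  have it: "iC \<in> Ar K" "Dom K iC = Car C" "Cod K iC = Car E" using i by (auto simp: homs_iff)
  have step: "Mul D \<bullet> (c \<star> (g \<bullet> n \<bullet> q \<bullet> s)) = Mul D \<bullet> (c \<star> (g' \<bullet> n \<bullet> q \<bullet> s))"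
    if s: "el s" "ob s = Car B \<odot> Car B" for s
  proof (rule lin_ext[where e = s and x = "Car B" and y = "Car B" and L = "\<lambda>s. Mul D \<bullet> (c \<star> (g \<bullet> n \<bullet> q \<bullet> s))" and R = "\<lambda>s. Mul D \<bullet> (c \<star> (g' \<bullet> n \<bullet> q \<bullet> s))"],
      (rule lin_intros | use c gt s in \<open>simp; fail\<close>)+)
    fix a b assume ab: "el a" "el b" "ob a = Car B" "ob b = Car B" "dj a b" "dj b a"
    have "Mul D \<bullet> (c \<star> (g \<bullet> n \<bullet> q \<bullet> (a \<star> b))) = Mul D \<bullet> ((Mul D \<bullet> (c \<star> (g \<bullet> v \<bullet> a))) \<star> (g \<bullet> v' \<bullet> b))"
      using ab c gt by (simp add: n_q mmor_mul[OF gm] mul_assoc)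
    also have "\<dots> = Mul D \<bullet> ((Mul D \<bullet> (c \<star> (g' \<bullet> v \<bullet> a))) \<star> (g \<bullet> v' \<bullet> b))" using e ab by simp
    also have "\<dots> = Mul D \<bullet> ((g' \<bullet> v \<bullet> a) \<star> (Mul D \<bullet> (c \<star> (g \<bullet> v' \<bullet> b))))"
      using ab c gt by (simp add: mul_ac)
    also have "\<dots> = Mul D \<bullet> ((g' \<bullet> v \<bullet> a) \<star> (Mul D \<bullet> (c \<star> (g' \<bullet> v' \<bullet> b))))" using e' ab by simp
    also have "\<dots> = Mul D \<bullet> (c \<star> (g' \<bullet> n \<bullet> q \<bullet> (a \<star> b)))"
      using ab c gt by (simp add: n_q mmor_mul[OF gm'] mul_ac)
    finally show "Mul D \<bullet> (c \<star> (g \<bullet> n \<bullet> q \<bullet> (a \<star> b))) = Mul D \<bullet> (c \<star> (g' \<bullet> n \<bullet> q \<bullet> (a \<star> b)))" .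
  qed
  have t: "Mul D \<bullet> (c \<star> (g \<bullet> n \<bullet> t)) = Mul D \<bullet> (c \<star> (g' \<bullet> n \<bullet> t))" if "el t" "ob t = Car E" for t
    using step[of "j \<bullet> t"] that q_surj by simp
  have "n \<bullet> iC \<bullet> x = x" using i it x by (simp flip: comp_app del: comp_app)
  then show ?thesis using t[of "iC \<bullet> x"] it x by simp
qed

text \<open>\<open>f\<close> and \<open>f'\<close> agree on A, so a \<otimes> b \<mapsto> f a
  \<cdot> f' b factors through B \<otimes>_A B = B \<times> C. On the image of (1, 0) the maps
  \<open>f\<close> and \<open>f'\<close> agree; disjointness makes it zero, and the factorisation
  lives on C alone.\<close>

lemma split_extend:
  assumes f: "mmor B D f" and f': "mmor B D f'" and one: "f \<bullet> one B = f' \<bullet> one B"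
    and fu: "\<And>r. el r \<Longrightarrow> ob r = Car A \<Longrightarrow> f \<bullet> u \<bullet> r = f' \<bullet> u \<bullet> r"
    and d: "disjoint_maps B D f f'"
  obtains g where "mmor C D g" "g \<cdot> v = f" "g \<cdot> v' = f'" "g \<bullet> one C = f \<bullet> one B"
proof -
  note ft = mmor_typ[OF f] mmor_typ[OF f']
  note fm = mmor_mul[OF f] and fm' = mmor_mul[OF f']
  let ?k = "Mul D \<cdot> (f \<boxtimes> f')"
  have k: "mmor (tensor_ring K B B) D ?k" by (rule pair_mmor[OF f f'])
  \<comment> \<open>\<open>f\<close> and \<open>f'\<close> have the same value at 1, which acts as a
    unit on both images.\<close>
  have f1: "Mul D \<bullet> ((f \<bullet> b) \<star> (f' \<bullet> one B)) = f \<bullet> b" if "el b" "ob b = Car B" for b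
    using fm[of b "one B"] that by (simp add: mul_simps flip: one)
  have f1': "Mul D \<bullet> ((f \<bullet> one B) \<star> (f' \<bullet> b)) = f' \<bullet> b" if "el b" "ob b = Car B" for b
    using fm'[of "one B" b] that by (simp add: mul_simps one)
  have kh: "?k \<in> homs K (Car B \<odot> Car B) (Car D)" using ft by (simp add: homs_iff)
  have "\<exists>k'\<in>homs K (Car E) (Car D). k' \<cdot> q = ?k"
  proof -
    have "?k \<bullet> ((Mul B \<bullet> ((u \<bullet> r) \<star> a)) \<star> b) = ?k \<bullet> (a \<star> (Mul B \<bullet> ((u \<bullet> r) \<star> b)))"
      if "rel A r" "rel B a" "rel B b" "dj r a" "dj a r" "dj r b" "dj b r" "dj a b" "dj b a" for r a b
      using that ft fu[of r] by (simp add: fm fm' mul_ac)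
    then show ?thesis using splits kh unfolding splits_def by blast
  qed
  then obtain k' where k': "k' \<in> Ar K" "Dom K k' = Car E" "Cod K k' = Car D" "k' \<cdot> q = ?k" by (auto simp: homs_iff)
  have kq: "k' \<bullet> q \<bullet> s = ?k \<bullet> s" if "el s" "ob s = Car B \<odot> Car B" for s
    using k' that by (simp flip: comp_app del: comp_app)
  have k'm: "k' \<bullet> Mul E \<bullet> (s \<star> t) = Mul D \<bullet> ((k' \<bullet> s) \<star> (k' \<bullet> t))" if "el s" "el t" "ob s = Car E" "ob t = Car E" for s t
  proof -
    have "Mul E \<bullet> (s \<star> t) = q \<bullet> Mul (tensor_ring K B B) \<bullet> ((j \<bullet> s) \<star> (j \<bullet> t))"
      using mmor_mul[OF split_mmors(3), of "j \<bullet> s" "j \<bullet> t"] that q_surj by simp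
    then have "k' \<bullet> Mul E \<bullet> (s \<star> t) = ?k \<bullet> Mul (tensor_ring K B B) \<bullet> ((j \<bullet> s) \<star> (j \<bullet> t))"
      using kq[of "Mul (tensor_ring K B B) \<bullet> ((j \<bullet> s) \<star> (j \<bullet> t))"] that tensor_ring_typ[of B B] by (simp add: homs_iff)
    also have "\<dots> = Mul D \<bullet> ((?k \<bullet> j \<bullet> s) \<star> (?k \<bullet> j \<bullet> t))"
      using mmor_mul[OF k, of "j \<bullet> s" "j \<bullet> t"] that by (simp del: comp_app)
    also have "\<dots> = Mul D \<bullet> ((k' \<bullet> s) \<star> (k' \<bullet> t))"
      using kq[of "j \<bullet> s"] kq[of "j \<bullet> t"] that q_surj by (simp del: comp_app)
    finally show ?thesis .
  qed
  obtain iB iC where i: "iB \<in> homs K (Car B) (Car E)" "iC \<in> homs K (Car C) (Car E)"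
    "m \<cdot> iB = Idn K (Car B)" "n \<cdot> iB = Zer K (Car B) (Car C)" "m \<cdot> iC = Zer K (Car C) (Car B)" "n \<cdot> iC = Idn K (Car C)"
    and iext: "\<And>f g y. f \<in> homs K (Car E) y \<Longrightarrow> g \<in> homs K (Car E) y \<Longrightarrow> f \<cdot> iB = g \<cdot> iB \<Longrightarrow> f \<cdot> iC = g \<cdot> iC \<Longrightarrow> f = g"
    and ieq: "\<And>a b. \<lbrakk>el a; el b; ob a = Car E; ob b = Car E; fst a = fst b; m \<bullet> a = m \<bullet> b; n \<bullet> a = n \<bullet> b\<rbrakk> \<Longrightarrow> a = b"
    by (rule ex_injections) blast
  have it: "iB \<in> Ar K" "Dom K iB = Car B" "Cod K iB = Car E" "iC \<in> Ar K" "Dom K iC = Car C" "Cod K iC = Car E"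
    using i by (auto simp: homs_iff)
  have mi: "m \<bullet> iB \<bullet> b = b" "n \<bullet> iB \<bullet> b = Zer K (Car B) (Car C) \<bullet> b" if "el b" "ob b = Car B" for b
    using i it that by (simp_all flip: comp_app del: comp_app)
  have ni: "n \<bullet> iC \<bullet> b = b" "m \<bullet> iC \<bullet> b = Zer K (Car C) (Car B) \<bullet> b" if "el b" "ob b = Car C" for b
    using i it that by (simp_all flip: comp_app del: comp_app)
  note mm = mmor_mul[OF split_mmors(4)] and nm = mmor_mul[OF split_mmors(5)]
  \<comment> \<open>The image in D of the idempotent (1, 0). Its product with f b, and likewise with
    f' b, is the image of (b, 0), so \<open>f\<close> and \<open>f'\<close> agree on it.\<close>
  define z where "z = k' \<bullet> iB \<bullet> one B"
  have z: "el z" "fst z = []" "ob z = Car D" using it k' by (auto simp: z_def)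
  have eB_left: "Mul E \<bullet> ((iB \<bullet> one B) \<star> (q \<bullet> (b \<star> one B))) = iB \<bullet> b" if b: "el b" "ob b = Car B" for b
  proof (rule ieq)
    show "m \<bullet> Mul E \<bullet> ((iB \<bullet> one B) \<star> (q \<bullet> (b \<star> one B))) = m \<bullet> iB \<bullet> b"
      using b it by (simp add: mm mi mul_simps)
    show "n \<bullet> Mul E \<bullet> ((iB \<bullet> one B) \<star> (q \<bullet> (b \<star> one B))) = n \<bullet> iB \<bullet> b"
      by (rule zero_unique) (use b it in \<open>simp_all add: nm mi\<close>)
  qed (use b it in simp_all)
  have eB_right: "Mul E \<bullet> ((iB \<bullet> one B) \<star> (q \<bullet> (one B \<star> b))) = iB \<bullet> b" if b: "el b" "ob b = Car B" for b
  proof (rule ieq)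
    show "m \<bullet> Mul E \<bullet> ((iB \<bullet> one B) \<star> (q \<bullet> (one B \<star> b))) = m \<bullet> iB \<bullet> b"
      using b it by (simp add: mm mi mul_simps)
    show "n \<bullet> Mul E \<bullet> ((iB \<bullet> one B) \<star> (q \<bullet> (one B \<star> b))) = n \<bullet> iB \<bullet> b"
      by (rule zero_unique) (use b it in \<open>simp_all add: nm mi\<close>)
  qed (use b it in simp_all)
  have zf: "Mul D \<bullet> (z \<star> (f \<bullet> b)) = k' \<bullet> iB \<bullet> b" if b: "el b" "ob b = Car B" for b
  proof -
    have "k' \<bullet> Mul E \<bullet> ((iB \<bullet> one B) \<star> (q \<bullet> (b \<star> one B))) = Mul D \<bullet> (z \<star> (k' \<bullet> q \<bullet> (b \<star> one B)))"
      using k'm[of "iB \<bullet> one B" "q \<bullet> (b \<star> one B)"] b it by (simp add: z_def)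
    then show ?thesis using b it ft by (simp add: eB_left kq f1)
  qed
  have zf': "Mul D \<bullet> (z \<star> (f' \<bullet> b)) = k' \<bullet> iB \<bullet> b" if b: "el b" "ob b = Car B" for b
  proof -
    have "k' \<bullet> Mul E \<bullet> ((iB \<bullet> one B) \<star> (q \<bullet> (one B \<star> b))) = Mul D \<bullet> (z \<star> (k' \<bullet> q \<bullet> (one B \<star> b)))"
      using k'm[of "iB \<bullet> one B" "q \<bullet> (one B \<star> b)"] b it by (simp add: z_def)
    then show ?thesis using b it ft by (simp add: eB_right kq f1')
  qed
  have "zero (Mul D \<bullet> (z \<star> (f \<bullet> one B)))"
    by (rule d[unfolded disjoint_maps_def, THEN spec, THEN mp]) (use z zf zf' in simp)
  then have z0: "zero z" using zf[of "one B"] by (simp add: z_def)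
  let ?g = "k' \<cdot> iC"
  \<comment> \<open>As \<open>z\<close> vanishes, \<open>k'\<close> vanishes on the whole summand B
    and hence factors through \<open>n\<close>.\<close>
  have gn: "k' = ?g \<cdot> n"
  proof (rule iext[of _ "Car D"])
    have "k' \<cdot> iB = Zer K (Car B) (Car D)"
    proof (rule ext1[of _ "Car B"])
      fix b assume b: "el b" "ob b = Car B"
      have "zero (k' \<bullet> iB \<bullet> b)" using zf[OF b, symmetric] z z0 b ft by simp
      then show "(k' \<cdot> iB) \<bullet> b = Zer K (Car B) (Car D) \<bullet> b"
        by (intro zero_unique) (use b it k' ft in simp_all)
    qed (use it k' ft in \<open>auto simp: homs_iff\<close>)
    then show "k' \<cdot> iB = (?g \<cdot> n) \<cdot> iB" using i it k' ft by simp
    show "k' \<cdot> iC = (?g \<cdot> n) \<cdot> iC" using i it k' by simp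
  qed (use it k' in \<open>auto simp: homs_iff\<close>)
  have gna: "?g \<bullet> n \<bullet> t = k' \<bullet> t" if "el t" "ob t = Car E" for t
  proof -
    have "(?g \<cdot> n) \<bullet> t = k' \<bullet> t" using gn by simp
    then show ?thesis using that it k' by simp
  qed
  have "mmor C D ?g"
  proof (rule mmorI)
    fix a b assume ab: "el a" "el b" "ob a = Car C" "ob b = Car C" "dj a b" "dj b a"
    have "Mul E \<bullet> ((iC \<bullet> a) \<star> (iC \<bullet> b)) = iC \<bullet> Mul C \<bullet> (a \<star> b)"
    proof (rule ieq)
      show "n \<bullet> Mul E \<bullet> ((iC \<bullet> a) \<star> (iC \<bullet> b)) = n \<bullet> iC \<bullet> Mul C \<bullet> (a \<star> b)"
        using ab it by (simp add: nm ni)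
      show "m \<bullet> Mul E \<bullet> ((iC \<bullet> a) \<star> (iC \<bullet> b)) = m \<bullet> iC \<bullet> Mul C \<bullet> (a \<star> b)"
        by (rule zero_unique) (use ab it in \<open>simp_all add: mm ni\<close>)
    qed (use ab it in simp_all)
    then show "?g \<bullet> Mul C \<bullet> (a \<star> b) = Mul D \<bullet> ((?g \<bullet> a) \<star> (?g \<bullet> b))"
      using k'm[of "iC \<bullet> a" "iC \<bullet> b"] ab it k' by simp
  qed (use it k' ft in \<open>auto simp: homs_iff\<close>)
  moreover have "?g \<cdot> v = f"
  proof (rule ext1[of _ "Car B"])
    fix b assume b: "el b" "ob b = Car B"
    have "?g \<bullet> v \<bullet> b = ?g \<bullet> n \<bullet> q \<bullet> (b \<star> one B)" using b by simp
    also have "\<dots> = f \<bullet> b" using gna[of "q \<bullet> (b \<star> one B)"] b kq[of "b \<star> one B"] ft f1 by simp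
    finally show "(?g \<cdot> v) \<bullet> b = f \<bullet> b" using b it k' by simp
  qed (use it k' ft in \<open>auto simp: homs_iff\<close>)
  moreover have "?g \<cdot> v' = f'"
  proof (rule ext1[of _ "Car B"])
    fix b assume b: "el b" "ob b = Car B"
    have "?g \<bullet> v' \<bullet> b = ?g \<bullet> n \<bullet> q \<bullet> (one B \<star> b)" using b by simp
    also have "\<dots> = f' \<bullet> b" using gna[of "q \<bullet> (one B \<star> b)"] b kq[of "one B \<star> b"] ft f1' by simp
    finally show "(?g \<cdot> v') \<bullet> b = f' \<bullet> b" using b it k' by simp
  qed (use it k' ft in \<open>auto simp: homs_iff\<close>)
  moreover have "?g \<bullet> one C = f \<bullet> one B"
  proof -
    have "(?g \<cdot> v) \<bullet> one B = f \<bullet> one B" using \<open>?g \<cdot> v = f\<close> by simp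
    then show ?thesis using split_ones(2) it k' by simp
  qed
  ultimately show ?thesis by (rule that)
qed

end
end

section \<open>From splitting algebras in the module category to rings in K\<close>

context separable
begin

lemma inv_asM_app [simp]:
  assumes "is_module K A M" "is_module K A N" "is_module K A P"
    "el m" "el n" "el p" "ob m = fst M" "ob n = fst N" "ob p = fst P" "dj m n" "dj m p" "dj n p"
  shows "inv_arrow K (asM M N P) \<bullet> Q M (T N P) \<bullet> (m \<star> (Q N P \<bullet> (n \<star> p))) = Q (T M N) P \<bullet> ((Q M N \<bullet> (m \<star> n)) \<star> p)"
  by (rule inv_app_eq) (use assms in auto)

text \<open>Separability is transitive: the splitting over A followed by \<open>sct\<close> splits
  the multiplication in K. \<open>L\<close> and \<open>R\<close> say that \<open>sct\<close>
  commutes with multiplication on the outer right and on the outer left; the x_i and y_i hidden in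
  \<open>eps\<close> can be pulled out because the multiplication is A-linear.\<close>

lemma und_separable:
  assumes "separable_ring MC S" shows "separable_ring K (UR S)"
proof -
  let ?X = "Car S" and ?m = "und_arrow (Mul S)"
  let ?I = "Idn K (fst ?X)"
  have S: "is_ring MC S" using assms by (simp add: separable_ring_def)
  note t = mtyp_typ[OF is_ring_mtyp[OF S]]
  note X = t(1)
  have e: "Mul S = (T ?X ?X, ?m, ?X)" using is_ring_mtyp[OF S] unfolding mtyp_def by blast
  obtain s where s: "s \<in> homs MC ?X (TenO MC ?X ?X)" and s1: "Comp MC (Mul S) s = Idn MC ?X"
    and s2: "Comp MC (TenA MC (Idn MC ?X) (Mul S)) (Comp MC (Asc MC ?X ?X ?X) (TenA MC s (Idn MC ?X))) = Comp MC s (Mul S)"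
    and s3: "Comp MC (TenA MC (Mul S) (Idn MC ?X)) (Comp MC (inv_arrow MC (Asc MC ?X ?X ?X)) (TenA MC (Idn MC ?X) s)) = Comp MC s (Mul S)"
    using assms unfolding separable_ring_def Let_def by blast
  obtain s0 where s0: "s = (?X, s0, T ?X ?X)" and l: "linear_mor K A ?X (T ?X ?X) s0" using s unfolding homs_MC by auto
  note st = lt[OF l]
  have iv: "inv_arrow MC (T (T ?X ?X) ?X, asM ?X ?X ?X, T ?X (T ?X ?X)) = (T ?X (T ?X ?X), inv_arrow K (asM ?X ?X ?X), T (T ?X ?X) ?X)"
    by (rule iso_MC(3)) (use X in auto)
  define M where "M = ?m"
  have M: "Mul S = (T ?X ?X, M, ?X)" "M = ?m" unfolding M_def by (rule e, rule refl)
  have q1: "M \<cdot> s0 = ?I" using s1 unfolding M(1) s0 by simp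
  have q2: "tnA ?X ?I ?X (T ?X ?X) M ?X \<cdot> (asM ?X ?X ?X \<cdot> tnA ?X s0 (T ?X ?X) ?X ?I ?X) = s0 \<cdot> M"
    using s2 unfolding M(1) s0 by simp
  have q3: "tnA (T ?X ?X) M ?X ?X ?I ?X \<cdot> (inv_arrow K (asM ?X ?X ?X) \<cdot> tnA ?X ?I ?X ?X s0 (T ?X ?X)) = s0 \<cdot> M"
    using s3 unfolding M(1) s0 by (simp add: iv)
  have lI: "linear_mor K A ?X ?X ?I" and lM: "linear_mor K A (T ?X ?X) ?X M" using X t(8) unfolding M(2) by auto
  note Mt = lt[OF lM]
  let ?mu = "M \<cdot> Q ?X ?X" and ?s = "sct ?X ?X \<cdot> s0" and ?x = "fst ?X"
  have e1: "Mul (UR S) = ?mu" "Car (UR S) = ?x" unfolding M(2) by simp_all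
  have mu_lin: "M \<bullet> Q ?X ?X \<bullet> ((snd ?X \<bullet> (r \<star> a)) \<star> b) = snd ?X \<bullet> (r \<star> (M \<bullet> Q ?X ?X \<bullet> (a \<star> b)))"
    if "el r" "el a" "el b" "ob r = Car A" "ob a = ?x" "ob b = ?x" "dj r a" "dj r b" "dj a b" for r a b
    using a_linear_act[OF lM, of r "Q ?X ?X \<bullet> (a \<star> b)"] that X by (simp add: tensor_act(2))
  have L: "(Idn K ?x \<boxtimes> ?mu) \<bullet> Asc K ?x ?x ?x \<bullet> ((sct ?X ?X \<bullet> t) \<star> b) = sct ?X ?X \<bullet> tnA ?X ?I ?X (T ?X ?X) M ?X \<bullet> asM ?X ?X ?X \<bullet> Q (T ?X ?X) ?X \<bullet> (t \<star> b)"
    if tb: "el t" "ob t = fst (T ?X ?X)" "el b" "ob b = ?x" "dj t b" "dj b t" for t b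
  proof (rule quot_wlog[OF X X, where t = t and L = "\<lambda>t. (Idn K ?x \<boxtimes> ?mu) \<bullet> Asc K ?x ?x ?x \<bullet> ((sct ?X ?X \<bullet> t) \<star> b)"
        and R = "\<lambda>t. sct ?X ?X \<bullet> tnA ?X ?I ?X (T ?X ?X) M ?X \<bullet> asM ?X ?X ?X \<bullet> Q (T ?X ?X) ?X \<bullet> (t \<star> b)"],
      (rule lin_intros | use tb X lI lM Mt in \<open>simp; fail\<close>)+)
    fix x y assume xy: "el x" "el y" "ob x = ?x" "ob y = ?x" "dj x y" "dj y x"
      "dst (mrg [] (fst b)) (fst x)" "dst (mrg [] (fst b)) (fst y)" "dst (fst x) (mrg [] (fst b))" "dst (fst y) (mrg [] (fst b))"
    have ea: "eps ?X ?X \<bullet> (x \<star> y) = (snd ?X \<boxtimes> snd ?X) \<bullet> middle_swap K (Car A) (Car A) ?x ?x \<bullet> (se \<star> (x \<star> y))" by (rule eps_app[OF X X]) (use xy in simp_all)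
    have eb: "eps ?X ?X \<bullet> (x \<star> (M \<bullet> Q ?X ?X \<bullet> (y \<star> b))) = (snd ?X \<boxtimes> snd ?X) \<bullet> middle_swap K (Car A) (Car A) ?x ?x \<bullet> (se \<star> (x \<star> (M \<bullet> Q ?X ?X \<bullet> (y \<star> b))))" by (rule eps_app[OF X X]) (use xy tb X Mt in simp_all)
    have "(Idn K ?x \<boxtimes> ?mu) \<bullet> Asc K ?x ?x ?x \<bullet> ((eps ?X ?X \<bullet> (x \<star> y)) \<star> b) = eps ?X ?X \<bullet> (x \<star> (M \<bullet> Q ?X ?X \<bullet> (y \<star> b)))"
      unfolding ea eb
      by (rule lin_ext[where x = "Car A" and y = "Car A" and e = se and
         L = "\<lambda>e. (Idn K ?x \<boxtimes> ?mu) \<bullet> Asc K ?x ?x ?x \<bullet> (((snd ?X \<boxtimes> snd ?X) \<bullet> middle_swap K (Car A) (Car A) ?x ?x \<bullet> (e \<star> (x \<star> y))) \<star> b)" and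
         R = "\<lambda>e. (snd ?X \<boxtimes> snd ?X) \<bullet> middle_swap K (Car A) (Car A) ?x ?x \<bullet> (e \<star> (x \<star> (M \<bullet> Q ?X ?X \<bullet> (y \<star> b))))"],
       (rule lin_intros | use xy tb X Mt in \<open>simp add: mu_lin; fail\<close>)+)
    then show "(Idn K ?x \<boxtimes> ?mu) \<bullet> Asc K ?x ?x ?x \<bullet> ((sct ?X ?X \<bullet> Q ?X ?X \<bullet> (x \<star> y)) \<star> b)
       = sct ?X ?X \<bullet> tnA ?X ?I ?X (T ?X ?X) M ?X \<bullet> asM ?X ?X ?X \<bullet> Q (T ?X ?X) ?X \<bullet> ((Q ?X ?X \<bullet> (x \<star> y)) \<star> b)"
      using xy tb X lI lM Mt by simp
  qed
  have R: "(?mu \<boxtimes> Idn K ?x) \<bullet> inv_arrow K (Asc K ?x ?x ?x) \<bullet> (a \<star> (sct ?X ?X \<bullet> t)) = sct ?X ?X \<bullet> tnA (T ?X ?X) M ?X ?X ?I ?X \<bullet> inv_arrow K (asM ?X ?X ?X) \<bullet> Q ?X (T ?X ?X) \<bullet> (a \<star> t)"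
    if tb: "el t" "ob t = fst (T ?X ?X)" "el a" "ob a = ?x" "dj t a" "dj a t" for t a
  proof (rule quot_wlog[OF X X, where t = t and L = "\<lambda>t. (?mu \<boxtimes> Idn K ?x) \<bullet> inv_arrow K (Asc K ?x ?x ?x) \<bullet> (a \<star> (sct ?X ?X \<bullet> t))"
        and R = "\<lambda>t. sct ?X ?X \<bullet> tnA (T ?X ?X) M ?X ?X ?I ?X \<bullet> inv_arrow K (asM ?X ?X ?X) \<bullet> Q ?X (T ?X ?X) \<bullet> (a \<star> t)"],
      (rule lin_intros | use tb X lI lM Mt in \<open>simp; fail\<close>)+)
    fix x y assume xy: "el x" "el y" "ob x = ?x" "ob y = ?x" "dj x y" "dj y x"
      "dst (mrg (fst a) []) (fst x)" "dst (mrg (fst a) []) (fst y)" "dst (fst x) (mrg (fst a) [])" "dst (fst y) (mrg (fst a) [])"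
    have mu2: "M \<bullet> Q ?X ?X \<bullet> (a \<star> (snd ?X \<bullet> (r \<star> x))) = snd ?X \<bullet> (r \<star> (M \<bullet> Q ?X ?X \<bullet> (a \<star> x)))"
      if "el r" "ob r = Car A" "dj r a" "dj a r" "dj r x" "dj x r" for r
      using quot_act[OF X X, of r a x] mu_lin[of r a x] that xy tb by simp
    have ea: "eps ?X ?X \<bullet> (x \<star> y) = (snd ?X \<boxtimes> snd ?X) \<bullet> middle_swap K (Car A) (Car A) ?x ?x \<bullet> (se \<star> (x \<star> y))" by (rule eps_app[OF X X]) (use xy in simp_all)
    have eb: "eps ?X ?X \<bullet> ((M \<bullet> Q ?X ?X \<bullet> (a \<star> x)) \<star> y) = (snd ?X \<boxtimes> snd ?X) \<bullet> middle_swap K (Car A) (Car A) ?x ?x \<bullet> (se \<star> ((M \<bullet> Q ?X ?X \<bullet> (a \<star> x)) \<star> y))" by (rule eps_app[OF X X]) (use xy tb X Mt in simp_all)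
    have "(?mu \<boxtimes> Idn K ?x) \<bullet> inv_arrow K (Asc K ?x ?x ?x) \<bullet> (a \<star> (eps ?X ?X \<bullet> (x \<star> y))) = eps ?X ?X \<bullet> ((M \<bullet> Q ?X ?X \<bullet> (a \<star> x)) \<star> y)"
      unfolding ea eb
      by (rule lin_ext[where x = "Car A" and y = "Car A" and e = se and
         L = "\<lambda>e. (?mu \<boxtimes> Idn K ?x) \<bullet> inv_arrow K (Asc K ?x ?x ?x) \<bullet> (a \<star> ((snd ?X \<boxtimes> snd ?X) \<bullet> middle_swap K (Car A) (Car A) ?x ?x \<bullet> (e \<star> (x \<star> y))))" and
         R = "\<lambda>e. (snd ?X \<boxtimes> snd ?X) \<bullet> middle_swap K (Car A) (Car A) ?x ?x \<bullet> (e \<star> ((M \<bullet> Q ?X ?X \<bullet> (a \<star> x)) \<star> y))"],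
       (rule lin_intros | use xy tb X Mt in \<open>simp add: mu2; fail\<close>)+)
    then show "(?mu \<boxtimes> Idn K ?x) \<bullet> inv_arrow K (Asc K ?x ?x ?x) \<bullet> (a \<star> (sct ?X ?X \<bullet> Q ?X ?X \<bullet> (x \<star> y)))
       = sct ?X ?X \<bullet> tnA (T ?X ?X) M ?X ?X ?I ?X \<bullet> inv_arrow K (asM ?X ?X ?X) \<bullet> Q ?X (T ?X ?X) \<bullet> (a \<star> (Q ?X ?X \<bullet> (x \<star> y)))"
      using xy tb X lI lM Mt by simp
  qed
  show ?thesis
    unfolding separable_ring_def Let_def e1
  proof (intro conjI bexI[of _ ?s] und_is_ring[OF S])
    show "?s \<in> homs K ?x (?x \<odot> ?x)" using X st by (simp add: homs_iff)
    show "?mu \<cdot> ?s = Idn K ?x"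
    proof (rule ext1[of _ ?x])
      fix a assume a: "el a" "ob a = ?x"
      have "(M \<cdot> s0) \<bullet> a = a" unfolding q1 using a by simp
      then show "(?mu \<cdot> ?s) \<bullet> a = Idn K ?x \<bullet> a" using a X st Mt by simp
    qed (use X st Mt in \<open>auto simp: homs_iff\<close>)
    show "(Idn K ?x \<boxtimes> ?mu) \<cdot> (Asc K ?x ?x ?x \<cdot> (?s \<boxtimes> Idn K ?x)) = ?s \<cdot> ?mu"
    proof (rule ext2[of _ ?x ?x])
      fix a b assume ab: "el a" "el b" "ob a = ?x" "ob b = ?x" "dj a b" "dj b a"
      have "(tnA ?X ?I ?X (T ?X ?X) M ?X \<cdot> (asM ?X ?X ?X \<cdot> tnA ?X s0 (T ?X ?X) ?X ?I ?X)) \<bullet> Q ?X ?X \<bullet> (a \<star> b) = (s0 \<cdot> M) \<bullet> Q ?X ?X \<bullet> (a \<star> b)"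
        unfolding q2 ..
      then have "tnA ?X ?I ?X (T ?X ?X) M ?X \<bullet> asM ?X ?X ?X \<bullet> Q (T ?X ?X) ?X \<bullet> ((s0 \<bullet> a) \<star> b) = s0 \<bullet> M \<bullet> Q ?X ?X \<bullet> (a \<star> b)"
        using ab X st Mt lI lM l by simp
      then show "((Idn K ?x \<boxtimes> ?mu) \<cdot> (Asc K ?x ?x ?x \<cdot> (?s \<boxtimes> Idn K ?x))) \<bullet> (a \<star> b) = (?s \<cdot> ?mu) \<bullet> (a \<star> b)"
        using L[of "s0 \<bullet> a" b] ab X st Mt by (simp del: ten_app) (simp add: ab X st Mt)
    qed (use X st Mt in \<open>auto simp: homs_iff\<close>)
    show "(?mu \<boxtimes> Idn K ?x) \<cdot> (inv_arrow K (Asc K ?x ?x ?x) \<cdot> (Idn K ?x \<boxtimes> ?s)) = ?s \<cdot> ?mu"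
    proof (rule ext2[of _ ?x ?x])
      fix a b assume ab: "el a" "el b" "ob a = ?x" "ob b = ?x" "dj a b" "dj b a"
      have "(tnA (T ?X ?X) M ?X ?X ?I ?X \<cdot> (inv_arrow K (asM ?X ?X ?X) \<cdot> tnA ?X ?I ?X ?X s0 (T ?X ?X))) \<bullet> Q ?X ?X \<bullet> (a \<star> b) = (s0 \<cdot> M) \<bullet> Q ?X ?X \<bullet> (a \<star> b)"
        unfolding q3 ..
      then have "tnA (T ?X ?X) M ?X ?X ?I ?X \<bullet> inv_arrow K (asM ?X ?X ?X) \<bullet> Q ?X (T ?X ?X) \<bullet> (a \<star> (s0 \<bullet> b)) = s0 \<bullet> M \<bullet> Q ?X ?X \<bullet> (a \<star> b)"
        using ab X st Mt lI lM l by simp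
      then show "((?mu \<boxtimes> Idn K ?x) \<cdot> (inv_arrow K (Asc K ?x ?x ?x) \<cdot> (Idn K ?x \<boxtimes> ?s))) \<bullet> (a \<star> b) = (?s \<cdot> ?mu) \<bullet> (a \<star> b)"
        using R[of "s0 \<bullet> b" a] ab X st Mt by (simp del: ten_app) (simp add: ab X st Mt)
    qed (use X st Mt in \<open>auto simp: homs_iff\<close>)
  qed
qed

lemma und_middle_swap:
  assumes m: "is_module K A a" "is_module K A b" "is_module K A c" "is_module K A d"
  obtains h where "middle_swap MC a b c d = (T (T a b) (T c d), h, T (T a c) (T b d))"
    "linear_mor K A (T (T a b) (T c d)) (T (T a c) (T b d)) h"
    "\<And>x y z w. \<lbrakk>el x; el y; el z; el w; ob x = fst a; ob y = fst b; ob z = fst c; ob w = fst d; dj x y; dj x z; dj x w; dj y z; dj y w; dj z w\<rbrakk>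
       \<Longrightarrow> h \<bullet> Q (T a b) (T c d) \<bullet> ((Q a b \<bullet> (x \<star> y)) \<star> (Q c d \<bullet> (z \<star> w))) = Q (T a c) (T b d) \<bullet> ((Q a c \<bullet> (x \<star> z)) \<star> (Q b d \<bullet> (y \<star> w)))"
proof -
  let ?f = "tnA (T b c) (swM b c) (T c b) d (Idn K (fst d)) d"
  let ?g = "asM c b d \<cdot> (?f \<cdot> inv_arrow K (asM b c d))"
  let ?h = "inv_arrow K (asM a c (T b d)) \<cdot> (tnA a (Idn K (fst a)) a (T b (T c d)) ?g (T c (T b d)) \<cdot> asM a b (T c d))"
  have l1: "linear_mor K A (T b (T c d)) (T (T b c) d) (inv_arrow K (asM b c d))" "linear_mor K A (T a (T c (T b d))) (T (T a c) (T b d)) (inv_arrow K (asM a c (T b d)))"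
    using m by (auto intro: linear_inverse)
  have lf: "linear_mor K A (T (T b c) d) (T (T c b) d) ?f" using m by simp
  have lg: "linear_mor K A (T b (T c d)) (T c (T b d)) ?g"
    by (rule linear_comp[OF linear_comp[OF l1(1) lf]]) (use m in simp)
  have lh2: "linear_mor K A (T a (T b (T c d))) (T a (T c (T b d))) (tnA a (Idn K (fst a)) a (T b (T c d)) ?g (T c (T b d)))"
    using m lg by simp
  have lh: "linear_mor K A (T (T a b) (T c d)) (T (T a c) (T b d)) ?h"
    by (rule linear_comp[OF linear_comp[OF _ lh2] l1(2)]) (use m in simp)
  show ?thesis
  proof (rule that[OF _ lh])
    show "middle_swap MC a b c d = (T (T a b) (T c d), ?h, T (T a c) (T b d))"
      using m by (simp add: middle_swap_def iso_MC(3))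
    fix x y z w assume e: "el x" "el y" "el z" "el w" "ob x = fst a" "ob y = fst b" "ob z = fst c" "ob w = fst d" "dj x y" "dj x z" "dj x w" "dj y z" "dj y w" "dj z w"
    show "?h \<bullet> Q (T a b) (T c d) \<bullet> ((Q a b \<bullet> (x \<star> y)) \<star> (Q c d \<bullet> (z \<star> w))) = Q (T a c) (T b d) \<bullet> ((Q a c \<bullet> (x \<star> z)) \<star> (Q b d \<bullet> (y \<star> w)))"
      using m e lg dst_sym[of "fst y" "fst z"] by simp
  qed
qed

text \<open>It lets products in B \<otimes>_A B be computed with tensors in K. The product of
  classes is known from the effect of the middle swap of modules on them.\<close>

lemma quot_ring_mor:
  assumes S: "is_ring MC S" and S': "is_ring MC S'"
  shows "ring_mor K (tensor_ring K (UR S) (UR S')) (UR (tensor_ring MC S S')) (Q (Car S) (Car S'))"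
proof -
  interpret MCi: symmetric_monoidal_category MC by (rule MC_smc)
  let ?X = "Car S" and ?m = "und_arrow (Mul S)" and ?u = "und_arrow (Unt S)"
  let ?X' = "Car S'" and ?m' = "und_arrow (Mul S')" and ?u' = "und_arrow (Unt S')"
  let ?E = "tensor_ring MC S S'"
  note t = mtyp_typ[OF is_ring_mtyp[OF S]] and t' = mtyp_typ[OF is_ring_mtyp[OF S']]
  have E: "is_ring MC ?E" by (rule MCi.tensor_ring_is_ring[OF S S'])
  note R = und_is_ring[OF S] und_is_ring[OF S'] und_is_ring[OF E]
  obtain h where h: "middle_swap MC ?X ?X' ?X ?X' = (T (T ?X ?X') (T ?X ?X'), h, T (T ?X ?X) (T ?X' ?X'))"
    and hl: "linear_mor K A (T (T ?X ?X') (T ?X ?X')) (T (T ?X ?X) (T ?X' ?X')) h"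
    and ha: "\<And>x y z w. \<lbrakk>el x; el y; el z; el w; ob x = fst ?X; ob y = fst ?X'; ob z = fst ?X; ob w = fst ?X'; dj x y; dj x z; dj x w; dj y z; dj y w; dj z w\<rbrakk>
       \<Longrightarrow> h \<bullet> Q (T ?X ?X') (T ?X ?X') \<bullet> ((Q ?X ?X' \<bullet> (x \<star> y)) \<star> (Q ?X ?X' \<bullet> (z \<star> w))) = Q (T ?X ?X) (T ?X' ?X') \<bullet> ((Q ?X ?X \<bullet> (x \<star> z)) \<star> (Q ?X' ?X' \<bullet> (y \<star> w)))"
    by (rule und_middle_swap[OF t(1) t'(1) t(1) t'(1)]) blast
  note ht = lt[OF hl]
  have e: "Mul S = (T ?X ?X, ?m, ?X)" "Unt S = (U, ?u, ?X)" "Mul S' = (T ?X' ?X', ?m', ?X')" "Unt S' = (U, ?u', ?X')"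
    using is_ring_mtyp[OF S] is_ring_mtyp[OF S'] unfolding mtyp_def by blast+
  have E1: "Car ?E = T ?X ?X'" by (simp add: tensor_ring_def)
  have "Mul ?E = Comp MC (TenA MC (Mul S) (Mul S')) (middle_swap MC ?X ?X' ?X ?X')" by (simp add: tensor_ring_def)
  also have "\<dots> = Comp MC (TenA MC (T ?X ?X, ?m, ?X) (T ?X' ?X', ?m', ?X')) (T (T ?X ?X') (T ?X ?X'), h, T (T ?X ?X) (T ?X' ?X'))"
    by (simp only: h arg_cong2[OF e(1) e(3), of "TenA MC"])
  finally have E2: "und_arrow (Mul ?E) = tnA (T ?X ?X) ?m ?X (T ?X' ?X') ?m' ?X' \<cdot> h" by simp
  have iv: "inv_arrow MC (T U U, luM U, U) = (U, inv_arrow K (luM U), T U U)" by (rule iso_MC(3)) auto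
  have "Unt ?E = Comp MC (TenA MC (Unt S) (Unt S')) (inv_arrow MC (T U U, luM U, U))" by (simp add: tensor_ring_def)
  also have "\<dots> = Comp MC (TenA MC (U, ?u, ?X) (U, ?u', ?X')) (U, inv_arrow K (luM U), T U U)"
    by (simp only: iv arg_cong2[OF e(2) e(4), of "TenA MC"])
  finally have E3: "und_arrow (Unt ?E) = tnA U ?u ?X U ?u' ?X' \<cdot> inv_arrow K (luM U)" by simp
  show ?thesis
    unfolding ring_mor_iff
  proof
    show "mmor (tensor_ring K (UR S) (UR S')) (UR ?E) (Q ?X ?X')"
      unfolding mmor_def
    proof (intro conjI tensor_ring_is_ring R)
      show "Q ?X ?X' \<in> homs K (Car (tensor_ring K (UR S) (UR S'))) (Car (UR ?E))" using t t' E1 by (simp add: homs_iff)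
      note tt = tensor_ring_typ[OF R(1,2), unfolded homs_iff]
      show "Q ?X ?X' \<cdot> Mul (tensor_ring K (UR S) (UR S')) = Mul (UR ?E) \<cdot> (Q ?X ?X' \<boxtimes> Q ?X ?X')"
      proof (rule ext4[of _ "fst ?X" "fst ?X'" "fst ?X" "fst ?X'"])
        show "Mul (UR ?E) \<cdot> (Q ?X ?X' \<boxtimes> Q ?X ?X') \<in> homs K (fst ?X \<odot> fst ?X' \<odot> (fst ?X \<odot> fst ?X')) (fst (T ?X ?X'))"
          using t t' R E1 E2 ht by (simp add: homs_iff)
      qed (use t t' tt R E1 E2 ht ha in \<open>auto simp: homs_iff\<close>)
    qed
    have "inv_arrow K (luM U) \<bullet> one A = Q U U \<bullet> (one A \<star> one A)"
      by (rule inv_app_eq) (auto simp: mul_simps)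
    then show "Q ?X ?X' \<bullet> one (tensor_ring K (UR S) (UR S')) = one (UR ?E)"
      using t t' R E1 E3 by (simp add: tensor_one)
  qed
qed

text \<open>The bridge from the definition of the degree to K: one step of a tower, phrased in
  modules, yields the data \<open>splits\<close>, on which the counting along towers rests.\<close>

lemma splitting_splits:
  assumes u: "ring_mor K A B u" and sp: "splitting_algebra MC (mod_ring K A B u) S w"
  shows "\<exists>E q j m n. splits A B (UR S) u (und_arrow w) E q j m n" "separable_ring K (UR S)"
proof -
  interpret MCi: symmetric_monoidal_category MC by (rule MC_smc)
  let ?Bm = "mod_ring K A B u" and ?v = "und_arrow w"
  let ?X = "Car ?Bm" and ?E = "tensor_ring MC ?Bm ?Bm" and ?R = "\<lambda>b. if b then ?Bm else S"
  let ?pr = "proj MC UNIV (\<lambda>b. Car (?R b))"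
  have sepS: "separable_ring MC S" and Bm: "is_ring MC ?Bm" and S: "is_ring MC S" and w: "ring_mor MC ?Bm S w"
    using sp by (auto simp: splitting_algebra_def separable_ring_def)
  show "separable_ring K (UR S)" by (rule und_separable[OF sepS])
  obtain h where h: "ring_isomorphism MC ?E (prod_ring MC UNIV ?R) h"
    and h1: "Comp MC (?pr True) h = Mul ?Bm"
    and h2: "Comp MC (?pr False) (Comp MC h (Comp MC (TenA MC (Idn MC ?X) (Unt ?Bm)) (inv_arrow MC (Run MC ?X)))) = w"
    using sp unfolding splitting_algebra_def Let_def by blast
  have R: "is_ring MC (?R b)" for b using Bm S by simp
  have "Car (?R b) \<in> Ob MC" for b using R[of b] MCi.ring_typ(1) by blast
  then have c0: "product_cone MC UNIV (\<lambda>b. Car (?R b)) (prod_ob MC UNIV (\<lambda>b. Car (?R b))) ?pr"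
    by (intro MCi.finite_cone) auto
  let ?p = "\<lambda>b. Comp MC (?pr b) h"
  have cone: "product_cone MC UNIV (\<lambda>b. Car (?R b)) (Car ?E) ?p" and pm: "\<And>b. ring_mor MC ?E (?R b) (?p b)"
    using MCi.ring_iso_cone[OF h R c0] by auto
  let ?Eu = "UR ?E" and ?q = "Q ?X ?X" and ?m = "und_arrow (?p True)" and ?n = "und_arrow (?p False)"
  have UB: "UR ?Bm = B" by (rule und_mod_ring[OF u])
  note t = mtyp_typ[OF is_ring_mtyp[OF Bm]] note X = t(1)
  have cB: "fst ?X = Car B" by (simp add: mod_ring_simps)
  have CE: "Car ?E = T ?X ?X" by (simp add: tensor_ring_def)
  have E: "is_ring MC ?E" by (rule MCi.tensor_ring_is_ring[OF Bm Bm])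
  have v: "ring_mor K B (UR S) ?v" using ring_mor_MC_und(1)[OF w] UB by simp
  have qr: "ring_mor K (tensor_ring K B B) ?Eu ?q" using quot_ring_mor[OF Bm Bm] UB by simp
  have mr: "ring_mor K ?Eu B ?m" using ring_mor_MC_und(1)[OF pm[of True]] UB by simp
  have nr: "ring_mor K ?Eu (UR S) ?n" using ring_mor_MC_und(1)[OF pm[of False]] by simp
  have mq: "?m \<cdot> ?q = Mul B"
  proof -
    have "Mul (UR ?Bm) = und_arrow (Mul ?Bm) \<cdot> ?q" by simp
    then show ?thesis unfolding UB h1 by simp
  qed
  have kc: "product_cone K UNIV (\<lambda>i. if i then Car B else Car (UR S)) (Car ?Eu) (\<lambda>i. if i then ?m else ?n)"
  proof -
    have "product_cone K UNIV (\<lambda>i. fst (Car (?R i))) (fst (Car ?E)) (\<lambda>i. und_arrow (?p i))" by (rule und_product_cone(1)[OF cone])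
    moreover have "(\<lambda>i. fst (Car (?R i))) = (\<lambda>i. if i then Car B else Car (UR S))" using cB by auto
    moreover have "(\<lambda>i. und_arrow (?p i)) = (\<lambda>i. if i then ?m else ?n)" by auto
    ultimately show ?thesis by simp
  qed
  have act: "snd ?X = Mul B \<cdot> (u \<boxtimes> Idn K (Car B))" by (simp add: mod_ring_simps)
  note ut = mmor_typ[OF ring_mor_mmor[OF u]]
  have acta: "snd ?X \<bullet> (r \<star> b) = Mul B \<bullet> ((u \<bullet> r) \<star> b)" if "el r" "el b" "ob r = Car A" "ob b = Car B" for r b
    unfolding act using that ut by simp
  have uni: "\<exists>k'\<in>homs K (Car ?Eu) z. k' \<cdot> ?q = k"
    if k: "k \<in> homs K (Car B \<odot> Car B) z"
      and kb: "\<forall>r a b. rel A r \<and> rel B a \<and> rel B b \<and> dj r a \<and> dj a r \<and> dj r b \<and> dj b r \<and> dj a b \<and> dj b a \<longrightarrow>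
          k \<bullet> ((Mul B \<bullet> ((u \<bullet> r) \<star> a)) \<star> b) = k \<bullet> (a \<star> (Mul B \<bullet> ((u \<bullet> r) \<star> b)))" for k z
  proof -
    have kt: "k \<in> Ar K" "Dom K k = Car B \<odot> Car B" "Cod K k = z" using k by (auto simp: homs_iff)
    have b: "balanced ?X ?X k"
    proof (rule balancedI[OF X X])
      fix r m n assume a: "el r" "el m" "el n" "ob r = Car A" "ob m = fst ?X" "ob n = fst ?X" "dj r m" "dj m r" "dj r n" "dj n r" "dj m n" "dj n m"
      then show "k \<bullet> ((snd ?X \<bullet> (r \<star> m)) \<star> n) = k \<bullet> (m \<star> (snd ?X \<bullet> (r \<star> n)))"
        using acta[of r m] acta[of r n] kb[THEN spec, THEN spec, THEN spec, of r m n] cB by simp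
    qed (use kt cB in simp_all)
    show ?thesis
      using descend_props[OF X X b] kt CE by (intro bexI[of _ "descend K ?q k"]) auto
  qed
  have bal1: "?q \<bullet> ((u \<bullet> r) \<star> one B) = ?q \<bullet> (one B \<star> (u \<bullet> r))" if r: "el r" "ob r = Car A" for r
    using quot_act[OF X X, of r "one B" "one B"] acta[of r "one B"] r ut cB by (simp add: mul_simps)
  have nq: "?n \<bullet> ?q \<bullet> (b \<star> one B) = ?v \<bullet> b" if b: "el b" "ob b = Car B" for b
  proof -
    have e: "Unt ?Bm = (U, u, ?X)" by (simp add: mod_ring_simps)
    have lu: "linear_mor K A U ?X u" using t(9) e by simp
    note lr = ruM_typ(4,5)[OF X]
    \<comment> \<open>\<open>h\<close> and the projection are displayed as triples so that
      composition in \<open>MC\<close> can be computed; \<open>h2\<close> then describes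
      \<open>w\<close> on b through the class of b \<otimes> 1.\<close>
    have "h \<in> homs MC (Car ?E) (prod_ob MC UNIV (\<lambda>b. Car (?R b)))"
      using h by (auto simp: ring_isomorphism_def ring_mor_def prod_ring_def Let_def)
    then obtain h0 where h0: "h = (T ?X ?X, h0, prod_ob MC UNIV (\<lambda>b. Car (?R b)))"
      "linear_mor K A (T ?X ?X) (prod_ob MC UNIV (\<lambda>b. Car (?R b))) h0" by (auto simp: homs_MC CE)
    have "?pr False \<in> homs MC (prod_ob MC UNIV (\<lambda>b. Car (?R b))) (Car S)"
      using MCi.cone_typ(2-4)[OF c0, of False] by (simp add: homs_def)
    then obtain p0 where p0: "?pr False = (prod_ob MC UNIV (\<lambda>b. Car (?R b)), p0, Car S)"
      "linear_mor K A (prod_ob MC UNIV (\<lambda>b. Car (?R b))) (Car S) p0" by (auto simp: homs_MC)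
    have iv: "inv_arrow MC (T ?X U, ruM ?X, ?X) = (?X, inv_arrow K (ruM ?X), T ?X U)" by (rule iso_MC(3)[OF lr])
    have n: "?n = p0 \<cdot> h0" using h0 p0 by simp
    have vv: "?v = p0 \<cdot> (h0 \<cdot> (tnA ?X (Idn K (fst ?X)) ?X U u ?X \<cdot> inv_arrow K (ruM ?X)))"
      unfolding h2[symmetric] p0(1) h0(1) e by (simp add: iv)
    have ib: "inv_arrow K (ruM ?X) \<bullet> b = Q ?X U \<bullet> (b \<star> one A)"
      by (rule inv_app_eq) (use X b cB in \<open>auto simp: a_act_one\<close>)
    have lI: "linear_mor K A ?X ?X (Idn K (fst ?X))" using X by simp
    show ?thesis unfolding n vv
      using b cB X ut lu lI ib lt[OF h0(2)] lt[OF p0(2)] ring_mor_one[OF u] by simp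
  qed
  have "splits A B (UR S) u ?v ?Eu ?q (sct ?X ?X) ?m ?n"
    unfolding splits_def
  proof (intro conjI u v qr mr nr mq kc)
    show "sct ?X ?X \<in> homs K (Car ?Eu) (Car B \<odot> Car B)" using X cB CE by (simp add: homs_iff)
    show "?q \<cdot> sct ?X ?X = Idn K (Car ?Eu)" using X CE by simp
    show "\<forall>k z. k \<in> homs K (Car B \<odot> Car B) z \<longrightarrow>
        (\<forall>r a b. rel A r \<and> rel B a \<and> rel B b \<and> dj r a \<and> dj a r \<and> dj r b \<and> dj b r \<and> dj a b \<and> dj b a \<longrightarrow>
          k \<bullet> ((Mul B \<bullet> ((u \<bullet> r) \<star> a)) \<star> b) = k \<bullet> (a \<star> (Mul B \<bullet> ((u \<bullet> r) \<star> b)))) \<longrightarrow>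
        (\<exists>k'\<in>homs K (Car ?Eu) z. k' \<cdot> ?q = k)"
      by (intro allI impI, rule uni)
    show "\<forall>r. rel A r \<longrightarrow> ?q \<bullet> ((u \<bullet> r) \<star> one B) = ?q \<bullet> (one B \<star> (u \<bullet> r))"
      by (intro allI impI, elim conjE, rule bal1)
    show "\<forall>b. rel B b \<longrightarrow> ?n \<bullet> ?q \<bullet> (b \<star> one B) = ?v \<bullet> b"
      by (intro allI impI, elim conjE, rule nq)
  qed
  then show "\<exists>E q j m n. splits A B (UR S) u ?v E q j m n" by blast
qed

end

section \<open>The splitting tower\<close>

context idempotent_complete_smc
begin

lemma unit_ring_separable: "separable_ring K (unit_ring K)"
proof -
  let ?I = "Unit K"
  let ?s = "inv_arrow K (Lun K ?I)"
  have lr: "Lun K ?I \<bullet> (a \<star> un) = a" if "el a" "ob a = ?I" for a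
    using run_app[of a ?I] that by (simp add: Run_Unit)
  have ll: "un \<star> (Lun K ?I \<bullet> t) = t" if "el t" "ob t = ?I \<odot> ?I" for t
  proof -
    have "un \<star> (Lun K ?I \<bullet> t) = ?s \<bullet> Lun K ?I \<bullet> t" by (rule inv_lun_app[symmetric]) (use that in simp_all)
    also have "\<dots> = t" by (rule inv_app) (use that in simp_all)
    finally show ?thesis .
  qed
  show ?thesis unfolding separable_ring_def Let_def
  proof (intro conjI bexI[of _ ?s] unit_ring_is_ring)
    show "?s \<in> homs K (Car (unit_ring K)) (Car (unit_ring K) \<odot> Car (unit_ring K))" by (simp add: unit_ring_def homs_iff)
    show "Mul (unit_ring K) \<cdot> ?s = Idn K (Car (unit_ring K))" by (simp add: unit_ring_def)
    show "(Idn K (Car (unit_ring K)) \<boxtimes> Mul (unit_ring K)) \<cdot> Asc K (Car (unit_ring K)) (Car (unit_ring K)) (Car (unit_ring K)) \<cdot>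
        (?s \<boxtimes> Idn K (Car (unit_ring K))) = ?s \<cdot> Mul (unit_ring K)"
      unfolding unit_ring_def by (rule ext2[of _ ?I ?I]) (auto simp: homs_iff ll)
    show "(Mul (unit_ring K) \<boxtimes> Idn K (Car (unit_ring K))) \<cdot> inv_arrow K (Asc K (Car (unit_ring K)) (Car (unit_ring K)) (Car (unit_ring K))) \<cdot>
        (Idn K (Car (unit_ring K)) \<boxtimes> ?s) = ?s \<cdot> Mul (unit_ring K)"
      unfolding unit_ring_def by (rule ext2[of _ ?I ?I]) (auto simp: homs_iff lr ll)
  qed
qed

lemma unit_ring_mor: "is_ring K A \<Longrightarrow> ring_mor K (unit_ring K) A (Unt A)"
proof -
  assume A: "is_ring K A"
  have "mmor (unit_ring K) A (Unt A)"
    unfolding mmor_def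
  proof (intro conjI A unit_ring_is_ring)
    show "Unt A \<in> homs K (Car (unit_ring K)) (Car A)" using A by (simp add: unit_ring_def homs_iff)
    show "Unt A \<cdot> Mul (unit_ring K) = Mul A \<cdot> (Unt A \<boxtimes> Unt A)"
    proof -
      have "Unt A \<cdot> Lun K (Unit K) = Mul A \<cdot> (Unt A \<boxtimes> Unt A)"
        by (rule ext_unit_ten) (use A in \<open>auto simp: homs_iff mul_simps\<close>)
      then show ?thesis by (simp add: unit_ring_def)
    qed
  qed
  moreover have "Unt A \<bullet> one (unit_ring K) = one A" by (simp add: unit_ring_def)
  ultimately show ?thesis by (simp add: ring_mor_iff)
qed

lemma separable_locale: "separable_ring K A \<Longrightarrow> separable K A"
  by unfold_locales

text \<open>Separability and the ring morphism are carried along together because the next step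
  needs both: the first gives the module category over \<open>R n\<close>, the second makes
  \<open>R (Suc n)\<close> a ring in it.\<close>

lemma tower_facts:
  assumes A: "separable_ring K A" and tw: "splitting_tower K A R u"
  shows "separable_ring K (R n) \<and> separable_ring K (R (Suc n)) \<and> ring_mor K (R n) (R (Suc n)) (u n) \<and>
     (\<exists>E q j m k. splits (R n) (R (Suc n)) (R (Suc (Suc n))) (u n) (u (Suc n)) E q j m k)"
proof -
  have R: "R 0 = unit_ring K" "R 1 = A" "u 0 = Unt A" using tw by (auto simp: splitting_tower_def)
  have step: "separable_ring K (R (Suc (Suc n))) \<and> ring_mor K (R (Suc n)) (R (Suc (Suc n))) (u (Suc n)) \<and>
      (\<exists>E q j m k. splits (R n) (R (Suc n)) (R (Suc (Suc n))) (u n) (u (Suc n)) E q j m k)"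
    if s: "separable_ring K (R n)" and m: "ring_mor K (R n) (R (Suc n)) (u n)" for n
  proof -
    have "\<exists>S w. splitting_algebra (mod_cat K (R n)) (mod_ring K (R n) (R (Suc n)) (u n)) S w \<and>
        R (Suc (Suc n)) = und_ring K (R n) S \<and> u (Suc n) = und_arrow w"
      using tw unfolding splitting_tower_def by blast
    then obtain S w where sp: "splitting_algebra (mod_cat K (R n)) (mod_ring K (R n) (R (Suc n)) (u n)) S w"
      and e: "R (Suc (Suc n)) = und_ring K (R n) S" "u (Suc n) = und_arrow w" by blast
    note L = separable.splitting_splits[OF separable_locale[OF s] m sp, folded e]
    then show ?thesis using split_mors(2) by blast
  qed
  have "separable_ring K (R n) \<and> separable_ring K (R (Suc n)) \<and> ring_mor K (R n) (R (Suc n)) (u n)"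
  proof (induction n)
    case 0 show ?case
      using A R unit_ring_separable unit_ring_mor[of A] by (simp add: separable_ring_def)
  next
    case (Suc n) then show ?case using step[of n] by blast
  qed
  then show ?thesis using step[of n] by blast
qed

section \<open>Counting disjoint maps along the tower\<close>

lemma disjoint_maps_sym:
  assumes "disjoint_maps B D f f'" "f \<bullet> one B = f' \<bullet> one B" shows "disjoint_maps B D f' f"
  unfolding disjoint_maps_def
proof (intro allI impI)
  fix z assume z: "el z \<and> fst z = [] \<and> ob z = Car D \<and> (\<forall>b. el b \<and> ob b = Car B \<longrightarrow> Mul D \<bullet> (z \<star> (f' \<bullet> b)) = Mul D \<bullet> (z \<star> (f \<bullet> b)))"
  have "zero (Mul D \<bullet> (z \<star> (f \<bullet> one B)))"
    by (rule assms(1)[unfolded disjoint_maps_def, THEN spec, THEN mp]) (use z in simp)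
  then show "zero (Mul D \<bullet> (z \<star> (f' \<bullet> one B)))" using assms(2) by simp
qed

text \<open>Pairwise disjoint maps out of \<open>R (n + 1)\<close> extend along the tower, so a tower that vanishes early
  admits only few of them.\<close>

lemma tower_bound:
  assumes sp: "\<And>n. \<exists>E q j m k. splits (R n) (R (Suc n)) (R (Suc (Suc n))) (u n) (u (Suc n)) E q j m k"
    and F: "\<And>i. i < Suc l \<Longrightarrow> mmor (R (Suc n)) D (F i)" "\<And>i. i < Suc l \<Longrightarrow> F i \<bullet> one (R (Suc n)) = c"
    and Fu: "\<And>i j r. i < Suc l \<Longrightarrow> j < Suc l \<Longrightarrow> el r \<Longrightarrow> ob r = Car (R n) \<Longrightarrow> F i \<bullet> u n \<bullet> r = F j \<bullet> u n \<bullet> r"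
    and d: "\<And>i j. i < Suc l \<Longrightarrow> j < Suc l \<Longrightarrow> i \<noteq> j \<Longrightarrow> disjoint_maps (R (Suc n)) D (F i) (F j)"
    and z: "zero_ring K (R (n + Suc l))"
  shows "zero c"
  using F Fu d z
proof (induction l arbitrary: n F)
  case 0
  \<comment> \<open>A single map is left and its domain is the zero ring, so its value at 1
    vanishes.\<close>
  have m: "mmor (R (Suc n)) D (F 0)" and o: "F 0 \<bullet> one (R (Suc n)) = c" using 0 by auto
  note t = mmor_typ[OF m]
  have "zero (one (R (Suc n)))" by (rule zero_ring_zero) (use 0 t in auto)
  then show ?case using o t by (metis el_app el_un ob_app ob_un ring_typ(5-7) zero_app)
next
  case (Suc l)
  obtain E q j m k where s: "splits (R n) (R (Suc n)) (R (Suc (Suc n))) (u n) (u (Suc n)) E q j m k" using sp by blast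
  let ?f = "F (Suc l)" and ?v = "snd_map (R (Suc n)) q k"
  note fm = Suc.prems(1)
  \<comment> \<open>The last map is paired with each of the others and thereby used up. The
    extensions all restrict to \<open>?f\<close> along \<open>u (Suc n)\<close>, as the next level
    demands, and to \<open>F i\<close> along \<open>?v\<close>, from which they inherit
    disjointness.\<close>
  have "\<exists>g. mmor (R (Suc (Suc n))) D g \<and> g \<cdot> u (Suc n) = ?f \<and> g \<cdot> ?v = F i \<and> g \<bullet> one (R (Suc (Suc n))) = ?f \<bullet> one (R (Suc n))"
    if i: "i < Suc l" for i
  proof -
    have i': "i < Suc (Suc l)" "Suc l < Suc (Suc l)" "Suc l \<noteq> i" using i by auto
    show ?thesis
      by (rule split_extend[OF s fm[OF i'(2)] fm[OF i'(1)] _ _ Suc.prems(4)[OF i'(2,1,3)]])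
        (use Suc.prems(2)[OF i'(1)] Suc.prems(2)[OF i'(2)] Suc.prems(3)[OF i'(2,1)] in auto)
  qed
  then obtain G where G: "\<And>i. i < Suc l \<Longrightarrow> mmor (R (Suc (Suc n))) D (G i)"
    "\<And>i. i < Suc l \<Longrightarrow> G i \<cdot> u (Suc n) = ?f" "\<And>i. i < Suc l \<Longrightarrow> G i \<cdot> ?v = F i"
    "\<And>i. i < Suc l \<Longrightarrow> G i \<bullet> one (R (Suc (Suc n))) = ?f \<bullet> one (R (Suc n))" by metis
  have G4: "G i \<bullet> one (R (Suc (Suc n))) = c" if "i < Suc l" for i using G(4)[OF that] Suc.prems(2)[of "Suc l"] by simp
  note vt = v'_typ[OF s] and v'm = v'_ring_mor[OF s] and st = split_typ[OF s]
  have Gv: "G i \<bullet> ?v \<bullet> b = F i \<bullet> b" if "i < Suc l" "el b" "ob b = Car (R (Suc n))" for i b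
  proof -
    have "(G i \<cdot> ?v) \<bullet> b = F i \<bullet> b" using G(3)[OF that(1)] by simp
    then show ?thesis using mmor_typ[OF G(1)[OF that(1)]] vt that by simp
  qed
  have Gu: "G i \<bullet> u (Suc n) \<bullet> b = ?f \<bullet> b" if "i < Suc l" "el b" "ob b = Car (R (Suc n))" for i b
  proof -
    have "(G i \<cdot> u (Suc n)) \<bullet> b = ?f \<bullet> b" using G(2)[OF that(1)] by simp
    then show ?thesis using mmor_typ[OF G(1)[OF that(1)]] st that by simp
  qed
  show ?case
  proof (rule Suc.IH[of "Suc n" G])
    show "G i \<bullet> u (Suc n) \<bullet> r = G j \<bullet> u (Suc n) \<bullet> r" if "i < Suc l" "j < Suc l" "el r" "ob r = Car (R (Suc n))" for i j r
      using Gu that by simp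
    show "disjoint_maps (R (Suc (Suc n))) D (G i) (G j)" if ij: "i < Suc l" "j < Suc l" "i \<noteq> j" for i j
      unfolding disjoint_maps_def
    proof (intro allI impI)
      fix z assume z: "el z \<and> fst z = [] \<and> ob z = Car D \<and>
        (\<forall>b. el b \<and> ob b = Car (R (Suc (Suc n))) \<longrightarrow> Mul D \<bullet> (z \<star> (G i \<bullet> b)) = Mul D \<bullet> (z \<star> (G j \<bullet> b)))"
      have ij': "i < Suc (Suc l)" "j < Suc (Suc l)" using ij by auto
      have "Mul D \<bullet> (z \<star> (F i \<bullet> b)) = Mul D \<bullet> (z \<star> (F j \<bullet> b))" if b: "el b" "ob b = Car (R (Suc n))" for b
      proof -
        have "Mul D \<bullet> (z \<star> (G i \<bullet> ?v \<bullet> b)) = Mul D \<bullet> (z \<star> (G j \<bullet> ?v \<bullet> b))"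
          using z[THEN conjunct2, THEN conjunct2, THEN conjunct2, THEN spec, of "?v \<bullet> b"] b vt by simp
        then show ?thesis using Gv b ij by simp
      qed
      then have "zero (Mul D \<bullet> (z \<star> (F i \<bullet> one (R (Suc n)))))"
        by (intro Suc.prems(4)[OF ij' ij(3), unfolded disjoint_maps_def, THEN spec, THEN mp]) (use z in simp)
      then show "zero (Mul D \<bullet> (z \<star> (G i \<bullet> one (R (Suc (Suc n))))))"
        using G4[OF ij(1)] Suc.prems(2)[OF ij'(1)] by simp
    qed
    show "zero_ring K (R (Suc n + Suc l))" using Suc.prems(5) by simp
  qed (use G(1) G4 in auto)
qed

text \<open>\<open>distinct_maps A B k f\<close>: no two of the maps \<open>f 0, \<dots>, f (k - 1)\<close> from \<open>A\<close> agree on a nonzero part of a \<open>B\<close>-algebra.\<close>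

definition distinct_maps where
  "distinct_maps A B k f \<longleftrightarrow> (\<forall>i<k. ring_mor K A B (f i)) \<and>
     (\<forall>D g c i j. ring_mor K B D g \<longrightarrow> el c \<longrightarrow> fst c = [] \<longrightarrow> ob c = Car D \<longrightarrow> i < j \<longrightarrow> j < k \<longrightarrow>
        (\<forall>a. el a \<longrightarrow> ob a = Car A \<longrightarrow> Mul D \<bullet> (c \<star> (g \<bullet> f i \<bullet> a)) = Mul D \<bullet> (c \<star> (g \<bullet> f j \<bullet> a))) \<longrightarrow> zero c)"

text \<open>The images of \<open>u\<close> and \<open>f\<close> generate C, stated as uniqueness of
  ring morphisms out of C relative to a part c of their target, so that it combines with
  \<open>distinct_maps\<close>.\<close>

definition generating where
  "generating A B C u f \<longleftrightarrow> (\<forall>D g g' c x. ring_mor K C D g \<longrightarrow> ring_mor K C D g' \<longrightarrow> el c \<longrightarrow> fst c = [] \<longrightarrow> ob c = Car D \<longrightarrow>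
        (\<forall>r. el r \<longrightarrow> ob r = Car B \<longrightarrow> Mul D \<bullet> (c \<star> (g \<bullet> u \<bullet> r)) = Mul D \<bullet> (c \<star> (g' \<bullet> u \<bullet> r))) \<longrightarrow>
        (\<forall>a. el a \<longrightarrow> ob a = Car A \<longrightarrow> Mul D \<bullet> (c \<star> (g \<bullet> f \<bullet> a)) = Mul D \<bullet> (c \<star> (g' \<bullet> f \<bullet> a))) \<longrightarrow>
        el x \<longrightarrow> ob x = Car C \<longrightarrow> Mul D \<bullet> (c \<star> (g \<bullet> x)) = Mul D \<bullet> (c \<star> (g' \<bullet> x)))"

lemma generatingD:
  assumes "generating A B C u f" "ring_mor K C D g" "ring_mor K C D g'" "el c" "fst c = []" "ob c = Car D"
    "\<And>r. el r \<Longrightarrow> ob r = Car B \<Longrightarrow> Mul D \<bullet> (c \<star> (g \<bullet> u \<bullet> r)) = Mul D \<bullet> (c \<star> (g' \<bullet> u \<bullet> r))"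
    "\<And>a. el a \<Longrightarrow> ob a = Car A \<Longrightarrow> Mul D \<bullet> (c \<star> (g \<bullet> f \<bullet> a)) = Mul D \<bullet> (c \<star> (g' \<bullet> f \<bullet> a))"
    "el x" "ob x = Car C"
  shows "Mul D \<bullet> (c \<star> (g \<bullet> x)) = Mul D \<bullet> (c \<star> (g' \<bullet> x))"
  by (rule assms(1)[unfolded generating_def, rule_format]) (rule assms; assumption)+

text \<open>At each level the old maps are continued along \<open>v\<close>, and the newest one also
  along \<open>v'\<close>. The induction carries two more facts: all but the newest map come from
  the ring one level below, where \<open>v\<close> and \<open>v'\<close> coincide, and the newest
  map together with that ring generates.\<close>

lemma tower_maps:
  assumes sp: "\<And>n. \<exists>E q j m k. splits (R n) (R (Suc n)) (R (Suc (Suc n))) (u n) (u (Suc n)) E q j m k"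
    and R1: "R 1 = A" and A: "is_ring K A"
  shows "\<exists>f. distinct_maps A (R (Suc n)) (Suc n) f \<and>
     (\<forall>j<n. \<exists>h. ring_mor K A (R n) h \<and> f j = u n \<cdot> h) \<and>
     generating A (R n) (R (Suc n)) (u n) (f n)"
proof (induction n)
  case 0
  have e: "R (Suc 0) = A" using R1 by simp
  have g: "g \<bullet> Idn K (Car A) \<bullet> a = g \<bullet> a" if "el a" "ob a = Car A" for g a using that by simp
  show ?case unfolding e distinct_maps_def generating_def
    by (rule exI[of _ "\<lambda>_. Idn K (Car A)"]) (use A ring_mor_Idn in \<open>simp\<close>)
next
  case (Suc n)
  then obtain f where fd: "distinct_maps A (R (Suc n)) (Suc n) f"
    and ff: "\<And>j. j < n \<Longrightarrow> \<exists>h. ring_mor K A (R n) h \<and> f j = u n \<cdot> h"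
    and gn: "generating A (R n) (R (Suc n)) (u n) (f n)" by blast
  note gen = generatingD[OF gn]
  have fm: "ring_mor K A (R (Suc n)) (f i)" if "i < Suc n" for i using fd that by (simp add: distinct_maps_def)
  have dist: "zero c" if "ring_mor K (R (Suc n)) D g" "el c" "fst c = []" "ob c = Car D" "i < j" "j < Suc n"
    "\<And>a. el a \<Longrightarrow> ob a = Car A \<Longrightarrow> Mul D \<bullet> (c \<star> (g \<bullet> f i \<bullet> a)) = Mul D \<bullet> (c \<star> (g \<bullet> f j \<bullet> a))" for D g c i j
    using fd that unfolding distinct_maps_def by blast
  obtain E q j m k where s: "splits (R n) (R (Suc n)) (R (Suc (Suc n))) (u n) (u (Suc n)) E q j m k" using sp by blast
  let ?v = "u (Suc n)" and ?v' = "snd_map (R (Suc n)) q k" and ?B = "R (Suc n)" and ?C = "R (Suc (Suc n))"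
  note st = split_typ[OF s] v'_typ[OF s]
  note vm = split_mors(2)[OF s] and v'm = v'_ring_mor[OF s]
  let ?f = "\<lambda>j. if j < Suc n then ?v \<cdot> f j else ?v' \<cdot> f n"
  have ft: "f i \<in> Ar K" "Dom K (f i) = Car A" "Cod K (f i) = Car ?B" if "i < Suc n" for i
    using mmor_typ[OF ring_mor_mmor[OF fm[OF that]]] by auto
  have fa: "?f i \<bullet> a = (if i < Suc n then ?v \<bullet> f i \<bullet> a else ?v' \<bullet> f n \<bullet> a)" if "el a" "ob a = Car A" for i a
    using ft[of i] ft[of n] st that by simp
  have gcomp: "(g \<cdot> h) \<bullet> x = g \<bullet> h \<bullet> x" if "ring_mor K ?C D g" "h \<in> Ar K" "Dom K h = Car ?B" "Cod K h = Car ?C" "el x" "ob x = Car ?B" for D g h x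
    using mmor_typ[OF ring_mor_mmor[OF that(1)]] that by simp
  have "distinct_maps A ?C (Suc (Suc n)) ?f"
    unfolding distinct_maps_def
  proof (intro conjI allI impI)
    show "ring_mor K A ?C (?f i)" if "i < Suc (Suc n)" for i
      using ring_mor_comp[OF fm vm] ring_mor_comp[OF fm v'm] by simp
    fix D g c i l assume g: "ring_mor K ?C D g" and c: "el c" "fst c = []" "ob c = Car D" and il: "i < l" "l < Suc (Suc n)"
      and eq: "\<forall>a. el a \<longrightarrow> ob a = Car A \<longrightarrow> Mul D \<bullet> (c \<star> (g \<bullet> ?f i \<bullet> a)) = Mul D \<bullet> (c \<star> (g \<bullet> ?f l \<bullet> a))"
    have eq': "Mul D \<bullet> (c \<star> (g \<bullet> ?v \<bullet> f i \<bullet> a)) = Mul D \<bullet> (c \<star> (g \<bullet> (if l < Suc n then ?v \<bullet> f l \<bullet> a else ?v' \<bullet> f n \<bullet> a)))"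
      if a: "el a" "ob a = Car A" for a
      using eq[THEN spec, THEN mp, THEN mp, OF a] il unfolding fa[OF a] by simp
    note gv = ring_mor_comp[OF vm g] and gv' = ring_mor_comp[OF v'm g]
    show "zero c"
    proof (cases "l < Suc n")
      case True
      show ?thesis
        by (rule dist[OF gv c il(1) True]) (use eq' True ft[of i] ft[of l] il gcomp[OF g] st in simp)
    next
      case l: False
      then have il': "i < Suc n" using il by simp
      show ?thesis
      proof (cases "i < n")
        case True
        obtain h where h: "ring_mor K A (R n) h" "f i = u n \<cdot> h" using ff[OF True] by blast
        note ht = mmor_typ[OF ring_mor_mmor[OF h(1)]]
        \<comment> \<open>\<open>f i\<close> comes from \<open>R n\<close>, where \<open>?v\<close>
          and \<open>?v'\<close> coincide. The comparison with \<open>?v' \<cdot> f n\<close> thus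
          takes place along \<open>?v'\<close> alone, and the old distinctness of \<open>f i\<close>
          and \<open>f n\<close> applies.\<close>
        have "?v \<bullet> f i \<bullet> a = ?v' \<bullet> f i \<bullet> a" if "el a" "ob a = Car A" for a
          using v_u[OF s, of "h \<bullet> a"] h(2) ht st that by simp
        then show ?thesis
          by (intro dist[OF gv' c True]) (use eq' l ft[of i] ft[of n] il' gcomp[OF g] st in \<open>simp_all\<close>)
      next
        case False
        then have "i = n" using il' by simp
        \<comment> \<open>By generation, agreement of \<open>?v \<cdot> f n\<close> with
          \<open>?v' \<cdot> f n\<close> extends to agreement of \<open>?v\<close> with
          \<open>?v'\<close> on all of \<open>?B\<close>, which \<open>split_disjoint\<close>
          excludes on a nonzero part.\<close>
        have "Mul D \<bullet> (c \<star> ((g \<cdot> ?v) \<bullet> x)) = Mul D \<bullet> (c \<star> ((g \<cdot> ?v') \<bullet> x))" if x: "el x" "ob x = Car ?B" for x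
          by (rule gen[OF gv gv' c _ _ x]) (use eq' l \<open>i = n\<close> ft[of n] gcomp[OF g] st v_u[OF s] in simp_all)
        then show ?thesis
          by (intro split_disjoint[OF s g c]) (use gcomp[OF g] st in simp)
      qed
    qed
  qed
  moreover have "\<forall>j<Suc n. \<exists>h. ring_mor K A ?B h \<and> ?f j = ?v \<cdot> h"
    using fm by auto
  moreover have "generating A ?B ?C ?v (?f (Suc n))"
    unfolding generating_def
  proof (intro allI impI)
    fix D g g' c x
    assume g: "ring_mor K ?C D g" and g': "ring_mor K ?C D g'" and c: "el c" "fst c = []" "ob c = Car D"
      and e1: "\<forall>r. el r \<longrightarrow> ob r = Car ?B \<longrightarrow> Mul D \<bullet> (c \<star> (g \<bullet> ?v \<bullet> r)) = Mul D \<bullet> (c \<star> (g' \<bullet> ?v \<bullet> r))"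
      and e2: "\<forall>a. el a \<longrightarrow> ob a = Car A \<longrightarrow> Mul D \<bullet> (c \<star> (g \<bullet> ?f (Suc n) \<bullet> a)) = Mul D \<bullet> (c \<star> (g' \<bullet> ?f (Suc n) \<bullet> a))"
      and x: "el x" "ob x = Car ?C"
    have e2': "Mul D \<bullet> (c \<star> (g \<bullet> ?v' \<bullet> f n \<bullet> a)) = Mul D \<bullet> (c \<star> (g' \<bullet> ?v' \<bullet> f n \<bullet> a))" if a: "el a" "ob a = Car A" for a
      using e2[THEN spec, THEN mp, THEN mp, OF a] unfolding fa[OF a] by simp
    \<comment> \<open>On \<open>R n\<close> the map \<open>?v'\<close> equals \<open>?v\<close>,
      where \<open>g\<close> and \<open>g'\<close> agree by assumption; the newest old map supplies
      the other generators of \<open>?B\<close>.\<close>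
    have e3: "Mul D \<bullet> (c \<star> (g \<bullet> ?v' \<bullet> y)) = Mul D \<bullet> (c \<star> (g' \<bullet> ?v' \<bullet> y))" if y: "el y" "ob y = Car ?B" for y
    proof -
      have "Mul D \<bullet> (c \<star> ((g \<cdot> ?v') \<bullet> y)) = Mul D \<bullet> (c \<star> ((g' \<cdot> ?v') \<bullet> y))"
      proof (rule gen[OF ring_mor_comp[OF v'm g] ring_mor_comp[OF v'm g'] c _ _ y])
        fix r assume r: "el r" "ob r = Car (R n)"
        show "Mul D \<bullet> (c \<star> ((g \<cdot> ?v') \<bullet> u n \<bullet> r)) = Mul D \<bullet> (c \<star> ((g' \<cdot> ?v') \<bullet> u n \<bullet> r))"
          using e1[THEN spec, THEN mp, THEN mp, of "u n \<bullet> r"] r gcomp[OF g] gcomp[OF g'] st v_u[OF s r, symmetric] by simp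
      qed (use e2' ft[of n] gcomp[OF g] gcomp[OF g'] st in simp)
      then show ?thesis using gcomp[OF g] gcomp[OF g'] st y by simp
    qed
    show "Mul D \<bullet> (c \<star> (g \<bullet> x)) = Mul D \<bullet> (c \<star> (g' \<bullet> x))"
      by (rule split_generate[OF s g g' c _ e3 x]) (rule e1[THEN spec, THEN mp, THEN mp])
  qed
  ultimately show ?case by blast
qed

end

section \<open>Endomorphisms of an indecomposable separable ring\<close>

context symmetric_monoidal_category
begin

section \<open>Sums of elements at a common stage\<close>

definition pl where "pl a b = (fst a, snd a \<boxplus> snd b)"

lemma fst_pl [simp]: "fst (pl a b) = fst a" by (simp add: pl_def)

lemma el_pl [simp]: "el a \<Longrightarrow> el b \<Longrightarrow> fst a = fst b \<Longrightarrow> ob a = ob b \<Longrightarrow> el (pl a b)"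
  and ob_pl [simp]: "el a \<Longrightarrow> el b \<Longrightarrow> fst a = fst b \<Longrightarrow> ob a = ob b \<Longrightarrow> ob (pl a b) = ob b"
  by (cases a; cases b; simp add: el_def ob_def pl_def)+

lemma app_pl: "el a \<Longrightarrow> el b \<Longrightarrow> fst a = fst b \<Longrightarrow> ob a = ob b \<Longrightarrow> f \<in> Ar K \<Longrightarrow> Dom K f = ob b \<Longrightarrow> f \<bullet> pl a b = pl (f \<bullet> a) (f \<bullet> b)"
  by (cases a; cases b; simp add: el_def ob_def pl_def app_def comp_add)

lemma ten_pl: "el a \<Longrightarrow> el b \<Longrightarrow> el c \<Longrightarrow> fst a = fst b \<Longrightarrow> ob a = ob b \<Longrightarrow> c \<star> pl a b = pl (c \<star> a) (c \<star> b)"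
  by (cases a; cases b; cases c; simp add: el_def ob_def pl_def ten_def ten_add add_comp)

lemma zeroD: "el a \<Longrightarrow> zero a \<Longrightarrow> snd a = Zer K (stg K (fst a)) (ob a)"
  unfolding zero_def ob_def el_def by (erule trans) simp

lemma pl_zero:
  assumes "el a" "el b" "fst a = fst b" "ob a = ob b"
  shows "zero b \<Longrightarrow> pl a b = a" "zero a \<Longrightarrow> pl a b = b"
proof -
  obtain U f where a: "a = (U, f)" by force
  obtain W g where b: "b = (W, g)" by force
  have t: "f \<in> Ar K" "g \<in> Ar K" "U = W" "Dom K f = stg K W" "Dom K g = stg K W" "Cod K f = Cod K g"
    using assms by (simp_all add: a b el_def ob_def)
  show "pl a b = a" if "zero b"
  proof -
    have "g = Zer K (stg K W) (Cod K g)" using zeroD[OF assms(2) that] by (simp add: b ob_def)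
    then have "f \<boxplus> g = f \<boxplus> Zer K (stg K W) (Cod K g)" by (rule arg_cong)
    then show ?thesis using t by (simp add: a b pl_def)
  qed
  show "pl a b = b" if "zero a"
  proof -
    have "f = Zer K (stg K W) (Cod K g)" using zeroD[OF assms(1) that] t by (simp add: a ob_def)
    then have "f \<boxplus> g = Zer K (stg K W) (Cod K g) \<boxplus> g" by (rule arg_cong)
    then show ?thesis using t by (simp add: a b pl_def)
  qed
qed

lemma ex_neg_el:
  assumes "el a" obtains b where "el b" "fst b = fst a" "ob b = ob a" "zero (pl a b)"
proof -
  obtain U f where a: "a = (U, f)" by force
  have f: "f \<in> Ar K" "Dom K f = stg K U" "obs U" using assms by (simp_all add: a el_def)
  from ex_neg[OF f(1)] obtain g where g: "g \<in> Ar K" "Dom K g = Dom K f" "Cod K g = Cod K f" "f \<boxplus> g = Zer K (Dom K f) (Cod K f)" .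
  show ?thesis
    by (rule that[of "(U, g)"]) (use f g in \<open>simp_all add: a el_def ob_def pl_def zero_def\<close>)
qed

lemma pl_cancel:
  assumes "el a" "el a'" "el b" "fst a = fst b" "fst a' = fst b" "ob a = ob b" "ob a' = ob b" "zero (pl a b)" "zero (pl a' b)"
  shows "a = a'"
proof -
  obtain U f where a: "a = (U, f)" by force
  obtain V f' where a': "a' = (V, f')" by force
  obtain W g where b: "b = (W, g)" by force
  have t: "f \<in> Ar K" "f' \<in> Ar K" "g \<in> Ar K" "U = W" "V = W" "Dom K f = Dom K g" "Dom K f' = Dom K g" "Cod K f = Cod K g" "Cod K f' = Cod K g"
    using assms(1-7) by (simp_all add: a a' b el_def ob_def)
  have "f \<boxplus> g = Zer K (Dom K g) (Cod K g)"
    using zeroD[OF el_pl[OF assms(1,3,4,6)] assms(8)] assms(3,4,6) t by (simp add: a b pl_def ob_def el_def)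
  moreover have "f' \<boxplus> g = Zer K (Dom K g) (Cod K g)"
    using zeroD[OF el_pl[OF assms(2,3,5,7)] assms(9)] assms(3,5,7) t by (simp add: a' b pl_def ob_def el_def)
  ultimately have n: "g \<boxplus> f = Zer K (Dom K g) (Cod K g)" "g \<boxplus> f' = Zer K (Dom K g) (Cod K g)"
    using t add_commute[of g f] add_commute[of g f'] by simp_all
  have "f = f'" by (rule neg_unique[of g]) (use t n in simp_all)
  then show ?thesis using t by (simp add: a a')
qed

lemma product_cone_reindex:
  assumes b: "bij_betw \<beta> J I" and c: "product_cone K J (\<lambda>j. X (\<beta> j)) P (\<lambda>j. p (\<beta> j))"
  shows "product_cone K I X P p"
proof -
  have im: "\<beta> ` J = I" using b by (simp add: bij_betw_def)
  have all: "(\<forall>i\<in>I. H i) \<longleftrightarrow> (\<forall>j\<in>J. H (\<beta> j))" for H using im by auto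
  note c' = c[unfolded product_cone_def, THEN conjunct2, THEN conjunct2, rule_format]
  show ?thesis unfolding product_cone_def all
  proof (intro conjI ballI allI impI)
    show "P \<in> Ob K" "\<And>j. j \<in> J \<Longrightarrow> p (\<beta> j) \<in> homs K P (X (\<beta> j))" using c unfolding product_cone_def by blast+
    show "\<exists>!h. h \<in> homs K y P \<and> (\<forall>j\<in>J. p (\<beta> j) \<cdot> h = f (\<beta> j))"
      if "y \<in> Ob K" "\<forall>j\<in>J. f (\<beta> j) \<in> homs K y (X (\<beta> j))" for y f
      by (rule c'[where f = "\<lambda>j. f (\<beta> j)"]) (use that in blast)+
  qed
qed

lemma product_cone_cong:
  assumes "product_cone K I X P p" "\<And>i. i \<in> I \<Longrightarrow> p i = p' i" shows "product_cone K I X P p'"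
  using assms unfolding product_cone_def by simp

end

context separable
begin

text \<open>For multiplicative \<open>f\<close>, \<open>f'\<close> on \<open>A\<close>, the element \<open>\<Sum> f x\<^sub>i f' y\<^sub>i\<close> is the largest idempotent on which \<open>f\<close> and \<open>f'\<close> agree.\<close>

lemma pair_se_balanced:
  assumes f: "mmor A D f" and f': "mmor A D f'" and a: "el a" "ob a = Car A"
  shows "Mul D \<bullet> ((f \<bullet> a) \<star> ((Mul D \<cdot> (f \<boxtimes> f')) \<bullet> se)) = Mul D \<bullet> ((f' \<bullet> a) \<star> ((Mul D \<cdot> (f \<boxtimes> f')) \<bullet> se))"
proof -
  note ft = mmor_typ[OF f] mmor_typ[OF f'] and fm = mmor_mul[OF f] mmor_mul[OF f']
  let ?h = "Mul D \<cdot> (f \<boxtimes> f')"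
  have "Mul D \<bullet> ((f \<bullet> a) \<star> (?h \<bullet> se)) = ?h \<bullet> (Mul A \<boxtimes> Idn K (Car A)) \<bullet> inv_arrow K (Asc K (Car A) (Car A) (Car A)) \<bullet> (a \<star> se)"
    by (rule lin_ext[where x = "Car A" and y = "Car A" and e = se and
         L = "\<lambda>e. Mul D \<bullet> ((f \<bullet> a) \<star> (?h \<bullet> e))" and
         R = "\<lambda>e. ?h \<bullet> (Mul A \<boxtimes> Idn K (Car A)) \<bullet> inv_arrow K (Asc K (Car A) (Car A) (Car A)) \<bullet> (a \<star> e)"],
       (rule lin_intros | use a ft in \<open>simp add: fm mul_assoc; fail\<close>)+)
  also have "\<dots> = ?h \<bullet> (Idn K (Car A) \<boxtimes> Mul A) \<bullet> Asc K (Car A) (Car A) (Car A) \<bullet> (se \<star> a)"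
    using sg_se_left[OF a] sg_se_right[OF a] by simp
  also have "\<dots> = Mul D \<bullet> ((f' \<bullet> a) \<star> (?h \<bullet> se))"
    by (rule lin_ext[where x = "Car A" and y = "Car A" and e = se and
         R = "\<lambda>e. Mul D \<bullet> ((f' \<bullet> a) \<star> (?h \<bullet> e))" and
         L = "\<lambda>e. ?h \<bullet> (Idn K (Car A) \<boxtimes> Mul A) \<bullet> Asc K (Car A) (Car A) (Car A) \<bullet> (e \<star> a)"],
       (rule lin_intros | use a ft in \<open>simp add: fm mul_ac; fail\<close>)+)
  finally show ?thesis .
qed

text \<open>z f(1) = \<Sum> z f(x_i) f(y_i) since \<Sum> x_i y_i = 1, and multiplied by z each
  f(y_i) may be replaced by f'(y_i).\<close>

lemma pair_se_agree:
  assumes f: "mmor A D f" and f': "mmor A D f'" and z: "el z" "fst z = []" "ob z = Car D"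
    and e: "\<And>a. el a \<Longrightarrow> ob a = Car A \<Longrightarrow> Mul D \<bullet> (z \<star> (f \<bullet> a)) = Mul D \<bullet> (z \<star> (f' \<bullet> a))"
  shows "Mul D \<bullet> (z \<star> (f \<bullet> one A)) = Mul D \<bullet> (z \<star> ((Mul D \<cdot> (f \<boxtimes> f')) \<bullet> se))"
proof -
  note ft = mmor_typ[OF f] mmor_typ[OF f'] and fm = mmor_mul[OF f] mmor_mul[OF f']
  have "Mul D \<bullet> (z \<star> (f \<bullet> Mul A \<bullet> se)) = Mul D \<bullet> (z \<star> ((Mul D \<cdot> (f \<boxtimes> f')) \<bullet> se))"
  proof (rule lin_ext[where x = "Car A" and y = "Car A" and e = se and
         L = "\<lambda>e. Mul D \<bullet> (z \<star> (f \<bullet> Mul A \<bullet> e))" and R = "\<lambda>e. Mul D \<bullet> (z \<star> ((Mul D \<cdot> (f \<boxtimes> f')) \<bullet> e))"],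
       (rule lin_intros | use z ft in \<open>simp; fail\<close>)+)
    fix a b assume ab: "el a" "el b" "ob a = Car A" "ob b = Car A" "dj a b" "dj b a"
    have "Mul D \<bullet> (z \<star> (f \<bullet> Mul A \<bullet> (a \<star> b))) = Mul D \<bullet> ((f \<bullet> a) \<star> (Mul D \<bullet> (z \<star> (f \<bullet> b))))"
      using ab z ft by (simp add: fm mul_ac)
    also have "\<dots> = Mul D \<bullet> (z \<star> ((Mul D \<cdot> (f \<boxtimes> f')) \<bullet> (a \<star> b)))"
      using e[OF ab(2,4)] ab z ft by (simp add: mul_ac)
    finally show "Mul D \<bullet> (z \<star> (f \<bullet> Mul A \<bullet> (a \<star> b))) = Mul D \<bullet> (z \<star> ((Mul D \<cdot> (f \<boxtimes> f')) \<bullet> (a \<star> b)))" .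
  qed
  then show ?thesis by simp
qed

end

section \<open>Idempotents and endomorphisms of an indecomposable ring\<close>

locale indecomposable = separable +
  assumes indec: "indecomposable_ring K A"
begin

abbreviation EA where "EA \<equiv> ring_endos K A"
abbreviation TA where "TA \<equiv> tensor_ring K A A"
abbreviation lam where "lam g \<equiv> Mul A \<cdot> (Idn K (Car A) \<boxtimes> g)"

lemma one_nonzero: "\<not> zero (one A)"
  using indec zero_ring_one[of A] by (auto simp: indecomposable_ring_def)

lemma EA_iff: "g \<in> EA \<longleftrightarrow> ring_mor K A A g"
  by (simp add: ring_endos_def)

lemma EA_mmor: "g \<in> EA \<Longrightarrow> mmor A A g"
  by (simp add: EA_iff ring_mor_mmor)

lemma EA_one: "g \<in> EA \<Longrightarrow> g \<bullet> one A = one A"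
  by (simp add: EA_iff ring_mor_one)

lemma EA_typ: "g \<in> EA \<Longrightarrow> g \<in> Ar K" "g \<in> EA \<Longrightarrow> Dom K g = Car A" "g \<in> EA \<Longrightarrow> Cod K g = Car A"
  using EA_mmor mmor_typ by blast+

lemma TA_ring [simp]: "is_ring K TA"
  by (rule tensor_ring_is_ring) auto

lemma TA_typ [simp]: "Mul TA \<in> Ar K" "Dom K (Mul TA) = Car A \<odot> Car A \<odot> (Car A \<odot> Car A)" "Cod K (Mul TA) = Car A \<odot> Car A"
  "Unt TA \<in> Ar K" "Dom K (Unt TA) = Unit K" "Cod K (Unt TA) = Car A \<odot> Car A"
  using tensor_ring_typ[OF A_ring A_ring] by (auto simp: homs_iff)

lemma lam_ring_mor: "g \<in> EA \<Longrightarrow> ring_mor K TA A (lam g)"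
  using pair_ring_mor[OF ring_mor_Idn[OF A_ring]] by (simp add: EA_iff)

text \<open>Multiplication by an idempotent element is an idempotent linear endomorphism, and its
  value at 1 recovers the element.\<close>

lemma global_indecomposable:
  assumes x: "el x" "fst x = []" "ob x = Car A" and xx: "Mul A \<bullet> (x \<star> x) = x"
  shows "x = one A \<or> zero x"
proof -
  let ?f = "Mul A \<cdot> ((Idn K (Car A) \<boxtimes> snd x) \<cdot> inv_arrow K (Run K (Car A)))"
  have sx: "snd x \<in> Ar K" "Dom K (snd x) = Unit K" "Cod K (snd x) = Car A" using x by auto
  have su: "snd x \<bullet> un = x" using snd_idel[OF x(1)] x(2) by (simp add: idel_Nil)
  have fa: "?f \<bullet> a = Mul A \<bullet> (a \<star> x)" if "el a" "ob a = Car A" for a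
    using that sx su by simp
  have ft: "?f \<in> homs K (Car A) (Car A)" using sx by (simp add: homs_iff)
  have "?f \<cdot> Mul A = Mul A \<cdot> (Idn K (Car A) \<boxtimes> ?f)"
  proof (rule ext2[of _ "Car A" "Car A"])
    fix a b assume ab: "el a" "el b" "ob a = Car A" "ob b = Car A" "dj a b" "dj b a"
    have "(?f \<cdot> Mul A) \<bullet> (a \<star> b) = ?f \<bullet> (Mul A \<bullet> (a \<star> b))" by (rule comp_app) (use ab ft in \<open>auto simp: homs_iff\<close>)
    also have "\<dots> = Mul A \<bullet> (a \<star> (?f \<bullet> b))" unfolding fa[OF ab(2,4)] using fa[of "Mul A \<bullet> (a \<star> b)"] ab x by (simp add: mul_assoc del: comp_app)
    also have "\<dots> = (Mul A \<cdot> (Idn K (Car A) \<boxtimes> ?f)) \<bullet> (a \<star> b)" using ab ft by (simp add: homs_iff del: comp_app) (simp add: ab homs_iff sx)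
    finally show "(?f \<cdot> Mul A) \<bullet> (a \<star> b) = (Mul A \<cdot> (Idn K (Car A) \<boxtimes> ?f)) \<bullet> (a \<star> b)" .
  qed (use ft in \<open>auto simp: homs_iff\<close>)
  moreover have "?f \<cdot> ?f = ?f"
  proof (rule ext1[of _ "Car A"])
    fix a assume a: "el a" "ob a = Car A"
    have "(?f \<cdot> ?f) \<bullet> a = ?f \<bullet> ?f \<bullet> a" by (rule comp_app) (use a ft in \<open>auto simp: homs_iff\<close>)
    also have "\<dots> = Mul A \<bullet> (a \<star> (Mul A \<bullet> (x \<star> x)))" unfolding fa[OF a] using fa[of "Mul A \<bullet> (a \<star> x)"] a x by (simp add: mul_assoc del: comp_app)
    also have "\<dots> = ?f \<bullet> a" unfolding xx fa[OF a] ..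
    finally show "(?f \<cdot> ?f) \<bullet> a = ?f \<bullet> a" .
  qed (use ft in \<open>auto simp: homs_iff\<close>)
  ultimately have "?f = Idn K (Car A) \<or> ?f = Zer K (Car A) (Car A)"
    using indec ft unfolding indecomposable_ring_def by blast
  moreover have "?f \<bullet> one A = x" using fa[of "one A"] x by (simp add: mul_simps del: comp_app)
  ultimately consider "x = Idn K (Car A) \<bullet> one A" | "x = Zer K (Car A) (Car A) \<bullet> one A" by metis
  then show ?thesis by cases (auto simp: zero_Zer)
qed

text \<open>g and g' agree on this element, so by \<open>pair_se_agree\<close> it is its own square.
  Were it 1, they would agree everywhere.\<close>

lemma endo_se_zero:
  assumes g: "g \<in> EA" and g': "g' \<in> EA" and ne: "g \<noteq> g'"
  shows "zero ((Mul A \<cdot> (g \<boxtimes> g')) \<bullet> se)"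
proof -
  note m = EA_mmor[OF g] EA_mmor[OF g']
  note t = EA_typ[OF g] EA_typ[OF g']
  let ?c = "(Mul A \<cdot> (g \<boxtimes> g')) \<bullet> se"
  have c: "el ?c" "fst ?c = []" "ob ?c = Car A" using t by simp_all
  have b: "Mul A \<bullet> (?c \<star> (g \<bullet> a)) = Mul A \<bullet> (?c \<star> (g' \<bullet> a))" if a: "el a" "ob a = Car A" for a
    using pair_se_balanced[OF m a] mul_comm[of A "g \<bullet> a" ?c] mul_comm[of A "g' \<bullet> a" ?c] a c t by (simp del: comp_app)
  have "Mul A \<bullet> (?c \<star> ?c) = ?c"
    using pair_se_agree[OF m c b] EA_one[OF g] mul_unr[of A ?c] c by simp
  then consider "?c = one A" | "zero ?c" using global_indecomposable[OF c] by blast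
  then show ?thesis
  proof cases
    case 1
    have "g = g'"
    proof (rule ext1[of _ "Car A"])
      fix a assume a: "el a" "ob a = Car A"
      then show "g \<bullet> a = g' \<bullet> a" using b[OF a] t unfolding 1 by (simp add: mul_simps)
    qed (use t in \<open>auto simp: homs_iff\<close>)
    then show ?thesis using ne by blast
  qed
qed

lemma endo_disjoint:
  assumes g: "g \<in> EA" and g': "g' \<in> EA" and ne: "g \<noteq> g'" shows "disjoint_maps A A g g'"
  unfolding disjoint_maps_def
proof (intro allI impI)
  fix z assume z: "el z \<and> fst z = [] \<and> ob z = Car A \<and> (\<forall>b. el b \<and> ob b = Car A \<longrightarrow> Mul A \<bullet> (z \<star> (g \<bullet> b)) = Mul A \<bullet> (z \<star> (g' \<bullet> b)))"
  then have z': "el z" "fst z = []" "ob z = Car A" by blast+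
  have e: "Mul A \<bullet> (z \<star> (g \<bullet> one A)) = Mul A \<bullet> (z \<star> ((Mul A \<cdot> (g \<boxtimes> g')) \<bullet> se))"
    by (rule pair_se_agree[OF EA_mmor[OF g] EA_mmor[OF g']]) (use z in blast)+
  show "zero (Mul A \<bullet> (z \<star> (g \<bullet> one A)))"
    unfolding e using endo_se_zero[OF assms] z' EA_typ[OF g] EA_typ[OF g'] by (simp del: comp_app)
qed

lemma endo_comp: "g \<in> EA \<Longrightarrow> h \<in> EA \<Longrightarrow> g \<cdot> h \<in> EA"
  using ring_mor_comp by (auto simp: EA_iff)

lemma endo_idn: "Idn K (Car A) \<in> EA"
  using ring_mor_Idn by (simp add: EA_iff)

text \<open>Endomorphisms are left cancellable, since \<open>g\<close> maps the vanishing element \<open>\<Sum> h x\<^sub>i h' y\<^sub>i\<close> to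
  \<open>\<Sum> g h x\<^sub>i g h' y\<^sub>i\<close>.\<close>

lemma endo_cancel:
  assumes g: "g \<in> EA" and h: "h \<in> EA" and h': "h' \<in> EA" and e: "g \<cdot> h = g \<cdot> h'"
  shows "h = h'"
proof (rule ccontr)
  assume "h \<noteq> h'"
  then have z: "zero ((Mul A \<cdot> (h \<boxtimes> h')) \<bullet> se)" using endo_se_zero h h' by blast
  note t = EA_typ[OF g] EA_typ[OF h] EA_typ[OF h']
  have gh: "g \<bullet> h' \<bullet> b = g \<bullet> h \<bullet> b" if "el b" "ob b = Car A" for b
  proof -
    have "(g \<cdot> h') \<bullet> b = (g \<cdot> h) \<bullet> b" using e by simp
    then show ?thesis using that t by simp
  qed
  have "g \<cdot> (Mul A \<cdot> (h \<boxtimes> h')) = (g \<cdot> h) \<cdot> Mul A"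
    by (rule ext2[of _ "Car A" "Car A"]) (use t gh in \<open>auto simp: homs_iff mmor_mul[OF EA_mmor[OF g]] mmor_mul[OF EA_mmor[OF h]]\<close>)
  then have "(g \<cdot> (Mul A \<cdot> (h \<boxtimes> h'))) \<bullet> se = ((g \<cdot> h) \<cdot> Mul A) \<bullet> se" by simp
  then have "g \<bullet> ((Mul A \<cdot> (h \<boxtimes> h')) \<bullet> se) = one A" using t EA_one[OF g] EA_one[OF h] by simp
  moreover have "zero (g \<bullet> ((Mul A \<cdot> (h \<boxtimes> h')) \<bullet> se))" using z t by (simp del: comp_app)
  ultimately show False using one_nonzero by simp
qed

text \<open>Left composition with g is injective, hence surjective on a finite set, so every g has a
  right inverse; a right inverse of that inverse can only be g.\<close>

lemma endo_group:
  assumes fin: "finite EA"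
  shows "group (comp_monoid K A EA)" and "g \<in> EA \<Longrightarrow> ring_isomorphism K A A g"
proof -
  have rinv: "\<exists>h\<in>EA. g \<cdot> h = Idn K (Car A)" if g: "g \<in> EA" for g
  proof -
    have "inj_on (\<lambda>h. g \<cdot> h) EA" using endo_cancel[OF g] by (auto intro: inj_onI)
    then have "(\<lambda>h. g \<cdot> h) ` EA = EA" using endo_comp[OF g] fin by (intro endo_inj_surj) auto
    then show ?thesis using endo_idn by (metis (no_types, lifting) imageE)
  qed
  have as: "(f \<cdot> g) \<cdot> h = f \<cdot> (g \<cdot> h)" if "f \<in> EA" "g \<in> EA" "h \<in> EA" for f g h
    using EA_typ[OF that(1)] EA_typ[OF that(2)] EA_typ[OF that(3)] by simp
  have lid: "Idn K (Car A) \<cdot> g = g" "g \<cdot> Idn K (Car A) = g" if "g \<in> EA" for g using EA_typ[OF that] by auto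
  have linv: "\<exists>h\<in>EA. h \<cdot> g = Idn K (Car A) \<and> g \<cdot> h = Idn K (Car A)" if g: "g \<in> EA" for g
  proof -
    obtain h where h: "h \<in> EA" "g \<cdot> h = Idn K (Car A)" using rinv[OF g] by blast
    obtain k where k: "k \<in> EA" "h \<cdot> k = Idn K (Car A)" using rinv[OF h(1)] by blast
    have "k = (g \<cdot> h) \<cdot> k" using h lid k by simp
    also have "\<dots> = g" using as[OF g h(1) k(1)] k lid[OF g] by simp
    finally show ?thesis using h k by blast
  qed
  show "group (comp_monoid K A EA)"
  proof (rule groupI)
    fix x assume "x \<in> carrier (comp_monoid K A EA)"
    then show "\<exists>y\<in>carrier (comp_monoid K A EA). y \<otimes>\<^bsub>comp_monoid K A EA\<^esub> x = \<one>\<^bsub>comp_monoid K A EA\<^esub>"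
      using linv[of x] by (auto simp: comp_monoid_def)
  qed (use endo_comp endo_idn as lid in \<open>auto simp: comp_monoid_def\<close>)
  show "ring_isomorphism K A A g" if g: "g \<in> EA"
  proof -
    obtain h where h: "h \<in> EA" "h \<cdot> g = Idn K (Car A)" "g \<cdot> h = Idn K (Car A)" using linv[OF g] by blast
    then have "inverse_arrows K g h" unfolding inverse_arrows_def using EA_typ[OF g] EA_typ[OF h(1)] by (simp add: homs_iff)
    then have "iso_arrow K g" unfolding iso_arrow_def by blast
    then show ?thesis using g by (simp add: ring_isomorphism_iff EA_iff)
  qed
qed

text \<open>Condition (iii) freed from the chosen product; it is the form in which the conditions
  are compared.\<close>

definition lambda_cone where
  "lambda_cone \<longleftrightarrow> product_cone K EA (\<lambda>_. Car A) (Car A \<odot> Car A) lam"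

lemma lambda_iso_iff:
  assumes fin: "finite EA" shows "lambda_iso K A EA \<longleftrightarrow> lambda_cone"
proof
  have c0: "product_cone K EA (\<lambda>_. Car A) (prod_ob K EA (\<lambda>_. Car A)) (proj K EA (\<lambda>_. Car A))"
    by (rule finite_cone[OF fin]) simp
  assume "lambda_iso K A EA"
  then have i: "ring_isomorphism K TA (prod_ring K EA (\<lambda>_. A)) (lambda_mor K A EA)" by (simp add: lambda_iso_def)
  have p: "proj K EA (\<lambda>_. Car A) g \<cdot> lambda_mor K A EA = lam g" if "g \<in> EA" for g
    unfolding lambda_mor_def by (rule tuple_props(2)[OF c0 _ _ that]) (use EA_typ in \<open>auto simp: homs_iff\<close>)
  show lambda_cone unfolding lambda_cone_def
    by (rule product_cone_cong[OF ring_iso_cone(1)[OF i _ c0, simplified] p]) auto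
next
  assume lambda_cone
  then have c: "product_cone K EA (\<lambda>_. Car A) (Car TA) lam" by (simp add: lambda_cone_def)
  show "lambda_iso K A EA"
    unfolding lambda_iso_def lambda_mor_def
    using ring_cone_iso[OF TA_ring lam_ring_mor c] by simp
qed

text \<open>The injected units are the orthogonal idempotents of the factors. Since the projections
  are ring morphisms, the effect of multiplying by one of them can be read off in each
  component.\<close>

lemma cone_idempotent:
  assumes b: "biprod I (\<lambda>_. Car A) (Car A \<odot> Car A) p j" and r: "\<And>i. i \<in> I \<Longrightarrow> ring_mor K TA A (p i)"
    and i: "i \<in> I" and t: "el t" "ob t = Car A \<odot> Car A"
  shows "Mul TA \<bullet> ((j i \<bullet> one A) \<star> t) = j i \<bullet> p i \<bullet> t"
proof -
  have c: "product_cone K I (\<lambda>_. Car A) (Car A \<odot> Car A) p" using b by (simp add: biprod_def)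
  note ji = biprod_props[OF b i]
  show ?thesis
  proof (rule cone_el_eq[OF c])
    fix k assume k: "k \<in> I"
    note pk = biprod_props[OF b k]
    have pj: "p k \<bullet> j i \<bullet> a = (if k = i then a else Zer K (Car A) (Car A) \<bullet> a)" if "el a" "ob a = Car A" for a
    proof -
      have "(p k \<cdot> j i) \<bullet> a = (if k = i then Idn K (Car A) else Zer K (Car A) (Car A)) \<bullet> a" using pk(9)[OF i] by simp
      then show ?thesis using that pk ji by (auto split: if_splits)
    qed
    have m: "p k \<bullet> Mul TA \<bullet> ((j i \<bullet> one A) \<star> t) = Mul A \<bullet> ((p k \<bullet> j i \<bullet> one A) \<star> (p k \<bullet> t))"
      using mmor_mul[OF ring_mor_mmor[OF r[OF k]], of "j i \<bullet> one A" t] t ji by simp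
    show "p k \<bullet> Mul TA \<bullet> ((j i \<bullet> one A) \<star> t) = p k \<bullet> j i \<bullet> p i \<bullet> t"
    proof (cases "k = i")
      case True then show ?thesis using m pj t ji by (simp add: mul_simps)
    next
      case False
      have "zero (Mul A \<bullet> ((p k \<bullet> j i \<bullet> one A) \<star> (p k \<bullet> t)))" using pj[of "one A"] False t pk by simp
      moreover have "zero (p k \<bullet> j i \<bullet> p i \<bullet> t)" using pj[of "p i \<bullet> t"] False t ji by simp
      ultimately show ?thesis unfolding m by (rule zero_unique[rotated 2]) (use t ji pk in simp_all)
    qed
  qed (use t ji in simp_all)
qed

lemma free_lam_linear: "g \<in> EA \<Longrightarrow> linear_mor K A (free_mod K A (Car A)) U (lam g)"
proof (rule linearI)
  assume g: "g \<in> EA"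
  note gt = EA_typ[OF g]
  fix r m assume a: "el r" "el m" "ob r = Car A" "ob m = fst (free_mod K A (Car A))" "dj r m" "dj m r"
  show "lam g \<bullet> snd (free_mod K A (Car A)) \<bullet> (r \<star> m) = snd U \<bullet> (r \<star> (lam g \<bullet> m))"
    by (rule lin_ext[where e = m and x = "Car A" and y = "Car A" and L = "\<lambda>m. lam g \<bullet> snd (free_mod K A (Car A)) \<bullet> (r \<star> m)" and R = "\<lambda>m. snd U \<bullet> (r \<star> (lam g \<bullet> m))"],
      (rule lin_intros | use a gt in \<open>simp add: mul_assoc; fail\<close>)+)
qed (use EA_typ in \<open>auto simp: homs_iff\<close>)

text \<open>Each \<open>lam g\<close> is linear over the left factor, so the cone lifts to modules.
  The endomorphisms are numbered below t = \<open>card EA\<close>, which is positive because of the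
  identity.\<close>

lemma lambda_cone_split:
  assumes fin: "finite EA" and c: lambda_cone
  shows "\<exists>t>0. rings_isomorphic MC (free_ring K A A) (prod_ring MC {..<t::nat} (\<lambda>_. unit_ring MC))"
proof -
  interpret MCi: symmetric_monoidal_category MC by (rule MC_smc)
  let ?F = "free_ring K A A" and ?X = "free_mod K A (Car A)"
  have pos: "card EA > 0" using fin endo_idn by (auto simp: card_gt_0_iff)
  obtain \<beta> where b: "bij_betw \<beta> {..<card EA} EA" using ex_bij_betw_nat_finite[OF fin] by (auto simp: atLeast0LessThan)
  have be: "\<beta> i \<in> EA" if "i < card EA" for i using b that by (auto simp: bij_betw_def)
  have c': "product_cone K {..<card EA} (\<lambda>i. Car A) (Car A \<odot> Car A) (\<lambda>i. lam (\<beta> i))"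
  proof -
    let ?g = "inv_into {..<card EA} \<beta>"
    have bi: "bij_betw ?g EA {..<card EA}" by (rule bij_betw_inv_into[OF b])
    have "product_cone K EA (\<lambda>_. Car A) (Car A \<odot> Car A) (\<lambda>g. lam (\<beta> (?g g)))"
      by (rule product_cone_cong[OF c[unfolded lambda_cone_def]]) (simp add: bij_betw_inv_into_right[OF b])
    then show ?thesis using product_cone_reindex[OF bi, of "\<lambda>_. Car A" _ "\<lambda>i. lam (\<beta> i)"] by simp
  qed
  have "product_cone MC {..<card EA} (\<lambda>i. U) ?X (\<lambda>i. (?X, lam (\<beta> i), U))"
    by (rule MC_product_cone) (use c' be free_lam_linear in auto)
  then have cone: "product_cone MC {..<card EA} (\<lambda>i. Car (unit_ring MC)) (Car ?F) (\<lambda>i. (?X, lam (\<beta> i), U))"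
    by (simp add: unit_ring_def free_ring_def)
  have F: "is_ring MC ?F" by (rule free_ring_is_ring) simp
  have m: "ring_mor MC ?F (unit_ring MC) (?X, lam (\<beta> i), U)" if "i \<in> {..<card EA}" for i
  proof -
    have e: "Car ?F = ?X" "Car (unit_ring MC) = U" by (simp_all add: unit_ring_def free_ring_def)
    have "ring_mor MC ?F (unit_ring MC) (Car ?F, lam (\<beta> i), Car (unit_ring MC))"
      using ring_mor_MC_iff[OF F MCi.unit_ring_is_ring, of "lam (\<beta> i)"] free_lam_linear[OF be] lam_ring_mor[OF be] that
        und_free_ring(1)[OF A_ring] und_unit_ring e by simp
    then show ?thesis unfolding e .
  qed
  show ?thesis
    unfolding rings_isomorphic_def using MCi.ring_cone_iso[OF F m cone] pos by blast
qed

text \<open>By linearity a projection \<open>p i\<close> is determined by b \<mapsto> p_i(1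
  \<otimes> b), a ring endomorphism \<open>g i\<close>, so \<open>p i = lam (g i)\<close>. It
  remains that i \<mapsto> \<open>g i\<close> is a bijection onto the endomorphisms.\<close>

lemma split_lambda_cone:
  assumes iso: "rings_isomorphic MC (free_ring K A A) (prod_ring MC {..<t::nat} (\<lambda>_. unit_ring MC))"
  shows "finite EA" "lambda_cone"
proof -
  interpret MCi: symmetric_monoidal_category MC by (rule MC_smc)
  let ?F = "free_ring K A A" and ?X = "free_mod K A (Car A)" and ?I = "{..<t}"
  obtain h where h: "ring_isomorphism MC ?F (prod_ring MC ?I (\<lambda>_. unit_ring MC)) h"
    using iso by (auto simp: rings_isomorphic_def)
  have e: "Car ?F = ?X" "Car (unit_ring MC) = U" by (simp_all add: unit_ring_def free_ring_def)
  let ?pr = "proj MC ?I (\<lambda>_. Car (unit_ring MC))"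
  let ?p = "\<lambda>i. Comp MC (?pr i) h"
  have c0: "product_cone MC ?I (\<lambda>_. Car (unit_ring MC)) (prod_ob MC ?I (\<lambda>_. Car (unit_ring MC))) ?pr"
    by (rule MCi.finite_cone) (use MCi.ring_typ(1)[OF MCi.unit_ring_is_ring] in auto)
  have cone: "product_cone MC ?I (\<lambda>_. Car (unit_ring MC)) (Car ?F) ?p" and pm: "\<And>i. i \<in> ?I \<Longrightarrow> ring_mor MC ?F (unit_ring MC) (?p i)"
    using MCi.ring_iso_cone[OF h MCi.unit_ring_is_ring c0] by auto
  define p where "p i = und_arrow (?p i)" for i
  have c: "product_cone K ?I (\<lambda>_. Car A) (Car A \<odot> Car A) p"
    using und_product_cone(1)[OF cone] by (simp add: e p_def[abs_def])
  have pr: "ring_mor K TA A (p i)" and pl: "linear_mor K A ?X U (p i)" if "i \<in> ?I" for i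
    using ring_mor_MC_und(1,2)[OF pm[OF that]] und_free_ring(1)[OF A_ring] und_unit_ring by (simp_all add: e p_def)
  note pt = lt[OF pl]
  define g where "g i = p i \<cdot> ((Unt A \<boxtimes> Idn K (Car A)) \<cdot> inv_arrow K (Lun K (Car A)))" for i
  have gt: "g i \<in> Ar K" "Dom K (g i) = Car A" "Cod K (g i) = Car A" if "i \<in> ?I" for i
    using pt[OF that] by (auto simp: g_def)
  have ga: "g i \<bullet> b = p i \<bullet> (one A \<star> b)" if "i \<in> ?I" "el b" "ob b = Car A" for i b
    using pt[OF that(1)] that by (simp add: g_def)
  have pa: "p i \<bullet> (a \<star> b) = Mul A \<bullet> (a \<star> (g i \<bullet> b))" if "i \<in> ?I" "el a" "el b" "ob a = Car A" "ob b = Car A" "dj a b" for i a b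
    using a_linear_act[OF pl[OF that(1)], of a "one A \<star> b"] ga[of i b] that by (simp add: mul_simps)
  have pg: "p i = lam (g i)" if "i \<in> ?I" for i
    by (rule ext2[of _ "Car A" "Car A"]) (use pa[OF that] pt[OF that] gt[OF that] in \<open>auto simp: homs_iff\<close>)
  have gE: "g i \<in> EA" if i: "i \<in> ?I" for i
    unfolding EA_iff ring_mor_iff
  proof (intro conjI mmorI A_ring)
    show "g i \<bullet> one A = one A" using ga[OF i, of "one A"] ring_mor_one[OF pr[OF i]] by (simp add: tensor_one)
    fix a b assume ab: "el a" "el b" "ob a = Car A" "ob b = Car A" "dj a b" "dj b a"
    then show "g i \<bullet> Mul A \<bullet> (a \<star> b) = Mul A \<bullet> ((g i \<bullet> a) \<star> (g i \<bullet> b))"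
      using mmor_mul[OF ring_mor_mmor[OF pr[OF i]], of "one A \<star> a" "one A \<star> b"] ga[OF i] by (simp add: mul_simps)
  qed (use gt[OF i] in \<open>simp add: homs_iff\<close>)
  obtain j where b: "biprod ?I (\<lambda>_. Car A) (Car A \<odot> Car A) p j" using cone_biprod[OF _ c] by auto
  note jt = biprod_props[OF b]
  have pj: "p k \<bullet> j i \<bullet> a = (if k = i then a else Zer K (Car A) (Car A) \<bullet> a)" if "i \<in> ?I" "k \<in> ?I" "el a" "ob a = Car A" for i k a
  proof -
    have "(p k \<cdot> j i) \<bullet> a = (if k = i then Idn K (Car A) else Zer K (Car A) (Car A)) \<bullet> a" using jt(9)[OF that(2,1)] by simp
    then show ?thesis using that jt(1-6)[OF that(1)] jt(4-6)[OF that(2)] by (auto split: if_splits)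
  qed
  have idem: "Mul TA \<bullet> ((j i \<bullet> one A) \<star> s) = j i \<bullet> p i \<bullet> s" if "i \<in> ?I" "el s" "ob s = Car A \<odot> Car A" for i s
    by (rule cone_idempotent[OF b pr that])
  \<comment> \<open>\<open>lam \<gamma>\<close> sends the idempotents
    \<open>j i \<bullet> one A\<close> to idempotents of A, each 0 or 1. They do not all vanish, and
    where one is 1 the map \<open>lam \<gamma>\<close> factors through that component.\<close>
  have onto: "\<exists>i\<in>?I. \<gamma> = g i" if \<gamma>: "\<gamma> \<in> EA" for \<gamma>
  proof -
    note \<gamma>t = EA_typ[OF \<gamma>] and lm = lam_ring_mor[OF \<gamma>]
    have lmul: "lam \<gamma> \<bullet> Mul TA \<bullet> (s \<star> s') = Mul A \<bullet> ((lam \<gamma> \<bullet> s) \<star> (lam \<gamma> \<bullet> s'))"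
      if "el s" "el s'" "ob s = Car A \<odot> Car A" "ob s' = Car A \<odot> Car A" for s s'
      using mmor_mul[OF ring_mor_mmor[OF lm], of s s'] that by (simp del: comp_app)
    have lt1: "lam \<gamma> \<in> Ar K" "Dom K (lam \<gamma>) = Car A \<odot> Car A" "Cod K (lam \<gamma>) = Car A" using \<gamma>t by auto
    define x where "x i = lam \<gamma> \<bullet> j i \<bullet> one A" for i
    have x: "el (x i)" "fst (x i) = []" "ob (x i) = Car A" if "i \<in> ?I" for i using jt(1-3)[OF that] lt1 by (simp_all add: x_def del: comp_app)
    have "Mul A \<bullet> (x i \<star> x i) = x i" if i: "i \<in> ?I" for i
      using lmul[of "j i \<bullet> one A" "j i \<bullet> one A"] idem[OF i, of "j i \<bullet> one A"] pj[OF i i, of "one A"] jt(1-3)[OF i]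
      by (simp add: x_def del: comp_app)
    then have dich: "x i = one A \<or> zero (x i)" if "i \<in> ?I" for i using global_indecomposable[OF x[OF that]] that by blast
    have "\<exists>i\<in>?I. x i = one A"
    proof (rule ccontr)
      assume "\<not> (\<exists>i\<in>?I. x i = one A)"
      then have z: "zero (x i)" if "i \<in> ?I" for i using dich that by blast
      \<comment> \<open>If all \<open>x i\<close> vanish, \<open>lam \<gamma>\<close> kills every
        summand of A \<otimes> A, although it sends 1 to 1.\<close>
      have "lam \<gamma> = Zer K (Car A \<odot> Car A) (Car A)"
      proof (rule biprod_ext[OF b])
        fix i assume i: "i \<in> ?I"
        show "lam \<gamma> \<cdot> j i = Zer K (Car A \<odot> Car A) (Car A) \<cdot> j i"
        proof (rule ext1[of _ "Car A"])
          fix a assume a: "el a" "ob a = Car A"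
          have "p i \<bullet> (a \<star> one A) = a" using pa[OF i, of a "one A"] EA_one[OF gE[OF i]] a by (simp add: mul_simps)
          then have "j i \<bullet> a = Mul TA \<bullet> ((j i \<bullet> one A) \<star> (a \<star> one A))" using idem[OF i, of "a \<star> one A"] a by simp
          then have "lam \<gamma> \<bullet> j i \<bullet> a = Mul A \<bullet> (x i \<star> (lam \<gamma> \<bullet> (a \<star> one A)))"
            using lmul[of "j i \<bullet> one A" "a \<star> one A"] a jt(1-3)[OF i] by (simp add: x_def del: comp_app)
          then have "zero (lam \<gamma> \<bullet> j i \<bullet> a)" using z[OF i] x[OF i] a lt1 by (simp del: comp_app)
          then have "lam \<gamma> \<bullet> j i \<bullet> a = Zer K (Car A \<odot> Car A) (Car A) \<bullet> j i \<bullet> a"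
            by (intro zero_unique) (use a jt(1-3)[OF i] lt1 in \<open>simp_all del: comp_app\<close>)
          moreover have "(lam \<gamma> \<cdot> j i) \<bullet> a = lam \<gamma> \<bullet> j i \<bullet> a" by (rule comp_app) (use a jt(1-3)[OF i] lt1 in auto)
          ultimately show "(lam \<gamma> \<cdot> j i) \<bullet> a = (Zer K (Car A \<odot> Car A) (Car A) \<cdot> j i) \<bullet> a"
            using a jt(1-3)[OF i] by (simp del: zer_comp)
        qed (use jt(1-3)[OF i] lt1 in \<open>auto simp: homs_iff\<close>)
      qed (use lt1 in \<open>auto simp: homs_iff\<close>)
      then have "one A = Zer K (Car A \<odot> Car A) (Car A) \<bullet> one TA" using ring_mor_one[OF lm] by simp
      moreover have "zero (Zer K (Car A \<odot> Car A) (Car A) \<bullet> one TA)" by (rule zero_Zer) auto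
      ultimately have "zero (one A)" by simp
      then show False using one_nonzero by blast
    qed
    then obtain i where i: "i \<in> ?I" and xi: "x i = one A" by blast
    have "lam \<gamma> = p i"
    proof (rule ext1[of _ "Car A \<odot> Car A"])
      fix s assume s: "el s" "ob s = Car A \<odot> Car A"
      \<comment> \<open>Multiplication by the idempotent of component i does not change the value of
        \<open>lam \<gamma>\<close>. So s may be replaced by p_i(s) \<otimes> 1, which has the same
        i-th component and on which \<open>lam \<gamma>\<close> is evident.\<close>
      have q: "lam \<gamma> \<bullet> s' = lam \<gamma> \<bullet> j i \<bullet> p i \<bullet> s'" if "el s'" "ob s' = Car A \<odot> Car A" for s'
      proof -
        have "lam \<gamma> \<bullet> Mul TA \<bullet> ((j i \<bullet> one A) \<star> s') = Mul A \<bullet> (x i \<star> (lam \<gamma> \<bullet> s'))"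
          using lmul[of "j i \<bullet> one A" s'] that jt(1-3)[OF i] by (simp add: x_def del: comp_app)
        then show ?thesis using idem[OF i that] xi that lt1 by (simp add: mul_simps del: comp_app)
      qed
      have pi: "p i \<bullet> ((p i \<bullet> s) \<star> one A) = p i \<bullet> s"
        using pa[OF i, of "p i \<bullet> s" "one A"] EA_one[OF gE[OF i]] s pt[OF i] by (simp add: mul_simps)
      have "lam \<gamma> \<bullet> s = lam \<gamma> \<bullet> ((p i \<bullet> s) \<star> one A)"
        using q[OF s] q[of "(p i \<bullet> s) \<star> one A"] pi s pt[OF i] by (simp del: comp_app)
      also have "\<dots> = p i \<bullet> s" using s pt[OF i] \<gamma>t EA_one[OF \<gamma>] by (simp add: mul_simps)
      finally show "lam \<gamma> \<bullet> s = p i \<bullet> s" .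
    qed (use lt1 pt[OF i] in \<open>auto simp: homs_iff\<close>)
    then have "\<gamma> = g i"
    proof -
      assume l: "lam \<gamma> = p i"
      show ?thesis
      proof (rule ext1[of _ "Car A"])
        fix a assume a: "el a" "ob a = Car A"
        have "lam \<gamma> \<bullet> (one A \<star> a) = p i \<bullet> (one A \<star> a)" using l by simp
        then show "\<gamma> \<bullet> a = g i \<bullet> a" using ga[OF i a] a \<gamma>t by (simp add: mul_simps)
      qed (use \<gamma>t gt[OF i] in \<open>auto simp: homs_iff\<close>)
    qed
    then show ?thesis using i by blast
  qed
  have inj: "inj_on g ?I"
  proof (rule inj_onI, rule ccontr)
    \<comment> \<open>Equal endomorphisms would give equal projections, but
      \<open>j i \<bullet> one A\<close> has component 1 at i and 0 at k.\<close>
    fix i k assume ik: "i \<in> ?I" "k \<in> ?I" "g i = g k" "i \<noteq> k"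
    then have "p i = p k" using pg by metis
    then have "one A = Zer K (Car A) (Car A) \<bullet> one A"
      using pj[OF ik(1,1), of "one A"] pj[OF ik(1,2), of "one A"] ik(4) by simp
    moreover have "zero (Zer K (Car A) (Car A) \<bullet> one A)" by (rule zero_Zer) auto
    ultimately have "zero (one A)" by simp
    then show False using one_nonzero by blast
  qed
  have im: "g ` ?I = EA" using onto gE by blast
  then show "finite EA" by (metis finite_imageI finite_lessThan)
  show lambda_cone unfolding lambda_cone_def
  proof (rule product_cone_reindex[of g ?I])
    show "bij_betw g ?I EA" using inj im by (simp add: bij_betw_def)
    show "product_cone K ?I (\<lambda>j. Car A) (Car A \<odot> Car A) (\<lambda>j. lam (g j))"
      by (rule product_cone_cong[OF c pg])
  qed
qed

end

section \<open>Restriction to the part cut out by an idempotent\<close>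

context symmetric_monoidal_category
begin

lemma ring_mor_unit:
  assumes "ring_mor K A D f" "el r" "ob r = Unit K" shows "f \<bullet> Unt A \<bullet> r = Unt D \<bullet> r"
proof -
  have "(f \<cdot> Unt A) \<bullet> r = Unt D \<bullet> r" using assms by (simp add: ring_mor_def)
  then show ?thesis using assms mmor_typ[OF ring_mor_mmor[OF assms(1)]] by simp
qed

text \<open>a \<mapsto> f a \<cdot> c, that is f restricted to the factor cut out by an idempotent
  c, with the factor kept inside D; the unit goes to c.\<close>

definition cut where "cut D c f = Mul D \<cdot> ((f \<boxtimes> snd c) \<cdot> inv_arrow K (Run K (Dom K f)))"

lemma cut_mmor:
  assumes f: "ring_mor K B D f" and c: "el c" "fst c = []" "ob c = Car D" "Mul D \<bullet> (c \<star> c) = c"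
  shows "mmor B D (cut D c f)" "el b \<Longrightarrow> ob b = Car B \<Longrightarrow> cut D c f \<bullet> b = Mul D \<bullet> ((f \<bullet> b) \<star> c)" "cut D c f \<bullet> one B = c"
proof -
  note t = mmor_typ[OF ring_mor_mmor[OF f]]
  have sc: "snd c \<in> Ar K" "Dom K (snd c) = Unit K" "Cod K (snd c) = Car D" using c(1-3) by auto
  have su: "snd c \<bullet> un = c" using snd_idel[OF c(1)] c(2) by (simp add: idel_Nil)
  have ft: "cut D c f \<in> homs K (Car B) (Car D)" using sc t by (simp add: homs_iff cut_def)
  show a: "cut D c f \<bullet> b = Mul D \<bullet> ((f \<bullet> b) \<star> c)" if "el b" "ob b = Car B" for b
    using that sc su t by (simp add: cut_def)
  show "cut D c f \<bullet> one B = c" using a[of "one B"] t ring_mor_one[OF f] c(1-3) by (simp add: mul_simps)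
  show "mmor B D (cut D c f)"
  proof (rule mmorI[OF t(1,2) ft])
    fix x y assume x: "el x" "el y" "ob x = Car B" "ob y = Car B" "dj x y" "dj y x"
    have "cut D c f \<bullet> Mul B \<bullet> (x \<star> y) = Mul D \<bullet> ((Mul D \<bullet> ((f \<bullet> x) \<star> (f \<bullet> y))) \<star> (Mul D \<bullet> (c \<star> c)))"
      unfolding c(4) using a[of "Mul B \<bullet> (x \<star> y)"] x t mmor_mul[OF ring_mor_mmor[OF f], of x y] by simp
    also have "\<dots> = Mul D \<bullet> ((Mul D \<bullet> ((f \<bullet> x) \<star> c)) \<star> (Mul D \<bullet> ((f \<bullet> y) \<star> c)))"
      using x t c(1-3) by (simp add: mul_ac)
    finally show "cut D c f \<bullet> Mul B \<bullet> (x \<star> y) = Mul D \<bullet> ((cut D c f \<bullet> x) \<star> (cut D c f \<bullet> y))"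
      using a x by simp
  qed
qed

definition inl where "inl A B = (Idn K (Car A) \<boxtimes> Unt B) \<cdot> inv_arrow K (Run K (Car A))"
definition inr where "inr A B = (Unt A \<boxtimes> Idn K (Car B)) \<cdot> inv_arrow K (Lun K (Car B))"

lemma inl_ring_mor:
  assumes "is_ring K A" "is_ring K B"
  shows "ring_mor K A (tensor_ring K A B) (inl A B)" "el a \<Longrightarrow> ob a = Car A \<Longrightarrow> inl A B \<bullet> a = a \<star> one B"
proof -
  show 1: "inl A B \<bullet> a = a \<star> one B" if "el a" "ob a = Car A" for a using that assms by (simp add: inl_def)
  have "mmor A (tensor_ring K A B) (inl A B)"
    by (rule mmorI) (use assms 1 in \<open>auto simp: tensor_ring_is_ring homs_iff inl_def mul_simps\<close>)
  then show "ring_mor K A (tensor_ring K A B) (inl A B)" using 1[of "one A"] assms by (simp add: ring_mor_iff tensor_one)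
qed

lemma inr_ring_mor:
  assumes "is_ring K A" "is_ring K B"
  shows "ring_mor K B (tensor_ring K A B) (inr A B)" "el b \<Longrightarrow> ob b = Car B \<Longrightarrow> inr A B \<bullet> b = one A \<star> b"
proof -
  show 1: "inr A B \<bullet> a = one A \<star> a" if "el a" "ob a = Car B" for a using that assms by (simp add: inr_def)
  have "mmor B (tensor_ring K A B) (inr A B)"
    by (rule mmorI) (use assms 1 in \<open>auto simp: tensor_ring_is_ring homs_iff inr_def mul_simps\<close>)
  then show "ring_mor K B (tensor_ring K A B) (inr A B)" using 1[of "one B"] assms by (simp add: ring_mor_iff tensor_one)
qed

end

context separable
begin

text \<open>If the restricted maps agree on w, then f and f' agree on v = w c. With e = \<Sum> f x_i
  \<cdot> f' y_i this gives v = v e = w (c e), and c e = 0 by assumption.\<close>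

lemma cut_disjoint:
  assumes f: "ring_mor K A D f" and f': "ring_mor K A D f'" and c: "el c" "fst c = []" "ob c = Car D" "Mul D \<bullet> (c \<star> c) = c"
    and z: "zero (Mul D \<bullet> (c \<star> ((Mul D \<cdot> (f \<boxtimes> f')) \<bullet> se)))"
  shows "disjoint_maps A D (cut D c f) (cut D c f')"
  unfolding disjoint_maps_def
proof (intro allI impI)
  note t = mmor_typ[OF ring_mor_mmor[OF f]] mmor_typ[OF ring_mor_mmor[OF f']]
  fix w assume w: "el w \<and> fst w = [] \<and> ob w = Car D \<and>
    (\<forall>b. el b \<and> ob b = Car A \<longrightarrow> Mul D \<bullet> (w \<star> (cut D c f \<bullet> b)) = Mul D \<bullet> (w \<star> (cut D c f' \<bullet> b)))"
  then have wt: "el w" "fst w = []" "ob w = Car D" by blast+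
  let ?e = "(Mul D \<cdot> (f \<boxtimes> f')) \<bullet> se"
  have e: "el ?e" "fst ?e = []" "ob ?e = Car D" using t by simp_all
  define v where "v = Mul D \<bullet> (w \<star> c)"
  have v: "el v" "fst v = []" "ob v = Car D" using wt c(1-3) t by (simp_all add: v_def)
  have "Mul D \<bullet> (v \<star> (f \<bullet> a)) = Mul D \<bullet> (v \<star> (f' \<bullet> a))" if a: "el a" "ob a = Car A" for a
  proof -
    have "Mul D \<bullet> (w \<star> (cut D c f \<bullet> a)) = Mul D \<bullet> (w \<star> (cut D c f' \<bullet> a))" using w a by blast
    then have "Mul D \<bullet> (w \<star> (Mul D \<bullet> ((f \<bullet> a) \<star> c))) = Mul D \<bullet> (w \<star> (Mul D \<bullet> ((f' \<bullet> a) \<star> c)))"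
      unfolding cut_mmor(2)[OF f c a] cut_mmor(2)[OF f' c a] .
    moreover have "Mul D \<bullet> (v \<star> (g \<bullet> a)) = Mul D \<bullet> (w \<star> (Mul D \<bullet> ((g \<bullet> a) \<star> c)))"
      if "g \<in> Ar K" "Dom K g = Car A" "Cod K g = Car D" for g
      unfolding v_def using mul_assoc[of D w c "g \<bullet> a"] mul_comm[of D c "g \<bullet> a"] that wt c(1-3) a t by simp
    ultimately show ?thesis using t by simp
  qed
  then have "Mul D \<bullet> (v \<star> (f \<bullet> one A)) = Mul D \<bullet> (v \<star> ?e)"
    by (rule pair_se_agree[OF ring_mor_mmor[OF f] ring_mor_mmor[OF f'] v])
  also have "\<dots> = Mul D \<bullet> (w \<star> (Mul D \<bullet> (c \<star> ?e)))"
    unfolding v_def by (rule mul_assoc) (use wt c(1-3) e t in simp_all)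
  finally have "v = Mul D \<bullet> (w \<star> (Mul D \<bullet> (c \<star> ?e)))" using ring_mor_one[OF f] mul_unr[of D v] v t by simp
  moreover have "zero (Mul D \<bullet> (w \<star> (Mul D \<bullet> (c \<star> ?e))))" using z wt c(1-3) e t by (simp del: comp_app)
  ultimately have "zero v" by (simp only:)
  then show "zero (Mul D \<bullet> (w \<star> (cut D c f \<bullet> one A)))" unfolding cut_mmor(3)[OF f c] v_def .
qed

end

section \<open>Endomorphisms and the degree\<close>

locale indecomposable_tower = indecomposable +
  fixes R u d
  assumes tower: "\<And>n. \<exists>E q j m k. splits (R n) (R (Suc n)) (R (Suc (Suc n))) (u n) (u (Suc n)) E q j m k"
    and R0: "R 0 = unit_ring K" and R1: "R 1 = A" and u0: "u 0 = Unt A"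
    and nonzero: "\<not> zero_ring K (R d)" and vanish: "zero_ring K (R (Suc d))"
begin

text \<open>The tower is entered at n = 0, with maps out of \<open>R 1 = A\<close> that agree on the
  unit ring \<open>R 0\<close>. \<open>Suc d\<close> of them are one too many since
  \<open>R (Suc d)\<close> is zero.\<close>

lemma disjoint_bound:
  assumes F: "\<And>i. i < Suc d \<Longrightarrow> mmor A D (F i)" "\<And>i. i < Suc d \<Longrightarrow> F i \<bullet> one A = c"
    and Fu: "\<And>i j r. i < Suc d \<Longrightarrow> j < Suc d \<Longrightarrow> el r \<Longrightarrow> ob r = Unit K \<Longrightarrow> F i \<bullet> Unt A \<bullet> r = F j \<bullet> Unt A \<bullet> r"
    and d: "\<And>i j. i < Suc d \<Longrightarrow> j < Suc d \<Longrightarrow> i \<noteq> j \<Longrightarrow> disjoint_maps A D (F i) (F j)"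
  shows "zero c"
proof -
  have e: "R (Suc 0) = A" "Car (R 0) = Unit K" "R (0 + Suc d) = R (Suc d)" using R1 R0 by (simp_all add: unit_ring_def)
  show ?thesis
    by (rule tower_bound[where R = R and u = u and n = 0 and l = d and D = D and F = F, unfolded e u0]) (use tower F Fu d vanish in blast)+
qed

lemma endo_bound: "finite EA" "card EA \<le> d"
proof -
  have no: False if F: "\<And>i. i < Suc d \<Longrightarrow> F i \<in> EA" "inj_on F {..<Suc d}" for F
  proof -
    have "zero (one A)"
    proof (rule disjoint_bound[where F = F and D = A])
      fix i j r assume ij: "i < Suc d" "j < Suc d"
      { assume "el r" "ob r = Unit K"
        then show "F i \<bullet> Unt A \<bullet> r = F j \<bullet> Unt A \<bullet> r" using F(1)[OF ij(1)] F(1)[OF ij(2)] by (simp add: EA_iff ring_mor_unit) }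
      assume "i \<noteq> j"
      then have "F i \<noteq> F j" using F(2) ij by (auto simp: inj_on_def)
      then show "disjoint_maps A A (F i) (F j)" using endo_disjoint F ij by blast
    qed (use F EA_mmor EA_one in blast)+
    then show False using one_nonzero by blast
  qed
  have "finite EA \<and> card EA \<le> d"
  proof (rule ccontr)
    assume "\<not> (finite EA \<and> card EA \<le> d)"
    \<comment> \<open>An infinite set and a finite one that is too large both contain exactly
      \<open>Suc d\<close> elements to test; finiteness is thus part of the result.\<close>
    then have "\<exists>S\<subseteq>EA. finite S \<and> card S = Suc d"
      using infinite_arbitrarily_large[of EA "Suc d"] obtain_subset_with_card_n[of "Suc d" EA] by (metis not_less_eq_eq)
    then obtain S where S: "S \<subseteq> EA" "finite S" "card S = Suc d" by blast
    obtain F where "bij_betw F {..<Suc d} S" using ex_bij_betw_nat_finite[OF S(2)] S(3) by (auto simp: atLeast0LessThan)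
    then have "inj_on F {..<Suc d}" "F i \<in> EA" if "i < Suc d" for i using that S(1) by (auto simp: bij_betw_def)
    then show False using no[of F] by blast
  qed
  then show "finite EA" "card EA \<le> d" by auto
qed

end

section \<open>The idempotents of A \<otimes> A attached to endomorphisms\<close>

context indecomposable
begin

text \<open>The idempotent \<open>\<Sum> \<gamma> x\<^sub>i \<otimes> y\<^sub>i\<close> of \<open>A \<otimes> A\<close> cuts out the image of \<open>lam \<gamma>\<close>.\<close>

definition ge where "ge g = (g \<boxtimes> Idn K (Car A)) \<bullet> se"

lemma ge_typ: "g \<in> EA \<Longrightarrow> el (ge g)" "g \<in> EA \<Longrightarrow> fst (ge g) = []" "g \<in> EA \<Longrightarrow> ob (ge g) = Car A \<odot> Car A"
  using EA_typ[of g] by (simp_all add: ge_def)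

text \<open>The value is \<Sum> g x_i \<cdot> h y_i: this is g(1) if g = h, and
  \<open>endo_se_zero\<close> applies otherwise.\<close>

lemma lam_ge:
  assumes g: "g \<in> EA" and h: "h \<in> EA"
  shows "g = h \<Longrightarrow> lam h \<bullet> ge g = one A" "g \<noteq> h \<Longrightarrow> zero (lam h \<bullet> ge g)"
proof -
  note t = EA_typ[OF g] EA_typ[OF h]
  have "lam h \<cdot> (g \<boxtimes> Idn K (Car A)) = Mul A \<cdot> (g \<boxtimes> h)"
    by (rule ext2[of _ "Car A" "Car A"]) (use t in \<open>auto simp: homs_iff\<close>)
  then have "(lam h \<cdot> (g \<boxtimes> Idn K (Car A))) \<bullet> se = (Mul A \<cdot> (g \<boxtimes> h)) \<bullet> se" by simp
  moreover have "(lam h \<cdot> (g \<boxtimes> Idn K (Car A))) \<bullet> se = lam h \<bullet> ge g" unfolding ge_def by (rule comp_app) (use t in auto)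
  ultimately have e: "lam h \<bullet> ge g = (Mul A \<cdot> (g \<boxtimes> h)) \<bullet> se" by simp
  show "zero (lam h \<bullet> ge g)" if "g \<noteq> h" unfolding e by (rule endo_se_zero[OF g h that])
  show "lam h \<bullet> ge g = one A" if "g = h"
  proof -
    have "Mul A \<cdot> (g \<boxtimes> g) = g \<cdot> Mul A" using EA_mmor[OF g] by (simp add: mmor_def)
    then have "(Mul A \<cdot> (g \<boxtimes> h)) \<bullet> se = (g \<cdot> Mul A) \<bullet> se" using that by simp
    also have "\<dots> = one A" using t EA_one[OF g] by simp
    finally show ?thesis using e by simp
  qed
qed

text \<open>\<Sum> g(x_i) a \<otimes> y_i b = \<Sum> g(b x_i) a \<otimes> y_i, because
  \<open>se\<close> lets b change sides; on the part cut out by \<open>ge g\<close> the right factor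
  acts through g.\<close>

lemma ge_mul:
  assumes g: "g \<in> EA" and t: "el t" "ob t = Car A \<odot> Car A"
  shows "Mul TA \<bullet> (ge g \<star> t) = Mul TA \<bullet> (ge g \<star> ((lam g \<bullet> t) \<star> one A))"
proof (rule lin_ext[where x = "Car A" and y = "Car A" and e = t and
      L = "\<lambda>t. Mul TA \<bullet> (ge g \<star> t)" and R = "\<lambda>t. Mul TA \<bullet> (ge g \<star> ((lam g \<bullet> t) \<star> one A))"],
    (rule lin_intros | use t EA_typ[OF g] ge_typ[OF g] in \<open>simp; fail\<close>)+)
  note gt = EA_typ[OF g] and gm = mmor_mul[OF EA_mmor[OF g]]
  fix a b assume ab: "el a" "el b" "ob a = Car A" "ob b = Car A" "dj a b" "dj b a"
  let ?G = "g \<boxtimes> Idn K (Car A)"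
  have "Mul TA \<bullet> (ge g \<star> (a \<star> b)) = Mul TA \<bullet> ((?G \<bullet> (Idn K (Car A) \<boxtimes> Mul A) \<bullet> Asc K (Car A) (Car A) (Car A) \<bullet> (se \<star> b)) \<star> (a \<star> one A))"
    unfolding ge_def
    by (rule lin_ext[where x = "Car A" and y = "Car A" and e = se and L = "\<lambda>e. Mul TA \<bullet> ((?G \<bullet> e) \<star> (a \<star> b))" and
         R = "\<lambda>e. Mul TA \<bullet> ((?G \<bullet> (Idn K (Car A) \<boxtimes> Mul A) \<bullet> Asc K (Car A) (Car A) (Car A) \<bullet> (e \<star> b)) \<star> (a \<star> one A))"],
       (rule lin_intros | use ab gt in \<open>simp add: mul_simps; fail\<close>)+)
  also have "\<dots> = Mul TA \<bullet> ((?G \<bullet> (Mul A \<boxtimes> Idn K (Car A)) \<bullet> inv_arrow K (Asc K (Car A) (Car A) (Car A)) \<bullet> (b \<star> se)) \<star> (a \<star> one A))"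
    using sg_se_left[of b] sg_se_right[of b] ab by simp
  also have "\<dots> = Mul TA \<bullet> (ge g \<star> ((lam g \<bullet> (a \<star> b)) \<star> one A))"
    unfolding ge_def
    by (rule lin_ext[where x = "Car A" and y = "Car A" and e = se and R = "\<lambda>e. Mul TA \<bullet> ((?G \<bullet> e) \<star> ((lam g \<bullet> (a \<star> b)) \<star> one A))" and
         L = "\<lambda>e. Mul TA \<bullet> ((?G \<bullet> (Mul A \<boxtimes> Idn K (Car A)) \<bullet> inv_arrow K (Asc K (Car A) (Car A) (Car A)) \<bullet> (b \<star> e)) \<star> (a \<star> one A))"],
       (rule lin_intros | use ab gt in \<open>simp add: mul_ac gm; fail\<close>)+)
  finally show "Mul TA \<bullet> (ge g \<star> (a \<star> b)) = Mul TA \<bullet> (ge g \<star> ((lam g \<bullet> (a \<star> b)) \<star> one A))" .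
qed

text \<open>With \<open>s\<close> mapping \<open>(a\<^sub>\<gamma>)\<close> to \<open>\<Sum> (a\<^sub>\<gamma> \<otimes> 1) \<cdot> ge \<gamma>\<close> and \<open>l = (lam \<gamma>)\<close>, the composite \<open>l \<cdot> s\<close> is the identity and \<open>s \<cdot> l\<close> is
  multiplication with \<open>E = \<Sum> ge \<gamma>\<close>.\<close>

lemma lambda_section:
  assumes fin: "finite EA"
  obtains E where "el E" "fst E = []" "ob E = Car A \<odot> Car A" "Mul TA \<bullet> (E \<star> E) = E"
    "\<forall>g\<in>EA. Mul TA \<bullet> (ge g \<star> E) = ge g" "E = one TA \<longrightarrow> lambda_cone"
proof -
  obtain P p j where b: "biprod EA (\<lambda>_. Car A) P p j" using ex_biprod[OF fin, of "\<lambda>_. Car A"] by auto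
  have c: "product_cone K EA (\<lambda>_. Car A) P p" using b by (simp add: biprod_def)
  note t = biprod_props[OF b]
  have P: "P \<in> Ob K" using c by (simp add: product_cone_def)
  have lt: "lam g \<in> Ar K" "Dom K (lam g) = Car A \<odot> Car A" "Cod K (lam g) = Car A" if "g \<in> EA" for g
    using EA_typ[OF that] by auto
  have lmul: "lam g \<bullet> Mul TA \<bullet> (s \<star> s') = Mul A \<bullet> ((lam g \<bullet> s) \<star> (lam g \<bullet> s'))"
    if "g \<in> EA" "el s" "el s'" "ob s = Car A \<odot> Car A" "ob s' = Car A \<odot> Car A" for g s s'
    using mmor_mul[OF ring_mor_mmor[OF lam_ring_mor[OF that(1)]], of s s'] that by (simp del: comp_app)
  have pj: "p k \<bullet> j i \<bullet> a = (if k = i then a else Zer K (Car A) (Car A) \<bullet> a)" if "i \<in> EA" "k \<in> EA" "el a" "ob a = Car A" for i k a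
  proof -
    have "(p k \<cdot> j i) \<bullet> a = (if k = i then Idn K (Car A) else Zer K (Car A) (Car A)) \<bullet> a" using t(9)[OF that(2,1)] by simp
    then show ?thesis using that t(1-6)[OF that(1)] t(4-6)[OF that(2)] by (auto split: if_splits)
  qed
  \<comment> \<open>\<open>B g\<close> is a \<mapsto> (a \<otimes> 1) \<cdot> ge g, the prescribed
    restriction of \<open>s\<close> to the summand of g.\<close>
  define B where "B g = cut TA (ge g) (inl A A)" for g
  have Bt: "B g \<in> Ar K" "Dom K (B g) = Car A" "Cod K (B g) = Car A \<odot> Car A" if "g \<in> EA" for g
    using ge_typ[OF that] mmor_typ[OF ring_mor_mmor[OF inl_ring_mor(1)[OF A_ring A_ring]]] by (simp_all add: B_def cut_def)
  have Ba: "B g \<bullet> a = Mul TA \<bullet> ((a \<star> one A) \<star> ge g)" if g: "g \<in> EA" and a: "el a" "ob a = Car A" for g a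
  proof -
    have "snd (ge g) \<bullet> un = ge g" using snd_idel[OF ge_typ(1)[OF g]] ge_typ(2)[OF g] by (simp add: idel_Nil)
    then show ?thesis using a ge_typ[OF g] inl_ring_mor(2)[OF A_ring A_ring a] mmor_typ[OF ring_mor_mmor[OF inl_ring_mor(1)[OF A_ring A_ring]]]
      by (simp add: B_def cut_def)
  qed
  have "\<exists>s\<in>homs K P (Car A \<odot> Car A). \<forall>g\<in>EA. s \<cdot> j g = B g"
    using b[unfolded biprod_def] Bt by (auto simp: homs_iff)
  then obtain s where s: "s \<in> Ar K" "Dom K s = P" "Cod K s = Car A \<odot> Car A" and sj: "\<And>g. g \<in> EA \<Longrightarrow> s \<cdot> j g = B g"
    by (auto simp: homs_iff)
  have sja: "s \<bullet> j g \<bullet> a = Mul TA \<bullet> ((a \<star> one A) \<star> ge g)" if "g \<in> EA" "el a" "ob a = Car A" for g a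
  proof -
    have "(s \<cdot> j g) \<bullet> a = s \<bullet> j g \<bullet> a" by (rule comp_app) (use s t[OF that(1)] that in auto)
    then show ?thesis unfolding sj[OF that(1)] Ba[OF that] by simp
  qed
  obtain l where l: "l \<in> Ar K" "Dom K l = Car A \<odot> Car A" "Cod K l = P" and pl: "\<And>g. g \<in> EA \<Longrightarrow> p g \<cdot> l = lam g"
    using cone_ex[OF c, of "Car A \<odot> Car A" lam] lt by (auto simp: homs_iff)
  have pla: "p g \<bullet> l \<bullet> x = lam g \<bullet> x" if "g \<in> EA" "el x" "ob x = Car A \<odot> Car A" for g x
  proof -
    have "(p g \<cdot> l) \<bullet> x = p g \<bullet> l \<bullet> x" by (rule comp_app) (use l t[OF that(1)] that in auto)
    then show ?thesis unfolding pl[OF that(1)] by simp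
  qed
  \<comment> \<open>In each component this is \<open>lam_ge\<close>.\<close>
  have ls: "l \<cdot> s = Idn K P"
  proof (rule biprod_ext[OF b P])
    fix g assume g: "g \<in> EA"
    note gt = ge_typ[OF g]
    show "(l \<cdot> s) \<cdot> j g = Idn K P \<cdot> j g"
    proof (rule ext1[of _ "Car A"])
      fix a assume a: "el a" "ob a = Car A"
      have "l \<bullet> s \<bullet> j g \<bullet> a = j g \<bullet> a"
      proof (rule cone_el_eq[OF c])
        fix h assume h: "h \<in> EA"
        have la: "lam h \<bullet> (a \<star> one A) = a" using a EA_typ[OF h] EA_one[OF h] by (simp add: mul_simps)
        have "p h \<bullet> l \<bullet> s \<bullet> j g \<bullet> a = Mul A \<bullet> (a \<star> (lam h \<bullet> ge g))"
          unfolding sja[OF g a] using pla[OF h, of "Mul TA \<bullet> ((a \<star> one A) \<star> ge g)"] lmul[OF h, of "a \<star> one A" "ge g"] la a gt by (simp del: comp_app)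
        also have "\<dots> = p h \<bullet> j g \<bullet> a"
        proof (cases "g = h")
          case True then show ?thesis using lam_ge(1)[OF g h True] pj[OF g h a] a by (simp add: mul_simps del: comp_app)
        next
          case False
          have "zero (Mul A \<bullet> (a \<star> (lam h \<bullet> ge g)))" using lam_ge(2)[OF g h False] a gt lt[OF h] by (simp del: comp_app)
          moreover have "zero (p h \<bullet> j g \<bullet> a)" using pj[OF g h a] a False by simp
          ultimately show ?thesis by (rule zero_unique[rotated 2]) (use a gt lt[OF h] t[OF g] t(4-6)[OF h] in \<open>simp_all del: comp_app\<close>)
        qed
        finally show "p h \<bullet> l \<bullet> s \<bullet> j g \<bullet> a = p h \<bullet> j g \<bullet> a" .
      qed (use a l s t[OF g] in simp_all)
      then show "((l \<cdot> s) \<cdot> j g) \<bullet> a = (Idn K P \<cdot> j g) \<bullet> a" using a l s t[OF g] by simp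
    qed (use l s t[OF g] in \<open>auto simp: homs_iff\<close>)
  qed (use l s P in \<open>auto simp: homs_iff\<close>)
  \<comment> \<open>\<open>ac\<close> lets A \<otimes> A act on P through the \<open>lam g\<close>.
    As \<open>s\<close> is linear for this action, which rests on \<open>ge_mul\<close>, s(l x) =
    s(x \<cdot> l 1) = x \<cdot> E.\<close>
  obtain ac where ac: "ac \<in> Ar K" "Dom K ac = Car A \<odot> Car A \<odot> P" "Cod K ac = P" and pac: "\<And>g. g \<in> EA \<Longrightarrow> p g \<cdot> ac = Mul A \<cdot> (lam g \<boxtimes> p g)"
    using cone_ex[OF c, of "Car A \<odot> Car A \<odot> P" "\<lambda>g. Mul A \<cdot> (lam g \<boxtimes> p g)"] lt t P by (auto simp: homs_iff)
  have paca: "p g \<bullet> ac \<bullet> (x \<star> y) = Mul A \<bullet> ((lam g \<bullet> x) \<star> (p g \<bullet> y))" if "g \<in> EA" "el x" "ob x = Car A \<odot> Car A" "el y" "ob y = P" for g x y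
  proof -
    have "(p g \<cdot> ac) \<bullet> (x \<star> y) = p g \<bullet> ac \<bullet> (x \<star> y)" by (rule comp_app) (use ac t[OF that(1)] that in auto)
    moreover have "(Mul A \<cdot> (lam g \<boxtimes> p g)) \<bullet> (x \<star> y) = Mul A \<bullet> ((lam g \<bullet> x) \<star> (p g \<bullet> y))"
      using lt[OF that(1)] t[OF that(1)] that by simp
    ultimately show ?thesis unfolding pac[OF that(1)] by simp
  qed
  have sac: "s \<cdot> ac = Mul TA \<cdot> (Idn K (Car A \<odot> Car A) \<boxtimes> s)"
  proof (rule biprod_ext_ten[OF b, of "Car A \<odot> Car A"])
    fix g assume g: "g \<in> EA"
    note gt = ge_typ[OF g]
    show "(s \<cdot> ac) \<cdot> (Idn K (Car A \<odot> Car A) \<boxtimes> j g) = (Mul TA \<cdot> (Idn K (Car A \<odot> Car A) \<boxtimes> s)) \<cdot> (Idn K (Car A \<odot> Car A) \<boxtimes> j g)"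
    proof (rule ext2[of _ "Car A \<odot> Car A" "Car A"])
      fix x a assume x: "el x" "el a" "ob x = Car A \<odot> Car A" "ob a = Car A" "dj x a" "dj a x"
      let ?y = "Mul A \<bullet> ((lam g \<bullet> x) \<star> a)"
      have y: "el ?y" "ob ?y = Car A" using x lt[OF g] by (simp_all del: comp_app)
      have "ac \<bullet> (x \<star> (j g \<bullet> a)) = j g \<bullet> ?y"
      proof (rule cone_el_eq[OF c])
        fix h assume h: "h \<in> EA"
        have pa: "p h \<bullet> ac \<bullet> (x \<star> (j g \<bullet> a)) = Mul A \<bullet> ((lam h \<bullet> x) \<star> (p h \<bullet> j g \<bullet> a))" by (rule paca[OF h]) (use x t[OF g] in simp_all)
        show "p h \<bullet> ac \<bullet> (x \<star> (j g \<bullet> a)) = p h \<bullet> j g \<bullet> ?y"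
        proof (cases "h = g")
          case True then show ?thesis unfolding pa pj[OF g h y] pj[OF g h x(2,4)] by simp
        next
          case False
          have "zero (Mul A \<bullet> ((lam h \<bullet> x) \<star> (p h \<bullet> j g \<bullet> a)))"
            unfolding pj[OF g h x(2,4)] using False x lt[OF h] by (simp del: comp_app)
          moreover have "zero (p h \<bullet> j g \<bullet> ?y)" unfolding pj[OF g h y] using False y by (simp del: comp_app)
          ultimately show ?thesis unfolding pa
            by (rule zero_unique[rotated 2]) (use x lt[OF h] lt[OF g] t[OF g] t(4-6)[OF h] in \<open>simp_all del: comp_app\<close>)
        qed
      qed (use x ac y lt[OF g] t[OF g] in \<open>simp_all del: comp_app\<close>)
      then have "s \<bullet> ac \<bullet> (x \<star> (j g \<bullet> a)) = Mul TA \<bullet> ((?y \<star> one A) \<star> ge g)" using sja[OF g y] by simp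
      also have "\<dots> = Mul TA \<bullet> (x \<star> (Mul TA \<bullet> ((a \<star> one A) \<star> ge g)))"
      proof -
        let ?w = "lam g \<bullet> x"
        have w: "el ?w" "ob ?w = Car A" "fst ?w = fst x" using x lt[OF g] by (simp_all del: comp_app)
        have "?y \<star> one A = Mul TA \<bullet> ((?w \<star> one A) \<star> (a \<star> one A))" using x w by (simp add: mul_simps del: comp_app)
        then have "Mul TA \<bullet> ((?y \<star> one A) \<star> ge g) = Mul TA \<bullet> ((Mul TA \<bullet> ((?w \<star> one A) \<star> (a \<star> one A))) \<star> ge g)" by (simp only:)
        also have "\<dots> = Mul TA \<bullet> ((a \<star> one A) \<star> (Mul TA \<bullet> (ge g \<star> (?w \<star> one A))))"
        proof -
          have m: "Mul TA \<bullet> ((Mul TA \<bullet> (u \<star> v)) \<star> w) = Mul TA \<bullet> (v \<star> (Mul TA \<bullet> (w \<star> u)))"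
            if "el u" "el v" "el w" "ob u = Car A \<odot> Car A" "ob v = Car A \<odot> Car A" "ob w = Car A \<odot> Car A" "dj u v" "dj v u" "fst w = []" for u v w
            using that mul_ac[OF TA_ring] by simp
          show ?thesis by (rule m) (use x w gt in \<open>simp_all del: comp_app\<close>)
        qed
        also have "\<dots> = Mul TA \<bullet> ((a \<star> one A) \<star> (Mul TA \<bullet> (ge g \<star> x)))" unfolding ge_mul[OF g x(1,3)] ..
        also have "\<dots> = Mul TA \<bullet> (x \<star> (Mul TA \<bullet> ((a \<star> one A) \<star> ge g)))"
        proof -
          have m: "Mul TA \<bullet> (v \<star> (Mul TA \<bullet> (w \<star> u))) = Mul TA \<bullet> (u \<star> (Mul TA \<bullet> (v \<star> w)))"
            if "el u" "el v" "el w" "ob u = Car A \<odot> Car A" "ob v = Car A \<odot> Car A" "ob w = Car A \<odot> Car A" "dj u v" "dj v u" "fst w = []" for u v w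
            using that mul_ac[OF TA_ring] by simp
          show ?thesis by (rule m) (use x gt in \<open>simp_all del: comp_app\<close>)
        qed
        finally show ?thesis .
      qed
      finally have q: "s \<bullet> ac \<bullet> (x \<star> (j g \<bullet> a)) = Mul TA \<bullet> (x \<star> (s \<bullet> j g \<bullet> a))" unfolding sja[OF g x(2,4)] .
      then show "((s \<cdot> ac) \<cdot> (Idn K (Car A \<odot> Car A) \<boxtimes> j g)) \<bullet> (x \<star> a) = ((Mul TA \<cdot> (Idn K (Car A \<odot> Car A) \<boxtimes> s)) \<cdot> (Idn K (Car A \<odot> Car A) \<boxtimes> j g)) \<bullet> (x \<star> a)"
        using s ac t[OF g] x by simp
    qed (use s ac t[OF g] in \<open>auto simp: homs_iff\<close>)
  qed (use s ac P in \<open>auto simp: homs_iff\<close>)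
  have saca: "s \<bullet> ac \<bullet> (x \<star> y) = Mul TA \<bullet> (x \<star> (s \<bullet> y))" if "el x" "ob x = Car A \<odot> Car A" "el y" "ob y = P" for x y
  proof -
    have "(s \<cdot> ac) \<bullet> (x \<star> y) = (Mul TA \<cdot> (Idn K (Car A \<odot> Car A) \<boxtimes> s)) \<bullet> (x \<star> y)" unfolding sac ..
    then show ?thesis using that s ac P by simp
  qed
  \<comment> \<open>l sends 1 to the family of units, so this is the sum of all \<open>ge g\<close>,
    obtained without finite sums of elements.\<close>
  define E where "E = s \<bullet> l \<bullet> one TA"
  have Et: "el E" "fst E = []" "ob E = Car A \<odot> Car A" using s l by (simp_all add: E_def)
  have slx: "s \<bullet> l \<bullet> x = Mul TA \<bullet> (x \<star> E)" if x: "el x" "ob x = Car A \<odot> Car A" for x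
  proof -
    have "l \<bullet> x = ac \<bullet> (x \<star> (l \<bullet> one TA))"
    proof (rule cone_el_eq[OF c])
      fix g assume g: "g \<in> EA"
      have "p g \<bullet> ac \<bullet> (x \<star> (l \<bullet> one TA)) = Mul A \<bullet> ((lam g \<bullet> x) \<star> (p g \<bullet> l \<bullet> one TA))" by (rule paca[OF g x]) (use l in simp_all)
      also have "p g \<bullet> l \<bullet> one TA = lam g \<bullet> one TA" by (rule pla[OF g]) simp_all
      also have "\<dots> = one A" by (rule ring_mor_one[OF lam_ring_mor[OF g]])
      also have "Mul A \<bullet> ((lam g \<bullet> x) \<star> one A) = lam g \<bullet> x" by (rule mul_unr) (use x lt[OF g] in \<open>simp_all del: comp_app\<close>)
      finally show "p g \<bullet> l \<bullet> x = p g \<bullet> ac \<bullet> (x \<star> (l \<bullet> one TA))" unfolding pla[OF g x] by simp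
    qed (use x l ac in simp_all)
    then have "s \<bullet> l \<bullet> x = s \<bullet> ac \<bullet> (x \<star> (l \<bullet> one TA))" by (rule arg_cong)
    also have "\<dots> = Mul TA \<bullet> (x \<star> E)" unfolding E_def by (rule saca) (use x l in simp_all)
    finally show ?thesis .
  qed
  show ?thesis
  proof (rule that[OF Et _ ballI impI])
    have "(l \<cdot> s) \<bullet> l \<bullet> one TA = l \<bullet> one TA" unfolding ls using l by simp
    then have "s \<bullet> l \<bullet> E = E" using s l by (simp add: E_def)
    then show "Mul TA \<bullet> (E \<star> E) = E" using slx[OF Et(1,3)] by simp
  next
    fix g assume g: "g \<in> EA"
    note gt = ge_typ[OF g]
    have "l \<bullet> ge g = j g \<bullet> one A"
    proof (rule cone_el_eq[OF c])
      fix h assume h: "h \<in> EA"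
      show "p h \<bullet> l \<bullet> ge g = p h \<bullet> j g \<bullet> one A"
      proof (cases "g = h")
        case True then show ?thesis using pla[OF h gt(1,3)] lam_ge(1)[OF g h True] pj[OF g h, of "one A"] by simp
      next
        case False
        have "zero (p h \<bullet> l \<bullet> ge g)" unfolding pla[OF h gt(1,3)] by (rule lam_ge(2)[OF g h False])
        moreover have "zero (p h \<bullet> j g \<bullet> one A)" using pj[OF g h, of "one A"] False by simp
        ultimately show ?thesis by (rule zero_unique[rotated 2]) (use gt l t[OF g] t(4-6)[OF h] in simp_all)
      qed
    qed (use gt l t[OF g] in simp_all)
    then have "s \<bullet> l \<bullet> ge g = Mul TA \<bullet> ((one A \<star> one A) \<star> ge g)" using sja[OF g, of "one A"] by simp
    also have "\<dots> = Mul TA \<bullet> (one TA \<star> ge g)" using tensor_one[OF A_ring A_ring] by simp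
    also have "\<dots> = ge g" by (rule mul_unl) (use gt in simp_all)
    finally show "Mul TA \<bullet> (ge g \<star> E) = ge g" using slx[OF gt(1,3)] by simp
  next
    \<comment> \<open>Now \<open>s\<close> and \<open>l\<close> are mutually inverse, and
      \<open>l\<close> transports the cone from P to A \<otimes> A.\<close>
    assume E1: "E = one TA"
    have "s \<cdot> l = Idn K (Car A \<odot> Car A)"
    proof (rule ext1[of _ "Car A \<odot> Car A"])
      fix x assume x: "el x" "ob x = Car A \<odot> Car A"
      have "s \<bullet> l \<bullet> x = x" unfolding slx[OF x] E1 by (rule mul_unr) (use x in simp_all)
      then show "(s \<cdot> l) \<bullet> x = Idn K (Car A \<odot> Car A) \<bullet> x" using x s l by simp
    qed (use s l in \<open>auto simp: homs_iff\<close>)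
    then have "inverse_arrows K l s" unfolding inverse_arrows_def using ls l s by (simp add: homs_iff)
    then have "iso_arrow K l" unfolding iso_arrow_def by blast
    from iso_cone[OF c this l(3)] have "product_cone K EA (\<lambda>_. Car A) (Car A \<odot> Car A) (\<lambda>i. p i \<cdot> l)" unfolding l(2) .
    then show lambda_cone unfolding lambda_cone_def by (rule product_cone_cong[OF _ pl])
  qed
qed

text \<open>The pairing equals \<open>inl\<close> applied to \<Sum> g x_i \<cdot> h y_i, which
  already vanishes in A.\<close>

lemma pair_inl_zero:
  assumes g: "g \<in> EA" and h: "h \<in> EA" and ne: "g \<noteq> h"
  shows "zero ((Mul TA \<cdot> ((inl A A \<cdot> g) \<boxtimes> (inl A A \<cdot> h))) \<bullet> se)"
proof -
  note t = EA_typ[OF g] EA_typ[OF h] and it = mmor_typ[OF ring_mor_mmor[OF inl_ring_mor(1)[OF A_ring A_ring]]]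
  have "Mul TA \<cdot> ((inl A A \<cdot> g) \<boxtimes> (inl A A \<cdot> h)) = inl A A \<cdot> (Mul A \<cdot> (g \<boxtimes> h))"
    by (rule ext2[of _ "Car A" "Car A"]) (use t it in \<open>auto simp: homs_iff inl_ring_mor(2) mul_simps\<close>)
  moreover have "(inl A A \<cdot> (Mul A \<cdot> (g \<boxtimes> h))) \<bullet> se = inl A A \<bullet> ((Mul A \<cdot> (g \<boxtimes> h)) \<bullet> se)"
    by (rule comp_app) (use t it in auto)
  moreover have "zero (inl A A \<bullet> ((Mul A \<cdot> (g \<boxtimes> h)) \<bullet> se))"
    using endo_se_zero[OF g h ne] t it by (simp del: comp_app)
  ultimately show ?thesis by simp
qed

lemma pair_inl_inr:
  assumes g: "g \<in> EA" shows "(Mul TA \<cdot> ((inl A A \<cdot> g) \<boxtimes> inr A A)) \<bullet> se = ge g"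
proof -
  note t = EA_typ[OF g] and it = mmor_typ[OF ring_mor_mmor[OF inl_ring_mor(1)[OF A_ring A_ring]]]
    mmor_typ[OF ring_mor_mmor[OF inr_ring_mor(1)[OF A_ring A_ring]]]
  have "Mul TA \<cdot> ((inl A A \<cdot> g) \<boxtimes> inr A A) = g \<boxtimes> Idn K (Car A)"
    by (rule ext2[of _ "Car A" "Car A"]) (use t it in \<open>auto simp: homs_iff inl_ring_mor(2) inr_ring_mor(2) mul_simps\<close>)
  then show ?thesis by (simp add: ge_def)
qed

end

context indecomposable_tower
begin

lemma card_eq_lambda_cone:
  assumes card: "card EA = d" shows lambda_cone
proof -
  have fin: "finite EA" by (rule endo_bound(1))
  obtain E where E: "el E" "fst E = []" "ob E = Car A \<odot> Car A" "Mul TA \<bullet> (E \<star> E) = E"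
    and eE: "\<forall>g\<in>EA. Mul TA \<bullet> (ge g \<star> E) = ge g" and fin_E: "E = one TA \<longrightarrow> lambda_cone"
    by (rule lambda_section[OF fin])
  \<comment> \<open>\<open>N\<close> is -E, and \<open>c\<close> below is 1 - E, the idempotent
    complementary to the sum of the \<open>ge g\<close>.\<close>
  obtain N where N: "el N" "fst N = fst E" "ob N = ob E" "zero (pl E N)" by (rule ex_neg_el[OF E(1)])
  have N': "fst N = []" "ob N = Car A \<odot> Car A" using N E by simp_all
  define c where "c = pl (one TA) N"
  have c: "el c" "fst c = []" "ob c = Car A \<odot> Car A" using N N' by (simp_all add: c_def)
  have dist: "Mul TA \<bullet> (x \<star> pl y z) = pl (Mul TA \<bullet> (x \<star> y)) (Mul TA \<bullet> (x \<star> z))"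
    if "el x" "el y" "el z" "ob x = Car A \<odot> Car A" "ob y = Car A \<odot> Car A" "ob z = Car A \<odot> Car A" "fst y = fst z" for x y z
    using that by (simp add: ten_pl app_pl)
  have mc: "Mul TA \<bullet> (x \<star> c) = pl x (Mul TA \<bullet> (x \<star> N))" if "el x" "ob x = Car A \<odot> Car A" for x
    unfolding c_def using dist[of x "one TA" N] mul_unr[of TA x] that N(1) N' by simp
  have zEN: "zero (pl (Mul TA \<bullet> (x \<star> E)) (Mul TA \<bullet> (x \<star> N)))" if x: "el x" "ob x = Car A \<odot> Car A" for x
  proof -
    have "zero (Mul TA \<bullet> (x \<star> pl E N))" using x N E by simp
    then show ?thesis unfolding dist[OF x(1) E(1) N(1) x(2) E(3) N'(2) N(2)[symmetric]] .
  qed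
  have gc: "zero (Mul TA \<bullet> (ge g \<star> c))" if g: "g \<in> EA" for g
    using zEN[of "ge g"] bspec[OF eE g] mc[of "ge g"] ge_typ[OF g] by simp
  have Ec: "zero (Mul TA \<bullet> (E \<star> c))" using zEN[OF E(1,3)] E(4) mc[OF E(1,3)] by simp
  have cE: "zero (Mul TA \<bullet> (c \<star> E))" using Ec mul_comm[of TA c E] c E by simp
  have "zero (Mul TA \<bullet> (c \<star> N))"
  proof -
    have "pl (Mul TA \<bullet> (c \<star> E)) (Mul TA \<bullet> (c \<star> N)) = Mul TA \<bullet> (c \<star> N)"
      by (rule pl_zero(2)) (use c E N N' cE in simp_all)
    then show ?thesis using zEN[OF c(1,3)] by simp
  qed
  then have "pl c (Mul TA \<bullet> (c \<star> N)) = c" by (intro pl_zero(1)) (use c N N' in simp_all)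
  then have cc: "Mul TA \<bullet> (c \<star> c) = c" using mc[OF c(1,3)] by simp
  have c': "el c" "fst c = []" "ob c = Car TA" "Mul TA \<bullet> (c \<star> c) = c" using c cc by simp_all
  obtain \<beta> where b: "bij_betw \<beta> {..<d} EA" using ex_bij_betw_nat_finite[OF fin] card by (auto simp: atLeast0LessThan)
  have be: "\<beta> i \<in> EA" if "i < d" for i using b that by (auto simp: bij_betw_def)
  \<comment> \<open>\<open>inr A A\<close> is the additional map, with index d; this makes
    \<open>Suc d\<close> maps in all.\<close>
  define f where "f i = (if i < d then inl A A \<cdot> \<beta> i else inr A A)" for i
  have fr: "ring_mor K A TA (f i)" for i
    using ring_mor_comp[OF _ inl_ring_mor(1)[OF A_ring A_ring], of A "\<beta> i"] be[of i] inr_ring_mor(1)[OF A_ring A_ring]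
    by (simp add: f_def EA_iff)
  note cm = cut_mmor[OF fr c']
  \<comment> \<open>Two maps into the left factor have a vanishing pairing already before the cut. A
    left map and \<open>inr\<close> pair to \<open>ge (\<beta> i)\<close>, which c annihilates; for
    this reason all maps are cut down to c.\<close>
  have dl: "disjoint_maps A TA (cut TA c (f i)) (cut TA c (f k))" if "i < d" "k < Suc d" "i \<noteq> k" for i k
  proof (rule cut_disjoint[OF fr fr c'])
    have ft: "f i \<in> Ar K" "Dom K (f i) = Car A" "Cod K (f i) = Car A \<odot> Car A" for i using mmor_typ[OF ring_mor_mmor[OF fr[of i]]] by simp_all
    show "zero (Mul TA \<bullet> (c \<star> ((Mul TA \<cdot> (f i \<boxtimes> f k)) \<bullet> se)))"
    proof (cases "k < d")
      case True
      then have "\<beta> i \<noteq> \<beta> k" using b that by (auto simp: bij_betw_def inj_on_def)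
      from pair_inl_zero[OF be[OF that(1)] be[OF True] this]
      have "zero ((Mul TA \<cdot> (f i \<boxtimes> f k)) \<bullet> se)" using that True by (simp add: f_def del: comp_app)
      then show ?thesis using c ft[of i] ft[of k] by (simp del: comp_app)
    next
      case False
      have "(Mul TA \<cdot> (f i \<boxtimes> f k)) \<bullet> se = ge (\<beta> i)" using pair_inl_inr[OF be[OF that(1)]] that False by (simp add: f_def del: comp_app)
      then show ?thesis using gc[OF be[OF that(1)]] mul_comm[of TA c "ge (\<beta> i)"] c ge_typ[OF be[OF that(1)]] by (simp del: comp_app)
    qed
  qed
  have "zero c"
  proof (rule disjoint_bound[where F = "\<lambda>i. cut TA c (f i)" and D = TA])
    fix i j r assume ij: "i < Suc d" "j < Suc d"
    { assume r: "el r" "ob r = Unit K"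
      have "cut TA c (f i) \<bullet> Unt A \<bullet> r = Mul TA \<bullet> ((Unt TA \<bullet> r) \<star> c)" for i
        using cm(2)[of "Unt A \<bullet> r" i] ring_mor_unit[OF fr[of i] r] r by simp
      then show "cut TA c (f i) \<bullet> Unt A \<bullet> r = cut TA c (f j) \<bullet> Unt A \<bullet> r" by simp }
    assume ne: "i \<noteq> j"
    show "disjoint_maps A TA (cut TA c (f i)) (cut TA c (f j))"
    proof (cases "i < d")
      case True then show ?thesis using dl ij ne by blast
    next
      case False
      then have "j < d" using ij ne by simp
      then show ?thesis using dl[of j i] ij ne disjoint_maps_sym cm(3) by metis
    qed
  qed (use cm(1,3) in blast)+
  then have "zero (pl (one TA) N)" by (simp add: c_def)
  \<comment> \<open>Both E + N and 1 + N vanish, so E and 1 are negatives of the same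
    element.\<close>
  then have "E = one TA" by (intro pl_cancel[of E "one TA" N]) (use E N N' in simp_all)
  then show ?thesis using fin_E by blast
qed

text \<open>The \<open>d\<close> pairwise distinct maps \<open>A \<rightarrow> R d\<close> of the tower agree on a nonzero part of \<open>R d\<close> with
  \<open>f 0 \<circ> \<gamma>\<close> for some endomorphisms \<open>\<gamma>\<close>, because \<open>(f 0, f i) : A \<otimes> A \<rightarrow> R d\<close> factors through a component
  of \<open>A \<otimes> A\<close> there.\<close>

lemma lambda_cone_bound:
  assumes lc: lambda_cone shows "d \<le> card EA"
proof (cases d)
  case (Suc n)
  let ?D = "R d"
  have fin: "finite EA" by (rule endo_bound(1))
  obtain f where "distinct_maps A (R (Suc n)) (Suc n) f" using tower_maps[OF tower R1 A_ring, of n] by blast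
  then have f: "distinct_maps A ?D d f" unfolding Suc .
  then have fr: "ring_mor K A ?D (f i)" if "i < d" for i using that by (simp add: distinct_maps_def)
  have D: "is_ring K ?D" using mmor_typ(2)[OF ring_mor_mmor[OF fr[of 0]]] Suc by simp
  have ft: "f i \<in> Ar K" "Dom K (f i) = Car A" "Cod K (f i) = Car ?D" if "i < d" for i
    using mmor_typ[OF ring_mor_mmor[OF fr[OF that]]] by simp_all
  obtain j where b: "biprod EA (\<lambda>_. Car A) (Car A \<odot> Car A) lam j" using cone_biprod[OF fin lc[unfolded lambda_cone_def]] .
  note jt = biprod_props(1-3)[OF b]
  have idem: "Mul TA \<bullet> ((j g \<bullet> one A) \<star> t) = j g \<bullet> lam g \<bullet> t" if "g \<in> EA" "el t" "ob t = Car A \<odot> Car A" for g t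
    by (rule cone_idempotent[OF b lam_ring_mor that])
  \<comment> \<open>The nonzero part c is shrunk once for each map, until on c every f i is f 0
    composed with some \<phi> i.\<close>
  have "\<exists>c \<phi>. el c \<and> fst c = [] \<and> ob c = Car ?D \<and> \<not> zero c \<and>
      (\<forall>i<k. \<phi> i \<in> EA \<and> (\<forall>a. el a \<longrightarrow> ob a = Car A \<longrightarrow> Mul ?D \<bullet> (c \<star> (f i \<bullet> a)) = Mul ?D \<bullet> (c \<star> (f 0 \<bullet> \<phi> i \<bullet> a))))" if "k \<le> d" for k
    using that
  proof (induction k)
    case 0
    have "\<not> zero (one ?D)" using zero_ring_one[OF D] nonzero by blast
    then show ?case using D by (intro exI[of _ "one ?D"]) simp
  next
    case (Suc k)
    then obtain c \<phi> where c: "el c" "fst c = []" "ob c = Car ?D" "\<not> zero c"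
      and \<phi>: "\<And>i. i < k \<Longrightarrow> \<phi> i \<in> EA" "\<And>i a. i < k \<Longrightarrow> el a \<Longrightarrow> ob a = Car A \<Longrightarrow> Mul ?D \<bullet> (c \<star> (f i \<bullet> a)) = Mul ?D \<bullet> (c \<star> (f 0 \<bullet> \<phi> i \<bullet> a))"
      by (metis Suc_leD)
    have k0: "0 < d" "k < d" using Suc.prems by auto
    define q where "q = Mul ?D \<cdot> (f 0 \<boxtimes> f k)"
    have qr: "ring_mor K TA ?D q" unfolding q_def by (rule pair_ring_mor[OF fr[OF k0(1)] fr[OF k0(2)]])
    have qt: "q \<in> Ar K" "Dom K q = Car A \<odot> Car A" "Cod K q = Car ?D" using mmor_typ[OF ring_mor_mmor[OF qr]] by simp_all
    have qm: "q \<bullet> Mul TA \<bullet> (s \<star> s') = Mul ?D \<bullet> ((q \<bullet> s) \<star> (q \<bullet> s'))" if "el s" "el s'" "ob s = Car A \<odot> Car A" "ob s' = Car A \<odot> Car A" for s s'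
      using mmor_mul[OF ring_mor_mmor[OF qr], of s s'] that by simp
    have qa: "q \<bullet> (a \<star> a') = Mul ?D \<bullet> ((f 0 \<bullet> a) \<star> (f k \<bullet> a'))" if "el a" "el a'" "ob a = Car A" "ob a' = Car A" for a a'
      using that ft[OF k0(1)] ft[OF k0(2)] D by (simp add: q_def)
    define x where "x g = q \<bullet> j g \<bullet> one A" for g
    have x: "el (x g)" "fst (x g) = []" "ob (x g) = Car ?D" if "g \<in> EA" for g using qt jt[OF that] by (simp_all add: x_def)
    have xq: "Mul ?D \<bullet> (x g \<star> (q \<bullet> t)) = q \<bullet> j g \<bullet> lam g \<bullet> t" if "g \<in> EA" "el t" "ob t = Car A \<odot> Car A" for g t
      using qm[of "j g \<bullet> one A" t] idem[OF that] that jt[OF that(1)] by (simp add: x_def del: comp_app)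
    \<comment> \<open>The \<open>x g\<close> are the images under \<open>q\<close> of the
      idempotents of A \<otimes> A. If c annihilated all of them, then c times \<open>q\<close>
      would vanish on every summand of A \<otimes> A, in particular at 1, and c would be
      zero.\<close>
    have "\<exists>g\<in>EA. \<not> zero (Mul ?D \<bullet> (c \<star> x g))"
    proof (rule ccontr)
      assume no: "\<not> (\<exists>g\<in>EA. \<not> zero (Mul ?D \<bullet> (c \<star> x g)))"
      define w where "w = Mul ?D \<cdot> ((snd c \<boxtimes> q) \<cdot> inv_arrow K (Lun K (Car A \<odot> Car A)))"
      have sc: "snd c \<in> Ar K" "Dom K (snd c) = Unit K" "Cod K (snd c) = Car ?D" using c by auto
      have su: "snd c \<bullet> un = c" using snd_idel[OF c(1)] c(2) by (simp add: idel_Nil)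
      have wt: "w \<in> Ar K" "Dom K w = Car A \<odot> Car A" "Cod K w = Car ?D" using sc qt D by (simp_all add: w_def)
      have wa: "w \<bullet> t = Mul ?D \<bullet> (c \<star> (q \<bullet> t))" if "el t" "ob t = Car A \<odot> Car A" for t
        using that sc su qt D by (simp add: w_def)
      have "w = Zer K (Car A \<odot> Car A) (Car ?D)"
      proof (rule biprod_ext[OF b])
        fix g assume g: "g \<in> EA"
        show "w \<cdot> j g = Zer K (Car A \<odot> Car A) (Car ?D) \<cdot> j g"
        proof (rule ext1[of _ "Car A"])
          fix a assume a: "el a" "ob a = Car A"
          have "lam g \<bullet> (a \<star> one A) = a" using a EA_typ[OF g] EA_one[OF g] by (simp add: mul_simps)
          then have "q \<bullet> j g \<bullet> a = Mul ?D \<bullet> (x g \<star> (q \<bullet> (a \<star> one A)))" using xq[OF g, of "a \<star> one A"] a by simp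
          then have "w \<bullet> j g \<bullet> a = Mul ?D \<bullet> (c \<star> (Mul ?D \<bullet> (x g \<star> (q \<bullet> (a \<star> one A)))))" using wa[of "j g \<bullet> a"] a jt[OF g] by simp
          also have "\<dots> = Mul ?D \<bullet> ((Mul ?D \<bullet> (c \<star> x g)) \<star> (q \<bullet> (a \<star> one A)))"
            by (rule mul_assoc[symmetric]) (use D c x[OF g] a qt in simp_all)
          finally have "zero (w \<bullet> j g \<bullet> a)" using no g c x[OF g] a qt D by simp
          then have "w \<bullet> j g \<bullet> a = Zer K (Car A \<odot> Car A) (Car ?D) \<bullet> j g \<bullet> a"
            by (rule zero_unique[rotated 2]) (use a jt[OF g] wt D in simp_all)
          moreover have "(w \<cdot> j g) \<bullet> a = w \<bullet> j g \<bullet> a" by (rule comp_app) (use a jt[OF g] wt in auto)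
          ultimately show "(w \<cdot> j g) \<bullet> a = (Zer K (Car A \<odot> Car A) (Car ?D) \<cdot> j g) \<bullet> a"
            using a jt[OF g] D by (simp del: zer_comp)
        qed (use jt[OF g] wt D in \<open>auto simp: homs_iff\<close>)
      qed (use wt D in \<open>auto simp: homs_iff\<close>)
      then have "w \<bullet> one TA = Zer K (Car A \<odot> Car A) (Car ?D) \<bullet> one TA" by (rule arg_cong)
      moreover have "w \<bullet> one TA = c" using wa[of "one TA"] ring_mor_one[OF qr] mul_unr[of ?D c] c D by simp
      moreover have "zero (Zer K (Car A \<odot> Car A) (Car ?D) \<bullet> one TA)" by (rule zero_Zer) (use D in simp_all)
      ultimately show False using c(4) by simp
    qed
    then obtain g where g: "g \<in> EA" and nz: "\<not> zero (Mul ?D \<bullet> (c \<star> x g))" by blast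
    note gt = EA_typ[OF g] and f0 = ft[OF k0(1)]
    \<comment> \<open>On this smaller part \<open>q\<close> factors through \<open>lam g\<close>,
      which does not distinguish 1 \<otimes> a from g a \<otimes> 1; hence f k agrees there with f 0
      composed with g.\<close>
    define e where "e = Mul ?D \<bullet> (c \<star> x g)"
    have e: "el e" "fst e = []" "ob e = Car ?D" "\<not> zero e" using c x[OF g] D nz by (simp_all add: e_def)
    have eq: "Mul ?D \<bullet> (e \<star> y) = Mul ?D \<bullet> (c \<star> (Mul ?D \<bullet> (x g \<star> y)))" "Mul ?D \<bullet> (e \<star> y) = Mul ?D \<bullet> (x g \<star> (Mul ?D \<bullet> (c \<star> y)))"
      if "el y" "ob y = Car ?D" for y
      unfolding e_def using mul_assoc[of ?D c "x g" y] mul_lcomm[of ?D c "x g" y] that c x[OF g] D by simp_all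
    have new: "Mul ?D \<bullet> (e \<star> (f k \<bullet> a)) = Mul ?D \<bullet> (e \<star> (f 0 \<bullet> g \<bullet> a))" if a: "el a" "ob a = Car A" for a
    proof -
      have "f k \<bullet> a = q \<bullet> (one A \<star> a)" "f 0 \<bullet> g \<bullet> a = q \<bullet> ((g \<bullet> a) \<star> one A)"
        using qa[of "one A" a] qa[of "g \<bullet> a" "one A"] ring_mor_one[OF fr[OF k0(1)]] ring_mor_one[OF fr[OF k0(2)]] a gt f0 ft[OF k0(2)] D
        by (simp_all add: mul_simps)
      moreover have "lam g \<bullet> (one A \<star> a) = g \<bullet> a" "lam g \<bullet> ((g \<bullet> a) \<star> one A) = g \<bullet> a"
        using a gt EA_one[OF g] by (simp_all add: mul_simps)
      ultimately have "Mul ?D \<bullet> (x g \<star> (f k \<bullet> a)) = Mul ?D \<bullet> (x g \<star> (f 0 \<bullet> g \<bullet> a))"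
        using xq[OF g, of "one A \<star> a"] xq[OF g, of "(g \<bullet> a) \<star> one A"] a gt by simp
      then show ?thesis using eq(1)[of "f k \<bullet> a"] eq(1)[of "f 0 \<bullet> g \<bullet> a"] a gt f0 ft[OF k0(2)] by simp
    qed
    have old: "Mul ?D \<bullet> (e \<star> (f i \<bullet> a)) = Mul ?D \<bullet> (e \<star> (f 0 \<bullet> \<phi> i \<bullet> a))" if "i < k" "el a" "ob a = Car A" for i a
      using eq(2)[of "f i \<bullet> a"] eq(2)[of "f 0 \<bullet> \<phi> i \<bullet> a"] \<phi>(2)[OF that] EA_typ[OF \<phi>(1)[OF that(1)]] f0 ft[of i] that k0 by simp
    show ?case
    proof (intro exI[of _ e] exI[of _ "\<phi>(k := g)"] conjI allI impI e)
      fix i assume i: "i < Suc k"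
      show "(\<phi>(k := g)) i \<in> EA" using i g \<phi>(1) by (auto simp: less_Suc_eq)
      fix a assume a: "el a" "ob a = Car A"
      show "Mul ?D \<bullet> (e \<star> (f i \<bullet> a)) = Mul ?D \<bullet> (e \<star> (f 0 \<bullet> (\<phi>(k := g)) i \<bullet> a))"
      proof (cases "i = k")
        case True then show ?thesis using new[OF a] by simp
      next
        case False then show ?thesis using old[OF _ a, of i] i by simp
      qed
    qed
  qed
  from this[of d] obtain c \<phi> where c: "el c" "fst c = []" "ob c = Car ?D" "\<not> zero c"
    and \<phi>: "\<And>i. i < d \<Longrightarrow> \<phi> i \<in> EA" "\<And>i a. i < d \<Longrightarrow> el a \<Longrightarrow> ob a = Car A \<Longrightarrow> Mul ?D \<bullet> (c \<star> (f i \<bullet> a)) = Mul ?D \<bullet> (c \<star> (f 0 \<bullet> \<phi> i \<bullet> a))"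
    by blast
  \<comment> \<open>Two maps with the same \<phi> would agree on the nonzero part c, contrary to
    \<open>distinct_maps\<close>.\<close>
  have "False" if il: "i < l" "l < d" "\<phi> i = \<phi> l" for i l
  proof -
    have "Mul ?D \<bullet> (c \<star> (Idn K (Car ?D) \<bullet> f i \<bullet> a)) = Mul ?D \<bullet> (c \<star> (Idn K (Car ?D) \<bullet> f l \<bullet> a))" if a: "el a" "ob a = Car A" for a
    proof -
      have "Idn K (Car ?D) \<bullet> f m \<bullet> a = f m \<bullet> a" if "m < d" for m using a ft[OF that] by simp
      then show ?thesis using \<phi>(2)[of i a] \<phi>(2)[of l a] il a by simp
    qed
    then have "zero c" using f[unfolded distinct_maps_def, THEN conjunct2, rule_format, OF ring_mor_Idn[OF D] c(1-3) il(1,2)] by blast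
    then show False using c(4) by blast
  qed
  then have "inj_on \<phi> {..<d}" by (intro linorder_inj_onI) auto
  moreover have "\<phi> ` {..<d} \<subseteq> EA" using \<phi>(1) by auto
  ultimately show ?thesis using card_inj_on_le[OF _ _ fin] by fastforce
qed simp

lemma card_iff_lambda_cone: "card EA = d \<longleftrightarrow> lambda_cone"
  using card_eq_lambda_cone lambda_cone_bound endo_bound(2) by (auto intro: le_antisym)

end

section \<open>Equivalence of the four conditions\<close>

theorem theorem5p9:
  fixes K :: "('o, 'm) smcat" and A :: "('o, 'm) cmon" and \<Gamma> :: "'m set"
  assumes "idempotent_complete_smc K"
    and "separable_ring K A"
    and "indecomposable_ring K A"
    and "degree K A \<noteq> \<infinity>"
    and "\<Gamma> = ring_endos K A"
  shows "(enat (card \<Gamma>) = degree K A \<longleftrightarrow>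
            (\<exists>t>0. rings_isomorphic (mod_cat K A) (free_ring K A A)
                     (prod_ring (mod_cat K A) {..<t::nat} (\<lambda>_. unit_ring (mod_cat K A))))) \<and>
         ((\<exists>t>0. rings_isomorphic (mod_cat K A) (free_ring K A A)
                     (prod_ring (mod_cat K A) {..<t::nat} (\<lambda>_. unit_ring (mod_cat K A))))
            \<longleftrightarrow> lambda_iso K A \<Gamma>) \<and>
         (lambda_iso K A \<Gamma> \<longleftrightarrow> group (comp_monoid K A \<Gamma>) \<and> quasi_Galois K A \<Gamma>)"
proof -
  interpret idempotent_complete_smc K by (rule assms(1))
  have ex: "\<exists>d. has_degree K A d" using assms(4) unfolding degree_def by presburger
  \<comment> \<open>The same choice as in \<open>degree\<close>; a tower attaining it supplies the
    locale.\<close>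
  define d where "d = (SOME d. has_degree K A d)"
  have deg: "degree K A = enat d" using ex by (simp add: degree_def d_def)
  have "has_degree K A d" unfolding d_def by (rule someI_ex[OF ex])
  then obtain R u where tw: "splitting_tower K A R u" and nz: "\<not> zero_ring K (R d)" and z: "zero_ring K (R (Suc d))"
    by (auto simp: has_degree_def)
  interpret indecomposable_tower K A R u d
    by unfold_locales (use assms(2,3) nz z tower_facts[OF assms(2) tw] tw in \<open>auto simp: splitting_tower_def\<close>)
  have fin: "finite EA" by (rule endo_bound(1))
  \<comment> \<open>Conditions (i), (ii) and (iii) are each equivalent to
    \<open>lambda_cone\<close>; (iv) adds to (iii) the group structure, which
    \<open>endo_group\<close> provides.\<close>
  have i: "enat (card \<Gamma>) = degree K A \<longleftrightarrow> lambda_cone" by (simp add: deg assms(5) card_iff_lambda_cone)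
  have ii: "(\<exists>t>0. rings_isomorphic (mod_cat K A) (free_ring K A A)
      (prod_ring (mod_cat K A) {..<t::nat} (\<lambda>_. unit_ring (mod_cat K A)))) \<longleftrightarrow> lambda_cone"
    using lambda_cone_split[OF fin] split_lambda_cone(2) by blast
  have iii: "lambda_iso K A \<Gamma> \<longleftrightarrow> lambda_cone" unfolding assms(5) by (rule lambda_iso_iff[OF fin])
  have iv: "group (comp_monoid K A \<Gamma>) \<and> quasi_Galois K A \<Gamma> \<longleftrightarrow> lambda_iso K A \<Gamma>"
    unfolding assms(5) quasi_Galois_def using endo_group[OF fin] fin assms(3) by (auto simp: indecomposable_ring_def)
  show ?thesis unfolding i ii iii iv by blast
qed

end
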